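(* The function $J_n:(\mathbb C^* )^n\to\mathbb C$ is continuous and holomorphic on the complement of the hyperplanes $$H_{ij}=\{z_i+\cdots+z_j=0\},\qquad1\le i<j\le n,$$ in the domain $$\mathcal D_n=\{(z_1,\ldots,z_n)\in(\mathbb C^* )^n:\ z_i/z_{i+1}\notin\mathbb R_{>0}\ \text{for}\ 1\le i<n\}.$$ Moreover, it satisfies the differential equation $$dJ_n(z_1,\ldots,z_n)=\sum_{i=1}^{n-1}J_i(z_1,\ldots,z_i)\,J_{n-i}(z_{i+1},\ldots,z_n)\;d\log\left(\frac{z_{i+1}+\cdots+z_n}{z_1+\cdots+z_i}\right).$$
   Context: Iterated integrals: for a path $\gamma:[0,1]\to\mathbb C$ and 1-forms with $\gamma^*\omega_i=g_i(t)dt$, $\int_\gamma\omega_1\circ\cdots\circ\omega_n=\int_{0\le t_1\le\cdots\le t_n\le1}g_1(t_1)\cdots g_n(t_n)\,dt_1\cdots dt_n$. Functions $M_n:(\mathbb C^* )^n\to\mathbb C$: $M_1\equiv2\pi i$ and, for $n\ge2$, with $s_i=z_1+\cdots+z_i$, $$M_n(z_1,\ldots,z_n)=2\pi i\int_C\frac{dt}{t-s_1}\circ\cdots\circ\frac{dt}{t-s_{n-1}},$$ where $C$ is the line segment from $0$ to $s_n$, perturbed if necessary to avoid any point $s_i\in[0,s_n]$ by small clockwise arcs; $M_n=0$ if $n\ge2$ and $s_n=0$. Functions $L_n:(\mathbb C^* )^n\to\mathbb C$: $L_1\equiv2\pi i$ and, for $n\ge2$, $$L_n(z_1,\ldots,z_n)=\sum_{k=1}^n\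 \sum_{\substack{0=i_0<\cdots<i_k=n\\ s_{i_j}-s_{i_{j-1}}\in\mathbb R_{>0}\cdot s_n}}\frac{(-1)^{k-1}}{k}\prod_{j=0}^{k-1}M_{i_{j+1}-i_j}(z_{i_j+1},\ldots,z_{i_{j+1}}),$$ the condition being imposed for all $1\le j\le k$, with $s_0=0$. One has $L_n(z_1,\ldots,z_n)=0$ whenever $n\geq 2$ and $s_n=0$. Functions $J_n:(\mathbb C^* )^n\to\mathbb C$: they form the compositional inverse of the sequence $(L_n)$, that is, they are determined recursively by $J_1\equiv\frac{1}{2\pi i}$ and, for $n\ge2$, $$\sum_{k=1}^n\ \sum_{0=i_0<\cdots<i_k=n}J_k\big(s_{i_1}-s_{i_0},\,s_{i_2}-s_{i_1},\ldots,s_{i_k}-s_{i_{k-1}}\big)\prod_{j=1}^kL_{i_j-i_{j-1}}(z_{i_{j-1}+1},\ldots,z_{i_j})=0,$$ where $s_0=0$ and a term in which some $s_{i_j}-s_{i_{j-1}}=0$ is understood to be $0$ (its factor $L_{i_j-i_{j-1}}$ vanishes). The term $k=n$ equals $(2\pi i)^nJ_n(z_1,\ldots,z_n)$.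
   Formalization: In the definition of M_n the forms dt/(t−s_i) are replaced by dt/(s_i−t), i.e. M_n is multiplied by (−1)^{n−1}; with the printed sign the differential equation fails already for n=2, where dJ_2 = −J_1J_1 dlog(z_2/z_1). *)

theory Defs
  imports "HOL-Analysis.Analysis"
begin

text \<open>
  A tuple \<open>(z_1, \<dots>, z_n)\<close> is represented by a sequence \<open>z :: nat \<Rightarrow> complex\<close> of which only the
  entries with index in \<open>{1..n}\<close> are used; \<open>psum z i\<close> is \<open>s_i = z_1 + \<dots> + z_i\<close>.
\<close>

definition psum :: "(nat \<Rightarrow> complex) \<Rightarrow> nat \<Rightarrow> complex" where
  "psum z i = (\<Sum>m=1..i. z m)"

definition ordered_simplex :: "nat \<Rightarrow> (nat \<Rightarrow> real) set" where
  "ordered_simplex n =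
     {t. (\<forall>i\<in>{1..n}. 0 \<le> t i \<and> t i \<le> 1) \<and> (\<forall>i\<in>{1..n}. \<forall>j\<in>{1..n}. i \<le> j \<longrightarrow> t i \<le> t j)}"

text \<open>
  \<open>iterated_integral \<gamma> n f\<close> is the iterated integral along \<open>\<gamma>\<close> of the 1-forms
  \<open>f 1 (w) dw, \<dots>, f n (w) dw\<close>, so that \<open>g_i t = f i (\<gamma> t) * \<gamma>' t\<close>.
\<close>

definition iterated_integral :: "(real \<Rightarrow> complex) \<Rightarrow> nat \<Rightarrow> (nat \<Rightarrow> complex \<Rightarrow> complex) \<Rightarrow> complex" where
  "iterated_integral \<gamma> n f =
     (LINT t:ordered_simplex n | Pi\<^sub>M {1..n} (\<lambda>_. lborel).
        (\<Prod>i=1..n. f i (\<gamma> (t i)) * vector_derivative \<gamma> (at (t i) within {0..1})))"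

text \<open>
  The segment \<open>[0, S]\<close>, except that for each \<open>a \<in> A \<subseteq> {0<..<1}\<close> the piece with parameter in
  \<open>]a - r, a + r[\<close> is replaced by the half circle about \<open>a * S\<close> that runs clockwise from
  \<open>(a - r) * S\<close> to \<open>(a + r) * S\<close>. The choice of \<open>a\<close> is unique as soon as \<open>r\<close> is small.
\<close>

definition detour_segment :: "complex \<Rightarrow> real set \<Rightarrow> real \<Rightarrow> real \<Rightarrow> complex" where
  "detour_segment S A r t =
     (if \<exists>a\<in>A. \<bar>t - a\<bar> < r
      then let a = (SOME a. a \<in> A \<and> \<bar>t - a\<bar> < r)
           in S * (of_real a + of_real r * cis (pi / 2 * (1 - (t - a) / r)))
      else of_real t * S)"

text \<open>
  The points \<open>s_i\<close>, \<open>1 \<le> i < n\<close>, interior to the segment \<open>[0, s_n]\<close>, in units of \<open>s_n\<close>. A point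
  \<open>s_i\<close> that coincides with an endpoint is not avoided: the iterated integral converges
  absolutely there, because \<open>s_1 \<noteq> 0\<close> and \<open>s_(n-1) \<noteq> s_n\<close>.
\<close>

definition segment_points :: "nat \<Rightarrow> (nat \<Rightarrow> complex) \<Rightarrow> real set" where
  "segment_points n z = {a. 0 < a \<and> a < 1 \<and> (\<exists>i\<in>{1..<n}. psum z i = of_real a * psum z n)}"

text \<open>
  By homotopy invariance the iterated integral does not depend on the radius \<open>r\<close> of the arcs once
  \<open>r\<close> is small; \<open>Lim\<close> selects this eventually constant value.

  Sign convention: the forms are \<open>dt / (s_i - t)\<close>, whereas the source writes \<open>dt / (t - s_i)\<close>.
  The latter would multiply \<open>M_fun n\<close> by \<open>(-1) ^ (n - 1)\<close>, hence also \<open>J_fun n\<close> at points where no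
  quotient \<open>z_i / z_(i+1)\<close> is a positive real, and there \<open>dJ_n\<close> would be minus the sum of the terms
  \<open>J_i * J_(n-i) * dlog ((z_(i+1) + \<dots> + z_n) / (z_1 + \<dots> + z_i))\<close>. For \<open>n = 2\<close> the present
  convention gives \<open>J_2 (z_1, z_2) = log (- z_2 / z_1) / (2\<pi>i)^2\<close>. It is also the one for which
  clockwise detours match the coefficients \<open>(-1) ^ (k - 1) / k\<close> in \<open>L_fun\<close>.
\<close>

definition M_fun :: "nat \<Rightarrow> (nat \<Rightarrow> complex) \<Rightarrow> complex" where
  "M_fun n z =
     (if n = 1 then 2 * of_real pi * \<i>
      else if psum z n = 0 then 0
      else 2 * of_real pi * \<i> *
        Lim (at_right 0) (\<lambda>r. iterated_integral (detour_segment (psum z n) (segment_points n z) r)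
                                (n - 1) (\<lambda>i w. 1 / (psum z i - w))))"

text \<open>The index sequences \<open>0 = i_0 < i_1 < \<dots> < i_k = n\<close>, as lists of length \<open>k + 1\<close>.\<close>

definition index_seqs :: "nat \<Rightarrow> nat \<Rightarrow> nat list set" where
  "index_seqs n k = {p. length p = k + 1 \<and> p ! 0 = 0 \<and> p ! k = n \<and> sorted_wrt (<) p}"

definition block :: "(nat \<Rightarrow> complex) \<Rightarrow> nat \<Rightarrow> nat \<Rightarrow> complex" where
  "block z i = (\<lambda>m. z (i + m))"

definition L_fun :: "nat \<Rightarrow> (nat \<Rightarrow> complex) \<Rightarrow> complex" where
  "L_fun n z =
     (if n = 1 then 2 * of_real pi * \<i>
      else (\<Sum>k=1..n. \<Sum>p | p \<in> index_seqs n k \<and>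
              (\<forall>j\<in>{1..k}. \<exists>r>0. psum z (p ! j) - psum z (p ! (j - 1)) = of_real r * psum z n).
            (-1) ^ (k - 1) / of_nat k *
            (\<Prod>j<k. M_fun (p ! (j + 1) - p ! j) (block z (p ! j)))))"

text \<open>
  The defining recursion for \<open>J_n\<close>, solved for its term \<open>k = n\<close>, which is \<open>(2\<pi>i)^n * J_n\<close>; see
  \<open>J_fun_recursion\<close> below for the original form.
\<close>

function J_fun :: "nat \<Rightarrow> (nat \<Rightarrow> complex) \<Rightarrow> complex" where
  "J_fun n z =
     (if n = 1 then 1 / (2 * of_real pi * \<i>)
      else - (\<Sum>k\<in>{1..<n}. \<Sum>p\<in>index_seqs n k.
                J_fun k (\<lambda>j. psum z (p ! j) - psum z (p ! (j - 1))) *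
                (\<Prod>j=1..k. L_fun (p ! j - p ! (j - 1)) (block z (p ! (j - 1)))))
           / (2 * of_real pi * \<i>) ^ n)"
  by auto
termination by (relation "Wellfounded.measure fst") auto

declare J_fun.simps [simp del]

lemma finite_index_seqs: "finite (index_seqs n k)"
proof (rule finite_subset)
  show "index_seqs n k \<subseteq> {p. set p \<subseteq> {..n} \<and> length p = k + 1}"
  proof
    fix p assume p: "p \<in> index_seqs n k"
    have "p ! i \<le> n" if "i < length p" for i
    proof (cases "i = k")
      case False
      with that p show ?thesis
        using sorted_wrt_nth_less[of "(<)" p i k] by (auto simp: index_seqs_def)
    qed (use p in \<open>auto simp: index_seqs_def\<close>)
    then show "p \<in> {p. set p \<subseteq> {..n} \<and> length p = k + 1}"
      using p by (auto simp: index_seqs_def in_set_conv_nth)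
  qed
  show "finite {p. set p \<subseteq> {..n} \<and> length p = k + 1}"
    by (rule finite_lists_length_eq) simp
qed

lemma index_seqs_full: "index_seqs n n = {[0..<n+1]}"
proof -
  have "p = [0..<n+1]" if p: "p \<in> index_seqs n n" for p
  proof (rule nth_equalityI)
    have len: "length p = n + 1" and p0: "p ! 0 = 0" and pn: "p ! n = n" and s: "sorted_wrt (<) p"
      using p by (auto simp: index_seqs_def)
    show "length p = length [0..<n+1]" using len by simp
    have lower: "i \<le> p ! i" if "i \<le> n" for i
      using that
    proof (induction i)
      case (Suc i)
      then show ?case using sorted_wrt_nth_less[OF s, of i "Suc i"] len by simp
    qed simp
    have upper: "p ! (n - i) \<le> n - i" if "i \<le> n" for i
      using that
    proof (induction i)
      case (Suc i)
      then have "p ! (n - Suc i) < p ! (n - i)"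
        using sorted_wrt_nth_less[OF s, of "n - Suc i" "n - i"] len by linarith
      with Suc show ?case by linarith
    qed (simp add: pn)
    fix i assume "i < length p"
    then have "i \<le> n" using len by simp
    then show "p ! i = [0..<n+1] ! i"
      using lower[of i] upper[of "n - i"] by (simp del: upt_Suc)
  qed
  moreover have "[0..<n+1] \<in> index_seqs n n"
    by (auto simp: index_seqs_def simp del: upt_Suc)
  ultimately show ?thesis by blast
qed

lemma psum_diff: "i \<ge> 1 \<Longrightarrow> psum z i - psum z (i - 1) = z i"
  by (cases i) (simp_all add: psum_def)

lemma M_fun_cong:
  assumes "\<And>m. m \<in> {1..n} \<Longrightarrow> z m = w m"
  shows "M_fun n z = M_fun n w"
proof -
  have ps: "psum z i = psum w i" if "i \<le> n" for i
    unfolding psum_def using that assms by (intro sum.cong) auto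
  have sp: "segment_points n z = segment_points n w"
    unfolding segment_points_def using ps by auto
  have "iterated_integral \<gamma> (n - 1) (\<lambda>i u. 1 / (psum z i - u)) =
        iterated_integral \<gamma> (n - 1) (\<lambda>i u. 1 / (psum w i - u))" for \<gamma>
    unfolding iterated_integral_def using ps
    by (intro arg_cong[where f = "set_lebesgue_integral _ _"] ext prod.cong) auto
  then show ?thesis unfolding M_fun_def using ps sp by simp
qed

lemma index_seqs_mono:
  assumes "p \<in> index_seqs n k" "i < j" "j \<le> k"
  shows "p ! i < p ! j"
  using assms by (auto simp: index_seqs_def intro: sorted_wrt_nth_less)

lemma index_seqs_le:
  assumes "p \<in> index_seqs n k" "i \<le> k"
  shows "p ! i \<le> n"
  using index_seqs_mono[OF assms(1), of i k] assms
  by (cases "i = k") (auto simp: index_seqs_def)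

lemma L_fun_cong:
  assumes "\<And>m. m \<in> {1..n} \<Longrightarrow> z m = w m"
  shows "L_fun n z = L_fun n w"
proof -
  have ps: "psum z i = psum w i" if "i \<le> n" for i
    unfolding psum_def using that assms by (intro sum.cong) auto
  have "(\<forall>j\<in>{1..k}. \<exists>r>0. psum z (p ! j) - psum z (p ! (j - 1)) = of_real r * psum z n) =
        (\<forall>j\<in>{1..k}. \<exists>r>0. psum w (p ! j) - psum w (p ! (j - 1)) = of_real r * psum w n)"
    if "p \<in> index_seqs n k" for p k
    using ps index_seqs_le[OF that] by (intro ball_cong) auto
  moreover have "M_fun (p ! (j + 1) - p ! j) (block z (p ! j)) =
                 M_fun (p ! (j + 1) - p ! j) (block w (p ! j))"
    if "p \<in> index_seqs n k" "j < k" for p j k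
    using index_seqs_le[OF that(1), of "j + 1"] that index_seqs_mono[OF that(1), of j "j + 1"]
    by (intro M_fun_cong) (auto simp: block_def intro!: assms)
  ultimately show ?thesis
    unfolding L_fun_def
    by (intro if_cong sum.cong arg_cong2[where f = "(*)"] prod.cong refl Collect_cong) auto
qed

lemma J_fun_cong:
  assumes "\<And>m. m \<in> {1..n} \<Longrightarrow> z m = w m"
  shows "J_fun n z = J_fun n w"
proof (cases "n = 1")
  case False
  have ps: "psum z i = psum w i" if "i \<le> n" for i
    unfolding psum_def using that assms by (intro sum.cong) auto
  show ?thesis
    using assms
  proof (induction n arbitrary: z w rule: less_induct)
    case (less n)
    have ps: "psum z i = psum w i" if "i \<le> n" for i
      unfolding psum_def using that less.prems by (intro sum.cong) auto
    have 1: "J_fun k (\<lambda>j. psum z (p ! j) - psum z (p ! (j - 1))) =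
             J_fun k (\<lambda>j. psum w (p ! j) - psum w (p ! (j - 1)))"
      if "k < n" "p \<in> index_seqs n k" for k p
      using that ps index_seqs_le[OF that(2)] by (intro less.IH) auto
    have 2: "L_fun (p ! j - p ! (j - 1)) (block z (p ! (j - 1))) =
             L_fun (p ! j - p ! (j - 1)) (block w (p ! (j - 1)))"
      if "p \<in> index_seqs n k" "j \<in> {1..k}" for p j k
      using index_seqs_le[OF that(1), of j] that index_seqs_mono[OF that(1), of "j - 1" j]
      by (intro L_fun_cong) (auto simp: block_def intro!: less.prems)
    show ?case
      unfolding J_fun.simps[of n z] J_fun.simps[of n w]
      using 1 2
      by (intro if_cong refl arg_cong2[where f = "(/)"] arg_cong[where f = uminus] sum.cong
            arg_cong2[where f = "(*)"] prod.cong) auto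
  qed
qed (simp add: J_fun.simps)

text \<open>
  Consequently a term of the recursion for \<open>J_n\<close> in which some difference
  \<open>s_(i_j) - s_(i_(j-1))\<close> vanishes is \<open>0\<close>, as it should be.
\<close>

lemma L_fun_eq_0:
  assumes "n \<ge> 2" "\<And>m. m \<in> {1..n} \<Longrightarrow> z m \<noteq> 0" "psum z n = 0"
  shows "L_fun n z = 0"
proof -
  have "(\<Prod>j<k. M_fun (p ! (j + 1) - p ! j) (block z (p ! j))) = 0"
    if k: "k \<in> {1..n}" and p: "p \<in> index_seqs n k"
      and r: "\<forall>j\<in>{1..k}. \<exists>r>0. psum z (p ! j) - psum z (p ! (j - 1)) = of_real r * psum z n"
    for k p
  proof -
    have z0: "psum z (p ! 1) = 0"
      using r k p assms(3) by (auto simp: index_seqs_def psum_def dest!: bspec[of _ _ 1])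
    have p0: "p ! 0 = 0" using p by (simp add: index_seqs_def)
    have "p ! 1 > 0" using index_seqs_mono[OF p, of 0 1] k by auto
    moreover have "p ! 1 \<noteq> 1" using z0 assms(1) assms(2)[of 1] by (auto simp: psum_def)
    ultimately have "M_fun (p ! (0 + 1) - p ! 0) (block z (p ! 0)) = 0"
      using z0 p0 by (simp add: M_fun_def block_def)
    then show ?thesis using k by (intro prod_zero) auto
  qed
  then show ?thesis
    unfolding L_fun_def using assms(1) by (auto intro!: sum.neutral)
qed

lemma J_fun_1: "J_fun 1 z = 1 / (2 * of_real pi * \<i>)"
  by (simp add: J_fun.simps)

lemma J_fun_recursion:
  assumes "n \<ge> 2"
  shows "(\<Sum>k=1..n. \<Sum>p\<in>index_seqs n k.
            J_fun k (\<lambda>j. psum z (p ! j) - psum z (p ! (j - 1))) *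
            (\<Prod>j=1..k. L_fun (p ! j - p ! (j - 1)) (block z (p ! (j - 1))))) = 0"
    (is "(\<Sum>k=1..n. ?T k) = 0")
proof -
  have "(\<Prod>j=1..n. L_fun ([0..<n+1] ! j - [0..<n+1] ! (j - 1)) (block z ([0..<n+1] ! (j - 1))))
        = (\<Prod>j=1..n. 2 * of_real pi * \<i>)"
    by (intro prod.cong) (auto simp: L_fun_def simp del: upt_Suc)
  moreover have "J_fun n (\<lambda>j. psum z ([0..<n+1] ! j) - psum z ([0..<n+1] ! (j - 1))) = J_fun n z"
    by (intro J_fun_cong) (auto simp: psum_diff[unfolded One_nat_def] simp del: upt_Suc)
  ultimately have "?T n = J_fun n z * (2 * of_real pi * \<i>) ^ n"
    by (simp add: index_seqs_full del: upt_Suc)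
  moreover have "J_fun n z * (2 * of_real pi * \<i>) ^ n = - (\<Sum>k\<in>{1..<n}. ?T k)"
    using assms by (subst J_fun.simps) simp
  moreover have "(\<Sum>k=1..n. ?T k) = ?T n + (\<Sum>k\<in>{1..<n}. ?T k)"
    using assms by (subst sum.last_plus) auto
  ultimately show ?thesis by simp
qed

text \<open>
  \<open>\<complex>\<^sup>n\<close> is \<open>complex ^ 'n\<close> with \<open>n = CARD('n)\<close>, the coordinates being numbered \<open>1, \<dots>, n\<close> along the
  linear order of \<open>'n\<close>.
\<close>

definition coord :: "complex ^ 'n::{finite,linorder} \<Rightarrow> nat \<Rightarrow> complex" where
  "coord z k = z $ (sorted_list_of_set (UNIV :: 'n set) ! (k - 1))"

definition J_vec :: "complex ^ 'n::{finite,linorder} \<Rightarrow> complex" where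
  "J_vec z = J_fun CARD('n) (coord z)"

definition D_dom :: "(complex ^ 'n::{finite,linorder}) set" where
  "D_dom = {z. (\<forall>i\<in>{1..CARD('n)}. coord z i \<noteq> 0) \<and>
               (\<forall>i\<in>{1..<CARD('n)}. \<not> (\<exists>r>0. coord z i / coord z (i + 1) = of_real r))}"

definition H_plane :: "nat \<Rightarrow> nat \<Rightarrow> (complex ^ 'n::{finite,linorder}) set" where
  "H_plane i j = {z. (\<Sum>m=i..j. coord z m) = 0}"

definition H_union :: "(complex ^ 'n::{finite,linorder}) set" where
  "H_union = (\<Union>(i, j)\<in>{(i, j). 1 \<le> i \<and> i < j \<and> j \<le> CARD('n)}. H_plane i j)"

text \<open>Holomorphy in several variables: complex differentiability, as for \<open>holomorphic_on\<close>.\<close>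

definition holomorphic_several_on ::
    "(complex ^ 'n \<Rightarrow> complex) \<Rightarrow> (complex ^ 'n) set \<Rightarrow> bool" where
  "holomorphic_several_on f S \<longleftrightarrow>
     (\<forall>z\<in>S. \<exists>D. (f has_derivative D) (at z within S) \<and> (\<forall>c h. D (c *s h) = c * D h))"

text \<open>The 1-form \<open>d log f = df / f\<close> at the point \<open>z\<close>, applied to the tangent vector \<open>h\<close>.\<close>

definition dlog :: "(complex ^ 'n \<Rightarrow> complex) \<Rightarrow> complex ^ 'n \<Rightarrow> complex ^ 'n \<Rightarrow> complex" where
  "dlog f z h = frechet_derivative f (at z) h / f z"

end

theory Submission
  imports Defs "HOL-Complex_Analysis.Complex_Analysis" "HOL-Real_Asymp.Real_Asymp"
begin

text \<open>
  Write \<open>s_k = z_1 + \<dots> + z_k\<close>. On \<open>D_n\<close> one has \<open>J_n = s_n * R(s_0, \<dots>, s_n)\<close>, where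
  \<open>R = (1/(2\<pi>i))^n \<integral> dp_1 \<dots> dp_{n-1} / ((p_1 - s_0) (p_2 - p_1) \<dots> (s_n - p_{n-1}))\<close> and \<open>p_k\<close> runs along the
  ray from \<open>s_k\<close> in the direction \<open>z_k\<close>. The condition \<open>z_i / z_{i+1} \<notin> \<real>_{>0}\<close> says that consecutive rays are
  separated by a half plane, which gives absolute convergence, continuity and freedom to tilt the rays.
  Moving the base point \<open>s_k\<close> produces residues, whence \<open>\<partial>R/\<partial>s_k = - R(s_0, \<dots>, s_k) R(s_k, \<dots>, s_n)\<close>; together
  with the homogeneity of \<open>R\<close> this is the differential equation.

  To identify \<open>J_n\<close>, put \<open>a(k, l) = (s_l - s_k) R(s_k, \<dots>, s_l)\<close>. On \<open>D_n\<close> the sums defining \<open>L\<close> and \<open>J\<close> combine to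
  the statement that \<open>\<Sum> M(s_{k_0}, \<dots>, s_{k_r}) a(k_0, k_1) \<dots> a(k_{r-1}, k_r)\<close>, over all chains from \<open>x\<close> to \<open>y\<close>,
  is \<open>1\<close> if \<open>y = x + 1\<close> and \<open>0\<close> otherwise. This holds because, with the base point \<open>t\<close> moving along
  \<open>C\<close>, the partial iterated integrals weighted by \<open>a\<close> sum to \<open>(s_y - t) R(t, s_{x+1}, \<dots>, s_y)\<close>, which vanishes
  at \<open>t = s_y\<close>.
\<close>


section \<open>Iterated integrals along rays\<close>

text \<open>All analytic control rests on one witness: linear forms \<open>Re (w_k * _)\<close> with
  a margin \<kappa>. For fixed \<open>w\<close> the conditions are open and affine in points and
  directions, so one witness serves neighbouring configurations, convex combinations, and a first
  point pushed out along its ray. The exponent -1/2 is chosen because it reproduces itself: divided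
  by the distance between two rays and integrated, it returns with the same exponent in the other
  ray parameter.

  The delicate point is the identity with M. Points s_i may lie on the segment or at its ends, and
  the first ray may run along the segment. Detours pass above and such a ray is tilted below, so the
  base point does not meet the ray before the end of the path; coincident consecutive points are
  harmless because the weights \<open>a\<close> vanish on them. If the ray starts at the very end,
  the limit 0 still follows from dominated convergence.

  L enters only as a logarithm along rays: on D_n two neighbouring steps never have the same
  direction, so the finest chain contributes nothing unless it is a single step, and trivial M-sums
  give trivial L-sums.\<close>

lemma set_integrable_ray_powr: "set_integrable lborel {0..} (\<lambda>x::real. (1 + x) powr (-3/2))"
proof -
  have "(\<integral>\<^sup>+x. ennreal ((1 + x) powr (-3/2)) * indicator {0..} x \<partial>lborel) = ennreal (0 - (-2) * (1 + 0) powr (-1/2))"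
  proof (rule nn_integral_FTC_atLeast[where F = "\<lambda>x. -2 * (1 + x) powr (-1/2)", THEN trans])
    show "((\<lambda>x::real. -2 * (1 + x) powr (-1/2)) \<longlongrightarrow> 0) at_top"
      by real_asymp
    show "((\<lambda>x. -2 * (1 + x) powr (-1/2)) has_real_derivative (1 + x) powr (-3/2)) (at x)"
      if "0 \<le> x" for x :: real
      using that by (auto intro!: derivative_eq_intros)
  qed auto
  moreover have "(\<integral>\<^sup>+x. ennreal (indicator {0..} x *\<^sub>R (1 + x) powr (-3/2)) \<partial>lborel)
      = (\<integral>\<^sup>+x. ennreal ((1 + x) powr (-3/2)) * indicator {0..} x \<partial>lborel)"
    by (intro nn_integral_cong) (auto simp: indicator_def)
  ultimately show ?thesis
    unfolding set_integrable_def
    by (intro integrableI_nonneg) auto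
qed

lemma ray_integrable:
  fixes f :: "real \<Rightarrow> complex"
  assumes "continuous_on {0..} f" "\<And>x. 0 \<le> x \<Longrightarrow> norm (f x) \<le> C * (1 + x) powr (-3/2)"
  shows "set_integrable lborel {0..} f"
  unfolding set_integrable_def
proof (rule Bochner_Integration.integrable_bound)
  show "integrable lborel (\<lambda>x. C * (indicator {0..} x *\<^sub>R (1 + x) powr (-3/2)))"
    using set_integrable_ray_powr unfolding set_integrable_def by (rule integrable_mult_right)
  show "(\<lambda>x. indicator {0..} x *\<^sub>R f x) \<in> borel_measurable lborel"
    using borel_measurable_continuous_on_indicator[OF _ assms(1)] by simp
  show "AE x in lborel. norm (indicator {0..} x *\<^sub>R f x) \<le> norm (C * (indicator {0..} x *\<^sub>R (1 + x) powr (-3/2)))"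
    using assms(2) by (auto simp: indicator_def intro!: AE_I2 order.trans[OF assms(2)])
qed

text \<open>Dominated convergence speaks about sequences, which is why continuity and derivatives
  are proved along sequences below. The bounds are required only eventually, since a uniform half
  plane margin is available only near the limit; shifting the sequence skips the first
  terms.\<close>

lemma ray_dct:
  fixes f :: "nat \<Rightarrow> real \<Rightarrow> complex"
  assumes cont: "eventually (\<lambda>n. continuous_on {0..} (f n)) sequentially"
    and lim: "\<And>x. 0 \<le> x \<Longrightarrow> (\<lambda>n. f n x) \<longlonglongrightarrow> g x"
    and bd: "eventually (\<lambda>n. \<forall>x\<ge>0. norm (f n x) \<le> C * (1 + x) powr (-3/2)) sequentially"
    and contg: "continuous_on {0..} g"
  shows "(\<lambda>n. LINT x:{0..}|lborel. f n x) \<longlonglongrightarrow> (LINT x:{0..}|lborel. g x)"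
proof -
  from eventually_conj[OF cont bd] obtain N
    where N: "\<And>n. n \<ge> N \<Longrightarrow> continuous_on {0..} (f n)"
      "\<And>n x. n \<ge> N \<Longrightarrow> x \<ge> 0 \<Longrightarrow> norm (f n x) \<le> C * (1 + x) powr (-3/2)"
    unfolding eventually_sequentially by blast
  have "(\<lambda>n. LINT x:{0..}|lborel. f (n + N) x) \<longlonglongrightarrow> (LINT x:{0..}|lborel. g x)"
    unfolding set_lebesgue_integral_def
  proof (rule integral_dominated_convergence)
    show "integrable lborel (\<lambda>x. C * (indicator {0..} x *\<^sub>R (1 + x) powr (-3/2)))"
      using set_integrable_ray_powr unfolding set_integrable_def by (rule integrable_mult_right)
    show "(\<lambda>x. indicator {0..} x *\<^sub>R g x) \<in> borel_measurable lborel"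
      using borel_measurable_continuous_on_indicator[OF _ contg] by simp
    show "(\<lambda>x. indicator {0..} x *\<^sub>R f (n + N) x) \<in> borel_measurable lborel" for n
      using borel_measurable_continuous_on_indicator[OF _ N(1)[of "n + N"]] by simp
    show "AE x in lborel. norm (indicator {0..} x *\<^sub>R f (n + N) x) \<le> C * (indicator {0..} x *\<^sub>R (1 + x) powr (-3/2))" for n
      using N(2)[of "n + N"] by (auto simp: indicator_def intro!: AE_I2)
    show "AE x in lborel. (\<lambda>n. indicator {0..} x *\<^sub>R f (n + N) x) \<longlonglongrightarrow> indicator {0..} x *\<^sub>R g x"
    proof (intro AE_I2)
      fix x
      show "(\<lambda>n. indicator {0..} x *\<^sub>R f (n + N) x) \<longlonglongrightarrow> indicator {0..} x *\<^sub>R g x"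
        using LIMSEQ_ignore_initial_segment[OF lim[of x], of N] by (cases "x \<ge> 0") auto
    qed
  qed
  then show ?thesis
    by (rule LIMSEQ_offset)
qed

text \<open>The substitution u = sqrt (1 + x) turns the majorant into 2 / (A + u^2), whose primitive
  is a multiple of arctan; the whole half line contributes at most
  \<open>pi * A powr (-1/2)\<close>. The decay in \<open>A\<close> has the same exponent as the
  decay assumed in \<open>x\<close>, which closes the induction in
  \<open>rayint_bound\<close>.\<close>

lemma ray_integral_bound:
  assumes A: "1 \<le> A"
    and bd: "\<And>x. 0 \<le> x \<Longrightarrow> norm (f x :: complex) \<le> C * (1 + x) powr (-1/2) / (A + 1 + x)"
  shows "norm (LINT x:{0..}|lborel. f x) \<le> C * pi * A powr (-1/2)"
proof -
  have C: "0 \<le> C"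
    using order.trans[OF norm_ge_zero bd[of 0]] A by (auto simp: zero_le_divide_iff)
  let ?h = "\<lambda>x::real. (1 + x) powr (-1/2) / (A + 1 + x)"
  let ?F = "\<lambda>x::real. 2 * A powr (-1/2) * arctan ((1 + x) powr (1/2) * A powr (-1/2))"
  have sq: "y powr (1/2) * y powr (1/2) = y" "y powr (-1/2) * y powr (-1/2) = 1 / y" if "0 < y" for y :: real
    using that by (auto simp: powr_add[symmetric] powr_minus_divide)
  have nn: "(\<integral>\<^sup>+x. ennreal (?h x) * indicator {0..} x \<partial>lborel) = ennreal (2 * A powr (-1/2) * (pi/2) - ?F 0)"
  proof (rule nn_integral_FTC_atLeast)
    have "filterlim (\<lambda>x::real. (1 + x) powr (1/2) * A powr (-1/2)) at_top at_top"
      using A by real_asymp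
    then have "((\<lambda>x. arctan ((1 + x) powr (1/2) * A powr (-1/2))) \<longlongrightarrow> pi/2) at_top"
      by (rule filterlim_compose[OF tendsto_arctan_at_top])
    then show "(?F \<longlongrightarrow> 2 * A powr (-1/2) * (pi/2)) at_top"
      by (intro tendsto_intros)
    show "(?F has_real_derivative ?h x) (at x)" if x: "0 \<le> x" for x :: real
    proof -
      have "(?F has_real_derivative 2 * A powr (-1/2) * ((1/2) * (1 + x) powr (1/2 - 1) * A powr (-1/2)
            / (1 + ((1 + x) powr (1/2) * A powr (-1/2))\<^sup>2))) (at x)"
        using x A by (auto intro!: derivative_eq_intros simp: field_simps)
      moreover have alg: "2 * a * ((1/2) * b * a / (1 + (u * a)\<^sup>2)) = (a * a) * b / (1 + (u * u) * (a * a))" for a b u :: real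
      proof -
        have "2 * a * ((1/2) * b * a / D) = (a * a) * b / D" for D by simp
        moreover have "(u * a)\<^sup>2 = (u * u) * (a * a)" by (simp add: power2_eq_square)
        ultimately show ?thesis by (simp only:)
      qed
      moreover have "(A powr (-1/2) * A powr (-1/2)) * (1 + x) powr (1/2 - 1)
            / (1 + ((1 + x) powr (1/2) * (1 + x) powr (1/2)) * (A powr (-1/2) * A powr (-1/2))) = ?h x"
        using x A by (simp only: sq) (simp add: field_simps)
      ultimately show ?thesis by (simp only: alg)
    qed
    show "0 \<le> ?h x" if "0 \<le> x" for x using that A by simp
  qed measurable
  have nn': "(\<integral>\<^sup>+ x. ennreal (indicator {0..} x *\<^sub>R ?h x) \<partial>lborel) = (\<integral>\<^sup>+x. ennreal (?h x) * indicator {0..} x \<partial>lborel)"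
    by (intro nn_integral_cong) (auto simp: indicator_def)
  have int: "integrable lborel (\<lambda>x. indicator {0..} x *\<^sub>R ?h x)"
  proof (rule integrableI_nonneg)
    show "(\<integral>\<^sup>+ x. ennreal (indicator {0..} x *\<^sub>R ?h x) \<partial>lborel) < \<infinity>"
      unfolding nn' nn by simp
  qed (use A in \<open>auto simp: indicator_def\<close>)
  have "(LINT x:{0..}|lborel. ?h x) = enn2real (\<integral>\<^sup>+ x. ennreal (indicator {0..} x *\<^sub>R ?h x) \<partial>lborel)"
    unfolding set_lebesgue_integral_def
    by (rule integral_eq_nn_integral) (use A in \<open>auto simp: indicator_def\<close>)
  also have "\<dots> \<le> A powr (-1/2) * pi"
  proof -
    have "0 \<le> ?F 0" by simp
    then have "(\<integral>\<^sup>+x. ennreal (?h x) * indicator {0..} x \<partial>lborel) \<le> ennreal (A powr (-1/2) * pi)"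
      unfolding nn by (intro ennreal_leI) simp
    then show ?thesis
      unfolding nn' by (intro enn2real_leI) auto
  qed
  finally have h: "(LINT x:{0..}|lborel. ?h x) \<le> A powr (-1/2) * pi" .
  have "integrable lborel (\<lambda>x. C * (indicator {0..} x *\<^sub>R ?h x))"
    using int by (rule integrable_mult_right)
  then have int2: "integrable lborel (\<lambda>x. indicator {0..} x *\<^sub>R (C * ?h x))"
    by (simp add: mult_ac)
  have le: "norm (indicator {0..} x *\<^sub>R f x) \<le> indicator {0..} x *\<^sub>R (C * ?h x)" for x
    using bd[of x] by (auto simp: indicator_def)
  have "norm (LINT x:{0..}|lborel. f x) \<le> (LINT x:{0..}|lborel. C * ?h x)"
    unfolding set_lebesgue_integral_def
  proof (cases "integrable lborel (\<lambda>x. indicator {0..} x *\<^sub>R f x)")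
    case True
    then show "norm (LINT x|lborel. indicator {0..} x *\<^sub>R f x) \<le> (LINT x|lborel. indicator {0..} x *\<^sub>R (C * ?h x))"
      by (rule Bochner_Integration.integral_norm_bound_integral[OF _ int2 le])
  next
    \<comment> \<open>The integral of a non-integrable function is 0, so here the estimate reduces
      to nonnegativity of the majorant.\<close>
    case False
    have "0 \<le> (LINT x|lborel. indicator {0..} x *\<^sub>R (C * ?h x))"
      using order.trans[OF norm_ge_zero le] by (intro integral_nonneg_AE AE_I2) 
    with False show "norm (LINT x|lborel. indicator {0..} x *\<^sub>R f x) \<le> (LINT x|lborel. indicator {0..} x *\<^sub>R (C * ?h x))"
      by (simp add: not_integrable_integral_eq)
  qed
  also have "\<dots> = C * (LINT x:{0..}|lborel. ?h x)"
    by (rule set_integral_mult_right)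
  also have "\<dots> \<le> C * (A powr (-1/2) * pi)"
    using h C by (rule mult_left_mono)
  finally show ?thesis by (simp add: mult_ac)
qed

section \<open>Ray integrals and separating half planes\<close>

definition inv_2pi_i :: complex where
  "inv_2pi_i = 1 / (2 * of_real pi * \<i>)"

lemma norm_inv_2pi_i: "norm inv_2pi_i \<le> 1"
  using pi_ge_two by (simp add: inv_2pi_i_def norm_divide norm_mult)

lemma inv_2pi_i_nonzero [simp]: "inv_2pi_i \<noteq> 0"
  by (simp add: inv_2pi_i_def)

text \<open>
  \<open>rayint m i s v\<close> is the integral \<open>R(s_i, \<dots>, s_{i+m+1})\<close> of the introduction, the variable \<open>p_k\<close>
  running along \<open>s_k + \<real>_{\<ge>0} v_k\<close> for \<open>i < k \<le> i + m\<close>; the value \<open>v_i\<close> does not enter.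
\<close>

primrec rayint :: "nat \<Rightarrow> nat \<Rightarrow> (nat \<Rightarrow> complex) \<Rightarrow> (nat \<Rightarrow> complex) \<Rightarrow> complex" where
  "rayint 0 i s v = inv_2pi_i / (s (Suc i) - s i)"
| "rayint (Suc m) i s v = inv_2pi_i *
     (LINT x:{0..}|lborel. v (Suc i) * rayint m (Suc i) (s(Suc i := s (Suc i) + of_real x * v (Suc i))) v
        / (s (Suc i) + of_real x * v (Suc i) - s i))"

text \<open>
  The linear form \<open>Re (w_k * _)\<close> separates the rays \<open>s_k + \<real>_{\<ge>0} v_k\<close> and \<open>s_{k+1} + \<real>_{\<ge>0} v_{k+1}\<close> with a
  margin that grows linearly along them.
\<close>

definition half_planes ::
    "real \<Rightarrow> (nat \<Rightarrow> complex) \<Rightarrow> (nat \<Rightarrow> complex) \<Rightarrow> (nat \<Rightarrow> complex) \<Rightarrow> nat \<Rightarrow> nat \<Rightarrow> bool" where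
  "half_planes \<kappa> w s v i n \<longleftrightarrow>
     (\<forall>k\<in>{i..<n}. norm (w k) \<le> 1 \<and> \<kappa> \<le> Re (w k * (s (Suc k) - s k)) \<and> Re (w k * v k) \<le> - \<kappa> \<and>
        (Suc k < n \<longrightarrow> \<kappa> \<le> Re (w k * v (Suc k))))"

lemma rayint_cong:
  assumes "\<And>k. i \<le> k \<Longrightarrow> k \<le> Suc (i + m) \<Longrightarrow> s k = s' k"
    and "\<And>k. i < k \<Longrightarrow> k \<le> i + m \<Longrightarrow> v k = v' k"
  shows "rayint m i s v = rayint m i s' v'"
  using assms
proof (induction m arbitrary: i s s')
  case (Suc m)
  have "rayint m (Suc i) (s(Suc i := s (Suc i) + x * v (Suc i))) v
      = rayint m (Suc i) (s'(Suc i := s' (Suc i) + x * v' (Suc i))) v'" for x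
    by (rule Suc.IH) (use Suc.prems in auto)
  then show ?case
    using Suc.prems(1)[of "Suc i"] Suc.prems(1)[of i] Suc.prems(2)[of "Suc i"] by simp
qed simp

lemma half_planes_mono:
  assumes "half_planes \<kappa> w s v i n" "i \<le> j" "\<kappa>' \<le> \<kappa>"
  shows "half_planes \<kappa>' w s v j n"
  unfolding half_planes_def
proof
  fix k assume "k \<in> {j..<n}"
  then have "k \<in> {i..<n}" using assms(2) by auto
  from bspec[OF assms(1)[unfolded half_planes_def] this] assms(3)
  show "norm (w k) \<le> 1 \<and> \<kappa>' \<le> Re (w k * (s (Suc k) - s k)) \<and> Re (w k * v k) \<le> - \<kappa>' \<and>
        (Suc k < n \<longrightarrow> \<kappa>' \<le> Re (w k * v (Suc k)))"
    by auto
qed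

lemma half_planes_front:
  assumes "half_planes \<kappa> w s v i n" "m \<le> n" 
  shows "half_planes \<kappa> w s v i m"
  using assms unfolding half_planes_def by auto

text \<open>Only the step from s_i to s_(i+1) changes, and
  \<open>Re (w i * v i) \<le> - \<kappa>\<close> makes its margin grow with \<open>x\<close>. This
  permits induction on the number of rays: inner integrals have their base point pushed out along a
  ray.\<close>

lemma half_planes_shift:
  assumes "half_planes \<kappa> w s v i n" "0 \<le> x" "0 < \<kappa>"
  shows "half_planes \<kappa> w (s(i := s i + of_real x * v i)) v i n"
  unfolding half_planes_def
proof (intro ballI)
  fix k assume k: "k \<in> {i..<n}"
  have *: "norm (w k) \<le> 1 \<and> \<kappa> \<le> Re (w k * (s (Suc k) - s k)) \<and> Re (w k * v k) \<le> - \<kappa> \<and>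
        (Suc k < n \<longrightarrow> \<kappa> \<le> Re (w k * v (Suc k)))"
    using assms(1) k unfolding half_planes_def by auto
  show "norm (w k) \<le> 1 \<and>
         \<kappa> \<le> Re (w k * ((s(i := s i + of_real x * v i)) (Suc k) - (s(i := s i + of_real x * v i)) k)) \<and>
         Re (w k * v k) \<le> - \<kappa> \<and> (Suc k < n \<longrightarrow> \<kappa> \<le> Re (w k * v (Suc k)))"
  proof (cases "k = i")
    case True
    have "Re (w k * (s (Suc k) - (s i + of_real x * v i)))
       = Re (w k * (s (Suc k) - s k)) - x * Re (w k * v k)"
      using True by (simp add: algebra_simps)
    moreover have "x * Re (w k * v k) \<le> 0"
      using assms(2,3) * by (intro mult_nonneg_nonpos) auto
    ultimately show ?thesis using * True by auto
  qed (use * k in auto)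
qed

lemma half_planes_shift_Suc:
  assumes "half_planes \<kappa> w s v i n" "0 \<le> x" "0 < \<kappa>"
  shows "half_planes \<kappa> w (s(Suc i := s (Suc i) + of_real x * v (Suc i))) v (Suc i) n"
  by (rule half_planes_shift[OF half_planes_mono[OF assms(1), of "Suc i" \<kappa>] assms(2,3)]) auto

text \<open>\<open>Re (w i * _)\<close> is bounded by the norm because
  \<open>norm (w i) \<le> 1\<close>, and both ray parameters enter it with coefficients of the right
  sign, so the denominators grow linearly in both.\<close>

lemma half_planes_lower:
  assumes "half_planes \<kappa> w s v i n" "i < n" "0 < \<kappa>" "0 \<le> x" 
  shows "\<kappa> * (1 + x) \<le> norm (s (Suc i) - (s i + of_real x * v i))"
    and "0 \<le> y \<Longrightarrow> Suc i < n \<Longrightarrow> \<kappa> * (1 + x + y) \<le> norm (s (Suc i) + of_real y * v (Suc i) - (s i + of_real x * v i))"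
proof -
  have *: "norm (w i) \<le> 1" "\<kappa> \<le> Re (w i * (s (Suc i) - s i))" "Re (w i * v i) \<le> - \<kappa>"
        "(Suc i < n \<longrightarrow> \<kappa> \<le> Re (w i * v (Suc i)))"
    using assms(1,2) unfolding half_planes_def by auto
  have le: "Re (w i * z) \<le> norm z" for z
    using complex_Re_le_cmod[of "w i * z"] mult_right_mono[OF *(1) norm_ge_zero, of z] by (simp add: norm_mult)
  have x: "x * Re (w i * v i) \<le> - (x * \<kappa>)"
    using mult_left_mono[OF *(3) assms(4)] by simp
  have "Re (w i * (s (Suc i) - (s i + of_real x * v i))) = Re (w i * (s (Suc i) - s i)) - x * Re (w i * v i)"
    by (simp add: algebra_simps)
  with x *(2) le[of "s (Suc i) - (s i + of_real x * v i)"]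
  show "\<kappa> * (1 + x) \<le> norm (s (Suc i) - (s i + of_real x * v i))" by (simp add: algebra_simps)
  assume y: "0 \<le> y" and n: "Suc i < n"
  have "y * \<kappa> \<le> y * Re (w i * v (Suc i))"
    using mult_left_mono[of \<kappa> "Re (w i * v (Suc i))" y] * y n by simp
  moreover have "Re (w i * (s (Suc i) + of_real y * v (Suc i) - (s i + of_real x * v i)))
       = Re (w i * (s (Suc i) - s i)) - x * Re (w i * v i) + y * Re (w i * v (Suc i))"
    by (simp add: algebra_simps)
  ultimately show "\<kappa> * (1 + x + y) \<le> norm (s (Suc i) + of_real y * v (Suc i) - (s i + of_real x * v i))"
    using x *(2) le[of "s (Suc i) + of_real y * v (Suc i) - (s i + of_real x * v i)"] by (simp add: algebra_simps)
qed

section \<open>Bounds and continuity of the ray integrals\<close>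

text \<open>Each integration costs a factor \<open>B\<close> for the direction, \<open>pi\<close>
  from \<open>ray_integral_bound\<close> and \<open>2 / \<kappa>\<close> from the denominator; the 2
  absorbs the shift by 1 in the majorant of that lemma.\<close>

primrec rayint_const :: "real \<Rightarrow> real \<Rightarrow> nat \<Rightarrow> real" where
  "rayint_const \<kappa> B 0 = 1 / \<kappa>"
| "rayint_const \<kappa> B (Suc m) = B * rayint_const \<kappa> B m * (2 / \<kappa>) * pi"

lemma rayint_const_nonneg: "0 < \<kappa> \<Longrightarrow> 0 \<le> B \<Longrightarrow> 0 \<le> rayint_const \<kappa> B m"
  by (induction m) auto

text \<open>One more integration of \<open>(1 + y) powr (-1/2)\<close> against the linearly growing
  denominator returns the same power of \<open>1 + x\<close>, so the decay along the ray of the base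
  point is the same at every level.\<close>

lemma rayint_bound:
  assumes "half_planes \<kappa> w s v i (Suc (i + m))" "0 < \<kappa>" "0 \<le> B"
    and "\<And>k. i < k \<Longrightarrow> k \<le> i + m \<Longrightarrow> norm (v k) \<le> B" and "0 \<le> x"
  shows "norm (rayint m i (s(i := s i + of_real x * v i)) v) \<le> rayint_const \<kappa> B m * (1 + x) powr (-1/2)"
  using assms
proof (induction m arbitrary: i x s)
  case 0
  \<comment> \<open>A single denominator decays like \<open>1 / (1 + x)\<close>; this is weakened to
    the exponent that survives the integrations.\<close>
  have "\<kappa> * (1 + x) powr (1/2) \<le> \<kappa> * (1 + x)"
    using 0 powr_mono[of "1/2" 1 "1 + x"] by (intro mult_left_mono) auto
  also have "\<dots> \<le> norm (s (Suc i) - (s i + of_real x * v i))"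
    using 0 by (intro half_planes_lower(1)[where n = "Suc i"]) auto
  finally have *: "\<kappa> * (1 + x) powr (1/2) \<le> norm (s (Suc i) - (s i + of_real x * v i))" .
  have "norm inv_2pi_i / norm (s (Suc i) - (s i + of_real x * v i)) \<le> 1 / (\<kappa> * (1 + x) powr (1/2))"
    using norm_inv_2pi_i * 0 by (intro frac_le) auto
  also have "\<dots> = 1 / \<kappa> * (1 + x) powr (-1/2)"
    by (simp add: powr_minus_divide)
  finally show ?case by (simp add: norm_divide)
next
  case (Suc m)
  let ?b = "s i + of_real x * v i" and ?p = "\<lambda>y. s (Suc i) + of_real y * v (Suc i)"
  let ?f = "\<lambda>y. v (Suc i) * rayint m (Suc i) ((s(i := ?b))(Suc i := ?p y)) v / (?p y - ?b)"
  let ?C = "B * rayint_const \<kappa> B m * (2 / \<kappa>)"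
  have "norm (LINT y:{0..}|lborel. ?f y) \<le> ?C * pi * (1 + x) powr (-1/2)"
  proof (rule ray_integral_bound)
    show "1 \<le> 1 + x" using Suc.prems by simp
    fix y :: real assume y: "0 \<le> y"
    have "rayint m (Suc i) ((s(i := ?b))(Suc i := ?p y)) v = rayint m (Suc i) (s(Suc i := ?p y)) v"
      by (rule rayint_cong) auto
    also have "norm \<dots> \<le> rayint_const \<kappa> B m * (1 + y) powr (-1/2)"
      using Suc.prems y half_planes_mono[OF Suc.prems(1), of "Suc i" \<kappa>]
      by (intro Suc.IH) auto
    finally have 1: "norm (rayint m (Suc i) ((s(i := ?b))(Suc i := ?p y)) v) \<le> rayint_const \<kappa> B m * (1 + y) powr (-1/2)" .
    have 2: "\<kappa> * (1 + x + y) \<le> norm (?p y - ?b)"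
      using Suc.prems y by (intro half_planes_lower(2)[where n = "Suc (i + Suc m)"]) auto
    \<comment> \<open>Half of the margin pays for the additional 1, so that
      \<open>ray_integral_bound\<close> applies with \<open>A = 1 + x\<close>.\<close>
    have "\<kappa> / 2 * (1 + x + 1 + y) \<le> \<kappa> * (1 + x + y)"
      using Suc.prems y mult_nonneg_nonneg[of \<kappa> "x + y"] by (simp add: field_simps)
    then have 3: "\<kappa> / 2 * (1 + x + 1 + y) \<le> norm (?p y - ?b)" using 2 by linarith
    have "norm (?f y) \<le> (B * (rayint_const \<kappa> B m * (1 + y) powr (-1/2))) / (\<kappa> / 2 * (1 + x + 1 + y))"
      unfolding norm_divide norm_mult
      using 1 3 Suc.prems y rayint_const_nonneg[of \<kappa> B m]
      by (intro frac_le mult_mono mult_nonneg_nonneg) auto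
    also have "\<dots> = ?C * (1 + y) powr (-1/2) / (1 + x + 1 + y)"
      using Suc.prems y by (simp add: field_simps)
    finally show "norm (?f y) \<le> ?C * (1 + y) powr (-1/2) / (1 + x + 1 + y)" .
  qed
  moreover have norm_le: "norm (inv_2pi_i * z) \<le> norm z" for z
    using mult_right_mono[OF norm_inv_2pi_i norm_ge_zero] by (simp add: norm_mult)
  ultimately have "norm (inv_2pi_i * (LINT y:{0..}|lborel. ?f y)) \<le> ?C * pi * (1 + x) powr (-1/2)"
    by (rule order.trans[rotated])
  moreover have "rayint (Suc m) i (s(i := ?b)) v = inv_2pi_i * (LINT y:{0..}|lborel. ?f y)"
    by simp
  moreover have "?C * pi = rayint_const \<kappa> B (Suc m)" by simp
  ultimately show ?case by (simp only:)
qed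

text \<open>The forms \<open>w\<close> stay fixed and only the margin shrinks: finitely many
  inequalities, strict for \<open>\<kappa>' < \<kappa>\<close> and continuous in points and
  directions. The dominated convergence arguments rely on this common \<open>w\<close> and
  margin.\<close>

lemma half_planes_eventually:
  assumes "half_planes \<kappa> w s v i n" "\<And>k. ((\<lambda>j. S j k) \<longlongrightarrow> s k) F" "\<And>k. ((\<lambda>j. V j k) \<longlongrightarrow> v k) F" "\<kappa>' < \<kappa>"
  shows "eventually (\<lambda>j. half_planes \<kappa>' w (S j) (V j) i n) F"
  unfolding half_planes_def
proof (intro eventually_ball_finite ballI)
  fix k assume k: "k \<in> {i..<n}"
  have *: "norm (w k) \<le> 1 \<and> \<kappa> \<le> Re (w k * (s (Suc k) - s k)) \<and> Re (w k * v k) \<le> - \<kappa> \<and>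
        (Suc k < n \<longrightarrow> \<kappa> \<le> Re (w k * v (Suc k)))"
    using assms(1) k unfolding half_planes_def by auto
  have "((\<lambda>j. Re (w k * (S j (Suc k) - S j k))) \<longlongrightarrow> Re (w k * (s (Suc k) - s k))) F"
    by (intro tendsto_intros assms)
  then have 1: "eventually (\<lambda>j. \<kappa>' < Re (w k * (S j (Suc k) - S j k))) F"
    by (rule order_tendstoD(1)) (use * assms(4) in linarith)
  have "((\<lambda>j. Re (w k * V j k)) \<longlongrightarrow> Re (w k * v k)) F"
    by (intro tendsto_intros assms)
  then have 2: "eventually (\<lambda>j. Re (w k * V j k) < - \<kappa>') F"
    by (rule order_tendstoD(2)) (use * assms(4) in linarith)
  have "eventually (\<lambda>j. Suc k < n \<longrightarrow> \<kappa>' < Re (w k * V j (Suc k))) F"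
  proof (cases "Suc k < n")
    case True
    have "((\<lambda>j. Re (w k * V j (Suc k))) \<longlongrightarrow> Re (w k * v (Suc k))) F"
      by (intro tendsto_intros assms)
    then have "eventually (\<lambda>j. \<kappa>' < Re (w k * V j (Suc k))) F"
      by (rule order_tendstoD(1)) (use * assms(4) True in linarith)
    then show ?thesis by eventually_elim simp
  qed simp
  with 1 2 show "eventually (\<lambda>j. norm (w k) \<le> 1 \<and> \<kappa>' \<le> Re (w k * (S j (Suc k) - S j k)) \<and>
        Re (w k * V j k) \<le> - \<kappa>' \<and> (Suc k < n \<longrightarrow> \<kappa>' \<le> Re (w k * V j (Suc k)))) F"
    by eventually_elim (use * in auto)
qed auto

lemma eventually_norm_bound:
  fixes V :: "'a \<Rightarrow> nat \<Rightarrow> complex"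
  assumes "\<And>k. ((\<lambda>j. V j k) \<longlongrightarrow> v k) F"
  obtains B where "B \<ge> 0" "eventually (\<lambda>j. \<forall>k\<le>n. norm (V j k) \<le> B) F"
proof (rule that[of "1 + (\<Sum>k\<le>n. norm (v k))"])
  have "eventually (\<lambda>j. \<forall>k\<in>{..n}. norm (V j k) \<le> 1 + (\<Sum>k\<le>n. norm (v k))) F"
  proof (intro eventually_ball_finite ballI)
    fix k assume k: "k \<in> {..n}"
    have "norm (v k) \<le> (\<Sum>k\<le>n. norm (v k))"
      using k by (intro member_le_sum) auto
    then have "norm (v k) < 1 + (\<Sum>k\<le>n. norm (v k))" by linarith
    with tendsto_norm[OF assms[of k]] show "eventually (\<lambda>j. norm (V j k) \<le> 1 + (\<Sum>k\<le>n. norm (v k))) F"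
      using order_tendstoD(2) by (fastforce elim: eventually_mono)
  qed auto
  then show "eventually (\<lambda>j. \<forall>k\<le>n. norm (V j k) \<le> 1 + (\<Sum>k\<le>n. norm (v k))) F"
    by eventually_elim auto
qed (simp add: sum_nonneg add_nonneg_nonneg)

text \<open>The decay -1/2 of the inner integral and -1 of the denominator combine to the integrable
  exponent -3/2.\<close>

lemma ray_integrand_bound:
  assumes "norm (v::complex) \<le> B" "norm r \<le> K * (1 + x) powr (-1/2)" "\<kappa> * (1 + x) \<le> norm d" "0 < \<kappa>" "0 \<le> x" "0 \<le> K"
  shows "norm (v * r / d) \<le> B * K / \<kappa> * (1 + x) powr (-3/2)"
proof -
  have "0 \<le> B" using assms(1) norm_ge_zero order.trans by blast
  then have "norm (v * r / d) \<le> (B * (K * (1 + x) powr (-1/2))) / (\<kappa> * (1 + x))"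
    unfolding norm_divide norm_mult using assms by (intro frac_le mult_mono mult_nonneg_nonneg) auto
  also have "\<dots> = B * K / \<kappa> * ((1 + x) powr (-1/2) / (1 + x) powr 1)"
    using assms by (simp add: field_simps)
  also have "(1 + x) powr (-1/2) / (1 + x) powr 1 = (1 + x) powr (-3/2)"
    using powr_diff[of "1 + x" "-1/2" 1] by simp
  finally show ?thesis .
qed

text \<open>Joint continuity in points and directions, by induction through dominated convergence.
  Near the limit one margin \<open>\<kappa>/2\<close> and one bound \<open>B\<close> on the
  directions hold along the whole sequence and yield a common majorant.\<close>

lemma rayint_tendsto_sequentially:
  assumes "half_planes \<kappa> w s v i (Suc (i + m))" "0 < \<kappa>" "\<And>k. (\<lambda>j. S j k) \<longlonglongrightarrow> s k" "\<And>k. (\<lambda>j. V j k) \<longlonglongrightarrow> v k"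
  shows "(\<lambda>j. rayint m i (S j) (V j)) \<longlonglongrightarrow> rayint m i s v"
  using assms
proof (induction m arbitrary: i S V s v \<kappa>)
  case 0
  have "\<kappa> * (1 + 0) \<le> norm (s (Suc i) - (s i + of_real 0 * v i))"
    by (rule half_planes_lower(1)[where n = "Suc i"]) (use 0 in auto)
  then have "s (Suc i) \<noteq> s i" using 0 by auto
  then show ?case
    using 0 by (auto intro!: tendsto_intros)
next
  case (Suc m)
  let ?n = "Suc (Suc (i + m))"
  let ?q = "\<lambda>s v x. v (Suc i) * rayint m (Suc i) (s(Suc i := s (Suc i) + of_real x * v (Suc i))) v
        / (s (Suc i) + of_real x * v (Suc i) - s i)"
  have lower: "\<kappa>' * (1 + x) \<le> norm (s (Suc i) + of_real x * v (Suc i) - s i)"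
    if "half_planes \<kappa>' w s v i ?n" "0 < \<kappa>'" "0 \<le> x" for \<kappa>' s v x
    using half_planes_lower(2)[OF that(1) _ that(2), of 0 x] that by simp
  \<comment> \<open>Continuity in the ray parameter is the induction hypothesis for fixed directions
    and a first point moving along its ray.\<close>
  have cont: "continuous_on {0..} (?q s v)"
    if hp: "half_planes \<kappa>' w s v i ?n" "0 < \<kappa>'" for \<kappa>' s v
  proof (intro continuous_on_mult continuous_on_divide continuous_intros)
    show "continuous_on {0..} (\<lambda>x. rayint m (Suc i) (s(Suc i := s (Suc i) + of_real x * v (Suc i))) v)"
      unfolding continuous_on_sequentially comp_def
    proof (intro allI ballI impI, elim conjE)
      fix X and a :: real assume a: "a \<in> {0..}" "X \<longlonglongrightarrow> a"
      show "(\<lambda>j. rayint m (Suc i) (s(Suc i := s (Suc i) + of_real (X j) * v (Suc i))) v) \<longlonglongrightarrow>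
          rayint m (Suc i) (s(Suc i := s (Suc i) + of_real a * v (Suc i))) v"
      proof (rule Suc.IH[OF _ hp(2)])
        show "half_planes \<kappa>' w (s(Suc i := s (Suc i) + of_real a * v (Suc i))) v (Suc i) (Suc (Suc i + m))"
          using half_planes_shift_Suc[OF hp(1) _ hp(2)] a by simp
        show "(\<lambda>j. (s(Suc i := s (Suc i) + of_real (X j) * v (Suc i))) k)
            \<longlonglongrightarrow> (s(Suc i := s (Suc i) + of_real a * v (Suc i))) k" for k
          using a by (cases "k = Suc i") (auto intro!: tendsto_intros)
      qed auto
    qed
    show "\<forall>x\<in>{0..}. s (Suc i) + of_real x * v (Suc i) - s i \<noteq> 0"
    proof
      fix x :: real assume "x \<in> {0..}"
      with lower[OF hp, of x] mult_pos_pos[OF hp(2), of "1 + x"] show "s (Suc i) + of_real x * v (Suc i) - s i \<noteq> 0"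
        by auto
    qed
  qed
  have hp: "half_planes \<kappa> w s v i ?n" using Suc.prems(1) by simp
  have ev: "eventually (\<lambda>j. half_planes (\<kappa>/2) w (S j) (V j) i ?n) sequentially"
    by (rule half_planes_eventually[OF hp]) (use Suc.prems in auto)
  obtain B where B: "B \<ge> 0" "eventually (\<lambda>j. \<forall>k\<le>?n. norm (V j k) \<le> B) sequentially"
    by (rule eventually_norm_bound[OF Suc.prems(4)])
  let ?C = "B * rayint_const (\<kappa>/2) B m / (\<kappa>/2)"
  have "(\<lambda>j. LINT x:{0..}|lborel. ?q (S j) (V j) x) \<longlonglongrightarrow> (LINT x:{0..}|lborel. ?q s v x)"
  proof (rule ray_dct)
    show "eventually (\<lambda>j. continuous_on {0..} (?q (S j) (V j))) sequentially"
      using ev by eventually_elim (use Suc.prems(2) in \<open>auto intro!: cont\<close>)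
    show "continuous_on {0..} (?q s v)"
      by (rule cont[OF hp Suc.prems(2)])
    show "(\<lambda>j. ?q (S j) (V j) x) \<longlonglongrightarrow> ?q s v x" if x: "0 \<le> x" for x
    proof (intro tendsto_divide tendsto_mult Suc.IH)
      show "half_planes \<kappa> w (s(Suc i := s (Suc i) + of_real x * v (Suc i))) v (Suc i) (Suc (Suc i + m))"
        using half_planes_shift_Suc[OF hp x Suc.prems(2)] by simp
      show "s (Suc i) + of_real x * v (Suc i) - s i \<noteq> 0"
        using lower[OF hp Suc.prems(2) x] mult_pos_pos[OF Suc.prems(2), of "1 + x"] x by auto
      show "(\<lambda>j. ((S j)(Suc i := S j (Suc i) + of_real x * V j (Suc i))) k)
            \<longlonglongrightarrow> (s(Suc i := s (Suc i) + of_real x * v (Suc i))) k" for k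
        using Suc.prems by (cases "k = Suc i") (auto intro!: tendsto_intros)
    qed (use Suc.prems in \<open>auto intro!: tendsto_intros\<close>)
    show "eventually (\<lambda>j. \<forall>x\<ge>0. norm (?q (S j) (V j) x) \<le> ?C * (1 + x) powr (-3/2)) sequentially"
      using ev B(2)
    proof eventually_elim
      case (elim j)
      show ?case
      proof (intro allI impI)
        fix x :: real assume x: "0 \<le> x"
        show "norm (?q (S j) (V j) x) \<le> ?C * (1 + x) powr (-3/2)"
        proof (rule ray_integrand_bound)
          show "norm (rayint m (Suc i) ((S j)(Suc i := S j (Suc i) + of_real x * V j (Suc i))) (V j))
              \<le> rayint_const (\<kappa>/2) B m * (1 + x) powr (-1/2)"
            using half_planes_mono[OF elim(1), of "Suc i" "\<kappa>/2"] Suc.prems(2) B elim(2) x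
            by (intro rayint_bound) auto
          show "\<kappa>/2 * (1 + x) \<le> norm (S j (Suc i) + of_real x * V j (Suc i) - S j i)"
            using elim Suc.prems(2) x by (intro lower) auto
        qed (use elim B x Suc.prems(2) rayint_const_nonneg[of "\<kappa>/2" B m] in auto)
      qed
    qed
  qed
  then show ?case
    by (auto intro!: tendsto_intros)
qed

lemma norm_bound: "\<exists>B\<ge>0. \<forall>k\<le>n. norm (v k :: complex) \<le> B" for n :: nat
  by (rule eventually_norm_bound[of "\<lambda>_. v" v sequentially n]) auto


lemma rayint_continuous_on_ray:
  assumes hp: "half_planes \<kappa> w s v i (Suc (i + m))" "0 < \<kappa>"
  shows "continuous_on {0..} (\<lambda>x. rayint m i (s(i := s i + of_real x * v i)) v)"
  unfolding continuous_on_sequentially comp_def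
proof (intro allI ballI impI, elim conjE)
  fix X and a :: real assume a: "a \<in> {0..}" "X \<longlonglongrightarrow> a"
  show "(\<lambda>j. rayint m i (s(i := s i + of_real (X j) * v i)) v) \<longlonglongrightarrow>
      rayint m i (s(i := s i + of_real a * v i)) v"
  proof (rule rayint_tendsto_sequentially[OF _ hp(2)])
    show "half_planes \<kappa> w (s(i := s i + of_real a * v i)) v i (Suc (i + m))"
      using half_planes_shift[OF hp(1) _ hp(2)] a by simp
    show "(\<lambda>j. (s(i := s i + of_real (X j) * v i)) k) \<longlonglongrightarrow> (s(i := s i + of_real a * v i)) k" for k
      using a by (cases "k = i") (auto intro!: tendsto_intros)
  qed auto
qed

lemma half_planes_ray_nonzero:
  assumes "half_planes \<kappa> w s v i n" "0 < \<kappa>" "Suc i < n" "0 \<le> x"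
  shows "\<kappa> * (1 + x) \<le> norm (s (Suc i) + of_real x * v (Suc i) - s i)"
    and "s (Suc i) + of_real x * v (Suc i) - s i \<noteq> 0"
proof -
  show *: "\<kappa> * (1 + x) \<le> norm (s (Suc i) + of_real x * v (Suc i) - s i)"
    using half_planes_lower(2)[OF assms(1) _ assms(2), of 0 x] assms by simp
  show "s (Suc i) + of_real x * v (Suc i) - s i \<noteq> 0"
    using * mult_pos_pos[OF assms(2), of "1 + x"] assms(4) by auto
qed

lemma rayint_integrand_integrable:
  assumes hp: "half_planes \<kappa> w s v i (Suc (Suc (i + m)))" "0 < \<kappa>"
  shows "set_integrable lborel {0..} (\<lambda>x. v (Suc i) * rayint m (Suc i) (s(Suc i := s (Suc i) + of_real x * v (Suc i))) v
        / (s (Suc i) + of_real x * v (Suc i) - s i))"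
proof -
  obtain B where B: "B \<ge> 0" "\<forall>k\<le>Suc (Suc (i + m)). norm (v k) \<le> B"
    using norm_bound[of "Suc (Suc (i + m))" v] by blast
  have hp': "half_planes \<kappa> w s v (Suc i) (Suc (Suc i + m))"
    using half_planes_mono[OF hp(1), of "Suc i" \<kappa>] by simp
  show ?thesis
  proof (rule ray_integrable)
    show "continuous_on {0..} (\<lambda>x. v (Suc i) * rayint m (Suc i) (s(Suc i := s (Suc i) + of_real x * v (Suc i))) v
        / (s (Suc i) + of_real x * v (Suc i) - s i))"
      using half_planes_ray_nonzero(2)[OF hp]
      by (intro continuous_on_divide continuous_on_mult rayint_continuous_on_ray[OF hp' hp(2)] continuous_intros) auto
    fix x :: real assume x: "0 \<le> x"
    show "norm (v (Suc i) * rayint m (Suc i) (s(Suc i := s (Suc i) + of_real x * v (Suc i))) v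
        / (s (Suc i) + of_real x * v (Suc i) - s i)) \<le> B * rayint_const \<kappa> B m / \<kappa> * (1 + x) powr (-3/2)"
      using B x hp(2) half_planes_ray_nonzero(1)[OF hp _ x] rayint_const_nonneg[OF hp(2) B(1)]
      by (intro ray_integrand_bound rayint_bound[OF hp']) auto
  qed
qed

section \<open>Differentiability in the base point\<close>

lemma has_field_derivative_sequentiallyI:
  fixes f :: "complex \<Rightarrow> complex"
  assumes "\<And>T. T \<longlonglongrightarrow> z \<Longrightarrow> (\<And>j::nat. T j \<noteq> z) \<Longrightarrow> (\<lambda>j. (f (T j) - f z) / (T j - z)) \<longlonglongrightarrow> D"
  shows "(f has_field_derivative D) (at z)"
  unfolding has_field_derivative_iff tendsto_at_iff_sequentially comp_def
  using assms by blast

lemma eventually_half_planes_upd: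
  assumes "half_planes \<kappa> w s v i n" "0 < \<kappa>" "T \<longlonglongrightarrow> s k"
  shows "eventually (\<lambda>j. half_planes (\<kappa>/2) w (s(k := T j)) v i n) sequentially"
proof (rule half_planes_eventually[OF assms(1)])
  show "(\<lambda>j. (s(k := T j)) l) \<longlonglongrightarrow> s l" for l
    using assms(3) by (cases "l = k") auto
qed (use assms(2) in auto)

text \<open>The base point occurs only in the outermost denominator, so the difference quotient is
  the same integral with an extra factor \<open>1 / (?u x - s i)\<close>, and dominated convergence
  applies. The existence of the derivative is what matters: it makes the integrand along the
  preceding ray holomorphic.\<close>

lemma rayint_base_differentiable:
  assumes hp: "half_planes \<kappa> w s v i (Suc (i + m))" "0 < \<kappa>"
  shows "(\<lambda>t. rayint m i (s(i := t)) v) field_differentiable (at (s i))"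
proof (cases m)
  case 0
  have "s (Suc i) \<noteq> s i"
    using half_planes_lower(1)[OF hp(1) _ hp(2), of 0] hp by auto
  then show ?thesis using 0
    by (auto intro!: derivative_intros)
next
  case (Suc m')
  note hp' = hp(1)[unfolded Suc add_Suc_right]
  let ?u = "\<lambda>x. s (Suc i) + of_real x * v (Suc i)"
  let ?A = "\<lambda>x. v (Suc i) * rayint m' (Suc i) (s(Suc i := ?u x)) v"
  have eq: "rayint m i (s(i := t)) v = inv_2pi_i * (LINT x:{0..}|lborel. ?A x / (?u x - t))" for t
  proof -
    have "rayint m' (Suc i) ((s(i := t))(Suc i := ?u x)) v = rayint m' (Suc i) (s(Suc i := ?u x)) v" for x
      by (rule rayint_cong) auto
    then show ?thesis by (simp add: Suc)
  qed
  obtain B where B: "B \<ge> 0" "\<forall>k\<le>Suc (Suc (i + m')). norm (v k) \<le> B"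
    using norm_bound[of "Suc (Suc (i + m'))" v] by blast
  have hp1: "half_planes \<kappa> w s v (Suc i) (Suc (Suc i + m'))"
    using half_planes_mono[OF hp', of "Suc i" \<kappa>] by simp
  have int: "set_integrable lborel {0..} (\<lambda>x. ?A x / (?u x - t))"
    if "half_planes (\<kappa>/2) w (s(i := t)) v i (Suc (Suc (i + m')))" for t
  proof -
    have "rayint m' (Suc i) ((s(i := t))(Suc i := ?u x)) v = rayint m' (Suc i) (s(Suc i := ?u x)) v" for x
      by (rule rayint_cong) auto
    then show ?thesis using rayint_integrand_integrable[OF that] hp(2) by simp
  qed
  have "((\<lambda>t. rayint m i (s(i := t)) v) has_field_derivative
      inv_2pi_i * (LINT x:{0..}|lborel. ?A x / (?u x - s i) / (?u x - s i))) (at (s i))"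
  proof (rule has_field_derivative_sequentiallyI)
    fix T :: "nat \<Rightarrow> complex" assume T: "T \<longlonglongrightarrow> s i" "\<And>j. T j \<noteq> s i"
    have ev: "eventually (\<lambda>j. half_planes (\<kappa>/2) w (s(i := T j)) v i (Suc (Suc (i + m')))) sequentially"
      by (rule eventually_half_planes_upd[OF hp' hp(2) T(1)])
    have nz: "?u x - t \<noteq> 0" "\<kappa>/2 * (1 + x) \<le> norm (?u x - t)"
      if "half_planes (\<kappa>/2) w (s(i := t)) v i (Suc (Suc (i + m')))" "0 \<le> x" for t x
      using half_planes_ray_nonzero[OF that(1) _ _ that(2)] hp(2) by auto
    have hp2: "half_planes (\<kappa>/2) w (s(i := s i)) v i (Suc (Suc (i + m')))"
      using half_planes_mono[OF hp', of i "\<kappa>/2"] hp(2) by simp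
    let ?C = "B * rayint_const \<kappa> B m' / (\<kappa>/2) / (\<kappa>/2)"
    have A: "continuous_on {0..} ?A"
      by (intro continuous_intros rayint_continuous_on_ray[OF hp1 hp(2)])
    have "(\<lambda>j. LINT x:{0..}|lborel. ?A x / (?u x - T j) / (?u x - s i)) \<longlonglongrightarrow>
        (LINT x:{0..}|lborel. ?A x / (?u x - s i) / (?u x - s i))"
    proof (rule ray_dct)
      show "eventually (\<lambda>j. continuous_on {0..} (\<lambda>x. ?A x / (?u x - T j) / (?u x - s i))) sequentially"
        using ev by eventually_elim
         (intro continuous_on_divide A continuous_intros; use nz nz(1)[OF hp2] in auto)
      show "continuous_on {0..} (\<lambda>x. ?A x / (?u x - s i) / (?u x - s i))"
        by (intro continuous_on_divide A continuous_intros; use nz(1)[OF hp2] in auto)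
      show "(\<lambda>j. ?A x / (?u x - T j) / (?u x - s i)) \<longlonglongrightarrow> ?A x / (?u x - s i) / (?u x - s i)" if "0 \<le> x" for x
        by (intro tendsto_divide tendsto_const tendsto_diff T nz(1)[OF hp2 that])
      show "eventually (\<lambda>j. \<forall>x\<ge>0. norm (?A x / (?u x - T j) / (?u x - s i)) \<le> ?C * (1 + x) powr (-3/2)) sequentially"
        using ev
      proof eventually_elim
        case (elim j)
        show ?case
        proof (intro allI impI)
          fix x :: real assume x: "0 \<le> x"
          have K: "0 \<le> rayint_const \<kappa> B m'" using rayint_const_nonneg hp(2) B(1) by blast
          have 1: "norm (?A x / (?u x - T j)) \<le> B * rayint_const \<kappa> B m' / (\<kappa>/2) * (1 + x) powr (-3/2)"
            using B x hp(2) nz(2)[OF elim x] K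
            by (intro ray_integrand_bound rayint_bound[OF hp1]) auto
          have "\<kappa>/2 * 1 \<le> \<kappa>/2 * (1 + x)" using hp(2) x by (intro mult_left_mono) auto
          then have 2: "\<kappa>/2 \<le> norm (?u x - s i)"
            using nz(2)[OF hp2 x] by linarith
          have "norm (?A x / (?u x - T j) / (?u x - s i)) \<le> (B * rayint_const \<kappa> B m' / (\<kappa>/2) * (1 + x) powr (-3/2)) / (\<kappa>/2)"
            unfolding norm_divide[of "_ / _" "?u x - s i"]
            using 1 2 hp(2) K B(1) by (intro frac_le) auto
          then show "norm (?A x / (?u x - T j) / (?u x - s i)) \<le> ?C * (1 + x) powr (-3/2)"
            by (simp add: field_simps)
        qed
      qed
    qed
    then have "(\<lambda>j. inv_2pi_i * (LINT x:{0..}|lborel. ?A x / (?u x - T j) / (?u x - s i))) \<longlonglongrightarrow>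
        inv_2pi_i * (LINT x:{0..}|lborel. ?A x / (?u x - s i) / (?u x - s i))"
      by (intro tendsto_intros)
    then show "(\<lambda>j. (rayint m i (s(i := T j)) v - rayint m i (s(i := s i)) v) / (T j - s i)) \<longlonglongrightarrow>
        inv_2pi_i * (LINT x:{0..}|lborel. ?A x / (?u x - s i) / (?u x - s i))"
    proof (rule Lim_transform_eventually)
      show "eventually (\<lambda>j. inv_2pi_i * (LINT x:{0..}|lborel. ?A x / (?u x - T j) / (?u x - s i)) =
         (rayint m i (s(i := T j)) v - rayint m i (s(i := s i)) v) / (T j - s i)) sequentially"
        using ev
      proof eventually_elim
        case (elim j)
        have "(LINT x:{0..}|lborel. ?A x / (?u x - T j)) - (LINT x:{0..}|lborel. ?A x / (?u x - s i))
           = (LINT x:{0..}|lborel. ?A x / (?u x - T j) - ?A x / (?u x - s i))"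
          by (rule set_integral_diff(2)[symmetric]) (use int elim hp2 in auto)
        also have "\<dots> = (LINT x:{0..}|lborel. (T j - s i) * (?A x / (?u x - T j) / (?u x - s i)))"
        proof (rule set_lebesgue_integral_cong)
          show "\<forall>x. x \<in> {0..} \<longrightarrow> ?A x / (?u x - T j) - ?A x / (?u x - s i) = (T j - s i) * (?A x / (?u x - T j) / (?u x - s i))"
          proof (intro allI impI)
            fix x :: real assume x: "x \<in> {0..}"
            have "a / p - a / q = (q - p) * (a / p / q)" if "p \<noteq> 0" "q \<noteq> 0" for a p q :: complex
              using that by (simp add: field_simps)
            from this[OF nz(1)[OF elim] nz(1)[OF hp2], of x x "?A x"] x
            show "?A x / (?u x - T j) - ?A x / (?u x - s i) = (T j - s i) * (?A x / (?u x - T j) / (?u x - s i))"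
              by simp
          qed
        qed auto
        also have "\<dots> = (T j - s i) * (LINT x:{0..}|lborel. ?A x / (?u x - T j) / (?u x - s i))"
          by (rule set_integral_mult_right)
        finally show ?case
          unfolding eq using T(2)[of j] by (simp add: right_diff_distrib[symmetric])
      qed
    qed
  qed
  then show ?thesis unfolding field_differentiable_def by blast
qed

section \<open>Moving the first ray\<close>

lemma ray_integral_primitive_tendsto:
  fixes \<Phi> :: "complex \<Rightarrow> complex"
  assumes \<Phi>: "\<And>x. 0 \<le> x \<Longrightarrow> (\<Phi> has_field_derivative f (a + of_real x * u)) (at (a + of_real x * u))"
    and cont: "continuous_on {0..} (\<lambda>x. f (a + of_real x * u))"
    and int: "set_integrable lborel {0..} (\<lambda>x. u * f (a + of_real x * u))"
  shows "(\<lambda>N::nat. \<Phi> (a + of_real (real N) * u)) \<longlonglongrightarrow> \<Phi> a + (LINT x:{0..}|lborel. u * f (a + of_real x * u))"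
proof -
  let ?g = "\<lambda>x. u * f (a + of_real x * u)"
  have fin: "(\<integral>x. indicator {0..X} x *\<^sub>R ?g x \<partial>lborel) = \<Phi> (a + of_real X * u) - \<Phi> (a + of_real 0 * u)"
    if X: "0 \<le> X" for X
  proof (rule integral_FTC_atLeastAtMost[OF X, where F = "\<lambda>x. \<Phi> (a + of_real x * u)"])
    fix x assume x: "0 \<le> x" "x \<le> X"
    have "((\<lambda>x. a + of_real x * u) has_vector_derivative u) (at x within {0..X})"
      unfolding has_vector_derivative_def
      by (auto intro!: derivative_eq_intros simp: scaleR_conv_of_real)
    from field_vector_diff_chain_within[OF this has_field_derivative_at_within[OF \<Phi>[OF x(1)]]]
    show "((\<lambda>x. \<Phi> (a + of_real x * u)) has_vector_derivative ?g x) (at x within {0..X})"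
      by (simp add: o_def)
  next
    show "continuous_on {0..X} ?g"
      by (intro continuous_intros continuous_on_subset[OF cont]) auto
  qed
  have "((\<lambda>y. \<integral>x. indicator {..y} x *\<^sub>R (indicator {0..} x *\<^sub>R ?g x) \<partial>lborel)
      \<longlongrightarrow> (\<integral>x. indicator {0..} x *\<^sub>R ?g x \<partial>lborel)) at_top"
    using int unfolding set_integrable_def by (intro tendsto_integral_at_top) auto
  then have "(\<lambda>N::nat. \<integral>x. indicator {..real N} x *\<^sub>R (indicator {0..} x *\<^sub>R ?g x) \<partial>lborel)
      \<longlonglongrightarrow> (\<integral>x. indicator {0..} x *\<^sub>R ?g x \<partial>lborel)"
    using filterlim_compose filterlim_real_sequentially by blast
  moreover have "(\<integral>x. indicator {..real N} x *\<^sub>R (indicator {0..} x *\<^sub>R ?g x) \<partial>lborel)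
      = \<Phi> (a + of_real (real N) * u) - \<Phi> a" for N
  proof -
    have "(\<integral>x. indicator {..real N} x *\<^sub>R (indicator {0..} x *\<^sub>R ?g x) \<partial>lborel)
        = (\<integral>x. indicator {0..real N} x *\<^sub>R ?g x \<partial>lborel)"
      by (intro Bochner_Integration.integral_cong) (auto simp: indicator_def)
    then show ?thesis using fin[of "real N"] by simp
  qed
  ultimately have "(\<lambda>N::nat. \<Phi> (a + of_real (real N) * u) - \<Phi> a)
      \<longlonglongrightarrow> (LINT x:{0..}|lborel. ?g x)"
    unfolding set_lebesgue_integral_def by simp
  from tendsto_add[OF tendsto_const[of "\<Phi> a"] this] show ?thesis by simp
qed

text \<open>The primitive converges along both rays, and the two limits agree: the segment joining
  the points with parameter N has length O(N), while the derivative on it is O(N^(-3/2)). Integral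
  plus initial value of \<Phi> is this common limit, which covers a change of direction and a change
  of origin at once.\<close>

lemma ray_integral_invariance:
  fixes \<Phi> :: "complex \<Rightarrow> complex"
  assumes Y: "convex Y" and \<Phi>: "\<And>p. p \<in> Y \<Longrightarrow> (\<Phi> has_field_derivative f p) (at p)"
    and contf: "continuous_on Y f"
    and a: "\<And>x. 0 \<le> x \<Longrightarrow> a + of_real x * u \<in> Y" and b: "\<And>x. 0 \<le> x \<Longrightarrow> b + of_real x * v \<in> Y"
    and bd: "\<And>x \<theta>. 0 \<le> x \<Longrightarrow> 0 \<le> \<theta> \<Longrightarrow> \<theta> \<le> 1 \<Longrightarrow>
       norm (f ((1 - \<theta>) *\<^sub>R (a + of_real x * u) + \<theta> *\<^sub>R (b + of_real x * v))) \<le> C * (1 + x) powr (-3/2)"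
  shows "(LINT x:{0..}|lborel. u * f (a + of_real x * u)) + \<Phi> a = (LINT x:{0..}|lborel. v * f (b + of_real x * v)) + \<Phi> b"
proof -
  have C: "0 \<le> C" using order.trans[OF norm_ge_zero bd[of 0 0]] by simp
  have int: "(\<lambda>N::nat. \<Phi> (e + of_real (real N) * d)) \<longlonglongrightarrow> \<Phi> e + (LINT x:{0..}|lborel. d * f (e + of_real x * d))"
    if e: "\<And>x. 0 \<le> x \<Longrightarrow> e + of_real x * d \<in> Y"
      and bd: "\<And>x. 0 \<le> x \<Longrightarrow> norm (f (e + of_real x * d)) \<le> C * (1 + x) powr (-3/2)" for e d
  proof (rule ray_integral_primitive_tendsto)
    show cont: "continuous_on {0..} (\<lambda>x. f (e + of_real x * d))"
      by (rule continuous_on_compose2[OF contf]) (use e in \<open>auto intro!: continuous_intros\<close>)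
    show "set_integrable lborel {0..} (\<lambda>x. d * f (e + of_real x * d))"
    proof (rule ray_integrable)
      show "norm (d * f (e + of_real x * d)) \<le> (norm d * C) * (1 + x) powr (-3/2)" if "0 \<le> x" for x
        using mult_left_mono[OF bd[OF that] norm_ge_zero[of d]] by (simp add: norm_mult mult_ac)
    qed (intro continuous_intros cont)
  qed (use e \<Phi> in auto)
  have A: "(\<lambda>N::nat. \<Phi> (a + of_real (real N) * u)) \<longlonglongrightarrow> \<Phi> a + (LINT x:{0..}|lborel. u * f (a + of_real x * u))"
  proof (rule int[OF a])
    show "norm (f (a + of_real x * u)) \<le> C * (1 + x) powr (-3/2)" if "0 \<le> x" for x
      using bd[of x 0] that by simp
  qed
  have B: "(\<lambda>N::nat. \<Phi> (b + of_real (real N) * v)) \<longlonglongrightarrow> \<Phi> b + (LINT x:{0..}|lborel. v * f (b + of_real x * v))"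
  proof (rule int[OF b])
    show "norm (f (b + of_real x * v)) \<le> C * (1 + x) powr (-3/2)" if "0 \<le> x" for x
      using bd[of x 1] that by simp
  qed
  have "(\<lambda>N::nat. \<Phi> (a + of_real (real N) * u) - \<Phi> (b + of_real (real N) * v)) \<longlonglongrightarrow> 0"
  proof (rule Lim_null_comparison)
    show "eventually (\<lambda>N::nat. norm (\<Phi> (a + of_real (real N) * u) - \<Phi> (b + of_real (real N) * v))
        \<le> C * (1 + real N) powr (-3/2) * (norm (a - b) + real N * norm (u - v))) sequentially"
    proof (rule always_eventually, rule allI)
      fix N :: nat
      let ?p = "a + of_real (real N) * u" and ?q = "b + of_real (real N) * v"
      have seg: "closed_segment ?p ?q \<subseteq> Y"
        by (intro closed_segment_subset a b Y) auto
      have "norm (\<Phi> ?p - \<Phi> ?q) \<le> C * (1 + real N) powr (-3/2) * norm (?p - ?q)"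
      proof (rule field_differentiable_bound[of "closed_segment ?p ?q" \<Phi> f])
        show "(\<Phi> has_field_derivative f z) (at z within closed_segment ?p ?q)" if "z \<in> closed_segment ?p ?q" for z
          using \<Phi> seg that by (auto intro: has_field_derivative_at_within)
        show "norm (f z) \<le> C * (1 + real N) powr (-3/2)" if "z \<in> closed_segment ?p ?q" for z
          using that bd[of "real N"] unfolding closed_segment_def by auto
      qed auto
      also have "norm (?p - ?q) \<le> norm (a - b) + real N * norm (u - v)"
      proof -
        have "?p - ?q = (a - b) + of_real (real N) * (u - v)" by (simp add: algebra_simps)
        then have "norm (?p - ?q) \<le> norm (a - b) + norm (of_real (real N) * (u - v))"
          by (metis norm_triangle_ineq)
        then show ?thesis by (simp add: norm_mult)
      qed
      finally show "norm (\<Phi> ?p - \<Phi> ?q) \<le> C * (1 + real N) powr (-3/2) * (norm (a - b) + real N * norm (u - v))"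
        using C by (simp add: mult_left_mono)
    qed
    show "(\<lambda>N::nat. C * (1 + real N) powr (-3/2) * (norm (a - b) + real N * norm (u - v))) \<longlonglongrightarrow> 0"
    proof -
      have "(\<lambda>N::nat. (1 + real N) powr (-3/2) * real N) \<longlonglongrightarrow> 0" "(\<lambda>N::nat. (1 + real N) powr (-3/2)) \<longlonglongrightarrow> 0"
        by real_asymp+
      from tendsto_add[OF tendsto_mult[OF tendsto_const[of "C * norm (u - v)"] this(1)]
          tendsto_mult[OF tendsto_const[of "C * norm (a - b)"] this(2)]]
      show ?thesis by (simp add: algebra_simps)
    qed
  qed
  from LIMSEQ_unique[OF this tendsto_diff[OF A B]] show ?thesis
    by (simp add: algebra_simps)
qed

text \<open>With \<open>w\<close> fixed all conditions are affine in points and directions. This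
  supplies the bound on the segments between two rays that \<open>ray_integral_invariance\<close>
  asks for.\<close>

lemma half_planes_convex:
  assumes "half_planes \<kappa> w s v i n" "half_planes \<kappa> w (s(k := p)) (v(k := u)) i n" "0 \<le> \<theta>" "\<theta> \<le> 1"
  shows "half_planes \<kappa> w (s(k := (1 - \<theta>) *\<^sub>R s k + \<theta> *\<^sub>R p)) (v(k := (1 - \<theta>) *\<^sub>R v k + \<theta> *\<^sub>R u)) i n"
proof -
  let ?s = "\<lambda>l. (1 - \<theta>) *\<^sub>R s l + \<theta> *\<^sub>R (s(k := p)) l" and ?v = "\<lambda>l. (1 - \<theta>) *\<^sub>R v l + \<theta> *\<^sub>R (v(k := u)) l"
  have "half_planes \<kappa> w ?s ?v i n"
    unfolding half_planes_def
  proof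
    fix l assume l: "l \<in> {i..<n}"
    note 1 = bspec[OF assms(1)[unfolded half_planes_def] l] and 2 = bspec[OF assms(2)[unfolded half_planes_def] l]
    have cvx: "(1 - \<theta>) * x + \<theta> * y \<ge> c" if "x \<ge> c" "y \<ge> c" for x y c :: real
      using convex_bound_le[of "-x" "-c" "-y" "1 - \<theta>" \<theta>] that assms(3,4) by (simp add: algebra_simps)
    have cvx': "(1 - \<theta>) * x + \<theta> * y \<le> c" if "x \<le> c" "y \<le> c" for x y c :: real
      using convex_bound_le[of x c y "1 - \<theta>" \<theta>] that assms(3,4) by simp
    have e1: "Re (w l * (?s (Suc l) - ?s l)) = (1 - \<theta>) * Re (w l * (s (Suc l) - s l)) + \<theta> * Re (w l * ((s(k := p)) (Suc l) - (s(k := p)) l))"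
      by (simp add: algebra_simps scaleR_conv_of_real)
    have e2: "Re (w l * ?v j) = (1 - \<theta>) * Re (w l * v j) + \<theta> * Re (w l * (v(k := u)) j)" for j
      by (simp add: algebra_simps scaleR_conv_of_real)
    show "norm (w l) \<le> 1 \<and> \<kappa> \<le> Re (w l * (?s (Suc l) - ?s l)) \<and> Re (w l * ?v l) \<le> - \<kappa> \<and>
        (Suc l < n \<longrightarrow> \<kappa> \<le> Re (w l * ?v (Suc l)))"
      unfolding e1 e2 using 1 2 by (intro conjI impI cvx cvx') auto
  qed
  moreover have "?s = s(k := (1 - \<theta>) *\<^sub>R s k + \<theta> *\<^sub>R p)" "?v = v(k := (1 - \<theta>) *\<^sub>R v k + \<theta> *\<^sub>R u)"
    by (auto simp: fun_eq_iff algebra_simps)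
  ultimately show ?thesis by simp
qed

lemma half_planes_ball:
  assumes "half_planes \<kappa> w s v i n" "0 < \<kappa>" "i \<le> k" 
  shows "\<exists>e>0. \<forall>p\<in>ball (s k) e. half_planes (\<kappa>/2) w (s(k := p)) v i n"
proof -
  have "eventually (\<lambda>p. half_planes (\<kappa>/2) w (s(k := p)) v i n) (nhds (s k))"
  proof (rule half_planes_eventually[OF assms(1)])
    show "((\<lambda>p. (s(k := p)) l) \<longlongrightarrow> s l) (nhds (s k))" for l
      by (cases "l = k") (auto simp: filterlim_ident)
  qed (use assms in auto)
  then show ?thesis
    unfolding eventually_nhds_metric by (auto simp: dist_commute)
qed

text \<open>
  Both the independence of \<open>rayint\<close> of the direction of its first ray and its derivative with respect to
  the origin of that ray are read off from a primitive \<open>\<Phi>\<close> of the integrand in an intersection of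
  two half planes.
\<close>

lemma rayint_first_ray:
  assumes hp: "half_planes \<kappa> w s v i (Suc (Suc (i + m)))" "0 < \<kappa>"
  shows "\<exists>\<Phi>. (\<Phi> has_field_derivative rayint m (Suc i) s v / (s (Suc i) - s i)) (at (s (Suc i))) \<and>
    (\<forall>p u \<kappa>'. half_planes \<kappa>' w (s(Suc i := p)) (v(Suc i := u)) i (Suc (Suc (i + m))) \<longrightarrow> 0 < \<kappa>' \<longrightarrow>
       rayint (Suc m) i (s(Suc i := p)) (v(Suc i := u)) + inv_2pi_i * \<Phi> p
       = rayint (Suc m) i s v + inv_2pi_i * \<Phi> (s (Suc i)))"
proof -
  let ?n = "Suc (Suc (i + m))" and ?k = "Suc i"
  \<comment> \<open>Every admissible first ray lies in this convex set, \<open>s i\<close> lies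
    outside it, and the inner integral is holomorphic for base points in it.\<close>
  define Y where "Y = {p. 0 < Re (w i * (p - s i))} \<inter> {p. 0 < Re (w ?k * (s (Suc ?k) - p))}"
  define f where "f p = rayint m ?k (s(?k := p)) v / (p - s i)" for p
  have ineq: "norm (w l) \<le> 1 \<and> \<kappa> \<le> Re (w l * (s (Suc l) - s l)) \<and> Re (w l * v l) \<le> - \<kappa> \<and>
      (Suc l < ?n \<longrightarrow> \<kappa> \<le> Re (w l * v (Suc l)))" if "l \<in> {i..<?n}" for l
    using hp(1) that unfolding half_planes_def by blast
  have Yeq: "Y = {p. inner (cnj (w i)) p > Re (w i * s i)} \<inter> {p. inner (cnj (w ?k)) p < Re (w ?k * s (Suc ?k))}"
    unfolding Y_def by (auto simp: algebra_simps inner_complex_def)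
  have convY: "convex Y" and openY: "open Y"
    unfolding Yeq by (auto intro!: convex_Int convex_halfspace_gt convex_halfspace_lt open_Int
      open_halfspace_gt open_halfspace_lt)
  have f_diff: "f field_differentiable (at p)" if p: "p \<in> Y" for p
  proof -
    define \<kappa>' where "\<kappa>' = min \<kappa> (min (Re (w ?k * (s (Suc ?k) - p))) ((norm (w ?k))\<^sup>2))"
    have "w ?k \<noteq> 0" using p by (auto simp: Y_def)
    then have pos: "0 < \<kappa>'" using hp(2) p unfolding \<kappa>'_def Y_def by auto
    \<comment> \<open>An arbitrary point of \<open>Y\<close> comes without a direction. Since
      \<open>rayint m ?k\<close> depends only on later directions, the one at \<open>?k\<close> can
      be chosen freely; \<open>- cnj (w ?k)\<close> gives \<open>- (norm (w ?k))\<^sup>2\<close>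
      under the form.\<close>
    let ?v = "v(?k := - cnj (w ?k))"
    have "half_planes \<kappa>' w (s(?k := p)) ?v ?k (Suc (?k + m))"
      unfolding half_planes_def
    proof
      fix l assume l: "l \<in> {?k..<Suc (?k + m)}"
      then have *: "norm (w l) \<le> 1 \<and> \<kappa> \<le> Re (w l * (s (Suc l) - s l)) \<and> Re (w l * v l) \<le> - \<kappa> \<and>
         (Suc l < ?n \<longrightarrow> \<kappa> \<le> Re (w l * v (Suc l)))" by (intro ineq) auto
      have "Re (w ?k * - cnj (w ?k)) = - (norm (w ?k))\<^sup>2"
        by (simp add: cmod_power2) (simp add: power2_eq_square)
      then show "norm (w l) \<le> 1 \<and> \<kappa>' \<le> Re (w l * ((s(?k := p)) (Suc l) - (s(?k := p)) l)) \<and> Re (w l * ?v l) \<le> - \<kappa>' \<and>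
        (Suc l < Suc (?k + m) \<longrightarrow> \<kappa>' \<le> Re (w l * ?v (Suc l)))"
        using * l by (cases "l = ?k") (auto simp: \<kappa>'_def)
    qed
    from rayint_base_differentiable[OF this pos]
    have "(\<lambda>t. rayint m ?k (s(?k := t)) ?v) field_differentiable at p" by simp
    moreover have "rayint m ?k (s(?k := t)) ?v = rayint m ?k (s(?k := t)) v" for t
      by (rule rayint_cong) auto
    moreover have "p - s i \<noteq> 0" using p by (auto simp: Y_def)
    ultimately show ?thesis
      unfolding f_def by (intro derivative_intros) auto
  qed
  then have hol: "f holomorphic_on Y"
    by (meson field_differentiable_at_within holomorphic_onI)
  obtain \<Phi> where "\<And>p. p \<in> Y \<Longrightarrow> (\<Phi> has_field_derivative f p) (at p within Y)"
    by (rule holomorphic_convex_primitive'[OF convY openY hol]) (rule that, blast)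
  then have \<Phi>: "(\<Phi> has_field_derivative f p) (at p)" if "p \<in> Y" for p
    using at_within_open[OF that openY] that by metis
  have inY: "p + of_real x * u \<in> Y"
    if *: "half_planes \<kappa>' w (s(?k := p)) (v(?k := u)) i ?n" "0 < \<kappa>'" "0 \<le> x" for \<kappa>' p u x
  proof -
    have "\<kappa>' \<le> Re (w i * (p - s i))" "Re (w i * u) \<ge> \<kappa>'"
      using bspec[OF *(1)[unfolded half_planes_def], of i] by auto
    moreover have "\<kappa>' \<le> Re (w ?k * (s (Suc ?k) - p))" "Re (w ?k * u) \<le> -\<kappa>'"
      using bspec[OF *(1)[unfolded half_planes_def], of ?k] by auto
    moreover have "0 \<le> x * Re (w i * u)" "x * Re (w ?k * u) \<le> 0"
      using calculation *(2,3) by (auto intro!: mult_nonneg_nonneg mult_nonneg_nonpos)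
    ultimately show ?thesis using *(2) unfolding Y_def by (simp add: algebra_simps)
  qed
  have rep: "rayint (Suc m) i (s(?k := p)) (v(?k := u)) = inv_2pi_i * (LINT x:{0..}|lborel. u * f (p + of_real x * u))" for p u
  proof -
    have "rayint m ?k (s(?k := q)) (v(?k := u)) = rayint m ?k (s(?k := q)) v" for q
      by (rule rayint_cong) auto
    then show ?thesis by (simp add: f_def)
  qed
  have hp0: "half_planes \<kappa> w (s(?k := s ?k)) (v(?k := v ?k)) i ?n" using hp by simp
  show ?thesis
  proof (intro exI[of _ \<Phi>] conjI allI impI)
    show "(\<Phi> has_field_derivative rayint m (Suc i) s v / (s (Suc i) - s i)) (at (s (Suc i)))"
      using \<Phi>[OF inY[OF hp0 hp(2), of 0, simplified]] by (simp add: f_def)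
    fix p u \<kappa>'
    assume hp': "half_planes \<kappa>' w (s(?k := p)) (v(?k := u)) i ?n" "0 < \<kappa>'"
    define c where "c = min \<kappa> \<kappa>'"
    have c: "0 < c" using hp(2) hp'(2) by (simp add: c_def)
    have h1: "half_planes c w s v i ?n" and h2: "half_planes c w (s(?k := p)) (v(?k := u)) i ?n"
      using half_planes_mono[OF hp(1), of i c] half_planes_mono[OF hp'(1), of i c] by (auto simp: c_def)
    obtain B where B: "B \<ge> 0" "\<forall>k\<le>?n. norm (v k) \<le> B"
      using norm_bound[of "?n" v] by blast
    have "(LINT x:{0..}|lborel. v ?k * f (s ?k + of_real x * v ?k)) + \<Phi> (s ?k)
        = (LINT x:{0..}|lborel. u * f (p + of_real x * u)) + \<Phi> p"
    proof (rule ray_integral_invariance[OF convY \<Phi>])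
      show "continuous_on Y f" using hol by (rule holomorphic_on_imp_continuous_on)
      show "s ?k + of_real x * v ?k \<in> Y" if "0 \<le> x" for x
        by (rule inY[OF hp0 hp(2) that])
      show "p + of_real x * u \<in> Y" if "0 \<le> x" for x
        by (rule inY[OF hp' that])
      fix x \<theta> :: real assume x: "0 \<le> x" "0 \<le> \<theta>" "\<theta> \<le> 1"
      let ?a = "(1 - \<theta>) *\<^sub>R s ?k + \<theta> *\<^sub>R p" and ?u = "(1 - \<theta>) *\<^sub>R v ?k + \<theta> *\<^sub>R u"
      have hc: "half_planes c w (s(?k := ?a)) (v(?k := ?u)) i ?n"
        by (rule half_planes_convex[OF h1 h2 x(2,3)])
      have hc': "half_planes c w (s(?k := ?a)) (v(?k := ?u)) ?k (Suc (?k + m))"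
        using half_planes_mono[OF hc, of ?k c] by simp
      have eq: "(1 - \<theta>) *\<^sub>R (s ?k + of_real x * v ?k) + \<theta> *\<^sub>R (p + of_real x * u) = ?a + of_real x * ?u"
        by (simp add: algebra_simps scaleR_conv_of_real)
      have r: "rayint m ?k (s(?k := ?a + of_real x * ?u)) (v(?k := ?u)) = rayint m ?k (s(?k := ?a + of_real x * ?u)) v"
        by (rule rayint_cong) auto
      have "norm (rayint m ?k (s(?k := ?a + of_real x * ?u)) (v(?k := ?u))) \<le> rayint_const c B m * (1 + x) powr (-1/2)"
        using rayint_bound[OF hc' c B(1) _ x(1)] B(2) by simp
      then have "norm (1 * rayint m ?k (s(?k := ?a + of_real x * ?u)) v / (?a + of_real x * ?u - s i))
          \<le> 1 * rayint_const c B m / c * (1 + x) powr (-3/2)"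
        using half_planes_ray_nonzero(1)[OF hc c _ x(1)] c x rayint_const_nonneg[OF c B(1)]
        unfolding r by (intro ray_integrand_bound) auto
      then show "norm (f ((1 - \<theta>) *\<^sub>R (s ?k + of_real x * v ?k) + \<theta> *\<^sub>R (p + of_real x * u)))
         \<le> rayint_const c B m / c * (1 + x) powr (-3/2)"
        unfolding eq f_def by simp
    qed
    then have "inv_2pi_i * ((LINT x:{0..}|lborel. v ?k * f (s ?k + of_real x * v ?k)) + \<Phi> (s ?k))
        = inv_2pi_i * ((LINT x:{0..}|lborel. u * f (p + of_real x * u)) + \<Phi> p)" by (simp only:)
    then show "rayint (Suc m) i (s(?k := p)) (v(?k := u)) + inv_2pi_i * \<Phi> p
       = rayint (Suc m) i s v + inv_2pi_i * \<Phi> (s ?k)"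
      using rep[of "s ?k" "v ?k"] unfolding rep fun_upd_triv by (simp only: distrib_left)
  qed
qed

text \<open>Each half plane inequality involves at most one direction vector, so with a common
  \<open>w\<close> the directions can be exchanged one at a time: the first by
  \<open>rayint_first_ray\<close> with unchanged origin, the others by induction under the
  integral.\<close>

lemma rayint_directions:
  assumes "half_planes \<kappa> w s v i (Suc (i + m))" "half_planes \<kappa> w s v' i (Suc (i + m))" "0 < \<kappa>"
  shows "rayint m i s v = rayint m i s v'"
  using assms
proof (induction m arbitrary: i s v)
  case (Suc m)
  let ?n = "Suc (Suc (i + m))"
  have hp: "half_planes \<kappa> w s v i ?n" "half_planes \<kappa> w s v' i ?n" using Suc.prems by simp_all
  have mixed: "half_planes \<kappa> w s (v(Suc i := v' (Suc i))) i ?n"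
    unfolding half_planes_def
  proof
    fix l assume "l \<in> {i..<?n}"
    from bspec[OF hp(1)[unfolded half_planes_def] this] bspec[OF hp(2)[unfolded half_planes_def] this]
    show "norm (w l) \<le> 1 \<and> \<kappa> \<le> Re (w l * (s (Suc l) - s l)) \<and> Re (w l * (v(Suc i := v' (Suc i))) l) \<le> - \<kappa> \<and>
        (Suc l < ?n \<longrightarrow> \<kappa> \<le> Re (w l * (v(Suc i := v' (Suc i))) (Suc l)))" by auto
  qed
  have "rayint (Suc m) i s v = rayint (Suc m) i s (v(Suc i := v' (Suc i)))"
  proof -
    obtain \<Phi> where "\<forall>p u \<kappa>'. half_planes \<kappa>' w (s(Suc i := p)) (v(Suc i := u)) i ?n \<longrightarrow> 0 < \<kappa>' \<longrightarrow>
       rayint (Suc m) i (s(Suc i := p)) (v(Suc i := u)) + inv_2pi_i * \<Phi> p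
       = rayint (Suc m) i s v + inv_2pi_i * \<Phi> (s (Suc i))"
      using rayint_first_ray[OF hp(1) Suc.prems(3)] by blast
    from this[rule_format, of \<kappa> "s (Suc i)" "v' (Suc i)"] mixed Suc.prems(3) show ?thesis by simp
  qed
  also have "\<dots> = rayint (Suc m) i s v'"
  proof -
    have "rayint m (Suc i) (s(Suc i := s (Suc i) + of_real x * v' (Suc i))) (v(Suc i := v' (Suc i)))
        = rayint m (Suc i) (s(Suc i := s (Suc i) + of_real x * v' (Suc i))) v'" if "0 \<le> x" for x
    proof (rule Suc.IH[OF _ _ Suc.prems(3)])
      show "half_planes \<kappa> w (s(Suc i := s (Suc i) + of_real x * v' (Suc i))) (v(Suc i := v' (Suc i))) (Suc i) (Suc (Suc i + m))"
        using half_planes_shift_Suc[OF mixed that Suc.prems(3)] by simp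
      show "half_planes \<kappa> w (s(Suc i := s (Suc i) + of_real x * v' (Suc i))) v' (Suc i) (Suc (Suc i + m))"
        using half_planes_shift_Suc[OF hp(2) that Suc.prems(3)] by simp
    qed
    then show ?thesis
      by (auto intro!: set_lebesgue_integral_cong)
  qed
  finally show ?case .
qed simp

section \<open>Derivatives of the ray integrals\<close>

text \<open>For the point next to the base the derivative is minus the integrand at the origin of
  its ray, read off from the primitive. For a later point one differentiates under the first
  integral; the factor that starts at \<open>k\<close> is independent of the first variable and
  leaves the integral.\<close>

lemma rayint_deriv:
  assumes "half_planes \<kappa> w s v i (Suc (i + m))" "0 < \<kappa>" "i < k" "k \<le> i + m"
  shows "((\<lambda>p. rayint m i (s(k := p)) v) has_field_derivative
      - (rayint (k - Suc i) i s v * rayint (i + m - k) k s v)) (at (s k))"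
  using assms
proof (induction m arbitrary: i s \<kappa>)
  case (Suc m)
  let ?n = "Suc (Suc (i + m))"
  have hp: "half_planes \<kappa> w s v i ?n" and \<kappa>: "0 < \<kappa>" using Suc.prems by simp_all
  show ?case
  proof (cases "k = Suc i")
    case True
    obtain \<Phi> where \<Phi>: "(\<Phi> has_field_derivative rayint m (Suc i) s v / (s (Suc i) - s i)) (at (s (Suc i)))"
      "\<forall>p u \<kappa>'. half_planes \<kappa>' w (s(Suc i := p)) (v(Suc i := u)) i ?n \<longrightarrow> 0 < \<kappa>' \<longrightarrow>
       rayint (Suc m) i (s(Suc i := p)) (v(Suc i := u)) + inv_2pi_i * \<Phi> p
       = rayint (Suc m) i s v + inv_2pi_i * \<Phi> (s (Suc i))"
      using rayint_first_ray[OF hp \<kappa>] by blast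
    obtain e where e: "e > 0" "\<forall>p\<in>ball (s (Suc i)) e. half_planes (\<kappa>/2) w (s(Suc i := p)) v i ?n"
      using half_planes_ball[OF hp \<kappa>, of "Suc i"] by auto
    have "((\<lambda>p. rayint (Suc m) i s v + inv_2pi_i * \<Phi> (s (Suc i)) - inv_2pi_i * \<Phi> p) has_field_derivative
        - (inv_2pi_i * (rayint m (Suc i) s v / (s (Suc i) - s i)))) (at (s (Suc i)))"
      by (auto intro!: derivative_eq_intros \<Phi>(1))
    then have "((\<lambda>p. rayint (Suc m) i (s(Suc i := p)) v) has_field_derivative
        - (inv_2pi_i * (rayint m (Suc i) s v / (s (Suc i) - s i)))) (at (s (Suc i)))"
    proof (rule has_field_derivative_transform_within[OF _ e(1)])
      fix p assume "dist p (s (Suc i)) < e"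
      then have "half_planes (\<kappa>/2) w (s(Suc i := p)) v i ?n" using e(2) by (simp add: dist_commute)
      with \<Phi>(2)[rule_format, of "\<kappa>/2" p "v (Suc i)"] \<kappa>
      show "rayint (Suc m) i s v + inv_2pi_i * \<Phi> (s (Suc i)) - inv_2pi_i * \<Phi> p = rayint (Suc m) i (s(Suc i := p)) v"
        unfolding fun_upd_triv by (metis add_diff_cancel_right' half_gt_zero)
    qed auto
    moreover have "- (rayint (k - Suc i) i s v * rayint (i + Suc m - k) k s v)
       = - (inv_2pi_i * (rayint m (Suc i) s v / (s (Suc i) - s i)))"
      by (simp add: True)
    ultimately show ?thesis by (simp only: True)
  next
    case False
    then have k: "Suc i < k" "k \<le> Suc i + m" using Suc.prems by auto
    define l where "l = k - Suc (Suc i)"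
    have l: "k - Suc i = Suc l" using k by (simp add: l_def)
    let ?u = "\<lambda>x. s (Suc i) + of_real x * v (Suc i)"
    let ?r = "\<lambda>p x. rayint m (Suc i) (s(k := p, Suc i := ?u x)) v"
    let ?q = "\<lambda>p x. v (Suc i) * ?r p x / (?u x - s i)"
    let ?a = "\<lambda>p x. rayint l (Suc i) (s(k := p, Suc i := ?u x)) v" and ?b = "\<lambda>p. rayint (Suc (i + m) - k) k (s(k := p)) v"
    have eq: "rayint (Suc m) i (s(k := p)) v = inv_2pi_i * (LINT x:{0..}|lborel. ?q p x)" for p
      using k by simp
    obtain B where B: "B \<ge> 0" "\<forall>k\<le>?n. norm (v k) \<le> B"
      using norm_bound[of ?n v] by blast
    obtain e where e: "e > 0" "\<forall>p\<in>ball (s k) e. half_planes (\<kappa>/2) w (s(k := p)) v i ?n"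
      using half_planes_ball[OF hp \<kappa>, of k] Suc.prems by auto
    have \<kappa>2: "0 < \<kappa>/2" using \<kappa> by simp
    have hpx: "half_planes (\<kappa>/2) w (s(k := p, Suc i := ?u x)) v (Suc i) (Suc (Suc i + m))"
      if "p \<in> ball (s k) e" "0 \<le> x" for p x
      using half_planes_shift_Suc[OF bspec[OF e(2) that(1)] that(2) \<kappa>2] k by simp
    have der: "((\<lambda>p. ?r p x) has_field_derivative - (?a p x * ?b p)) (at p)"
      if "p \<in> ball (s k) e" "0 \<le> x" for p x
    proof -
      have "((\<lambda>p'. rayint m (Suc i) ((s(k := p, Suc i := ?u x))(k := p')) v) has_field_derivative
        - (rayint (k - Suc (Suc i)) (Suc i) (s(k := p, Suc i := ?u x)) v *
           rayint (Suc i + m - k) k (s(k := p, Suc i := ?u x)) v)) (at ((s(k := p, Suc i := ?u x)) k))"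
        by (rule Suc.IH[OF hpx[OF that] \<kappa>2 k])
      moreover have "(s(k := p, Suc i := ?u x))(k := p') = s(k := p', Suc i := ?u x)" for p'
        using k by auto
      moreover have "rayint (Suc i + m - k) k (s(k := p, Suc i := ?u x)) v = ?b p"
        unfolding add_Suc using k by (intro rayint_cong) auto
      ultimately show ?thesis using k unfolding l_def by simp
    qed
    define Ka where "Ka = rayint_const (\<kappa>/2) B l"
    define Kb where "Kb = rayint_const (\<kappa>/2) B (Suc (i + m) - k)"
    have Knn: "0 \<le> Ka" "0 \<le> Kb" unfolding Ka_def Kb_def using rayint_const_nonneg[OF \<kappa>2 B(1)] by auto
    have bd: "norm (?a p x * ?b p) \<le> Ka * Kb * (1 + x) powr (-1/2)"
      if p: "p \<in> ball (s k) e" and x: "0 \<le> x" for p x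
    proof -
      have h: "half_planes (\<kappa>/2) w (s(k := p)) v i ?n" using e(2) p by blast
      have h1: "half_planes (\<kappa>/2) w (s(k := p)) v (Suc i) (Suc (Suc i + l))"
        using half_planes_front[OF half_planes_mono[OF h, of "Suc i" "\<kappa>/2"], of "Suc (Suc i + l)"] k
        by (simp add: l_def)
      have "norm (rayint l (Suc i) ((s(k := p))(Suc i := (s(k := p)) (Suc i) + of_real x * v (Suc i))) v)
          \<le> rayint_const (\<kappa>/2) B l * (1 + x) powr (-1/2)"
        using B(2) k by (intro rayint_bound[OF h1 \<kappa>2 B(1) _ x]) (auto simp: l_def)
      then have 1: "norm (?a p x) \<le> Ka * (1 + x) powr (-1/2)"
        using k by (simp add: Ka_def)
      have h2: "half_planes (\<kappa>/2) w (s(k := p)) v k (Suc (k + (Suc (i + m) - k)))"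
        using half_planes_mono[OF h, of k "\<kappa>/2"] k by simp
      have "norm (rayint (Suc (i + m) - k) k ((s(k := p))(k := (s(k := p)) k + of_real 0 * v k)) v)
          \<le> rayint_const (\<kappa>/2) B (Suc (i + m) - k) * (1 + 0) powr (-1/2)"
        using B(2) k by (intro rayint_bound[OF h2 \<kappa>2 B(1)]) auto
      then have 2: "norm (?b p) \<le> Kb" by (simp add: Kb_def)
      show ?thesis
        using mult_mono[OF 1 2] Knn by (simp add: norm_mult mult_ac)
    qed
    have nz: "\<kappa>/2 * (1 + x) \<le> norm (?u x - s i)" "?u x - s i \<noteq> 0" if "0 \<le> x" for x
      using half_planes_ray_nonzero[OF half_planes_mono[OF hp, of i "\<kappa>/2"] \<kappa>2 _ that] \<kappa> by auto
    have s_ball: "s k \<in> ball (s k) e" using e(1) by simp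
    have contr: "continuous_on {0..} (?r p)" if p: "p \<in> ball (s k) e" for p
    proof -
      have h: "half_planes (\<kappa>/2) w (s(k := p)) v (Suc i) (Suc (Suc i + m))"
        using half_planes_mono[OF bspec[OF e(2) p], of "Suc i" "\<kappa>/2"] by simp
      show ?thesis using rayint_continuous_on_ray[OF h \<kappa>2] k by simp
    qed
    have contq: "continuous_on {0..} (?q p)" if p: "p \<in> ball (s k) e" for p
      by (intro continuous_on_divide continuous_on_mult contr[OF p] continuous_intros) (use nz in auto)
    have intq: "set_integrable lborel {0..} (?q p)" if p: "p \<in> ball (s k) e" for p
      using rayint_integrand_integrable[OF bspec[OF e(2) p] \<kappa>2] k by simp
    let ?D = "\<lambda>x. v (Suc i) * (- (?a (s k) x * ?b (s k))) / (?u x - s i)"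
    have conta: "continuous_on {0..} (?a (s k))"
    proof -
      have h1: "half_planes (\<kappa>/2) w s v (Suc i) (Suc (Suc i + l))"
        using half_planes_front[OF half_planes_mono[OF hp, of "Suc i" "\<kappa>/2"], of "Suc (Suc i + l)"] k \<kappa>
        by (simp add: l_def)
      show ?thesis using rayint_continuous_on_ray[OF h1 \<kappa>2] by simp
    qed
    have "((\<lambda>p. rayint (Suc m) i (s(k := p)) v) has_field_derivative
        inv_2pi_i * (LINT x:{0..}|lborel. ?D x)) (at (s k))"
    proof (rule has_field_derivative_sequentiallyI)
      fix T :: "nat \<Rightarrow> complex" assume T: "T \<longlonglongrightarrow> s k" "\<And>j. T j \<noteq> s k"
      have ev: "eventually (\<lambda>j. T j \<in> ball (s k) e) sequentially"
        using T(1) e(1) by (metis s_ball open_ball topological_tendstoD)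
      let ?Q = "\<lambda>j x. v (Suc i) * ((?r (T j) x - ?r (s k) x) / (T j - s k)) / (?u x - s i)"
      have "(\<lambda>j. LINT x:{0..}|lborel. ?Q j x) \<longlonglongrightarrow> (LINT x:{0..}|lborel. ?D x)"
      proof (rule ray_dct)
        show "eventually (\<lambda>j. continuous_on {0..} (?Q j)) sequentially"
          using ev
        proof eventually_elim
          case (elim j)
          show ?case
            by (intro continuous_on_divide continuous_on_mult continuous_on_diff contr[OF elim] contr[OF s_ball] continuous_intros)
              (use nz T in auto)
        qed
        show "continuous_on {0..} ?D"
          by (intro continuous_on_divide continuous_on_mult continuous_on_minus conta continuous_intros) (use nz in auto)
        show "(\<lambda>j. ?Q j x) \<longlonglongrightarrow> ?D x" if x: "0 \<le> x" for x
        proof (intro tendsto_divide tendsto_mult tendsto_const nz(2)[OF x])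
          show "(\<lambda>j. (?r (T j) x - ?r (s k) x) / (T j - s k)) \<longlonglongrightarrow> - (?a (s k) x * ?b (s k))"
            using der[OF s_ball x] T unfolding has_field_derivative_iff tendsto_at_iff_sequentially comp_def
            by auto
        qed
        show "eventually (\<lambda>j. \<forall>x\<ge>0. norm (?Q j x) \<le> B * (Ka * Kb) / (\<kappa>/2) * (1 + x) powr (-3/2)) sequentially"
          using ev
        proof eventually_elim
          case (elim j)
          show ?case
          proof (intro allI impI)
            fix x :: real assume x: "0 \<le> x"
            \<comment> \<open>The majorant for the difference quotients comes from the mean value
              inequality on the ball, where the derivative is bounded uniformly in
              \<open>p\<close>.\<close>
            have "norm (?r (T j) x - ?r (s k) x) \<le> Ka * Kb * (1 + x) powr (-1/2) * norm (T j - s k)"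
            proof (rule field_differentiable_bound[of "ball (s k) e" _ "\<lambda>p. - (?a p x * ?b p)"])
              show "((\<lambda>p. ?r p x) has_field_derivative - (?a p x * ?b p)) (at p within ball (s k) e)"
                if "p \<in> ball (s k) e" for p
                using der[OF that x] by (rule has_field_derivative_at_within)
              show "norm (- (?a p x * ?b p)) \<le> Ka * Kb * (1 + x) powr (-1/2)" if "p \<in> ball (s k) e" for p
                using bd[OF that x] by simp
            qed (use elim s_ball in auto)
            then have "norm ((?r (T j) x - ?r (s k) x) / (T j - s k)) \<le> Ka * Kb * (1 + x) powr (-1/2)"
              using T(2)[of j] by (simp add: norm_divide divide_le_eq)
            then show "norm (?Q j x) \<le> B * (Ka * Kb) / (\<kappa>/2) * (1 + x) powr (-3/2)"
              using B k Knn by (intro ray_integrand_bound nz(1)[OF x] \<kappa>2 x) auto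
          qed
        qed
      qed
      then have "(\<lambda>j. inv_2pi_i * (LINT x:{0..}|lborel. ?Q j x)) \<longlonglongrightarrow> inv_2pi_i * (LINT x:{0..}|lborel. ?D x)"
        by (intro tendsto_intros)
      then show "(\<lambda>j. (rayint (Suc m) i (s(k := T j)) v - rayint (Suc m) i (s(k := s k)) v) / (T j - s k))
          \<longlonglongrightarrow> inv_2pi_i * (LINT x:{0..}|lborel. ?D x)"
      proof (rule Lim_transform_eventually)
        show "eventually (\<lambda>j. inv_2pi_i * (LINT x:{0..}|lborel. ?Q j x) =
           (rayint (Suc m) i (s(k := T j)) v - rayint (Suc m) i (s(k := s k)) v) / (T j - s k)) sequentially"
          using ev
        proof eventually_elim
          case (elim j)
          have "(LINT x:{0..}|lborel. ?q (T j) x) - (LINT x:{0..}|lborel. ?q (s k) x)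
            = (LINT x:{0..}|lborel. ?q (T j) x - ?q (s k) x)"
            by (rule set_integral_diff(2)[symmetric, OF intq[OF elim] intq[OF s_ball]])
          also have "\<dots> = (LINT x:{0..}|lborel. (T j - s k) * ?Q j x)"
          proof (intro set_lebesgue_integral_cong allI impI)
            have "a * r1 / d - a * r2 / d = t * (a * ((r1 - r2) / t) / d)" if "t \<noteq> 0" for a r1 r2 d t :: complex
              using that by (cases "d = 0") (simp_all add: field_simps)
            moreover have "T j - s k \<noteq> 0" using T(2)[of j] by simp
            ultimately show "?q (T j) x - ?q (s k) x = (T j - s k) * ?Q j x" for x
              by (simp only: fun_upd_triv)
          qed auto
          also have "\<dots> = (T j - s k) * (LINT x:{0..}|lborel. ?Q j x)"
            by (rule set_integral_mult_right)
          finally show ?case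
            unfolding eq using T(2)[of j] by (simp add: right_diff_distrib[symmetric])
        qed
      qed
    qed
    also have "inv_2pi_i * (LINT x:{0..}|lborel. ?D x) = - (rayint (k - Suc i) i s v * rayint (i + Suc m - k) k s v)"
    proof -
      have "(LINT x:{0..}|lborel. ?D x) = (LINT x:{0..}|lborel. (- ?b (s k)) *
          (v (Suc i) * rayint l (Suc i) (s(Suc i := ?u x)) v / (?u x - s i)))"
        by (intro set_lebesgue_integral_cong) auto
      also have "\<dots> = (- ?b (s k)) * (LINT x:{0..}|lborel. v (Suc i) * rayint l (Suc i) (s(Suc i := ?u x)) v / (?u x - s i))"
        by (rule set_integral_mult_right)
      finally show ?thesis unfolding l by simp
    qed
    finally show ?thesis .
  qed
qed simp

section \<open>Homogeneity and total derivatives\<close>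

lemma rayint_isCont:
  fixes P Q :: "'q::metric_space \<Rightarrow> nat \<Rightarrow> complex"
  assumes "half_planes \<kappa> w (P q) (Q q) i (Suc (i + m))" "0 < \<kappa>" "\<And>k. isCont (\<lambda>q. P q k) q" "\<And>k. isCont (\<lambda>q. Q q k) q"
  shows "isCont (\<lambda>q. rayint m i (P q) (Q q)) q"
  unfolding continuous_at_sequentially comp_def
proof (intro allI impI)
  fix X assume X: "X \<longlonglongrightarrow> q"
  show "(\<lambda>n. rayint m i (P (X n)) (Q (X n))) \<longlonglongrightarrow> rayint m i (P q) (Q q)"
    by (rule rayint_tendsto_sequentially[OF assms(1,2)])
      (use assms(3,4) X in \<open>auto simp: continuous_at_sequentially comp_def\<close>)
qed

text \<open>There are \<open>m\<close> differentials and \<open>m + 1\<close> denominators, each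
  scaling by \<open>c\<close>, hence degree -1; translations drop out. Multiplied by the difference
  of its end points, the integral is therefore invariant.\<close>

lemma rayint_affine:
  assumes "c \<noteq> 0"
  shows "rayint m i (\<lambda>k. c * s k + d) (\<lambda>k. c * v k) = rayint m i s v / c"
proof (induction m arbitrary: i s)
  case (Suc m)
  have 1: "rayint m (Suc i) ((\<lambda>k. c * s k + d)(Suc i := c * s (Suc i) + d + x * (c * v (Suc i)))) (\<lambda>k. c * v k)
      = rayint m (Suc i) (s(Suc i := s (Suc i) + x * v (Suc i))) v / c" for x
  proof -
    have "(\<lambda>k. c * s k + d)(Suc i := c * s (Suc i) + d + x * (c * v (Suc i)))
      = (\<lambda>k. c * (s(Suc i := s (Suc i) + x * v (Suc i))) k + d)"
      by (auto simp: fun_eq_iff algebra_simps)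
    then show ?thesis by (simp only: Suc.IH)
  qed
  have 2: "c * s (Suc i) + d + x * (c * v (Suc i)) - (c * s i + d) = c * (s (Suc i) + x * v (Suc i) - s i)" for x
    by (simp add: algebra_simps)
  have "rayint (Suc m) i (\<lambda>k. c * s k + d) (\<lambda>k. c * v k) = inv_2pi_i *
     (LINT x:{0..}|lborel. (v (Suc i) * rayint m (Suc i) (s(Suc i := s (Suc i) + of_real x * v (Suc i))) v
        / (s (Suc i) + of_real x * v (Suc i) - s i)) / c)"
    unfolding rayint.simps(2) 1 2 using assms by (simp add: mult_ac)
  then show ?case by (simp only: set_integral_divide_zero rayint.simps times_divide_eq_right)
next
  case 0
  have "c * s (Suc i) - c * s i = c * (s (Suc i) - s i)" by (simp add: algebra_simps)
  then show ?case using assms by simp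
qed

lemma rayint_index_shift:
  "rayint m j (\<lambda>k. s (i + k)) (\<lambda>k. v (i + k)) = rayint m (i + j) s v"
proof (induction m arbitrary: j s)
  case (Suc m)
  have "rayint m (Suc j) ((\<lambda>k. s (i + k))(Suc j := y)) (\<lambda>k. v (i + k))
      = rayint m (Suc (i + j)) (s(Suc (i + j) := y)) v" for y
  proof -
    have "(\<lambda>k. s (i + k))(Suc j := y) = (\<lambda>k. (s(Suc (i + j) := y)) (i + k))"
      by (auto simp: fun_eq_iff)
    then show ?thesis using Suc.IH[of "Suc j" "s(Suc (i + j) := y)"] by (simp only: add_Suc_right)
  qed
  then show ?case by simp
qed simp

text \<open>Dividing the forms by the phase of \<open>c\<close> undoes the rotation without changing
  their norms, and the margin scales with \<open>norm c\<close>.\<close>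

lemma half_planes_affine:
  assumes "half_planes \<kappa> w s v i n" "c \<noteq> 0"
  shows "half_planes (norm c * \<kappa>) (\<lambda>k. w k * of_real (norm c) / c) (\<lambda>k. c * s k + d) (\<lambda>k. c * v k) i n"
  unfolding half_planes_def
proof
  fix k assume "k \<in> {i..<n}"
  note * = bspec[OF assms(1)[unfolded half_planes_def] this]
  have e: "Re (w k * of_real (norm c) / c * (c * z)) = norm c * Re (w k * z)" for z
  proof -
    have "w k * of_real (norm c) / c * (c * z) = of_real (norm c) * (w k * z)"
      using assms(2) by simp
    moreover have "Re (of_real r * u) = r * Re u" for r u by simp
    ultimately show ?thesis by (simp only:)
  qed
  have d: "c * s (Suc k) + d - (c * s k + d) = c * (s (Suc k) - s k)" by (simp add: algebra_simps)
  have n: "norm (w k * of_real (norm c) / c) = norm (w k)"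
    using assms(2) by (simp add: norm_mult norm_divide)
  show "norm (w k * of_real (norm c) / c) \<le> 1 \<and>
         norm c * \<kappa> \<le> Re (w k * of_real (norm c) / c * (c * s (Suc k) + d - (c * s k + d))) \<and>
         Re (w k * of_real (norm c) / c * (c * v k)) \<le> - (norm c * \<kappa>) \<and>
         (Suc k < n \<longrightarrow> norm c * \<kappa> \<le> Re (w k * of_real (norm c) / c * (c * v (Suc k))))"
    unfolding d e n mult_minus_right[symmetric]
    using * by (intro conjI impI mult_left_mono norm_ge_zero) simp_all
qed

lemma isCont_tendsto_nhds: "isCont f a \<Longrightarrow> (f \<longlongrightarrow> f a) (nhds a)"
  by (simp add: isCont_def tendsto_at_iff_tendsto_nhds)

text \<open>A mean value argument for \<open>g p z - C * z\<close> as a function of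
  \<open>z\<close>. Only the dependence on the second argument is differentiated, so the subtracted
  \<open>g p (\<sigma> p0)\<close> may vary with \<open>p\<close> in any manner; this permits moving
  the points of a configuration one after the other.\<close>

lemma has_derivative_increment:
  fixes g :: "'p::real_normed_vector \<Rightarrow> complex \<Rightarrow> complex"
  assumes \<sigma>: "(\<sigma> has_derivative D) (at p0)"
    and g: "\<And>\<epsilon>. \<epsilon> > 0 \<Longrightarrow> \<exists>d>0. \<forall>p\<in>ball p0 d. \<forall>z\<in>ball (\<sigma> p0) d. (g p has_field_derivative G p z) (at z) \<and> norm (G p z - C) \<le> \<epsilon>"
  shows "((\<lambda>p. g p (\<sigma> p) - g p (\<sigma> p0)) has_derivative (\<lambda>h. C * D h)) (at p0)"
proof -
  let ?R = "\<lambda>p. g p (\<sigma> p) - g p (\<sigma> p0) - C * (\<sigma> p - \<sigma> p0)"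
  have bl: "bounded_linear D" using \<sigma> by (rule has_derivative_bounded_linear)
  then obtain K where K: "\<And>h. norm (D h) \<le> norm h * K" "K > 0"
    using bounded_linear.pos_bounded by blast
  have "(?R has_derivative (\<lambda>h. 0)) (at p0)"
    unfolding has_derivative_within_alt
  proof (intro conjI allI impI)
    fix \<epsilon> :: real assume \<epsilon>: "0 < \<epsilon>"
    define \<delta> where "\<delta> = \<epsilon> / (K + 1)"
    have \<delta>: "\<delta> > 0" using \<epsilon> K by (simp add: \<delta>_def)
    obtain d where d: "d > 0" "\<forall>p\<in>ball p0 d. \<forall>z\<in>ball (\<sigma> p0) d. (g p has_field_derivative G p z) (at z) \<and> norm (G p z - C) \<le> \<delta>"
      using g[OF \<delta>] by blast
    obtain d1 where d1: "d1 > 0" "\<forall>y. norm (y - p0) < d1 \<longrightarrow> norm (\<sigma> y - \<sigma> p0 - D (y - p0)) \<le> 1 * norm (y - p0)"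
      using conjunct2[OF \<sigma>[unfolded has_derivative_within_alt], rule_format, of 1] by auto
    show "\<exists>d>0. \<forall>y\<in>UNIV. norm (y - p0) < d \<longrightarrow> norm (?R y - ?R p0 - 0) \<le> \<epsilon> * norm (y - p0)"
    proof (intro exI[of _ "min d (min d1 (d / (K + 1)))"] conjI ballI impI)
      show "0 < min d (min d1 (d / (K + 1)))" using d d1 K by auto
      fix y assume y: "norm (y - p0) < min d (min d1 (d / (K + 1)))"
      have "norm (\<sigma> y - \<sigma> p0) \<le> norm (\<sigma> y - \<sigma> p0 - D (y - p0)) + norm (D (y - p0))"
        by (metis add.commute diff_add_cancel norm_triangle_ineq)
      also have "\<dots> \<le> norm (y - p0) + norm (y - p0) * K"
        using d1(2) y K(1)[of "y - p0"] by (intro add_mono) auto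
      finally have \<sigma>y: "norm (\<sigma> y - \<sigma> p0) \<le> (K + 1) * norm (y - p0)" by (simp add: algebra_simps)
      also have "\<dots> < d" using y K by (simp add: field_simps)
      finally have inb: "\<sigma> y \<in> ball (\<sigma> p0) d" by (simp add: dist_norm norm_minus_commute)
      have "norm (y - p0) < d" using y by linarith
      then have yb: "y \<in> ball p0 d" unfolding mem_ball dist_norm norm_minus_commute[of p0 y] .
      have "norm ((g y (\<sigma> y) - C * \<sigma> y) - (g y (\<sigma> p0) - C * \<sigma> p0)) \<le> \<delta> * norm (\<sigma> y - \<sigma> p0)"
      proof (rule field_differentiable_bound[of "ball (\<sigma> p0) d" "\<lambda>z. g y z - C * z" "\<lambda>z. G y z - C"])
        fix z assume z: "z \<in> ball (\<sigma> p0) d"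
        show "((\<lambda>z. g y z - C * z) has_field_derivative G y z - C) (at z within ball (\<sigma> p0) d)"
          using d(2)[rule_format, OF yb z] by (intro has_field_derivative_at_within[OF DERIV_diff] DERIV_cmult_Id) blast
        show "norm (G y z - C) \<le> \<delta>" using d(2)[rule_format, OF yb z] by blast
      next
        show "\<sigma> y \<in> ball (\<sigma> p0) d" by (fact inb)
      qed (use d(1) in simp_all)
      also have "\<dots> \<le> \<delta> * ((K + 1) * norm (y - p0))"
        using \<sigma>y \<delta> by (intro mult_left_mono) auto
      also have "\<dots> = \<epsilon> * norm (y - p0)" using K by (simp add: \<delta>_def)
      finally show "norm (?R y - ?R p0 - 0) \<le> \<epsilon> * norm (y - p0)" by (simp add: algebra_simps)
    qed
  qed auto
  then have "((\<lambda>p. ?R p + C * (\<sigma> p - \<sigma> p0)) has_derivative (\<lambda>h. 0 + C * (D h - 0))) (at p0)"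
    by (intro has_derivative_add has_derivative_mult_right has_derivative_diff \<sigma> has_derivative_const)
  then show ?thesis by simp
qed

text \<open>The chain rule by telescoping: \<open>H j p\<close> has only the inner points with index
  below \<open>j\<close> moved, and each passage to the next \<open>j\<close> is an increment in one
  variable. Joint continuity of the partial derivatives, which the increment lemma demands, comes
  from \<open>rayint_isCont\<close>.\<close>

lemma rayint_has_derivative:
  fixes S :: "'p::real_normed_vector \<Rightarrow> nat \<Rightarrow> complex"
  assumes hp: "half_planes \<kappa> w (S p0) v i (Suc (i + m))" "0 < \<kappa>"
    and D: "\<And>k. i < k \<Longrightarrow> k \<le> i + m \<Longrightarrow> ((\<lambda>p. S p k) has_derivative D k) (at p0)"
    and const: "\<And>p. S p i = S p0 i" "\<And>p. S p (Suc (i + m)) = S p0 (Suc (i + m))"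
  shows "((\<lambda>p. rayint m i (S p) v) has_derivative
     (\<lambda>h. \<Sum>k=Suc i..i+m. - (rayint (k - Suc i) i (S p0) v * rayint (i + m - k) k (S p0) v) * D k h)) (at p0)"
proof -
  define H where "H j p k = (if i < k \<and> k < j \<and> k \<le> i + m then S p k else S p0 k)" for j p k
  have H0: "H j p0 = S p0" for j by (auto simp: H_def fun_eq_iff)
  have contH: "isCont (\<lambda>p. H j p k) p0" for j k
  proof (cases "i < k \<and> k < j \<and> k \<le> i + m")
    case True
    then show ?thesis using has_derivative_continuous[OF D[of k]] by (simp add: H_def)
  next
    case False
    then have "(\<lambda>p. H j p k) = (\<lambda>p. S p0 k)" by (auto simp: H_def)
    then show ?thesis by simp
  qed
  have main: "((\<lambda>p. rayint m i (H (Suc i + j) p) v) has_derivative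
     (\<lambda>h. \<Sum>k=Suc i..<Suc i + j. - (rayint (k - Suc i) i (S p0) v * rayint (i + m - k) k (S p0) v) * D k h)) (at p0)"
    if "j \<le> m" for j
    using that
  proof (induction j)
    case 0
    have "H (Suc i) p = S p0" for p by (auto simp: H_def fun_eq_iff)
    then show ?case by simp
  next
    case (Suc j)
    let ?l = "Suc i + j"
    have l: "i < ?l" "?l \<le> i + m" using Suc.prems by auto
    let ?g = "\<lambda>p z. rayint m i ((H ?l p)(?l := z)) v"
    let ?P = "\<lambda>q. (H ?l (fst q))(?l := snd q)"
    let ?G = "\<lambda>p z. - (rayint (?l - Suc i) i ((H ?l p)(?l := z)) v * rayint (i + m - ?l) ?l ((H ?l p)(?l := z)) v)"
    let ?C = "- (rayint (?l - Suc i) i (S p0) v * rayint (i + m - ?l) ?l (S p0) v)"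
    have P0: "?P (p0, S p0 ?l) = S p0" by (simp add: H0)
    have contP: "isCont (\<lambda>q. ?P q k) (p0, S p0 ?l)" for k
    proof (cases "k = ?l")
      case False
      have "isCont (\<lambda>q. H ?l (fst q) k) (p0, S p0 ?l)"
        by (rule isCont_o2[where f = fst and g = "\<lambda>p. H ?l p k"]) (auto simp: contH intro!: isCont_fst)
      with False show ?thesis by simp
    qed (auto intro!: isCont_snd)
    have "((\<lambda>p. ?g p (S p ?l) - ?g p (S p0 ?l)) has_derivative (\<lambda>h. ?C * D ?l h)) (at p0)"
    proof (rule has_derivative_increment[OF D[OF l]])
      fix \<epsilon> :: real assume \<epsilon>: "\<epsilon> > 0"
      have "isCont (\<lambda>q. ?G (fst q) (snd q)) (p0, S p0 ?l)"
      proof (intro isCont_minus isCont_mult)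
        show "isCont (\<lambda>q. rayint (?l - Suc i) i (?P q) v) (p0, S p0 ?l)"
        proof (rule rayint_isCont[OF _ hp(2) contP])
          show "half_planes \<kappa> w (?P (p0, S p0 ?l)) v i (Suc (i + (?l - Suc i)))"
            unfolding P0 by (rule half_planes_front[OF hp(1)]) (use l in auto)
        qed auto
        show "isCont (\<lambda>q. rayint (i + m - ?l) ?l (?P q) v) (p0, S p0 ?l)"
        proof (rule rayint_isCont[OF _ hp(2) contP])
          show "half_planes \<kappa> w (?P (p0, S p0 ?l)) v ?l (Suc (?l + (i + m - ?l)))"
            unfolding P0 using half_planes_mono[OF hp(1), of ?l \<kappa>] l by simp
        qed auto
      qed
      then have "((\<lambda>q. ?G (fst q) (snd q)) \<longlongrightarrow> ?C) (nhds (p0, S p0 ?l))"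
        using P0 by (auto dest: isCont_tendsto_nhds)
      then have ev1: "eventually (\<lambda>q. dist (?G (fst q) (snd q)) ?C < \<epsilon>) (nhds (p0, S p0 ?l))"
        using \<epsilon> by (rule tendstoD)
      have ev2: "eventually (\<lambda>q. half_planes (\<kappa>/2) w (?P q) v i (Suc (i + m))) (nhds (p0, S p0 ?l))"
      proof (rule half_planes_eventually[OF hp(1)])
        show "((\<lambda>q. ?P q k) \<longlongrightarrow> S p0 k) (nhds (p0, S p0 ?l))" for k
          using isCont_tendsto_nhds[OF contP[of k]] unfolding P0 .
      qed (use hp(2) in auto)
      obtain d where d: "d > 0" "\<And>q. dist q (p0, S p0 ?l) < d \<Longrightarrow>
         dist (?G (fst q) (snd q)) ?C < \<epsilon> \<and> half_planes (\<kappa>/2) w (?P q) v i (Suc (i + m))"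
        using eventually_conj[OF ev1 ev2] unfolding eventually_nhds_metric by blast
      show "\<exists>d>0. \<forall>p\<in>ball p0 d. \<forall>z\<in>ball (S p0 ?l) d. (?g p has_field_derivative ?G p z) (at z) \<and> norm (?G p z - ?C) \<le> \<epsilon>"
      proof (intro exI[of _ "d/2"] conjI ballI)
        show "0 < d/2" using d by simp
        fix p z assume p: "p \<in> ball p0 (d/2)" and z: "z \<in> ball (S p0 ?l) (d/2)"
        have "dist (p, z) (p0, S p0 ?l) \<le> dist p p0 + dist z (S p0 ?l)"
          unfolding dist_Pair_Pair by (rule sqrt_sum_squares_le_sum) auto
        also have "\<dots> < d" using p z by (simp add: dist_commute)
        finally have q: "dist (?G p z) ?C < \<epsilon>" "half_planes (\<kappa>/2) w ((H ?l p)(?l := z)) v i (Suc (i + m))"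
          using d(2)[of "(p, z)"] by auto
        show "norm (?G p z - ?C) \<le> \<epsilon>" using q(1) by (simp add: dist_norm)
        show "(?g p has_field_derivative ?G p z) (at z)"
          using rayint_deriv[OF q(2) _ l] hp(2) by simp
      qed
    qed
    from has_derivative_add[OF Suc.IH this] Suc.prems
    have "((\<lambda>p. rayint m i (H ?l p) v + (?g p (S p ?l) - ?g p (S p0 ?l))) has_derivative
       (\<lambda>h. (\<Sum>k=Suc i..<Suc i + j. - (rayint (k - Suc i) i (S p0) v * rayint (i + m - k) k (S p0) v) * D k h) + ?C * D ?l h)) (at p0)"
      by simp
    moreover have "(H ?l p)(?l := S p ?l) = H (Suc i + Suc j) p" "(H ?l p)(?l := S p0 ?l) = H ?l p" for p
      using l by (auto simp: H_def fun_eq_iff)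
    ultimately show ?case by simp
  qed
  have "rayint m i (H (Suc i + m) p) v = rayint m i (S p) v" for p
    by (rule rayint_cong) (use const[of p] in \<open>auto simp: H_def le_Suc_eq\<close>)
  moreover have "{Suc i..<Suc i + m} = {Suc i..i + m}" by auto
  ultimately show ?thesis using main[of m] by simp
qed

text \<open>
  The normalised points \<open>\<sigma>_k = (s_k - s_i) / (s_n - s_i)\<close> absorb the two end points, so that only the
  derivatives of \<open>rayint\<close> with respect to inner points enter.
\<close>

lemma scaled_rayint_has_derivative:
  fixes S :: "'p::real_normed_vector \<Rightarrow> nat \<Rightarrow> complex"
  assumes hp: "half_planes \<kappa> w (S p0) v i (Suc (i + m))" "0 < \<kappa>"
    and ne: "S p0 (Suc (i + m)) \<noteq> S p0 i"
    and cont: "isCont (\<lambda>p. S p i) p0" "isCont (\<lambda>p. S p (Suc (i + m))) p0"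
    and D: "\<And>k. i < k \<Longrightarrow> k \<le> i + m \<Longrightarrow>
        ((\<lambda>p. (S p k - S p i) / (S p (Suc (i + m)) - S p i)) has_derivative D k) (at p0)"
  shows "((\<lambda>p. (S p (Suc (i + m)) - S p i) * rayint m i (S p) v) has_derivative
     (\<lambda>h. \<Sum>k=Suc i..i+m. - ((S p0 (Suc (i + m)) - S p0 i)\<^sup>2 *
        (rayint (k - Suc i) i (S p0) v * rayint (i + m - k) k (S p0) v)) * D k h)) (at p0)"
proof -
  let ?n = "Suc (i + m)"
  define \<Delta> where "\<Delta> p = S p ?n - S p i" for p
  \<comment> \<open>The end points are pinned to 0 and 1. Indices out of range keep their value at
    \<open>p0\<close>, so that \<open>S' p0\<close> is an affine image of \<open>S p0\<close> at
    every index.\<close>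
  define S' where "S' p k = (if k = i then 0 else if k = ?n then 1 else if i < k \<and> k \<le> i + m then (S p k - S p i) / \<Delta> p
      else (S p0 k - S p0 i) / \<Delta> p0)" for p k
  have \<Delta>0: "\<Delta> p0 \<noteq> 0" using ne by (simp add: \<Delta>_def)
  have cont\<Delta>: "isCont \<Delta> p0" unfolding \<Delta>_def by (intro isCont_diff cont)
  have ev\<Delta>: "eventually (\<lambda>p. \<Delta> p \<noteq> 0) (nhds p0)"
    using isCont_tendsto_nhds[OF cont\<Delta>] \<Delta>0 by (rule tendsto_imp_eventually_ne)
  have S'0: "S' p0 k = (1 / \<Delta> p0) * S p0 k + (- S p0 i / \<Delta> p0)" for k
    using \<Delta>0 by (auto simp: S'_def \<Delta>_def simp flip: diff_divide_distrib)
  have r0: "rayint l j (S' p0) (\<lambda>k. (1 / \<Delta> p0) * v k) = rayint l j (S p0) v * \<Delta> p0" for l j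
    using rayint_affine[of "1 / \<Delta> p0" l j "S p0" "- S p0 i / \<Delta> p0" v] \<Delta>0 unfolding S'0[abs_def] by simp
  define w' where "w' = (\<lambda>k. w k * of_real (norm (1 / \<Delta> p0)) / (1 / \<Delta> p0))"
  define \<kappa>' where "\<kappa>' = norm (1 / \<Delta> p0) * \<kappa>"
  have \<kappa>': "0 < \<kappa>'" using hp(2) \<Delta>0 by (simp add: \<kappa>'_def)
  have hp': "half_planes \<kappa>' w' (S' p0) (\<lambda>k. (1 / \<Delta> p0) * v k) i ?n"
    using half_planes_affine[OF hp(1), of "1 / \<Delta> p0" "- S p0 i / \<Delta> p0"] \<Delta>0
    unfolding S'0[abs_def] w'_def \<kappa>'_def by simp
  have contS': "isCont (\<lambda>p. S' p k) p0" for k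
  proof (cases "i < k \<and> k \<le> i + m")
    case True
    then show ?thesis using has_derivative_continuous[OF D[of k]] by (simp add: S'_def \<Delta>_def)
  next
    case False
    then have "(\<lambda>p. S' p k) = (\<lambda>p. S' p0 k)" by (auto simp: S'_def)
    then show ?thesis by simp
  qed
  have tS': "((\<lambda>p. S' p k) \<longlongrightarrow> S' p0 k) (nhds p0)" for k
    using isCont_tendsto_nhds[OF contS'] .
  have ev1: "eventually (\<lambda>p. half_planes (\<kappa>'/2) w' (S' p) (\<lambda>k. (1 / \<Delta> p0) * v k) i ?n) (nhds p0)"
    by (rule half_planes_eventually[OF hp' tS']) (use \<kappa>' in auto)
  have ev2: "eventually (\<lambda>p. half_planes (\<kappa>'/2) w' (S' p) (\<lambda>k. (1 / \<Delta> p) * v k) i ?n) (nhds p0)"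
  proof (rule half_planes_eventually[OF hp' tS'])
    show "((\<lambda>p. (1 / \<Delta> p) * v k) \<longlongrightarrow> (1 / \<Delta> p0) * v k) (nhds p0)" for k
      using isCont_tendsto_nhds[OF cont\<Delta>] \<Delta>0 by (intro tendsto_intros)
  qed (use \<kappa>' in auto)
  \<comment> \<open>Homogeneity produces directions scaled by \<open>1 / \<Delta> p\<close>, which
    vary with \<open>p\<close>. Near \<open>p0\<close> they and the directions scaled by
    \<open>1 / \<Delta> p0\<close> are admissible for the same forms, so the latter may replace
    them.\<close>
  have ev: "eventually (\<lambda>p. rayint m i (S' p) (\<lambda>k. (1 / \<Delta> p0) * v k) = \<Delta> p * rayint m i (S p) v) (nhds p0)"
    using ev1 ev2 ev\<Delta>
  proof eventually_elim
    case (elim p)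
    have "rayint m i (S' p) (\<lambda>k. (1 / \<Delta> p0) * v k) = rayint m i (S' p) (\<lambda>k. (1 / \<Delta> p) * v k)"
      by (rule rayint_directions[OF elim(1,2)]) (use \<kappa>' in simp)
    also have "\<dots> = rayint m i (\<lambda>k. (1 / \<Delta> p) * S p k + (- S p i / \<Delta> p)) (\<lambda>k. (1 / \<Delta> p) * v k)"
      using elim(3) by (intro rayint_cong) (auto simp: S'_def \<Delta>_def simp flip: diff_divide_distrib)
    also have "\<dots> = \<Delta> p * rayint m i (S p) v"
      using rayint_affine[of "1 / \<Delta> p" m i "S p" "- S p i / \<Delta> p" v] elim(3) by simp
    finally show ?case .
  qed
  have "((\<lambda>p. rayint m i (S' p) (\<lambda>k. (1 / \<Delta> p0) * v k)) has_derivative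
     (\<lambda>h. \<Sum>k=Suc i..i+m. - (rayint (k - Suc i) i (S' p0) (\<lambda>k. (1 / \<Delta> p0) * v k) *
        rayint (i + m - k) k (S' p0) (\<lambda>k. (1 / \<Delta> p0) * v k)) * D k h)) (at p0)"
  proof (rule rayint_has_derivative)
    show "half_planes \<kappa>' w' (S' p0) (\<lambda>k. (1 / \<Delta> p0) * v k) i (Suc (i + m))" "0 < \<kappa>'"
      by (fact hp' \<kappa>')+
    show "((\<lambda>p. S' p k) has_derivative D k) (at p0)" if "i < k" "k \<le> i + m" for k
      using D[OF that] that by (simp add: S'_def \<Delta>_def)
  qed (auto simp: S'_def)
  then have "((\<lambda>p. \<Delta> p * rayint m i (S p) v) has_derivative
     (\<lambda>h. \<Sum>k=Suc i..i+m. - (rayint (k - Suc i) i (S' p0) (\<lambda>k. (1 / \<Delta> p0) * v k) *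
        rayint (i + m - k) k (S' p0) (\<lambda>k. (1 / \<Delta> p0) * v k)) * D k h)) (at p0)"
    using has_derivative_transform_eventually[of _ _ p0 UNIV] ev
    by (smt (verit, ccfv_threshold) UNIV_I eventually_at_filter eventually_mono eventually_nhds_x_imp_x)
  then show ?thesis
    unfolding r0 by (simp add: \<Delta>_def power2_eq_square mult_ac)
qed

text \<open>The normalised point (s_k - t) / (s_n - t) has derivative (s_k - s_n) / (s_n - s_i)^2 at
  t = s_i, and the square cancels. The result is the linear differential equation in the base point
  that drives the telescoping of the iterated integrals.\<close>

lemma scaled_rayint_base_deriv:
  assumes hp: "half_planes \<kappa> w s v i (Suc (i + m))" "0 < \<kappa>" and ne: "s (Suc (i + m)) \<noteq> s i"
  shows "((\<lambda>t. (s (Suc (i + m)) - t) * rayint m i (s(i := t)) v) has_field_derivative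
     (\<Sum>k=Suc i..i+m. rayint (k - Suc i) i s v * ((s (Suc (i + m)) - s k) * rayint (i + m - k) k s v))) (at (s i))"
proof -
  let ?S = "\<lambda>t. s(i := t)" and ?n = "Suc (i + m)"
  have "((\<lambda>t. (?S t ?n - ?S t i) * rayint m i (?S t) v) has_derivative
     (\<lambda>h. \<Sum>k=Suc i..i+m. - ((?S (s i) ?n - ?S (s i) i)\<^sup>2 *
        (rayint (k - Suc i) i (?S (s i)) v * rayint (i + m - k) k (?S (s i)) v)) * ((s k - s ?n) / (s ?n - s i)\<^sup>2 * h))) (at (s i))"
  proof (rule scaled_rayint_has_derivative)
    show "half_planes \<kappa> w (?S (s i)) v i ?n" using hp by simp
    fix k assume k: "i < k" "k \<le> i + m"
    have "((\<lambda>t. (s k - t) / (s ?n - t)) has_field_derivative (s k - s ?n) / (s ?n - s i)\<^sup>2) (at (s i))"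
      using ne by (auto intro!: derivative_eq_intros simp: power2_eq_square field_simps)
    then show "((\<lambda>t. (?S t k - ?S t i) / (?S t ?n - ?S t i)) has_derivative
        (\<lambda>h. (s k - s ?n) / (s ?n - s i)\<^sup>2 * h)) (at (s i))"
      using k by (simp add: has_field_derivative_def del: times_divide_eq_left)
  qed (use hp ne in auto)
  moreover have "(\<Sum>k=Suc i..i+m. - ((s ?n - s i)\<^sup>2 * (rayint (k - Suc i) i s v * rayint (i + m - k) k s v)) * ((s k - s ?n) / (s ?n - s i)\<^sup>2 * h))
     = (\<Sum>k=Suc i..i+m. rayint (k - Suc i) i s v * ((s ?n - s k) * rayint (i + m - k) k s v)) * h" for h
    unfolding sum_distrib_right using ne by (intro sum.cong) (auto simp: field_simps)
  ultimately show ?thesis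
    unfolding has_field_derivative_def by (simp del: times_divide_eq_left)
qed

section \<open>Chains and the compositional inverse\<close>

text \<open>The index sequences of \<open>L_fun\<close> and \<open>J_fun\<close>, but between
  arbitrary end points and without prescribed length, so that sums over them can be expanded from
  either end.\<close>

definition chains :: "nat \<Rightarrow> nat \<Rightarrow> nat list set" where
  "chains i j = {q. q \<noteq> [] \<and> hd q = i \<and> last q = j \<and> sorted_wrt (<) q}"

lemma chains_subset: "q \<in> chains i j \<Longrightarrow> set q \<subseteq> {i..j}"
proof
  fix x assume q: "q \<in> chains i j" and x: "x \<in> set q"
  have ne: "q \<noteq> []" and s: "sorted_wrt (<) q" using q by (auto simp: chains_def)
  obtain l where l: "l < length q" "x = q ! l" using x by (auto simp: in_set_conv_nth)
  have "q ! 0 \<le> q ! l"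
    using l sorted_wrt_nth_less[OF s, of 0 l] by (cases "l = 0") auto
  moreover have "q ! l \<le> q ! (length q - 1)"
  proof (cases "l = length q - 1")
    case False
    then have "l < length q - 1" "length q - 1 < length q" using l by linarith+
    then show ?thesis by (rule less_imp_le[OF sorted_wrt_nth_less[OF s]])
  qed simp
  ultimately show "x \<in> {i..j}"
    using q l ne by (auto simp: chains_def hd_conv_nth last_conv_nth)
qed

lemma finite_chains [simp]: "finite (chains i j)"
proof (rule finite_subset)
  show "chains i j \<subseteq> {q. set q \<subseteq> {i..j} \<and> distinct q}"
    using chains_subset by (auto simp: chains_def strict_sorted_iff)
qed (simp add: finite_subset_distinct)

lemma chains_nonempty_le: "q \<in> chains i j \<Longrightarrow> i \<le> j"
  using chains_subset[of q i j] by (cases q) (auto simp: chains_def)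

lemma chains_refl: "chains i i = {[i]}"
proof -
  have "q = [i]" if q: "q \<in> chains i i" for q
  proof -
    have "distinct q" "set q \<subseteq> {i}" "q \<noteq> []"
      using chains_subset[OF q] q by (auto simp: chains_def strict_sorted_iff)
    then show ?thesis by (cases q) (auto, metis list.set_intros(1) singletonD subsetD neq_Nil_conv)
  qed
  then show ?thesis by (auto simp: chains_def)
qed

lemma Cons_in_chains: "q \<in> chains m j \<Longrightarrow> i < m \<Longrightarrow> i # q \<in> chains i j"
  using chains_subset[of q m j] by (auto simp: chains_def)

lemma snoc_in_chains: "q \<in> chains i l \<Longrightarrow> l < j \<Longrightarrow> q @ [j] \<in> chains i j"
  using chains_subset[of q i l] by (force simp: chains_def sorted_wrt_append)

lemma chains_Cons_eq:
  assumes "i < j"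
  shows "chains i j = (\<lambda>(m, q). i # q) ` (SIGMA m:{i<..j}. chains m j)"
proof (intro equalityI subsetI)
  fix q assume q: "q \<in> chains i j"
  then obtain p where p: "q = i # p" by (cases q) (auto simp: chains_def)
  with q assms have "p \<noteq> []" by (auto simp: chains_def)
  with q p have p': "p \<in> chains (hd p) j" "i < hd p" by (auto simp: chains_def)
  with chains_nonempty_le[OF p'(1)] p
  show "q \<in> (\<lambda>(m, q). i # q) ` (SIGMA m:{i<..j}. chains m j)"
    by (intro image_eqI[of _ _ "(hd p, p)"]) auto
qed (auto intro: Cons_in_chains)

lemma sum_chains_Cons:
  fixes F :: "nat list \<Rightarrow> complex"
  assumes "i < j"
  shows "(\<Sum>q\<in>chains i j. F q) = (\<Sum>m\<in>{i<..j}. \<Sum>q\<in>chains m j. F (i # q))"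
proof -
  have inj: "inj_on (\<lambda>(m, q). i # q) (SIGMA m:{i<..j}. chains m j)"
    by (auto simp: inj_on_def chains_def)
  show ?thesis
    unfolding chains_Cons_eq[OF assms] sum.reindex[OF inj]
    by (simp add: sum.Sigma case_prod_unfold)
qed

lemma chains_snoc_eq:
  assumes "i < j"
  shows "chains i j = (\<lambda>(l, q). q @ [j]) ` (SIGMA l:{i..<j}. chains i l)"
proof (intro equalityI subsetI)
  fix q assume q: "q \<in> chains i j"
  then obtain p where p: "q = p @ [j]" by (cases q rule: rev_cases) (auto simp: chains_def)
  with q assms have "p \<noteq> []" by (auto simp: chains_def)
  with q p have p': "p \<in> chains i (last p)" "last p < j" by (auto simp: chains_def sorted_wrt_append)
  with chains_nonempty_le[OF p'(1)] p
  show "q \<in> (\<lambda>(l, q). q @ [j]) ` (SIGMA l:{i..<j}. chains i l)"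
    by (intro image_eqI[of _ _ "(last p, p)"]) auto
qed (auto intro: snoc_in_chains)

lemma sum_chains_snoc:
  fixes F :: "nat list \<Rightarrow> complex"
  assumes "i < j"
  shows "(\<Sum>q\<in>chains i j. F q) = (\<Sum>l\<in>{i..<j}. \<Sum>q\<in>chains i l. F (q @ [j]))"
proof -
  have inj: "inj_on (\<lambda>(l, q). q @ [j]) (SIGMA l:{i..<j}. chains i l)"
    by (auto simp: inj_on_def chains_def)
  show ?thesis
    unfolding chains_snoc_eq[OF assms] sum.reindex[OF inj]
    by (simp add: sum.Sigma case_prod_unfold)
qed

section \<open>Products along chains and composition of sequences\<close>

fun chain_prod :: "(nat \<Rightarrow> nat \<Rightarrow> complex) \<Rightarrow> nat list \<Rightarrow> complex" where
  "chain_prod a (x # y # q) = a x y * chain_prod a (y # q)"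
| "chain_prod a q = 1"

lemma chain_prod_Cons: "q \<noteq> [] \<Longrightarrow> chain_prod a (x # q) = a x (hd q) * chain_prod a q"
  by (cases q) auto

lemma chain_prod_append:
  "p \<noteq> [] \<Longrightarrow> q \<noteq> [] \<Longrightarrow> last p = hd q \<Longrightarrow> chain_prod a (p @ tl q) = chain_prod a p * chain_prod a q"
proof (induction a p rule: chain_prod.induct)
  case ("2_2" a x)
  then show ?case by (metis append_Cons append_Nil chain_prod.simps(3) last.simps list.collapse mult_1)
qed auto

lemma chain_prod_snoc: "q \<noteq> [] \<Longrightarrow> chain_prod a (q @ [y]) = chain_prod a q * a (last q) y"
  using chain_prod_append[of q "[last q, y]" a] by simp

lemma chain_prod_eq_prod: "length q = Suc k \<Longrightarrow> chain_prod a q = (\<Prod>j<k. a (q ! j) (q ! Suc j))"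
proof (induction a q arbitrary: k rule: chain_prod.induct)
  case (1 a x y q)
  then obtain k' where k: "k = Suc k'" "length (y # q) = Suc k'" by (cases k) auto
  show ?case unfolding k(1) prod.lessThan_Suc_shift using 1(1)[OF k(2)] by simp
qed auto

lemma chain_prod_cong:
  assumes "q \<in> chains i j" "\<And>x y. i \<le> x \<Longrightarrow> x < y \<Longrightarrow> y \<le> j \<Longrightarrow> a x y = b x y"
  shows "chain_prod a q = chain_prod b q"
proof -
  obtain k where k: "length q = Suc k" using assms(1) by (cases q) (auto simp: chains_def)
  show ?thesis
    unfolding chain_prod_eq_prod[OF k]
  proof (rule prod.cong[OF refl])
    fix l assume l: "l \<in> {..<k}"
    have "q ! l < q ! Suc l"
      using l k assms(1) sorted_wrt_nth_less[of "(<)" q l "Suc l"] by (auto simp: chains_def)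
    moreover have "q ! l \<in> {i..j}" "q ! Suc l \<in> {i..j}"
      using l k by (auto intro!: subsetD[OF chains_subset[OF assms(1)]] simp del: atLeastAtMost_iff)
    ultimately show "a (q ! l) (q ! Suc l) = b (q ! l) (q ! Suc l)"
      using assms(2) by auto
  qed
qed

text \<open>
  \<open>subchain_sum F G r\<close> sums, over the subchains of \<open>r\<close> with the same end points, the product of \<open>F\<close> at the
  subchain and of \<open>G\<close> at the segments into which it divides \<open>r\<close>: it is the composition of the sequences
  \<open>F\<close> and \<open>G\<close>.
\<close>

function subchain_sum :: "(nat list \<Rightarrow> complex) \<Rightarrow> (nat list \<Rightarrow> complex) \<Rightarrow> nat list \<Rightarrow> complex" where
  "subchain_sum F G r = (if length r \<le> 1 then F r
     else \<Sum>d\<in>{1..<length r}. G (take (Suc d) r) * subchain_sum (\<lambda>q. F (hd r # q)) G (drop d r))"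
  by auto
termination by (relation "Wellfounded.measure (\<lambda>(F, G, r). length r)") auto

declare subchain_sum.simps [simp del]

text \<open>Refining every step of a chain \<open>q\<close> yields a chain \<open>r\<close> with
  \<open>q\<close> as a subchain, and the weights \<open>a\<close> of the refinements multiply to
  the weight of \<open>r\<close>. Regrouping by \<open>r\<close> is the associativity of
  composition; the induction splits off the refinement of the first step.\<close>

lemma sum_chains_compose:
  "(\<Sum>q\<in>chains i j. F q * chain_prod (\<lambda>x y. \<Sum>r\<in>chains x y. G r * chain_prod a r) q)
   = (\<Sum>r\<in>chains i j. subchain_sum F G r * chain_prod a r)"
proof (induction "j - i" arbitrary: i F rule: less_induct)
  case less
  let ?G = "\<lambda>x y. \<Sum>r\<in>chains x y. G r * chain_prod a r"
  consider "j < i" | "i = j" | "i < j" by linarith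
  then show ?case
  proof cases
    case 1
    then have "chains i j = {}" using chains_nonempty_le by fastforce
    then show ?thesis by simp
  next
    case 2
    then show ?thesis by (simp add: chains_refl subchain_sum.simps)
  next
    case 3
    let ?T = "\<lambda>r1 r2. G r1 * chain_prod a r1 * (subchain_sum (\<lambda>q. F (i # q)) G r2 * chain_prod a r2)"
    have "(\<Sum>q\<in>chains i j. F q * chain_prod ?G q)
        = (\<Sum>m\<in>{i<..j}. \<Sum>q\<in>chains m j. F (i # q) * chain_prod ?G (i # q))"
      by (rule sum_chains_Cons[OF 3])
    also have "\<dots> = (\<Sum>m\<in>{i<..j}. ?G i m * (\<Sum>q\<in>chains m j. F (i # q) * chain_prod ?G q))"
      unfolding sum_distrib_left
      by (intro sum.cong refl) (auto simp: chain_prod_Cons chains_def)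
    also have "\<dots> = (\<Sum>m\<in>{i<..j}. ?G i m * (\<Sum>r\<in>chains m j. subchain_sum (\<lambda>q. F (i # q)) G r * chain_prod a r))"
      using 3 by (intro sum.cong refl arg_cong2[where f = "(*)"] less) auto
    also have "\<dots> = (\<Sum>m\<in>{i<..j}. \<Sum>(r1, r2)\<in>chains i m \<times> chains m j. ?T r1 r2)"
      by (simp only: sum_product sum.cartesian_product)
    also have "\<dots> = (\<Sum>(m, r1, r2)\<in>(SIGMA m:{i<..j}. chains i m \<times> chains m j). ?T r1 r2)"
      by (subst sum.Sigma) (auto simp: case_prod_unfold)
    \<comment> \<open>\<open>d\<close> is the position in \<open>r\<close> at which the first step
      of \<open>q\<close> ends; \<open>take (Suc d) r\<close> and \<open>drop d r\<close> share the
      entry \<open>r ! d\<close>.\<close>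
    also have "\<dots> = (\<Sum>(r, d)\<in>(SIGMA r:chains i j. {1..<length r}). ?T (take (Suc d) r) (drop d r))"
    proof (rule sum.reindex_bij_witness[where
          j = "\<lambda>(m, r1, r2). (r1 @ tl r2, length r1 - 1)" and
          i = "\<lambda>(r, d). (r ! d, take (Suc d) r, drop d r)"])
      fix x assume "x \<in> (SIGMA m:{i<..j}. chains i m \<times> chains m j)"
      then obtain m r1 r2 where x: "x = (m, r1, r2)" "i < m" "m \<le> j" "r1 \<in> chains i m" "r2 \<in> chains m j" by auto
      have r1: "r1 \<noteq> []" "hd r1 = i" "last r1 = m" "sorted_wrt (<) r1"
        and r2: "r2 \<noteq> []" "hd r2 = m" "last r2 = j" "sorted_wrt (<) r2"
        using x by (auto simp: chains_def)
      obtain t where t: "r2 = m # t" using r2 by (cases r2) auto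
      have len: "2 \<le> length r1"
        using r1 x(2) by (cases r1; cases "tl r1") auto
      obtain b where b: "r1 = b @ [m]" using r1 by (metis append_butlast_last_id)
      have b': "length r1 = Suc (length b)" using b by simp
      have tk: "take (length r1) (r1 @ t) = r1" by simp
      have dr: "drop (length b) (r1 @ t) = r2" using b t by simp
      have "set r1 \<subseteq> {i..m}" using chains_subset[OF x(4)] .
      moreover have "\<forall>y\<in>set t. m < y" using r2 t by auto
      ultimately have "sorted_wrt (<) (r1 @ t)"
        using r1 r2 t by (fastforce simp: sorted_wrt_append)
      then have ch: "r1 @ tl r2 \<in> chains i j"
        using r1 r2 t by (auto simp: chains_def)
      show "(case case x of (m, r1, r2) \<Rightarrow> (r1 @ tl r2, length r1 - 1) of (r, d) \<Rightarrow> (r ! d, take (Suc d) r, drop d r)) = x"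
        using x b b' t dr by (simp add: nth_append)
      show "(case x of (m, r1, r2) \<Rightarrow> (r1 @ tl r2, length r1 - 1)) \<in> (SIGMA r:chains i j. {1..<length r})"
        using x ch len r2 by auto
      show "(case case x of (m, r1, r2) \<Rightarrow> (r1 @ tl r2, length r1 - 1) of (r, d) \<Rightarrow> ?T (take (Suc d) r) (drop d r))
         = (case x of (m, r1, r2) \<Rightarrow> ?T r1 r2)"
        using x b b' t dr by simp
    next
      fix y assume "y \<in> (SIGMA r:chains i j. {1..<length r})"
      then obtain r d where y: "y = (r, d)" "r \<in> chains i j" "1 \<le> d" "d < length r" by auto
      have r: "r \<noteq> []" "hd r = i" "last r = j" "sorted_wrt (<) r" using y by (auto simp: chains_def)
      have 1: "take (Suc d) r @ tl (drop d r) = r"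
        by (metis append_take_drop_id drop_Suc tl_drop)
      show "(case case y of (r, d) \<Rightarrow> (r ! d, take (Suc d) r, drop d r) of (m, r1, r2) \<Rightarrow> (r1 @ tl r2, length r1 - 1)) = y"
        using y 1 by simp
      have "take (Suc d) r \<in> chains i (r ! d)"
      proof -
        have "last (take (Suc d) r) = r ! d" using y by (simp add: take_Suc_conv_app_nth)
        then show ?thesis using r y by (auto simp: chains_def sorted_wrt_take)
      qed
      moreover have "drop d r \<in> chains (r ! d) j"
        using r y by (auto simp: chains_def hd_drop_conv_nth sorted_wrt_drop)
      moreover have "i < r ! d"
        using sorted_wrt_nth_less[OF r(4), of 0 d] y r by (simp add: hd_conv_nth)
      moreover have "r ! d \<le> j" using chains_subset[OF y(2)] y by (meson atLeastAtMost_iff nth_mem subsetD)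
      ultimately show "(case y of (r, d) \<Rightarrow> (r ! d, take (Suc d) r, drop d r)) \<in> (SIGMA m:{i<..j}. chains i m \<times> chains m j)"
        using y by simp
    qed
    also have "\<dots> = (\<Sum>r\<in>chains i j. \<Sum>d\<in>{1..<length r}. ?T (take (Suc d) r) (drop d r))"
      by (subst sum.Sigma) auto
    also have "\<dots> = (\<Sum>r\<in>chains i j. subchain_sum F G r * chain_prod a r)"
    proof (rule sum.cong[OF refl])
      fix r assume r: "r \<in> chains i j"
      have len: "\<not> length r \<le> 1" using r 3 by (cases r; cases "tl r") (auto simp: chains_def)
      have "chain_prod a r = chain_prod a (take (Suc d) r) * chain_prod a (drop d r)" if "d \<in> {1..<length r}" for d
      proof -
        have "take (Suc d) r @ tl (drop d r) = r"
          by (metis append_take_drop_id drop_Suc tl_drop)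
        moreover have "last (take (Suc d) r) = hd (drop d r)"
          using that by (simp add: take_Suc_conv_app_nth hd_drop_conv_nth)
        ultimately show ?thesis
          using chain_prod_append[of "take (Suc d) r" "drop d r" a] that len by (cases "r = []") auto
      qed
      then show "(\<Sum>d\<in>{1..<length r}. ?T (take (Suc d) r) (drop d r)) = subchain_sum F G r * chain_prod a r"
        using len r by (subst subchain_sum.simps) (auto simp: sum_distrib_right chains_def intro!: sum.cong)
    qed
    finally show ?thesis .
  qed
qed

abbreviation segment_of :: "nat list \<Rightarrow> nat \<Rightarrow> nat \<Rightarrow> nat list" where
  "segment_of r x y \<equiv> take (Suc (y - x)) (drop x r)"

text \<open>Unfolds the recursion by cutting lists into a sum over lists of positions in
  \<open>r\<close>, the shape in which the defining sums of L and J are given.\<close>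

lemma subchain_sum_conv_chains:
  assumes "length r = Suc N" "b \<le> N"
  shows "(\<Sum>p\<in>chains b N. F (map ((!) r) p) * chain_prod (\<lambda>x y. G (segment_of r x y)) p) = subchain_sum F G (drop b r)"
  using assms(2)
proof (induction "N - b" arbitrary: b F rule: less_induct)
  case less
  let ?g = "\<lambda>x y. G (segment_of r x y)"
  show ?case
  proof (cases "b = N")
    case True
    have "drop N r = [r ! N]"
      using assms(1) Cons_nth_drop_Suc[of N r] by simp
    then show ?thesis using True by (simp add: chains_refl subchain_sum.simps)
  next
    case False
    then have b: "b < N" using less by simp
    have "(\<Sum>p\<in>chains b N. F (map ((!) r) p) * chain_prod ?g p)
       = (\<Sum>m\<in>{b<..N}. \<Sum>p\<in>chains m N. F (map ((!) r) (b # p)) * chain_prod ?g (b # p))"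
      by (rule sum_chains_Cons[OF b])
    also have "\<dots> = (\<Sum>m\<in>{b<..N}. ?g b m * (\<Sum>p\<in>chains m N. F (r ! b # map ((!) r) p) * chain_prod ?g p))"
      unfolding sum_distrib_left
      by (intro sum.cong refl) (auto simp: chain_prod_Cons chains_def)
    also have "\<dots> = (\<Sum>m\<in>{b<..N}. ?g b m * subchain_sum (\<lambda>q. F (r ! b # q)) G (drop m r))"
      using b by (intro sum.cong refl arg_cong2[where f = "(*)"] less) auto
    also have "\<dots> = (\<Sum>d\<in>{1..<Suc (N - b)}. G (take (Suc d) (drop b r)) *
         subchain_sum (\<lambda>q. F (r ! b # q)) G (drop d (drop b r)))"
      by (rule sum.reindex_bij_witness[where j = "\<lambda>m. m - b" and i = "\<lambda>d. d + b"]) (auto simp: add.commute)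
    also have "\<dots> = subchain_sum F G (drop b r)"
      using b assms by (subst (2) subchain_sum.simps) (auto simp: hd_drop_conv_nth Suc_diff_le)
    finally show ?thesis .
  qed
qed

lemma sum_index_seqs:
  fixes T :: "nat list \<Rightarrow> complex"
  assumes "1 \<le> N"
  shows "(\<Sum>k=1..N. \<Sum>p\<in>index_seqs N k. T p) = (\<Sum>p\<in>chains 0 N. T p)"
proof -
  have "chains 0 N = (\<Union>k\<in>{1..N}. index_seqs N k)"
  proof (intro equalityI subsetI)
    fix p assume p: "p \<in> chains 0 N"
    then have p': "p \<noteq> []" "p ! 0 = 0" "p ! (length p - 1) = N" "sorted_wrt (<) p"
      by (auto simp: chains_def hd_conv_nth last_conv_nth)
    have "length p \<noteq> 1" using p' assms by auto
    moreover have "length p \<noteq> 0" using p' by simp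
    moreover have "length p \<le> Suc N"
    proof -
      have "distinct p" using p'(4) by (simp add: strict_sorted_iff)
      then have "length p = card (set p)" by (simp add: distinct_card)
      also have "\<dots> \<le> card {0..N}" by (rule card_mono) (use chains_subset[OF p] in auto)
      finally show ?thesis by simp
    qed
    ultimately show "p \<in> (\<Union>k\<in>{1..N}. index_seqs N k)"
      using p' by (intro UN_I[of "length p - 1"]; cases "length p") (auto simp: index_seqs_def Suc_le_eq)
  next
    fix p assume "p \<in> (\<Union>k\<in>{1..N}. index_seqs N k)"
    then obtain k where "length p = Suc k" "p ! 0 = 0" "p ! k = N" "sorted_wrt (<) p"
      by (auto simp: index_seqs_def)
    moreover from this have "p \<noteq> []" by auto
    ultimately show "p \<in> chains 0 N" by (simp add: chains_def hd_conv_nth last_conv_nth)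
  qed
  moreover have "(\<Sum>p\<in>(\<Union>k\<in>{1..N}. index_seqs N k). T p) = (\<Sum>k=1..N. \<Sum>p\<in>index_seqs N k. T p)"
    by (rule sum.UNION_disjoint) (simp_all add: finite_index_seqs, auto simp: index_seqs_def)
  ultimately show ?thesis by simp
qed

text \<open>The weight supported on unit steps is neutral for composition: only the finest chain
  survives.\<close>

lemma sum_chains_unit_steps:
  fixes F :: "nat list \<Rightarrow> complex"
  assumes "i \<le> j"
  shows "(\<Sum>q\<in>chains i j. F q * chain_prod (\<lambda>x y. if y = Suc x then 1 else 0) q) = F [i..<Suc j]"
  using assms
proof (induction "j - i" arbitrary: i F rule: less_induct)
  case less
  let ?e = "\<lambda>x y. if y = Suc x then 1 else (0::complex)"
  show ?case
  proof (cases "i = j")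
    case True
    then show ?thesis by (simp add: chains_refl)
  next
    case False
    then have i: "i < j" using less by simp
    have "(\<Sum>q\<in>chains i j. F q * chain_prod ?e q) = (\<Sum>m\<in>{i<..j}. \<Sum>q\<in>chains m j. F (i # q) * chain_prod ?e (i # q))"
      by (rule sum_chains_Cons[OF i])
    also have "\<dots> = (\<Sum>m\<in>{i<..j}. if m = Suc i then \<Sum>q\<in>chains (Suc i) j. F (i # q) * chain_prod ?e q else 0)"
      by (intro sum.cong refl) (auto simp: chain_prod_Cons chains_def intro!: sum.neutral sum.cong)
    also have "\<dots> = (\<Sum>q\<in>chains (Suc i) j. F (i # q) * chain_prod ?e q)"
      using i by (subst sum.delta) auto
    also have "\<dots> = F (i # [Suc i..<Suc j])"
      by (rule less(1)) (use i in auto)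
    also have "i # [Suc i..<Suc j] = [i..<Suc j]" using i by (simp add: upt_conv_Cons)
    finally show ?thesis .
  qed
qed

section \<open>The sequences J, L and M as functions of chains\<close>

definition increments :: "(nat \<Rightarrow> complex) \<Rightarrow> nat list \<Rightarrow> nat \<Rightarrow> complex" where
  "increments s q = (\<lambda>m. s (q ! m) - s (q ! (m - 1)))"

lemma psum_increments: "psum (increments s q) l = s (q ! l) - s (q ! 0)"
  by (induction l) (auto simp: psum_def increments_def)

abbreviation J_chain :: "(nat \<Rightarrow> complex) \<Rightarrow> nat list \<Rightarrow> complex" where
  "J_chain s q \<equiv> J_fun (length q - 1) (increments s q)"

abbreviation L_chain :: "(nat \<Rightarrow> complex) \<Rightarrow> nat list \<Rightarrow> complex" where
  "L_chain s q \<equiv> L_fun (length q - 1) (increments s q)"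

abbreviation M_chain :: "(nat \<Rightarrow> complex) \<Rightarrow> nat list \<Rightarrow> complex" where
  "M_chain s q \<equiv> M_fun (length q - 1) (increments s q)"

text \<open>The logarithm coefficients from the definition of L for a chain of
  \<open>length q - 1\<close> steps, supported on chains all of whose steps are positive multiples
  of the total step. A one-element chain gets 0 through division by zero.\<close>

definition ray_coeff :: "(nat \<Rightarrow> complex) \<Rightarrow> nat list \<Rightarrow> complex" where
  "ray_coeff s q = (if \<forall>j\<in>{1..length q - 1}. \<exists>r>0. s (q ! j) - s (q ! (j - 1)) = of_real r * (s (last q) - s (hd q))
     then (-1) ^ (length q - 2) / of_nat (length q - 1) else 0)"

lemma L_fun_1 [simp]: "L_fun (Suc 0) z = 2 * of_real pi * \<i>"
  by (simp add: L_fun_def)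

lemma M_fun_1 [simp]: "M_fun (Suc 0) z = 2 * of_real pi * \<i>"
  by (simp add: M_fun_def)

lemma block_increments:
  assumes "x < y" "y < length r" "m \<in> {1..y - x}"
  shows "block (increments s r) x m = increments s (segment_of r x y) m"
  using assms by (auto simp: block_def increments_def)

lemma Suc_minus_2: "Suc k - 2 = k - 1"
  by simp

lemma segment_of_length: "x < y \<Longrightarrow> y < length r \<Longrightarrow> length (segment_of r x y) = Suc (y - x)"
  by auto

lemma chains_step:
  assumes "p \<in> chains 0 N" "length p = Suc k" "j < k"
  shows "p ! j < p ! Suc j" "p ! Suc j \<le> N"
proof -
  show "p ! j < p ! Suc j"
    using assms sorted_wrt_nth_less[of "(<)" p j "Suc j"] by (auto simp: chains_def)
  show "p ! Suc j \<le> N"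
    using chains_subset[OF assms(1)] assms nth_mem[of "Suc j" p] by (auto simp del: nth_mem)
qed

text \<open>The defining recursion of J says that composing it with L gives the neutral element; for
  a single step this is J_1 L_1 = 1.\<close>

lemma J_compose_L:
  assumes len: "length r = Suc N" and N: "1 \<le> N"
  shows "subchain_sum (J_chain s) (L_chain s) r = (if N = 1 then 1 else 0)"
proof -
  let ?z = "increments s r"
  let ?J = "\<lambda>k p. J_fun k (\<lambda>j. psum ?z (p ! j) - psum ?z (p ! (j - 1)))"
  let ?L = "\<lambda>k p. \<Prod>j=1..k. L_fun (p ! j - p ! (j - 1)) (block ?z (p ! (j - 1)))"
  have eq: "J_chain s (map ((!) r) p) * chain_prod (\<lambda>x y. L_chain s (segment_of r x y)) p
      = ?J (length p - 1) p * ?L (length p - 1) p" if p: "p \<in> chains 0 N" for p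
  proof -
    obtain k where k: "length p = Suc k" using p by (cases p) (auto simp: chains_def)
    have "J_fun k (increments s (map ((!) r) p)) = ?J k p"
      unfolding psum_increments using k by (intro J_fun_cong) (auto simp: increments_def)
    moreover have "chain_prod (\<lambda>x y. L_chain s (segment_of r x y)) p
       = (\<Prod>j<k. L_fun (p ! Suc j - p ! j) (block ?z (p ! j)))"
      unfolding chain_prod_eq_prod[OF k]
    proof (rule prod.cong[OF refl])
      fix j assume j: "j \<in> {..<k}"
      have st: "p ! j < p ! Suc j" "p ! Suc j < length r" using chains_step[OF p k, of j] j len by auto
      show "L_chain s (segment_of r (p ! j) (p ! Suc j)) = L_fun (p ! Suc j - p ! j) (block ?z (p ! j))"
        unfolding segment_of_length[OF st] diff_Suc_1
        by (rule L_fun_cong) (use block_increments[OF st] in auto)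
    qed
    moreover have "(\<Prod>j<k. L_fun (p ! Suc j - p ! j) (block ?z (p ! j))) = ?L k p"
      by (rule prod.reindex_bij_witness[of _ "\<lambda>j. j - 1" Suc]) auto
    ultimately show ?thesis using k by simp
  qed
  have "subchain_sum (J_chain s) (L_chain s) r
     = (\<Sum>p\<in>chains 0 N. J_chain s (map ((!) r) p) * chain_prod (\<lambda>x y. L_chain s (segment_of r x y)) p)"
    using subchain_sum_conv_chains[OF len, of 0 "J_chain s" "L_chain s"] by simp
  also have "\<dots> = (\<Sum>p\<in>chains 0 N. ?J (length p - 1) p * ?L (length p - 1) p)"
    by (rule sum.cong[OF refl eq])
  also have "\<dots> = (\<Sum>k=1..N. \<Sum>p\<in>index_seqs N k. ?J (length p - 1) p * ?L (length p - 1) p)"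
    by (rule sum_index_seqs[OF N, symmetric])
  also have "\<dots> = (\<Sum>k=1..N. \<Sum>p\<in>index_seqs N k. ?J k p * ?L k p)"
    by (intro sum.cong refl) (auto simp: index_seqs_def)
  also have "\<dots> = (if N = 1 then 1 else 0)"
  proof (cases "N = 1")
    case True
    have "index_seqs 1 1 = {[0, 1]}" using index_seqs_full[of 1] by (simp add: upt_rec)
    then show ?thesis using True J_fun_1 by simp
  next
    case False
    then show ?thesis using J_fun_recursion[of N ?z] N by simp
  qed
  finally show ?thesis .
qed

text \<open>L is the composition of the logarithm coefficients with M. For a single step the
  separate clause in \<open>L_fun\<close> agrees with the general sum, whose ray condition holds
  with factor 1.\<close>

lemma L_chain_eq:
  assumes len: "length r = Suc N" and N: "1 \<le> N"
  shows "L_chain s r = subchain_sum (ray_coeff s) (M_chain s) r"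
proof -
  let ?z = "increments s r"
  let ?c = "\<lambda>k p. \<forall>j\<in>{1..k}. \<exists>\<rho>>0. psum ?z (p ! j) - psum ?z (p ! (j - 1)) = of_real \<rho> * psum ?z N"
  let ?T = "\<lambda>k p. if ?c k p then (-1) ^ (k - 1) / of_nat k * (\<Prod>j<k. M_fun (p ! (j + 1) - p ! j) (block ?z (p ! j))) else 0"
  have eq: "ray_coeff s (map ((!) r) p) * chain_prod (\<lambda>x y. M_chain s (segment_of r x y)) p = ?T (length p - 1) p"
    if p: "p \<in> chains 0 N" for p
  proof -
    obtain k where k: "length p = Suc k" using p by (cases p) (auto simp: chains_def)
    have ends: "p ! 0 = 0" "p ! k = N" "p \<noteq> []" using p k by (auto simp: chains_def hd_conv_nth last_conv_nth)
    have ends': "hd (map ((!) r) p) = r ! 0" "last (map ((!) r) p) = r ! N"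
      using p ends by (auto simp: chains_def hd_map last_map)
    have c: "(\<forall>j\<in>{1..k}. \<exists>\<rho>>0. s (map ((!) r) p ! j) - s (map ((!) r) p ! (j - 1)) = of_real \<rho> * (s (r ! N) - s (r ! 0))) = ?c k p"
      using k by (intro ball_cong refl) (auto simp: psum_increments)
    have "ray_coeff s (map ((!) r) p) = (if ?c k p then (-1) ^ (k - 1) / of_nat k else 0)"
      unfolding ray_coeff_def ends' length_map k diff_Suc_1 c Suc_minus_2 ..
    moreover have "chain_prod (\<lambda>x y. M_chain s (segment_of r x y)) p
       = (\<Prod>j<k. M_fun (p ! (j + 1) - p ! j) (block ?z (p ! j)))"
      unfolding chain_prod_eq_prod[OF k]
    proof (rule prod.cong[OF refl])
      fix j assume j: "j \<in> {..<k}"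
      have st: "p ! j < p ! Suc j" "p ! Suc j < length r" using chains_step[OF p k, of j] j len by auto
      show "M_chain s (segment_of r (p ! j) (p ! Suc j)) = M_fun (p ! (j + 1) - p ! j) (block ?z (p ! j))"
        unfolding segment_of_length[OF st] diff_Suc_1 Suc_eq_plus1[symmetric]
        by (rule M_fun_cong) (use block_increments[OF st] in auto)
    qed
    moreover have "(if C then u else 0) * v = (if C then u * v else 0)" for C and u v :: complex by simp
    ultimately show ?thesis unfolding k diff_Suc_1 by (simp only:)
  qed
  have "L_chain s r = (\<Sum>k=1..N. \<Sum>p\<in>index_seqs N k. ?T k p)"
  proof (cases "N = 1")
    case True
    have "index_seqs 1 1 = {[0, 1]}" using index_seqs_full[of 1] by (simp add: upt_rec)
    moreover have "\<exists>\<rho>>0. psum ?z 1 - psum ?z 0 = of_real \<rho> * psum ?z 1"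
      by (intro exI[of _ 1]) (simp add: psum_def)
    ultimately show ?thesis using True len by simp
  next
    case False
    have "L_chain s r = (\<Sum>k=1..N. \<Sum>p | p \<in> index_seqs N k \<and> ?c k p. (-1) ^ (k - 1) / of_nat k *
       (\<Prod>j<k. M_fun (p ! (j + 1) - p ! j) (block ?z (p ! j))))"
      unfolding L_fun_def using False len by simp
    also have "\<dots> = (\<Sum>k=1..N. \<Sum>p\<in>index_seqs N k. ?T k p)"
      by (intro sum.cong refl sum.inter_filter finite_index_seqs)
    finally show ?thesis .
  qed
  also have "\<dots> = (\<Sum>k=1..N. \<Sum>p\<in>index_seqs N k. ?T (length p - 1) p)"
    by (intro sum.cong refl) (auto simp: index_seqs_def)
  also have "\<dots> = (\<Sum>p\<in>chains 0 N. ?T (length p - 1) p)"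
    by (rule sum_index_seqs[OF N])
  also have "\<dots> = (\<Sum>p\<in>chains 0 N. ray_coeff s (map ((!) r) p) * chain_prod (\<lambda>x y. M_chain s (segment_of r x y)) p)"
    by (rule sum.cong[OF refl eq[symmetric]])
  also have "\<dots> = subchain_sum (ray_coeff s) (M_chain s) r"
    using subchain_sum_conv_chains[OF len, of 0 "ray_coeff s" "M_chain s"] by simp
  finally show ?thesis .
qed

lemma L_chain_eq_0:
  assumes "length r = Suc N" "2 \<le> N" "\<And>m. m \<in> {1..N} \<Longrightarrow> s (r ! m) \<noteq> s (r ! (m - 1))" "s (r ! N) = s (r ! 0)"
  shows "L_chain s r = 0"
proof -
  have "L_fun N (increments s r) = 0"
  proof (rule L_fun_eq_0)
    show "psum (increments s r) N = 0" unfolding psum_increments using assms by simp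
    show "increments s r m \<noteq> 0" if "m \<in> {1..N}" for m
      using assms(3)[OF that] by (simp add: increments_def)
  qed (use assms in simp)
  then show ?thesis using assms(1) by simp
qed

lemma chain_prod_nonzeroD:
  assumes "chain_prod a q \<noteq> 0" "length q = Suc k" "m \<in> {1..k}"
  shows "a (q ! (m - 1)) (q ! m) \<noteq> 0"
proof -
  have "m - 1 \<in> {..<k}" "Suc (m - 1) = m" using assms(3) by auto
  moreover have "\<forall>j\<in>{..<k}. a (q ! j) (q ! Suc j) \<noteq> 0"
    using assms(1) unfolding chain_prod_eq_prod[OF assms(2)] by (simp add: prod_zero_iff)
  ultimately show ?thesis by metis
qed

text \<open>
  On \<open>D_n\<close>, if the sums over chains built from \<open>a\<close> with \<open>M\<close> are trivial beyond the first superdiagonal,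
  then so are their logarithms along rays, which are the sums built with \<open>L\<close>; inverting \<open>L\<close> recovers \<open>a\<close>.
\<close>

lemma J_fun_eq_residue:
  fixes a :: "nat \<Rightarrow> nat \<Rightarrow> complex"
  assumes n: "1 \<le> n"
    and z: "\<And>i. i \<in> {1..n} \<Longrightarrow> z i \<noteq> 0"
    and D: "\<And>i. i \<in> {1..<n} \<Longrightarrow> \<not> (\<exists>r>0. z i / z (i + 1) = of_real r)"
    and a0: "\<And>x y. x < y \<Longrightarrow> y \<le> n \<Longrightarrow> psum z x = psum z y \<Longrightarrow> a x y = 0"
    and M: "\<And>x y. x < y \<Longrightarrow> y \<le> n \<Longrightarrow> psum z x \<noteq> psum z y \<Longrightarrow>
      (\<Sum>r\<in>chains x y. M_chain (psum z) r * chain_prod a r) = (if y = Suc x then 1 else 0)"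
  shows "J_fun n z = a 0 n"
proof -
  let ?s = "psum z" and ?e = "\<lambda>x y. if y = Suc x then 1 else (0::complex)"
  have sdiff: "?s (Suc x) - ?s x = z (Suc x)" for x by (simp add: psum_def)
  have M1: "(2 * of_real pi * \<i>) * a x (Suc x) = 1" if "Suc x \<le> n" for x
  proof -
    have "?s x \<noteq> ?s (Suc x)" using sdiff[of x] z[of "Suc x"] that by auto
    moreover have "chains x (Suc x) = {[x, Suc x]}"
    proof -
      have 1: "{x<..Suc x} = {Suc x}" by auto
      have 2: "(SIGMA m:{Suc x}. chains m (Suc x)) = {(Suc x, [Suc x])}"
        by (auto simp: chains_refl)
      show ?thesis by (subst chains_Cons_eq[OF lessI]) (simp only: 1 2 image_insert image_empty case_prod_conv)
    qed
    ultimately show ?thesis using M[of x "Suc x"] that by simp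
  qed
  have L: "(\<Sum>r\<in>chains x y. L_chain ?s r * chain_prod a r) = ?e x y" if xy: "x < y" "y \<le> n" for x y
  proof (cases "?s x = ?s y")
    case True
    have ne: "y \<noteq> Suc x" using True sdiff[of x] z[of "Suc x"] xy by auto
    \<comment> \<open>For coincident end points the hypothesis on M says nothing. Here L itself
      vanishes, unless two consecutive points of the chain coincide, and then the weight
      vanishes.\<close>
    have "L_chain ?s r * chain_prod a r = 0" if r: "r \<in> chains x y" for r
    proof (rule ccontr)
      assume nz: "L_chain ?s r * chain_prod a r \<noteq> 0"
      obtain N where N: "length r = Suc N" using r by (cases r) (auto simp: chains_def)
      have ends: "r ! 0 = x" "r ! N = y" using r N by (auto simp: chains_def hd_conv_nth last_conv_nth simp flip: length_greater_0_conv)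
      have "N \<noteq> 0"
      proof
        assume "N = 0" with ends xy(1) show False by simp
      qed
      have step: "r ! (m - 1) < r ! m" "r ! m \<le> n" if "m \<in> {1..N}" for m
      proof -
        show "r ! (m - 1) < r ! m" using r that N sorted_wrt_nth_less[of "(<)" r "m - 1" m] by (auto simp: chains_def)
        have "r ! m \<in> {x..y}" using that N by (intro subsetD[OF chains_subset[OF r]]) auto
        then show "r ! m \<le> n" using xy by auto
      qed
      have distinct: "?s (r ! m) \<noteq> ?s (r ! (m - 1))" if "m \<in> {1..N}" for m
        using chain_prod_nonzeroD[of a r N m] a0[OF step[OF that]] nz N that by fastforce
      have "N \<noteq> 1" using distinct[of 1] ends True by auto
      then have "2 \<le> N" using \<open>N \<noteq> 0\<close> by auto
      from L_chain_eq_0[OF N this distinct] nz True ends show False by auto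
    qed
    then show ?thesis using ne by (simp add: sum.neutral)
  next
    case False
    let ?M = "\<lambda>x y. \<Sum>r\<in>chains x y. M_chain ?s r * chain_prod a r"
    have "(\<Sum>r\<in>chains x y. L_chain ?s r * chain_prod a r) = (\<Sum>r\<in>chains x y. subchain_sum (ray_coeff ?s) (M_chain ?s) r * chain_prod a r)"
    proof (rule sum.cong[OF refl])
      fix r assume r: "r \<in> chains x y"
      have "length r \<noteq> 0" "length r \<noteq> 1" using r xy by (auto simp: chains_def length_Suc_conv)
      then have "length r = Suc (length r - 1)" "1 \<le> length r - 1" by linarith+
      from L_chain_eq[OF this] show "L_chain ?s r * chain_prod a r = subchain_sum (ray_coeff ?s) (M_chain ?s) r * chain_prod a r"
        by simp
    qed
    also have "\<dots> = (\<Sum>q\<in>chains x y. ray_coeff ?s q * chain_prod ?M q)"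
      by (rule sum_chains_compose[symmetric])
    also have "\<dots> = (\<Sum>q\<in>chains x y. ray_coeff ?s q * chain_prod ?e q)"
    proof (rule sum.cong[OF refl])
      fix q assume q: "q \<in> chains x y"
      show "ray_coeff ?s q * chain_prod ?M q = ray_coeff ?s q * chain_prod ?e q"
      proof (cases "ray_coeff ?s q = 0")
        case nz: False
        obtain k where k: "length q = Suc k" using q by (cases q) (auto simp: chains_def)
        have ends: "hd q = x" "last q = y" using q by (auto simp: chains_def)
        have "chain_prod ?M q = chain_prod ?e q"
          unfolding chain_prod_eq_prod[OF k]
        proof (rule prod.cong[OF refl])
          fix j assume j: "j \<in> {..<k}"
          have st: "q ! j < q ! Suc j" using q j k sorted_wrt_nth_less[of "(<)" q j "Suc j"] by (auto simp: chains_def)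
          have "q ! Suc j \<in> {x..y}" using j k by (intro subsetD[OF chains_subset[OF q]]) auto
          then have le: "q ! Suc j \<le> n" using xy by auto
          \<comment> \<open>A nonzero coefficient makes every step a positive multiple of the
            nonzero total step, so its ends differ and the hypothesis on M applies.\<close>
          have "\<exists>r>0. ?s (q ! Suc j) - ?s (q ! j) = of_real r * (?s y - ?s x)"
          proof -
            have "\<forall>j\<in>{1..length q - 1}. \<exists>r>0. ?s (q ! j) - ?s (q ! (j - 1)) = of_real r * (?s y - ?s x)"
              using nz unfolding ray_coeff_def ends by (meson)
            from bspec[OF this, of "Suc j"] j k show ?thesis by simp
          qed
          then have "?s (q ! j) \<noteq> ?s (q ! Suc j)" using False by auto
          from M[OF st le this] show "?M (q ! j) (q ! Suc j) = ?e (q ! j) (q ! Suc j)" .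
        qed
        then show ?thesis by simp
      qed simp
    qed
    also have "\<dots> = ray_coeff ?s [x..<Suc y]"
      by (rule sum_chains_unit_steps) (use xy in simp)
    also have "\<dots> = ?e x y"
    proof (cases "y = Suc x")
      case True
      have "[x..<Suc y] = [x, Suc x]" using True by (simp add: upt_rec)
      moreover have "\<exists>r>0. ?s (Suc x) - ?s x = of_real r * (?s (Suc x) - ?s x)" by (intro exI[of _ 1]) auto
      ultimately show ?thesis using True by (simp add: ray_coeff_def)
    next
      case ne: False
      have nth: "[x..<Suc y] ! j = x + j" if "j \<le> y - x" for j using that xy by (simp del: upt_Suc)
      \<comment> \<open>If the first two unit steps lay on one ray,
        \<open>z (Suc x) / z (Suc (Suc x))\<close> would be a positive real, which the domain
        excludes.\<close>
      have "\<not> (\<forall>j\<in>{1..length [x..<Suc y] - 1}. \<exists>r>0. ?s ([x..<Suc y] ! j) - ?s ([x..<Suc y] ! (j - 1))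
         = of_real r * (?s (last [x..<Suc y]) - ?s (hd [x..<Suc y])))"
      proof
        assume *: "\<forall>j\<in>{1..length [x..<Suc y] - 1}. \<exists>r>0. ?s ([x..<Suc y] ! j) - ?s ([x..<Suc y] ! (j - 1))
         = of_real r * (?s (last [x..<Suc y]) - ?s (hd [x..<Suc y]))"
        let ?d = "?s (last [x..<Suc y]) - ?s (hd [x..<Suc y])"
        have len: "1 \<in> {1..length [x..<Suc y] - 1}" "2 \<in> {1..length [x..<Suc y] - 1}" using ne xy by auto
        obtain r1 where r1: "r1 > 0" "z (Suc x) = of_real r1 * ?d"
          using bspec[OF * len(1)] ne xy nth[of 1] nth[of 0] sdiff[of x] by (auto simp del: upt_Suc)
        obtain r2 where r2: "r2 > 0" "z (Suc (Suc x)) = of_real r2 * ?d"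
          using bspec[OF * len(2)] ne xy nth[of 2] nth[of 1] sdiff[of "Suc x"] by (auto simp: numeral_2_eq_2 simp del: upt_Suc)
        have "?d \<noteq> 0" using r1 z[of "Suc x"] ne xy by auto
        then have "z (Suc x) / z (Suc (Suc x)) = of_real (r1 / r2)" unfolding r1 r2 by simp
        moreover have "r1 / r2 > 0" using r1 r2 by simp
        ultimately show False using D[of "Suc x"] ne xy by auto
      qed
      then have "ray_coeff ?s [x..<Suc y] = 0" unfolding ray_coeff_def by (rule if_not_P)
      then show ?thesis using ne by simp
    qed
    finally show ?thesis .
  qed
  have "J_fun n z = J_chain ?s [0..<Suc n]"
  proof -
    have "J_fun n z = J_fun n (increments ?s [0..<Suc n])"
      by (rule J_fun_cong) (auto simp: increments_def psum_diff[unfolded One_nat_def] simp del: upt_Suc)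
    then show ?thesis by (simp del: upt_Suc)
  qed
  also have "\<dots> = (\<Sum>q\<in>chains 0 n. J_chain ?s q * chain_prod ?e q)"
    by (rule sum_chains_unit_steps[symmetric]) simp
  \<comment> \<open>The neutral weight is replaced by the L-sum that equals it; associativity then
    brings J and L together, and only the two-point chain remains.\<close>
  also have "\<dots> = (\<Sum>q\<in>chains 0 n. J_chain ?s q * chain_prod (\<lambda>x y. \<Sum>r\<in>chains x y. L_chain ?s r * chain_prod a r) q)"
  proof (rule sum.cong[OF refl])
    fix q assume q: "q \<in> chains 0 n"
    have "chain_prod ?e q = chain_prod (\<lambda>x y. \<Sum>r\<in>chains x y. L_chain ?s r * chain_prod a r) q"
      by (rule chain_prod_cong[OF q]) (rule L[symmetric])
    then show "J_chain ?s q * chain_prod ?e q = J_chain ?s q * chain_prod (\<lambda>x y. \<Sum>r\<in>chains x y. L_chain ?s r * chain_prod a r) q"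
      by simp
  qed
  also have "\<dots> = (\<Sum>r\<in>chains 0 n. subchain_sum (J_chain ?s) (L_chain ?s) r * chain_prod a r)"
    by (rule sum_chains_compose)
  also have "\<dots> = (\<Sum>r\<in>chains 0 n. if r = [0, n] then a 0 n else 0)"
  proof (rule sum.cong[OF refl])
    fix r assume r: "r \<in> chains 0 n"
    have "length r \<noteq> 0" "length r \<noteq> 1" using r n by (auto simp: chains_def length_Suc_conv)
    then have len: "length r = Suc (length r - 1)" "1 \<le> length r - 1" by linarith+
    have "length r - 1 = 1 \<longleftrightarrow> r = [0, n]"
    proof
      assume "length r - 1 = 1"
      then obtain x y where "r = [x, y]" using len by (auto simp: length_Suc_conv)
      then show "r = [0, n]" using r by (simp add: chains_def)
    qed simp
    then show "subchain_sum (J_chain ?s) (L_chain ?s) r * chain_prod a r = (if r = [0, n] then a 0 n else 0)"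
      unfolding J_compose_L[OF len] by auto
  qed
  also have "\<dots> = a 0 n"
    using n by (subst sum.delta[OF finite_chains]) (auto simp: chains_def)
  finally show ?thesis .
qed

section \<open>Iterated integrals along a path\<close>

primrec nested_integral :: "(nat \<Rightarrow> real \<Rightarrow> complex) \<Rightarrow> nat \<Rightarrow> real \<Rightarrow> complex" where
  "nested_integral h 0 \<tau> = 1"
| "nested_integral h (Suc m) \<tau> = (LINT u:{0..\<tau>}|lborel. nested_integral h m u * h (Suc m) u)"

text \<open>The same integral with absolute values, in the extended nonnegative reals, where it
  always exists and Tonelli applies; its finiteness serves as the integrability criterion.\<close>

primrec nested_nn_integral :: "(nat \<Rightarrow> real \<Rightarrow> complex) \<Rightarrow> nat \<Rightarrow> real \<Rightarrow> ennreal" where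
  "nested_nn_integral h 0 \<tau> = 1"
| "nested_nn_integral h (Suc m) \<tau> =
     (\<integral>\<^sup>+u. nested_nn_integral h m u * ennreal (norm (h (Suc m) u)) * indicator {0..\<tau>} u \<partial>lborel)"

definition simplex_upto :: "nat \<Rightarrow> real \<Rightarrow> (nat \<Rightarrow> real) set" where
  "simplex_upto m \<tau> = {t. (\<forall>i\<in>{1..m}. 0 \<le> t i \<and> t i \<le> \<tau>) \<and> (\<forall>i\<in>{1..m}. \<forall>j\<in>{1..m}. i \<le> j \<longrightarrow> t i \<le> t j)}"

lemma ordered_simplex_eq: "ordered_simplex m = simplex_upto m 1"
  by (simp add: ordered_simplex_def simplex_upto_def)

lemma simplex_upto_Suc:
  "x(Suc m := y) \<in> simplex_upto (Suc m) \<tau> \<longleftrightarrow> y \<in> {0..\<tau>} \<and> x \<in> simplex_upto m y"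
proof
  assume *: "x(Suc m := y) \<in> simplex_upto (Suc m) \<tau>"
  have b: "0 \<le> (x(Suc m := y)) i \<and> (x(Suc m := y)) i \<le> \<tau>" if "i \<in> {1..Suc m}" for i
    using * that unfolding simplex_upto_def by blast
  have mono: "(x(Suc m := y)) i \<le> (x(Suc m := y)) j" if "i \<in> {1..Suc m}" "j \<in> {1..Suc m}" "i \<le> j" for i j
    using * that unfolding simplex_upto_def by blast
  have "y \<in> {0..\<tau>}" using b[of "Suc m"] by simp
  moreover have "0 \<le> x i \<and> x i \<le> y" if "i \<in> {1..m}" for i
    using b[of i] mono[of i "Suc m"] that by auto
  moreover have "x i \<le> x j" if "i \<in> {1..m}" "j \<in> {1..m}" "i \<le> j" for i j
    using mono[of i j] that by auto
  ultimately show "y \<in> {0..\<tau>} \<and> x \<in> simplex_upto m y" unfolding simplex_upto_def by blast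
next
  assume *: "y \<in> {0..\<tau>} \<and> x \<in> simplex_upto m y"
  have b: "0 \<le> x i \<and> x i \<le> y" if "i \<in> {1..m}" for i
    using * that unfolding simplex_upto_def by blast
  have mono: "x i \<le> x j" if "i \<in> {1..m}" "j \<in> {1..m}" "i \<le> j" for i j
    using * that unfolding simplex_upto_def by blast
  show "x(Suc m := y) \<in> simplex_upto (Suc m) \<tau>"
    unfolding simplex_upto_def
  proof (intro CollectI conjI ballI impI)
    fix i assume "i \<in> {1..Suc m}"
    then show "0 \<le> (x(Suc m := y)) i" "(x(Suc m := y)) i \<le> \<tau>"
      using b[of i] * by (cases "i = Suc m"; force)+
    fix j assume "j \<in> {1..Suc m}" "i \<le> j"
    then show "(x(Suc m := y)) i \<le> (x(Suc m := y)) j"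
      using b[of i] mono[of i j] \<open>i \<in> {1..Suc m}\<close> by (cases "j = Suc m"; cases "i = Suc m") auto
  qed
qed

definition simplex_integrand :: "(nat \<Rightarrow> real \<Rightarrow> complex) \<Rightarrow> nat \<Rightarrow> real \<Rightarrow> (nat \<Rightarrow> real) \<Rightarrow> complex" where
  "simplex_integrand h m \<tau> t = indicator (simplex_upto m \<tau>) t *\<^sub>R (\<Prod>i=1..m. h i (t i))"

lemma simplex_integrand_Suc:
  "simplex_integrand h (Suc m) \<tau> (x(Suc m := y)) = indicator {0..\<tau>} y *\<^sub>R (h (Suc m) y * simplex_integrand h m y x)"
proof -
  have "(\<Prod>i=1..Suc m. h i ((x(Suc m := y)) i)) = h (Suc m) y * (\<Prod>i=1..m. h i (x i))"
    by (simp add: prod.nat_ivl_Suc')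
  moreover have "indicator (simplex_upto (Suc m) \<tau>) (x(Suc m := y)) = (indicator {0..\<tau>} y * indicator (simplex_upto m y) x :: real)"
    using simplex_upto_Suc[of x m y \<tau>] by (auto simp: indicator_def)
  ultimately show ?thesis by (simp add: simplex_integrand_def)
qed

lemma measurable_simplex_integrand [measurable]:
  assumes [measurable]: "\<And>i. h i \<in> borel_measurable borel"
  shows "simplex_integrand h m \<tau> \<in> borel_measurable (Pi\<^sub>M {1..m} (\<lambda>_. lborel))"
proof -
  have comp [measurable]: "(\<lambda>t. t i) \<in> borel_measurable (Pi\<^sub>M {1..m} (\<lambda>_. lborel :: real measure))" if "i \<in> {1..m}" for i
    using measurable_component_singleton[OF that, of "\<lambda>_. lborel"] by simp
  have "Measurable.pred (Pi\<^sub>M {1..m} (\<lambda>_. lborel)) (\<lambda>t. t \<in> simplex_upto m \<tau>)"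
    unfolding simplex_upto_def mem_Collect_eq
  proof (intro pred_intros_logic pred_intros_finite finite_atLeastAtMost)
    fix i j assume "i \<in> {1..m}" "j \<in> {1..m}"
    then show "Measurable.pred (Pi\<^sub>M {1..m} (\<lambda>_. lborel)) (\<lambda>t. (t i :: real) \<le> t j)"
      unfolding pred_def by (intro borel_measurable_le comp)
  next
    fix i assume "i \<in> {1..m}"
    note [measurable] = comp[OF this]
    show "Measurable.pred (Pi\<^sub>M {1..m} (\<lambda>_. lborel)) (\<lambda>t. 0 \<le> (t i :: real))"
      "Measurable.pred (Pi\<^sub>M {1..m} (\<lambda>_. lborel)) (\<lambda>t. (t i :: real) \<le> \<tau>)"
      by measurable
  qed simp_all
  then have 1: "(\<lambda>t. indicator (simplex_upto m \<tau>) t :: real) \<in> borel_measurable (Pi\<^sub>M {1..m} (\<lambda>_. lborel))"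
    by (simp add: borel_measurable_indicator' pred_def Int_def conj_commute)
  have 2: "(\<lambda>t. \<Prod>i=1..m. h i (t i)) \<in> borel_measurable (Pi\<^sub>M {1..m} (\<lambda>_. lborel))"
  proof (rule borel_measurable_prod)
    fix i assume "i \<in> {1..m}"
    note [measurable] = comp[OF this]
    show "(\<lambda>t. h i (t i)) \<in> borel_measurable (Pi\<^sub>M {1..m} (\<lambda>_. lborel))" by measurable
  qed
  show ?thesis
    unfolding simplex_integrand_def[abs_def] using 1 2 by (intro borel_measurable_scaleR)
qed

interpretation lborel_product: product_sigma_finite "\<lambda>_::nat. lborel :: real measure"
  by standard

lemma nn_integral_simplex:
  assumes [measurable]: "\<And>i. h i \<in> borel_measurable borel"
  shows "(\<integral>\<^sup>+t. ennreal (norm (simplex_integrand h m \<tau> t)) \<partial>Pi\<^sub>M {1..m} (\<lambda>_. lborel)) = nested_nn_integral h m \<tau>"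
proof (induction m arbitrary: \<tau>)
  case 0
  show ?case
    using lborel_product.nn_integral_empty[of "\<lambda>t. ennreal (norm (simplex_integrand h 0 \<tau> t))"]
    by (simp add: simplex_integrand_def simplex_upto_def)
next
  case (Suc m)
  have ins: "{1..Suc m} = insert (Suc m) {1..m}" by auto
  have meas: "(\<lambda>t. ennreal (norm (simplex_integrand h (Suc m) \<tau> t))) \<in> borel_measurable (Pi\<^sub>M (insert (Suc m) {1..m}) (\<lambda>_. lborel))"
    unfolding ins[symmetric] using measurable_simplex_integrand[of h "Suc m" \<tau>, OF assms] by simp
  have "(\<integral>\<^sup>+t. ennreal (norm (simplex_integrand h (Suc m) \<tau> t)) \<partial>Pi\<^sub>M {1..Suc m} (\<lambda>_. lborel))
     = (\<integral>\<^sup>+y. \<integral>\<^sup>+x. ennreal (norm (simplex_integrand h (Suc m) \<tau> (x(Suc m := y)))) \<partial>Pi\<^sub>M {1..m} (\<lambda>_. lborel) \<partial>lborel)"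
    unfolding ins by (rule lborel_product.product_nn_integral_insert_rev[OF _ _ meas]) auto
  also have "\<dots> = (\<integral>\<^sup>+y. nested_nn_integral h m y * ennreal (norm (h (Suc m) y)) * indicator {0..\<tau>} y \<partial>lborel)"
  proof (rule nn_integral_cong)
    fix y :: real
    have "(\<integral>\<^sup>+x. ennreal (norm (simplex_integrand h (Suc m) \<tau> (x(Suc m := y)))) \<partial>Pi\<^sub>M {1..m} (\<lambda>_. lborel))
       = (\<integral>\<^sup>+x. (indicator {0..\<tau>} y * ennreal (norm (h (Suc m) y))) * ennreal (norm (simplex_integrand h m y x)) \<partial>Pi\<^sub>M {1..m} (\<lambda>_. lborel))"
      unfolding simplex_integrand_Suc by (intro nn_integral_cong) (auto simp: norm_mult ennreal_mult indicator_def)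
    also have "\<dots> = (indicator {0..\<tau>} y * ennreal (norm (h (Suc m) y))) * nested_nn_integral h m y"
      unfolding Suc.IH[symmetric]
      by (rule nn_integral_cmult) (use measurable_simplex_integrand[of h m y, OF assms] in simp)
    finally show "(\<integral>\<^sup>+x. ennreal (norm (simplex_integrand h (Suc m) \<tau> (x(Suc m := y)))) \<partial>Pi\<^sub>M {1..m} (\<lambda>_. lborel))
      = nested_nn_integral h m y * ennreal (norm (h (Suc m) y)) * indicator {0..\<tau>} y"
      by (simp add: mult_ac)
  qed
  finally show ?case by simp
qed

text \<open>Fubini with the coordinate \<open>i\<close> integrated last. It will be the largest
  variable of the simplex, on which the range of the others depends.\<close>

lemma integral_insert_swap:
  fixes f :: "(nat \<Rightarrow> real) \<Rightarrow> complex"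
  assumes I: "finite I" "i \<notin> I"
    and f: "integrable (Pi\<^sub>M (insert i I) (\<lambda>_. lborel)) f"
  shows "integral\<^sup>L (Pi\<^sub>M (insert i I) (\<lambda>_. lborel)) f = (\<integral>y. (\<integral>x. f (x(i:=y)) \<partial>Pi\<^sub>M I (\<lambda>_. lborel)) \<partial>lborel)"
proof -
  interpret I: finite_product_sigma_finite "\<lambda>_::nat. lborel :: real measure" I
    by standard (rule I)
  interpret P: pair_sigma_finite "Pi\<^sub>M I (\<lambda>_. lborel :: real measure)" "lborel :: real measure" ..
  have meas: "f \<in> borel_measurable (Pi\<^sub>M (insert i I) (\<lambda>_. lborel))" using f by auto
  have meas2: "(\<lambda>(x, y). f (x(i := y))) \<in> borel_measurable (Pi\<^sub>M I (\<lambda>_. lborel) \<Otimes>\<^sub>M lborel)"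
    using measurable_comp[OF measurable_add_dim meas] by (simp add: comp_def case_prod_unfold)
  have "integrable (Pi\<^sub>M I (\<lambda>_. lborel) \<Otimes>\<^sub>M lborel) (\<lambda>(x, y). f (x(i := y)))"
  proof (rule integrableI_bounded[OF meas2])
    have "(\<integral>\<^sup>+z. ennreal (norm (case z of (x, y) \<Rightarrow> f (x(i := y)))) \<partial>(Pi\<^sub>M I (\<lambda>_. lborel) \<Otimes>\<^sub>M lborel))
       = (\<integral>\<^sup>+x. \<integral>\<^sup>+y. ennreal (norm (f (x(i := y)))) \<partial>lborel \<partial>Pi\<^sub>M I (\<lambda>_. lborel))"
      using meas2 by (subst lborel.nn_integral_fst[symmetric]) (auto simp: case_prod_unfold)
    also have "\<dots> = (\<integral>\<^sup>+t. ennreal (norm (f t)) \<partial>Pi\<^sub>M (insert i I) (\<lambda>_. lborel))"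
      using meas I by (intro lborel_product.product_nn_integral_insert[symmetric]) auto
    also have "\<dots> < \<infinity>" using f by (simp add: integrable_iff_bounded)
    finally show "(\<integral>\<^sup>+z. ennreal (norm (case z of (x, y) \<Rightarrow> f (x(i := y)))) \<partial>(Pi\<^sub>M I (\<lambda>_. lborel) \<Otimes>\<^sub>M lborel)) < \<infinity>" .
  qed
  from P.Fubini_integral[OF this] lborel_product.product_integral_insert[OF I f] show ?thesis by simp
qed

text \<open>Finiteness of the inner integrals is asked only below 1, because an inner form may have
  a pole at the end of the path and its integral up to 1 may diverge. The value \<open>y = 1\<close>
  of the outer variable is a null set.\<close>

lemma integral_simplex:
  assumes h: "\<And>i. h i \<in> borel_measurable borel"
    and fin: "\<And>k y. k < m \<Longrightarrow> 0 \<le> y \<Longrightarrow> y < 1 \<Longrightarrow> nested_nn_integral h k y < \<infinity>"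
    and \<tau>: "\<tau> \<le> 1" "nested_nn_integral h m \<tau> < \<infinity>"
  shows "(\<integral>t. simplex_integrand h m \<tau> t \<partial>Pi\<^sub>M {1..m} (\<lambda>_. lborel)) = nested_integral h m \<tau>"
  using fin \<tau>
proof (induction m arbitrary: \<tau>)
  case 0
  show ?case
    using lborel_product.nn_integral_empty[of "\<lambda>_. 1"]
    by (simp add: simplex_integrand_def simplex_upto_def measure_def)
next
  case (Suc m)
  have ins: "{1..Suc m} = insert (Suc m) {1..m}" by auto
  have int: "integrable (Pi\<^sub>M (insert (Suc m) {1..m}) (\<lambda>_. lborel)) (simplex_integrand h (Suc m) \<tau>)"
    unfolding ins[symmetric]
  proof (rule integrableI_bounded)
    show "simplex_integrand h (Suc m) \<tau> \<in> borel_measurable (Pi\<^sub>M {1..Suc m} (\<lambda>_. lborel))"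
      by (rule measurable_simplex_integrand[of h "Suc m" \<tau>, OF h])
    show "(\<integral>\<^sup>+t. ennreal (norm (simplex_integrand h (Suc m) \<tau> t)) \<partial>Pi\<^sub>M {1..Suc m} (\<lambda>_. lborel)) < \<infinity>"
      unfolding nn_integral_simplex[of h "Suc m" \<tau>, OF h] by (rule Suc.prems(3))
  qed
  have "(\<integral>t. simplex_integrand h (Suc m) \<tau> t \<partial>Pi\<^sub>M {1..Suc m} (\<lambda>_. lborel))
     = (\<integral>y. (\<integral>x. simplex_integrand h (Suc m) \<tau> (x(Suc m := y)) \<partial>Pi\<^sub>M {1..m} (\<lambda>_. lborel)) \<partial>lborel)"
    unfolding ins by (rule integral_insert_swap[OF _ _ int]) auto
  also have "\<dots> = (\<integral>y. indicator {0..\<tau>} y *\<^sub>R (h (Suc m) y * (\<integral>x. simplex_integrand h m y x \<partial>Pi\<^sub>M {1..m} (\<lambda>_. lborel))) \<partial>lborel)"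
    unfolding simplex_integrand_Suc by simp
  also have "\<dots> = (LINT y:{0..\<tau>}|lborel. nested_integral h m y * h (Suc m) y)"
    unfolding set_lebesgue_integral_def
  proof (rule integral_discrete_difference[of "{1}"])
    fix y :: real assume "y \<notin> {1}"
    show "indicator {0..\<tau>} y *\<^sub>R (h (Suc m) y * (\<integral>x. simplex_integrand h m y x \<partial>Pi\<^sub>M {1..m} (\<lambda>_. lborel)))
      = indicator {0..\<tau>} y *\<^sub>R (nested_integral h m y * h (Suc m) y)"
    proof (cases "y \<in> {0..\<tau>}")
      case True
      then have y: "0 \<le> y" "y < 1" using Suc.prems(2) \<open>y \<notin> {1}\<close> by auto
      have "(\<integral>x. simplex_integrand h m y x \<partial>Pi\<^sub>M {1..m} (\<lambda>_. lborel)) = nested_integral h m y"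
        using y Suc.prems(1) by (intro Suc.IH) auto
      then show ?thesis by (simp add: mult_ac)
    qed simp
  qed auto
  finally show ?case by simp
qed

lemma measurable_nested_integral:
  assumes h [measurable]: "\<And>i. h i \<in> borel_measurable borel"
  shows "nested_integral h m \<in> borel_measurable borel"
proof (induction m)
  case 0
  then show ?case by simp
next
  case (Suc m)
  note [measurable] = Suc.IH
  have "(\<lambda>\<tau>. \<integral>u. (if 0 \<le> u \<and> u \<le> \<tau> then nested_integral h m u * h (Suc m) u else 0) \<partial>lborel) \<in> borel_measurable borel"
    by measurable
  moreover have "nested_integral h (Suc m) = (\<lambda>\<tau>. \<integral>u. (if 0 \<le> u \<and> u \<le> \<tau> then nested_integral h m u * h (Suc m) u else 0) \<partial>lborel)"
    by (auto simp: fun_eq_iff set_lebesgue_integral_def indicator_def intro!: Bochner_Integration.integral_cong)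
  ultimately show ?case by simp
qed

lemma norm_nested_integral_le: "ennreal (norm (nested_integral h m \<tau>)) \<le> nested_nn_integral h m \<tau>"
proof (induction m arbitrary: \<tau>)
  case (Suc m)
  let ?f = "\<lambda>u. indicator {0..\<tau>} u *\<^sub>R (nested_integral h m u * h (Suc m) u)"
  have "ennreal (norm (integral\<^sup>L lborel ?f)) \<le> (\<integral>\<^sup>+u. ennreal (norm (?f u)) \<partial>lborel)"
  proof (cases "integrable lborel ?f")
    case True
    then show ?thesis by (rule integral_norm_bound_ennreal)
  qed (simp add: not_integrable_integral_eq)
  also have "\<dots> \<le> nested_nn_integral h (Suc m) \<tau>"
    unfolding nested_nn_integral.simps
  proof (rule nn_integral_mono)
    fix u :: real
    have "ennreal (norm (nested_integral h m u)) * ennreal (norm (h (Suc m) u))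
       \<le> nested_nn_integral h m u * ennreal (norm (h (Suc m) u))"
      by (rule mult_right_mono[OF Suc.IH]) simp
    then show "ennreal (norm (?f u)) \<le> nested_nn_integral h m u * ennreal (norm (h (Suc m) u)) * indicator {0..\<tau>} u"
      by (auto simp: norm_mult ennreal_mult indicator_def)
  qed
  finally show ?case by (simp add: set_lebesgue_integral_def)
qed simp

section \<open>Convergence with poles at the ends of the path\<close>

text \<open>The exact value is \<open>2 / sqrt (1 - \<tau>) - 2\<close>. The factor \<tau> in the
  bound matters: it cancels a possible pole of the next form at 0.\<close>

lemma nn_integral_inverse_three_halves:
  assumes "0 \<le> \<tau>" "\<tau> < 1"
  shows "(\<integral>\<^sup>+u. ennreal (1 / ((1 - u) * sqrt (1 - u))) * indicator {0..\<tau>} u \<partial>lborel) \<le> ennreal (2 * (\<tau> / sqrt (1 - \<tau>)))"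
proof -
  have "(\<integral>\<^sup>+u. ennreal (1 / ((1 - u) * sqrt (1 - u))) * indicator {0..\<tau>} u \<partial>lborel)
     = ennreal (2 / sqrt (1 - \<tau>) - 2 / sqrt (1 - 0))"
  proof (rule nn_integral_FTC_Icc[where F = "\<lambda>u. 2 / sqrt (1 - u)"])
    fix u assume "u \<in> {0..\<tau>}"
    then have u: "0 \<le> u" "u \<le> \<tau>" by auto
    have s: "sqrt (1 - u) \<noteq> 0" "sqrt (1 - u) * sqrt (1 - u) = 1 - u" using u assms by auto
    have "((\<lambda>u. 2 / sqrt (1 - u)) has_real_derivative (0 * sqrt (1 - u) - 2 * (inverse (sqrt (1 - u)) / 2 * (- 1))) / (sqrt (1 - u) * sqrt (1 - u))) (at u)"
      using u assms by (auto intro!: derivative_eq_intros)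
    then show "((\<lambda>u. 2 / sqrt (1 - u)) has_real_derivative 1 / ((1 - u) * sqrt (1 - u))) (at u)"
      unfolding s by (simp add: field_simps)
    show "0 \<le> 1 / ((1 - u) * sqrt (1 - u))" using u assms by simp
  qed (use assms in auto)
  also have "\<dots> \<le> ennreal (2 * (\<tau> / sqrt (1 - \<tau>)))"
  proof (rule ennreal_leI)
    define w where "w = sqrt (1 - \<tau>)"
    have w: "0 < w" "w \<le> 1" "\<tau> = 1 - w * w" using assms by (auto simp: w_def)
    have "w * w \<le> w" using w by (simp add: mult_left_le)
    then have "2 / w - 2 \<le> 2 * ((1 - w * w) / w)" using w(1) by (simp add: field_simps)
    then show "2 / sqrt (1 - \<tau>) - 2 / sqrt (1 - 0) \<le> 2 * (\<tau> / sqrt (1 - \<tau>))"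
      by (simp add: w(3)[symmetric] flip: w_def)
  qed
  finally show ?thesis .
qed

lemma nn_integral_inverse_sqrt:
  "(\<integral>\<^sup>+u. ennreal (1 / sqrt (1 - u)) * indicator {0..1} u \<partial>lborel) < \<infinity>"
proof -
  let ?f = "\<lambda>u::real. if u \<in> {0..1} then 1 / sqrt (1 - u) else 0"
  have "((\<lambda>u. 1 / sqrt (1 - u)) has_integral (- 2 * sqrt (1 - 1)) - (- 2 * sqrt (1 - 0))) {0..1::real}"
  proof (rule fundamental_theorem_of_calculus_interior)
    show "((\<lambda>u. - 2 * sqrt (1 - u)) has_vector_derivative 1 / sqrt (1 - u)) (at u)" if "u \<in> {0<..<1}" for u :: real
      unfolding has_real_derivative_iff_has_vector_derivative[symmetric]
      using that by (auto intro!: derivative_eq_intros simp: field_simps)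
  qed (auto intro!: continuous_intros)
  then have "(?f has_integral 2) UNIV"
    unfolding has_integral_restrict_UNIV by simp
  then have "integral\<^sup>N lborel ?f = ennreal 2"
    by (intro nn_integral_has_integral_lborel) auto
  moreover have "integral\<^sup>N lborel ?f = (\<integral>\<^sup>+u. ennreal (1 / sqrt (1 - u)) * indicator {0..1} u \<partial>lborel)"
    by (intro nn_integral_cong) (auto simp: indicator_def)
  ultimately show ?thesis by simp
qed

text \<open>\<open>E\<close> holds exceptional parameters such as the corners of a path. Inner forms
  may have simple poles at both ends, as s_i may coincide with either end point; the first form has
  none at 0, and in \<open>singular_forms_end\<close> the last has none at 1. This reflects s_1
  \<noteq> 0 and s_(n-1) \<noteq> s_n.\<close>

locale singular_forms =
  fixes h :: "nat \<Rightarrow> real \<Rightarrow> complex" and m :: nat and C :: real and E :: "real set"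
  assumes fin_E: "finite E" and meas: "\<And>i. h i \<in> borel_measurable borel" and C: "0 \<le> C"
    and bound: "\<And>i u. i \<in> {1..m} \<Longrightarrow> 0 < u \<Longrightarrow> u < 1 \<Longrightarrow> u \<notin> E \<Longrightarrow> norm (h i u) \<le> C / (u * (1 - u))"
    and bound_first: "\<And>u. 1 \<le> m \<Longrightarrow> 0 < u \<Longrightarrow> u < 1 \<Longrightarrow> u \<notin> E \<Longrightarrow> norm (h 1 u) \<le> C / (1 - u)"
begin

lemma AE_generic: "AE u in lborel. u \<notin> insert 0 (insert 1 E)"
  using fin_E by (intro AE_not_in finite_imp_null_set_lborel) simp

text \<open>The true growth at 1 is at most a power of a logarithm;
  \<open>1 / sqrt (1 - \<tau>)\<close> is a cruder shape that reproduces itself, since multiplying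
  it by \<open>1 / (1 - u)\<close> and integrating returns it with a factor 2. The numerator \<tau>
  cancels the pole of the next form at 0.\<close>

lemma nested_nn_integral_bound:
  assumes "1 \<le> k" "k \<le> m" "0 \<le> \<tau>" "\<tau> < 1"
  shows "nested_nn_integral h k \<tau> \<le> ennreal ((2 * C) ^ k * (\<tau> / sqrt (1 - \<tau>)))"
  using assms
proof (induction k arbitrary: \<tau>)
  case (Suc k)
  let ?K = "(2 * C) ^ k * C"
  have K: "0 \<le> ?K" using C by simp
  have "nested_nn_integral h (Suc k) \<tau> \<le> (\<integral>\<^sup>+u. ennreal ?K * (ennreal (1 / ((1 - u) * sqrt (1 - u))) * indicator {0..\<tau>} u) \<partial>lborel)"
    unfolding nested_nn_integral.simps
  proof (rule nn_integral_mono_AE)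
    show "AE u in lborel. nested_nn_integral h k u * ennreal (norm (h (Suc k) u)) * indicator {0..\<tau>} u
       \<le> ennreal ?K * (ennreal (1 / ((1 - u) * sqrt (1 - u))) * indicator {0..\<tau>} u)"
      using AE_generic
    proof eventually_elim
      case (elim u)
      show ?case
      proof (cases "u \<in> {0..\<tau>}")
        case True
        then have u: "0 < u" "u < 1" "u \<notin> E" using elim Suc.prems by auto
        have s: "0 < sqrt (1 - u)" "sqrt (1 - u) \<le> 1" using u by auto
        have "nested_nn_integral h k u * ennreal (norm (h (Suc k) u)) \<le> ennreal (?K * (1 / ((1 - u) * sqrt (1 - u))))"
        proof (cases "k = 0")
          case True
          have "norm (h 1 u) \<le> C / (1 - u)" by (rule bound_first[OF _ u]) (use Suc.prems in simp)
          also have "\<dots> \<le> C / ((1 - u) * sqrt (1 - u))"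
            using s u C by (intro divide_left_mono mult_pos_pos) (auto simp: mult_left_le)
          finally show ?thesis using True by (simp add: ennreal_leI)
        next
          case False
          have "nested_nn_integral h k u * ennreal (norm (h (Suc k) u))
             \<le> ennreal ((2 * C) ^ k * (u / sqrt (1 - u))) * ennreal (C / (u * (1 - u)))"
            using False Suc.prems u by (intro mult_mono Suc.IH ennreal_leI bound) auto
          also have "\<dots> = ennreal (((2 * C) ^ k * (u / sqrt (1 - u))) * (C / (u * (1 - u))))"
            using C u by (intro ennreal_mult[symmetric]) auto
          also have "((2 * C) ^ k * (u / sqrt (1 - u))) * (C / (u * (1 - u))) = ?K * (1 / ((1 - u) * sqrt (1 - u)))"
            using u by (simp add: mult_ac)
          finally show ?thesis .
        qed
        also have "\<dots> = ennreal ?K * ennreal (1 / ((1 - u) * sqrt (1 - u)))"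
          using K u by (intro ennreal_mult) auto
        finally show ?thesis using True by simp
      qed simp
    qed
  qed
  also have "\<dots> = ennreal ?K * (\<integral>\<^sup>+u. ennreal (1 / ((1 - u) * sqrt (1 - u))) * indicator {0..\<tau>} u \<partial>lborel)"
    by (rule nn_integral_cmult) measurable
  also have "\<dots> \<le> ennreal ?K * ennreal (2 * (\<tau> / sqrt (1 - \<tau>)))"
    using Suc.prems by (intro mult_left_mono nn_integral_inverse_three_halves) auto
  also have "\<dots> = ennreal (?K * (2 * (\<tau> / sqrt (1 - \<tau>))))"
    using K Suc.prems by (intro ennreal_mult[symmetric]) auto
  also have "?K * (2 * (\<tau> / sqrt (1 - \<tau>))) = (2 * C) ^ Suc k * (\<tau> / sqrt (1 - \<tau>))" by simp
  finally show ?case .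
qed simp

lemma nested_nn_integral_finite: "k \<le> m \<Longrightarrow> 0 \<le> \<tau> \<Longrightarrow> \<tau> < 1 \<Longrightarrow> nested_nn_integral h k \<tau> < \<infinity>"
  using nested_nn_integral_bound[of k \<tau>] by (cases "k = 0") (auto intro: le_less_trans)

lemma set_integrable_of_finite:
  assumes "nested_nn_integral h (Suc k) \<tau> < \<infinity>"
  shows "set_integrable lborel {0..\<tau>} (\<lambda>u. nested_integral h k u * h (Suc k) u)"
  unfolding set_integrable_def
proof (rule integrableI_bounded)
  note [measurable] = meas measurable_nested_integral[of h, OF meas]
  show "(\<lambda>u. indicator {0..\<tau>} u *\<^sub>R (nested_integral h k u * h (Suc k) u)) \<in> borel_measurable lborel"
    by measurable
  have "(\<integral>\<^sup>+u. ennreal (norm (indicator {0..\<tau>} u *\<^sub>R (nested_integral h k u * h (Suc k) u))) \<partial>lborel) \<le> nested_nn_integral h (Suc k) \<tau>"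
    unfolding nested_nn_integral.simps
  proof (rule nn_integral_mono)
    fix u :: real
    have "ennreal (norm (nested_integral h k u)) * ennreal (norm (h (Suc k) u))
       \<le> nested_nn_integral h k u * ennreal (norm (h (Suc k) u))"
      by (rule mult_right_mono[OF norm_nested_integral_le]) simp
    then show "ennreal (norm (indicator {0..\<tau>} u *\<^sub>R (nested_integral h k u * h (Suc k) u)))
       \<le> nested_nn_integral h k u * ennreal (norm (h (Suc k) u)) * indicator {0..\<tau>} u"
      by (auto simp: norm_mult ennreal_mult indicator_def)
  qed
  then show "(\<integral>\<^sup>+u. ennreal (norm (indicator {0..\<tau>} u *\<^sub>R (nested_integral h k u * h (Suc k) u))) \<partial>lborel) < \<infinity>"
    using assms by (rule le_less_trans)
qed

lemma set_integrable_nested: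
  "k < m \<Longrightarrow> 0 \<le> \<tau> \<Longrightarrow> \<tau> < 1 \<Longrightarrow> set_integrable lborel {0..\<tau>} (\<lambda>u. nested_integral h k u * h (Suc k) u)"
  by (intro set_integrable_of_finite nested_nn_integral_finite) auto

end

locale singular_forms_end = singular_forms +
  assumes m: "1 \<le> m"
    and bound_last: "\<And>u. 0 < u \<Longrightarrow> u < 1 \<Longrightarrow> u \<notin> E \<Longrightarrow> norm (h m u) \<le> C / u"
begin

text \<open>The last form has no pole at 1, and the factor \<open>u\<close> of the inner bound
  removes its pole at 0, which leaves the integrable \<open>1 / sqrt (1 - u)\<close>.\<close>

lemma nested_nn_integral_finite_1: "nested_nn_integral h m 1 < \<infinity>"
proof -
  obtain k where k: "m = Suc k" using m by (cases m) auto
  let ?K = "(2 * C) ^ k * (2 * C)"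
  have K: "0 \<le> ?K" using C by simp
  have "nested_nn_integral h (Suc k) 1 \<le> (\<integral>\<^sup>+u. ennreal ?K * (ennreal (1 / sqrt (1 - u)) * indicator {0..1} u) \<partial>lborel)"
    unfolding nested_nn_integral.simps
  proof (rule nn_integral_mono_AE)
    show "AE u in lborel. nested_nn_integral h k u * ennreal (norm (h (Suc k) u)) * indicator {0..1} u
       \<le> ennreal ?K * (ennreal (1 / sqrt (1 - u)) * indicator {0..1} u)"
      using AE_generic
    proof eventually_elim
      case (elim u)
      show ?case
      proof (cases "u \<in> {0..1}")
        case True
        then have u: "0 < u" "u < 1" "u \<notin> E" using elim by auto
        have s: "0 < sqrt (1 - u)" "sqrt (1 - u) \<le> 1" using u by auto
        have "nested_nn_integral h k u * ennreal (norm (h (Suc k) u)) \<le> ennreal (?K * (1 / sqrt (1 - u)))"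
        proof (cases "k = 0")
          case True
          \<comment> \<open>A single form is both first and last; each of the two bounds is used on
            the half interval away from its pole.\<close>
          have "norm (h 1 u) \<le> 2 * C"
          proof (cases "u \<le> 1/2")
            case True
            have "C / (1 - u) \<le> C / (1/2)" using True C u by (intro divide_left_mono) auto
            then show ?thesis using bound_first[OF m u] by simp
          next
            case False
            have "C / u \<le> C / (1/2)" using False C u by (intro divide_left_mono) auto
            then show ?thesis using bound_last[OF u] k True \<open>k = 0\<close> by simp
          qed
          also have "\<dots> \<le> 2 * C * (1 / sqrt (1 - u))"
            using s C by (simp add: field_simps mult_left_le)
          finally show ?thesis using True by (simp add: ennreal_leI)
        next
          case False
          have "nested_nn_integral h k u * ennreal (norm (h (Suc k) u))
             \<le> ennreal ((2 * C) ^ k * (u / sqrt (1 - u))) * ennreal (C / u)"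
            using False u k bound_last[OF u] by (intro mult_mono nested_nn_integral_bound ennreal_leI) auto
          also have "\<dots> = ennreal (((2 * C) ^ k * (u / sqrt (1 - u))) * (C / u))"
            using C u by (intro ennreal_mult[symmetric]) auto
          also have "((2 * C) ^ k * (u / sqrt (1 - u))) * (C / u) = (2 * C) ^ k * C * (1 / sqrt (1 - u))"
            using u by simp
          also have "ennreal \<dots> \<le> ennreal (?K * (1 / sqrt (1 - u)))"
            using C s by (intro ennreal_leI mult_right_mono mult_left_mono) auto
          finally show ?thesis .
        qed
        also have "\<dots> = ennreal ?K * ennreal (1 / sqrt (1 - u))"
          using K s by (intro ennreal_mult) auto
        finally show ?thesis using True by simp
      qed simp
    qed
  qed
  also have "\<dots> = ennreal ?K * (\<integral>\<^sup>+u. ennreal (1 / sqrt (1 - u)) * indicator {0..1} u \<partial>lborel)"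
    by (rule nn_integral_cmult) measurable
  also have "\<dots> < \<infinity>" using nn_integral_inverse_sqrt by (simp add: ennreal_mult_less_top)
  finally show ?thesis using k by simp
qed

lemma integral_simplex_1:
  "(\<integral>t. simplex_integrand h m 1 t \<partial>Pi\<^sub>M {1..m} (\<lambda>_. lborel)) = nested_integral h m 1"
  by (rule integral_simplex) (use meas nested_nn_integral_finite nested_nn_integral_finite_1 in auto)

text \<open>The values below 1 determine the full integral, so identities have to be proved only
  where all inner integrals converge.\<close>

lemma nested_integral_tendsto: "(nested_integral h m \<longlongrightarrow> nested_integral h m 1) (at_left 1)"
proof -
  obtain k where k: "m = Suc k" using m by (cases m) auto
  let ?f = "\<lambda>u. nested_integral h k u * h (Suc k) u"
  have int: "set_integrable lborel {0..1} ?f"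
    using nested_nn_integral_finite_1 k by (intro set_integrable_of_finite) auto
  have eq: "nested_integral h m \<tau> = integral {0..\<tau>} ?f" if "\<tau> \<le> 1" for \<tau>
  proof -
    have "set_integrable lborel {0..\<tau>} ?f" by (rule set_integrable_subset[OF int]) (use that in auto)
    then show ?thesis unfolding k by (simp add: set_borel_integral_eq_integral)
  qed
  have "continuous_on {0..1} (\<lambda>\<tau>. integral {0..\<tau>} ?f)"
    by (rule indefinite_integral_continuous_1) (use int in \<open>simp add: set_borel_integral_eq_integral\<close>)
  then have "((\<lambda>\<tau>. integral {0..\<tau>} ?f) \<longlongrightarrow> integral {0..1} ?f) (at 1 within {0..1})"
    by (simp add: continuous_on_def)
  then have "((\<lambda>\<tau>. integral {0..\<tau>} ?f) \<longlongrightarrow> integral {0..1} ?f) (at_left 1)"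
    by (simp add: at_within_Icc_at_left)
  moreover have "eventually (\<lambda>\<tau>. integral {0..\<tau>} ?f = nested_integral h m \<tau>) (at_left 1)"
    using eq by (auto simp: eventually_at_left_field intro!: exI[of _ 0])
  ultimately show ?thesis
    using eq[of 1] by (auto intro: Lim_transform_eventually)
qed

end

lemma nested_integral_cong:
  assumes "finite E" "\<And>i u. i \<in> {1..m} \<Longrightarrow> 0 \<le> u \<Longrightarrow> u \<le> \<tau> \<Longrightarrow> u \<notin> E \<Longrightarrow> h i u = g i u"
  shows "nested_integral h m \<tau> = nested_integral g m \<tau>"
  using assms(2)
proof (induction m arbitrary: \<tau>)
  case (Suc m)
  have "nested_integral h m u = nested_integral g m u" if "u \<le> \<tau>" for u
    using that Suc.prems by (intro Suc.IH) auto
  then show ?case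
    using Suc.prems assms(1) unfolding nested_integral.simps set_lebesgue_integral_def
    by (intro integral_discrete_difference[of E]) (auto simp: indicator_def countable_finite)
qed simp

text \<open>At the finitely many parameters in \<open>E\<close> the \<open>vector_derivative\<close>
  of the path may be arbitrary. The auxiliary \<open>g\<close> agrees there with the integrand of
  \<open>iterated_integral\<close> pointwise, and differs from \<open>h\<close> only on this null
  set.\<close>

lemma iterated_integral_eq_nested:
  assumes "singular_forms_end h m C E"
    and vd: "\<And>i u. i \<in> {1..m} \<Longrightarrow> 0 \<le> u \<Longrightarrow> u \<le> 1 \<Longrightarrow> u \<notin> E \<Longrightarrow>
      h i u = f i (\<gamma> u) * vector_derivative \<gamma> (at u within {0..1})"
  shows "iterated_integral \<gamma> m f = nested_integral h m 1"
proof -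
  interpret singular_forms_end h m C E by fact
  define g where "g i u = (if u \<in> {0..1} \<and> i \<in> {1..m} then f i (\<gamma> u) * vector_derivative \<gamma> (at u within {0..1}) else h i u)" for i u
  have gh: "g i u = h i u" if "u \<notin> E" for i u
    using vd[of i u] that by (auto simp: g_def)
  have meas_g: "g i \<in> borel_measurable borel" for i
    by (rule measurable_discrete_difference[OF meas[of i], of E]) (use fin_E gh in \<open>auto simp: countable_finite\<close>)
  interpret g: singular_forms_end g m C E
    by unfold_locales (use fin_E meas_g bound bound_first bound_last m C gh in auto)
  have "iterated_integral \<gamma> m f = (\<integral>t. simplex_integrand g m 1 t \<partial>Pi\<^sub>M {1..m} (\<lambda>_. lborel))"
    unfolding iterated_integral_def set_lebesgue_integral_def ordered_simplex_eq simplex_integrand_def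
  proof (rule Bochner_Integration.integral_cong[OF refl])
    fix t
    show "indicator (simplex_upto m 1) t *\<^sub>R (\<Prod>i = 1..m. f i (\<gamma> (t i)) * vector_derivative \<gamma> (at (t i) within {0..1}))
       = indicator (simplex_upto m 1) t *\<^sub>R (\<Prod>i = 1..m. g i (t i))"
    proof (cases "t \<in> simplex_upto m 1")
      case True
      then have "0 \<le> t i \<and> t i \<le> 1" if "i \<in> {1..m}" for i
        using that unfolding simplex_upto_def by blast
      then show ?thesis by (intro arg_cong2[where f = scaleR] refl prod.cong) (auto simp: g_def)
    qed simp
  qed
  also have "\<dots> = nested_integral g m 1" by (rule g.integral_simplex_1)
  also have "\<dots> = nested_integral h m 1" by (rule nested_integral_cong[OF fin_E gh])
  finally show ?thesis .
qed

section \<open>Normalised paths from 0 to 1\<close>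

text \<open>The end point s_n is scaled to 1. A path may leave the unit interval only upwards and
  coincides with it within \<rho> of both ends; there the singular forms are explicit and the same
  for all paths.\<close>

locale unit_path =
  fixes \<gamma> \<gamma>' :: "real \<Rightarrow> complex" and E :: "real set" and B \<rho> :: real
  assumes cont: "continuous_on {0..1} \<gamma>" and meas: "\<gamma>' \<in> borel_measurable borel" and fin_E: "finite E"
    and deriv: "\<And>u. 0 < u \<Longrightarrow> u < 1 \<Longrightarrow> u \<notin> E \<Longrightarrow> (\<gamma> has_vector_derivative \<gamma>' u) (at u)"
    and deriv_bound: "\<And>u. 0 < u \<Longrightarrow> u < 1 \<Longrightarrow> u \<notin> E \<Longrightarrow> norm (\<gamma>' u) \<le> B"
    and \<rho>: "0 < \<rho>" "\<rho> < 1/2"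
    and start: "\<And>u. 0 \<le> u \<Longrightarrow> u \<le> \<rho> \<Longrightarrow> \<gamma> u = of_real u"
    and finish: "\<And>u. 1 - \<rho> \<le> u \<Longrightarrow> u \<le> 1 \<Longrightarrow> \<gamma> u = of_real u"
    and upper: "\<And>u. 0 < u \<Longrightarrow> u < 1 \<Longrightarrow> 0 \<le> Im (\<gamma> u) \<and> 0 < Re (\<gamma> u) \<and> Re (\<gamma> u) < 1"
begin

text \<open>The pullback of dw / (\<sigma>_i - w), cut off outside the unit interval, where the path
  is not known to be measurable.\<close>

definition form :: "(nat \<Rightarrow> complex) \<Rightarrow> nat \<Rightarrow> real \<Rightarrow> complex" where
  "form \<sigma> i u = indicator {0..1} u *\<^sub>R (\<gamma>' u / (\<sigma> i - \<gamma> u))"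

lemma measurable_form: "form \<sigma> i \<in> borel_measurable borel"
proof -
  have [measurable]: "(\<lambda>u. indicator {0..1} u *\<^sub>R \<gamma> u) \<in> borel_measurable borel"
    using borel_measurable_continuous_on_indicator[OF _ cont] by simp
  note [measurable] = meas
  have "form \<sigma> i = (\<lambda>u. indicator {0..1} u *\<^sub>R (\<gamma>' u / (\<sigma> i - indicator {0..1} u *\<^sub>R \<gamma> u)))"
    by (auto simp: form_def fun_eq_iff indicator_def)
  also have "\<dots> \<in> borel_measurable borel" by measurable
  finally show ?thesis .
qed

lemma dist_lower_bound_interval:
  assumes "0 \<le> a" "b \<le> 1" "\<And>u. a \<le> u \<Longrightarrow> u \<le> b \<Longrightarrow> \<gamma> u \<noteq> z"
  shows "\<exists>c>0. \<forall>u. a \<le> u \<longrightarrow> u \<le> b \<longrightarrow> c \<le> norm (z - \<gamma> u)"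
proof (cases "a \<le> b")
  case True
  have "continuous_on {a..b} (\<lambda>u. norm (z - \<gamma> u))"
    by (intro continuous_intros continuous_on_subset[OF cont]) (use assms in auto)
  then obtain u0 where u0: "u0 \<in> {a..b}" "\<forall>u\<in>{a..b}. norm (z - \<gamma> u0) \<le> norm (z - \<gamma> u)"
    using continuous_attains_inf[of "{a..b}" "\<lambda>u. norm (z - \<gamma> u)"] True by auto
  moreover have "0 < norm (z - \<gamma> u0)" using assms(3)[of u0] u0(1) by auto
  ultimately show ?thesis by (intro exI[of _ "norm (z - \<gamma> u0)"]) auto
next
  case False
  then show ?thesis by (intro exI[of _ 1]) auto
qed

text \<open>By compactness the distance to \<open>z\<close> is bounded below away from the end. Near
  the end the path is the segment, so for \<open>z = 1\<close> the distance is exactly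
  \<open>1 - u\<close>.\<close>

lemma dist_lower_bound_first:
  assumes "z \<noteq> 0" "\<And>u. 0 < u \<Longrightarrow> u < 1 \<Longrightarrow> \<gamma> u \<noteq> z"
  shows "\<exists>c>0. \<forall>u. 0 < u \<longrightarrow> u < 1 \<longrightarrow> c * (1 - u) \<le> norm (z - \<gamma> u)"
proof -
  have ne: "\<gamma> u \<noteq> z" if "0 \<le> u" "u \<le> 1 - \<rho>" for u
    using assms start[of 0] \<rho> that by (cases "u = 0") auto
  obtain c0 where c0: "c0 > 0" "\<forall>u. 0 \<le> u \<longrightarrow> u \<le> 1 - \<rho> \<longrightarrow> c0 \<le> norm (z - \<gamma> u)"
    using dist_lower_bound_interval[of 0 "1 - \<rho>" z] ne \<rho> by auto
  have "\<exists>c1>0. \<forall>u. 1 - \<rho> \<le> u \<longrightarrow> u < 1 \<longrightarrow> c1 * (1 - u) \<le> norm (z - \<gamma> u)"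
  proof (cases "z = 1")
    case True
    have "norm (z - \<gamma> u) = 1 - u" if "1 - \<rho> \<le> u" "u < 1" for u
    proof -
      have "z - \<gamma> u = of_real (1 - u)" using finish[of u] that True by simp
      then have "norm (z - \<gamma> u) = \<bar>1 - u\<bar>" by (simp only: norm_of_real)
      then show ?thesis using that by simp
    qed
    then show ?thesis by (intro exI[of _ 1]) auto
  next
    case False
    have "\<gamma> u \<noteq> z" if "1 - \<rho> \<le> u" "u \<le> 1" for u
      using assms(2)[of u] finish[of 1] \<rho> that False by (cases "u = 1") auto
    then obtain c1 where c1: "c1 > 0" "\<forall>u. 1 - \<rho> \<le> u \<longrightarrow> u \<le> 1 \<longrightarrow> c1 \<le> norm (z - \<gamma> u)"
      using dist_lower_bound_interval[of "1 - \<rho>" 1 z] \<rho> by auto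
    have "c1 * (1 - u) \<le> norm (z - \<gamma> u)" if "1 - \<rho> \<le> u" "u < 1" for u
    proof -
      have "c1 * (1 - u) \<le> c1 * 1" using c1(1) that \<rho> by (intro mult_left_mono) auto
      then show ?thesis using c1(2) that by (metis less_imp_le mult.right_neutral order.trans)
    qed
    then show ?thesis using c1(1) by blast
  qed
  then obtain c1 where c1: "c1 > 0" "\<forall>u. 1 - \<rho> \<le> u \<longrightarrow> u < 1 \<longrightarrow> c1 * (1 - u) \<le> norm (z - \<gamma> u)" by blast
  have "min c0 c1 * (1 - u) \<le> norm (z - \<gamma> u)" if u: "0 < u" "u < 1" for u
  proof (cases "u \<le> 1 - \<rho>")
    case True
    have "min c0 c1 * (1 - u) \<le> c0 * 1" using u c0(1) c1(1) by (intro mult_mono) auto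
    also have "\<dots> \<le> norm (z - \<gamma> u)" using c0(2) u True by simp
    finally show ?thesis .
  next
    case False
    have "min c0 c1 * (1 - u) \<le> c1 * (1 - u)" using u by (intro mult_right_mono) auto
    also have "\<dots> \<le> norm (z - \<gamma> u)" using c1(2) u False by simp
    finally show ?thesis .
  qed
  moreover have "0 < min c0 c1" using c0(1) c1(1) by simp
  ultimately show ?thesis by blast
qed

lemma dist_lower_bound_last:
  assumes "z \<noteq> 1" "\<And>u. 0 < u \<Longrightarrow> u < 1 \<Longrightarrow> \<gamma> u \<noteq> z"
  shows "\<exists>c>0. \<forall>u. 0 < u \<longrightarrow> u < 1 \<longrightarrow> c * u \<le> norm (z - \<gamma> u)"
proof -
  have ne: "\<gamma> u \<noteq> z" if "\<rho> \<le> u" "u \<le> 1" for u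
    using assms finish[of 1] \<rho> that by (cases "u = 1") auto
  obtain c0 where c0: "c0 > 0" "\<forall>u. \<rho> \<le> u \<longrightarrow> u \<le> 1 \<longrightarrow> c0 \<le> norm (z - \<gamma> u)"
    using dist_lower_bound_interval[of \<rho> 1 z] ne \<rho> by auto
  have "\<exists>c1>0. \<forall>u. 0 < u \<longrightarrow> u \<le> \<rho> \<longrightarrow> c1 * u \<le> norm (z - \<gamma> u)"
  proof (cases "z = 0")
    case True
    have "norm (z - \<gamma> u) = u" if "0 < u" "u \<le> \<rho>" for u
      using start[of u] that True by simp
    then show ?thesis by (intro exI[of _ 1]) auto
  next
    case False
    have "\<gamma> u \<noteq> z" if "0 \<le> u" "u \<le> \<rho>" for u
      using assms(2)[of u] start[of 0] \<rho> that False by (cases "u = 0") auto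
    then obtain c1 where c1: "c1 > 0" "\<forall>u. 0 \<le> u \<longrightarrow> u \<le> \<rho> \<longrightarrow> c1 \<le> norm (z - \<gamma> u)"
      using dist_lower_bound_interval[of 0 \<rho> z] \<rho> by auto
    have "c1 * u \<le> norm (z - \<gamma> u)" if "0 < u" "u \<le> \<rho>" for u
    proof -
      have "c1 * u \<le> c1 * 1" using c1(1) that \<rho> by (intro mult_left_mono) auto
      then show ?thesis using c1(2) that by (metis less_imp_le mult.right_neutral order.trans)
    qed
    then show ?thesis using c1(1) by blast
  qed
  then obtain c1 where c1: "c1 > 0" "\<forall>u. 0 < u \<longrightarrow> u \<le> \<rho> \<longrightarrow> c1 * u \<le> norm (z - \<gamma> u)" by blast
  have "min c0 c1 * u \<le> norm (z - \<gamma> u)" if u: "0 < u" "u < 1" for u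
  proof (cases "\<rho> \<le> u")
    case True
    have "min c0 c1 * u \<le> c0 * 1" using u c0(1) c1(1) by (intro mult_mono) auto
    also have "\<dots> \<le> norm (z - \<gamma> u)" using c0(2) u True by simp
    finally show ?thesis .
  next
    case False
    have "min c0 c1 * u \<le> c1 * u" using u by (intro mult_right_mono) auto
    also have "\<dots> \<le> norm (z - \<gamma> u)" using c1(2) u False by simp
    finally show ?thesis .
  qed
  moreover have "0 < min c0 c1" using c0(1) c1(1) by simp
  ultimately show ?thesis by blast
qed

lemma dist_lower_bound:
  assumes "\<And>u. 0 < u \<Longrightarrow> u < 1 \<Longrightarrow> \<gamma> u \<noteq> z"
  shows "\<exists>c>0. \<forall>u. 0 < u \<longrightarrow> u < 1 \<longrightarrow> c * (u * (1 - u)) \<le> norm (z - \<gamma> u)"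
proof (cases "z = 0")
  case False
  then obtain c where c: "c > 0" "\<forall>u. 0 < u \<longrightarrow> u < 1 \<longrightarrow> c * (1 - u) \<le> norm (z - \<gamma> u)"
    using dist_lower_bound_first[OF _ assms] by auto
  have "c * (u * (1 - u)) \<le> norm (z - \<gamma> u)" if "0 < u" "u < 1" for u
  proof -
    have "c * (u * (1 - u)) \<le> c * (1 - u)" using c(1) that by (intro mult_left_mono) auto
    then show ?thesis using c(2) that by fastforce
  qed
  then show ?thesis using c(1) by blast
next
  case True
  then obtain c where c: "c > 0" "\<forall>u. 0 < u \<longrightarrow> u < 1 \<longrightarrow> c * u \<le> norm (z - \<gamma> u)"
    using dist_lower_bound_last[OF _ assms] by auto
  have "c * (u * (1 - u)) \<le> norm (z - \<gamma> u)" if "0 < u" "u < 1" for u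
  proof -
    have "c * (u * (1 - u)) \<le> c * u" using c(1) that by (intro mult_left_mono) auto
    then show ?thesis using c(2) that by fastforce
  qed
  then show ?thesis using c(1) by blast
qed

lemma norm_form_le:
  assumes "0 < c" "0 < u" "u < 1" "u \<notin> E" "0 < d" "c * d \<le> norm (\<sigma> i - \<gamma> u)" "\<bar>B\<bar> / c \<le> C"
  shows "norm (form \<sigma> i u) \<le> C / d"
proof -
  have "norm (form \<sigma> i u) = norm (\<gamma>' u) / norm (\<sigma> i - \<gamma> u)"
    using assms(2,3) by (simp add: form_def norm_divide)
  also have "\<dots> \<le> \<bar>B\<bar> / (c * d)"
    using deriv_bound[OF assms(2,3,4)] assms by (intro frac_le) auto
  also have "\<dots> = \<bar>B\<bar> / c / d" by simp
  also have "\<dots> \<le> C / d" using assms by (intro divide_right_mono) auto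
  finally show ?thesis .
qed

lemma singular_forms_form:
  assumes avoid: "\<And>i u. i \<in> {1..m} \<Longrightarrow> 0 < u \<Longrightarrow> u < 1 \<Longrightarrow> \<gamma> u \<noteq> \<sigma> i" and first: "1 \<le> m \<Longrightarrow> \<sigma> 1 \<noteq> 0"
  shows "\<exists>C. singular_forms (form \<sigma>) m C E"
    and "1 \<le> m \<Longrightarrow> \<sigma> m \<noteq> 1 \<Longrightarrow> \<exists>C. singular_forms_end (form \<sigma>) m C E"
proof -
  have "\<forall>i. \<exists>c>0. i \<in> {1..m} \<longrightarrow> (\<forall>u. 0 < u \<longrightarrow> u < 1 \<longrightarrow> c * (u * (1 - u)) \<le> norm (\<sigma> i - \<gamma> u))"
    using dist_lower_bound[OF avoid] by (metis zero_less_one)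
  then obtain c where c: "\<And>i. c i > 0"
    "\<And>i u. i \<in> {1..m} \<Longrightarrow> 0 < u \<Longrightarrow> u < 1 \<Longrightarrow> c i * (u * (1 - u)) \<le> norm (\<sigma> i - \<gamma> u)" by metis
  obtain c1 where c1: "c1 > 0" "1 \<le> m \<Longrightarrow> \<forall>u. 0 < u \<longrightarrow> u < 1 \<longrightarrow> c1 * (1 - u) \<le> norm (\<sigma> 1 - \<gamma> u)"
    using dist_lower_bound_first[OF first avoid[of 1]] by (cases "1 \<le> m") (auto intro: that[of 1])
  obtain cm where cm: "cm > 0" "1 \<le> m \<Longrightarrow> \<sigma> m \<noteq> 1 \<Longrightarrow> \<forall>u. 0 < u \<longrightarrow> u < 1 \<longrightarrow> cm * u \<le> norm (\<sigma> m - \<gamma> u)"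
    using dist_lower_bound_last[of "\<sigma> m"] avoid[of m] by (cases "1 \<le> m \<and> \<sigma> m \<noteq> 1") (auto intro: that[of 1])
  define C where "C = (\<Sum>i\<in>{1..m}. \<bar>B\<bar> / c i) + \<bar>B\<bar> / c1 + \<bar>B\<bar> / cm"
  have S: "0 \<le> (\<Sum>i\<in>{1..m}. \<bar>B\<bar> / c i)" using c(1) by (intro sum_nonneg) (auto intro!: divide_nonneg_pos)
  have C0: "0 \<le> C" unfolding C_def using S c1(1) cm(1) by (intro add_nonneg_nonneg) auto
  have C1: "\<bar>B\<bar> / c i \<le> C" if "i \<in> {1..m}" for i
  proof -
    have "\<bar>B\<bar> / c i \<le> (\<Sum>i\<in>{1..m}. \<bar>B\<bar> / c i)"
      using that c(1) by (intro member_le_sum) (auto intro!: divide_nonneg_pos)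
    moreover have "0 \<le> \<bar>B\<bar> / c1" "0 \<le> \<bar>B\<bar> / cm" using c1(1) cm(1) by auto
    ultimately show ?thesis unfolding C_def by linarith
  qed
  have C2: "\<bar>B\<bar> / c1 \<le> C" "\<bar>B\<bar> / cm \<le> C"
  proof -
    have "0 \<le> \<bar>B\<bar> / c1" "0 \<le> \<bar>B\<bar> / cm" using c1(1) cm(1) by auto
    then show "\<bar>B\<bar> / c1 \<le> C" "\<bar>B\<bar> / cm \<le> C" unfolding C_def using S by linarith+
  qed
  have sf: "singular_forms (form \<sigma>) m C E"
  proof
    show "norm (form \<sigma> i u) \<le> C / (u * (1 - u))" if "i \<in> {1..m}" "0 < u" "u < 1" "u \<notin> E" for i u
      using that c C1 by (intro norm_form_le[of "c i"]) auto
    show "norm (form \<sigma> 1 u) \<le> C / (1 - u)" if "1 \<le> m" "0 < u" "u < 1" "u \<notin> E" for u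
      using that c1 C2 by (intro norm_form_le[of c1]) auto
  qed (use fin_E measurable_form C0 in auto)
  then show "\<exists>C. singular_forms (form \<sigma>) m C E" by blast
  show "\<exists>C. singular_forms_end (form \<sigma>) m C E" if m: "1 \<le> m" "\<sigma> m \<noteq> 1"
  proof -
    interpret singular_forms "form \<sigma>" m C E by (rule sf)
    have "singular_forms_end (form \<sigma>) m C E"
    proof
      show "norm (form \<sigma> m u) \<le> C / u" if "0 < u" "u < 1" "u \<notin> E" for u
        using that cm m C2 by (intro norm_form_le[of cm]) auto
    qed (use m in auto)
    then show ?thesis by blast
  qed
qed

lemma path_FTC:
  assumes ab: "0 \<le> a" "a \<le> b" "b \<le> 1" and contF: "continuous_on {a..b} (\<lambda>u. F (\<gamma> u))"
    and F: "\<And>u. a < u \<Longrightarrow> u < b \<Longrightarrow> (F has_field_derivative f u) (at (\<gamma> u))"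
  shows "((\<lambda>u. f u * \<gamma>' u) has_integral (F (\<gamma> b) - F (\<gamma> a))) {a..b}"
proof (rule fundamental_theorem_of_calculus_interior_strong[OF fin_E ab(2) _ contF])
  fix x assume x: "x \<in> {a<..<b} - E"
  have 1: "(\<gamma> has_vector_derivative \<gamma>' x) (at x)" using x ab by (intro deriv) auto
  have 2: "(F has_field_derivative f x) (at (\<gamma> x))" using x by (intro F) auto
  have "((F \<circ> \<gamma>) has_vector_derivative (\<gamma>' x * f x)) (at x)"
    by (rule field_vector_diff_chain_at[OF 1 2])
  then show "((\<lambda>u. F (\<gamma> u)) has_vector_derivative f x * \<gamma>' x) (at x)"
    by (simp only: o_def mult.commute)
qed

lemma nested_integral_Suc_split:
  assumes sf: "singular_forms (form \<sigma>) m C E" and k: "k < m" and ab: "0 \<le> a" "a \<le> b" "b < 1"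
  shows "nested_integral (form \<sigma>) (Suc k) b = nested_integral (form \<sigma>) (Suc k) a
     + integral {a..b} (\<lambda>u. nested_integral (form \<sigma>) k u / (\<sigma> (Suc k) - \<gamma> u) * \<gamma>' u)"
    and "(\<lambda>u. nested_integral (form \<sigma>) k u / (\<sigma> (Suc k) - \<gamma> u) * \<gamma>' u) integrable_on {a..b}"
proof -
  interpret singular_forms "form \<sigma>" m C E by (rule sf)
  let ?f = "\<lambda>u. nested_integral (form \<sigma>) k u * form \<sigma> (Suc k) u"
  let ?g = "\<lambda>u. nested_integral (form \<sigma>) k u / (\<sigma> (Suc k) - \<gamma> u) * \<gamma>' u"
  have int: "set_integrable lborel {0..\<tau>} ?f" if "0 \<le> \<tau>" "\<tau> < 1" for \<tau>
    by (rule set_integrable_nested[OF k that])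
  have N: "nested_integral (form \<sigma>) (Suc k) \<tau> = integral {0..\<tau>} ?f" if "0 \<le> \<tau>" "\<tau> < 1" for \<tau>
    using set_borel_integral_eq_integral[OF int[OF that]] by simp
  have io: "?f integrable_on {0..b}" using set_borel_integral_eq_integral[OF int[of b]] ab by simp
  have io': "?f integrable_on {a..b}"
    by (rule integrable_subinterval_real[OF io]) (use ab in auto)
  have fg: "?f u = ?g u" if "u \<in> {a..b}" for u
    using that ab by (simp add: form_def mult_ac)
  show "?g integrable_on {a..b}"
    using io' integrable_cong[of "{a..b}" ?f ?g] fg by simp
  have "integral {0..b} ?f = integral {0..a} ?f + integral {a..b} ?f"
    using Henstock_Kurzweil_Integration.integral_combine[OF ab(1,2) io] by simp
  also have "integral {a..b} ?f = integral {a..b} ?g"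
    by (rule Henstock_Kurzweil_Integration.integral_cong) (rule fg)
  finally show "nested_integral (form \<sigma>) (Suc k) b = nested_integral (form \<sigma>) (Suc k) a + integral {a..b} ?g"
    using N[of a] N[of b] ab by simp
qed

text \<open>A tower of primitives \<open>F\<close> on a region containing the path carries the
  nested integrals. Values are matched at \<rho> and not at 0, because 0 may be a pole of the forms
  and need not belong to the region.\<close>

lemma nested_integral_eq_primitive:
  assumes sf: "singular_forms (form \<sigma>) m C E"
    and X: "\<And>u. \<rho> \<le> u \<Longrightarrow> u < 1 \<Longrightarrow> \<gamma> u \<in> X"
    and F0: "\<And>w. F 0 w = 1"
    and F: "\<And>k w. k < m \<Longrightarrow> w \<in> X \<Longrightarrow> (F (Suc k) has_field_derivative F k w / (\<sigma> (Suc k) - w)) (at w)"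
    and F\<rho>: "\<And>k. k \<le> m \<Longrightarrow> F k (of_real \<rho>) = nested_integral (form \<sigma>) k \<rho>"
    and k: "k \<le> m" and \<tau>: "\<rho> \<le> \<tau>" "\<tau> < 1"
  shows "nested_integral (form \<sigma>) k \<tau> = F k (\<gamma> \<tau>)"
  using k \<tau>
proof (induction k arbitrary: \<tau>)
  case 0
  then show ?case by (simp add: F0)
next
  case (Suc k)
  let ?g = "\<lambda>u. nested_integral (form \<sigma>) k u / (\<sigma> (Suc k) - \<gamma> u) * \<gamma>' u"
  have contF: "continuous_on {\<rho>..\<tau>} (\<lambda>u. F (Suc k) (\<gamma> u))"
  proof -
    have 1: "continuous_on (\<gamma> ` {\<rho>..\<tau>}) (F (Suc k))"
      by (rule continuous_at_imp_continuous_on) (use F X Suc.prems in \<open>force intro: DERIV_isCont\<close>)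
    have 2: "continuous_on {\<rho>..\<tau>} \<gamma>" by (rule continuous_on_subset[OF cont]) (use \<rho> Suc.prems in auto)
    show ?thesis by (rule continuous_on_compose2[OF 1 2]) auto
  qed
  have "((\<lambda>u. F k (\<gamma> u) / (\<sigma> (Suc k) - \<gamma> u) * \<gamma>' u) has_integral (F (Suc k) (\<gamma> \<tau>) - F (Suc k) (\<gamma> \<rho>))) {\<rho>..\<tau>}"
    by (rule path_FTC[OF _ _ _ contF]) (use \<rho> Suc.prems F X in auto)
  then have "integral {\<rho>..\<tau>} (\<lambda>u. F k (\<gamma> u) / (\<sigma> (Suc k) - \<gamma> u) * \<gamma>' u) = F (Suc k) (\<gamma> \<tau>) - F (Suc k) (\<gamma> \<rho>)"
    by (rule integral_unique)
  moreover have "integral {\<rho>..\<tau>} ?g = integral {\<rho>..\<tau>} (\<lambda>u. F k (\<gamma> u) / (\<sigma> (Suc k) - \<gamma> u) * \<gamma>' u)"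
    by (rule Henstock_Kurzweil_Integration.integral_cong) (use Suc in auto)
  moreover have "F (Suc k) (\<gamma> \<rho>) = nested_integral (form \<sigma>) (Suc k) \<rho>"
    using F\<rho>[of "Suc k"] Suc.prems start[of \<rho>] \<rho> by simp
  ultimately show ?case
    using nested_integral_Suc_split(1)[OF sf, of k \<rho> \<tau>] Suc.prems \<rho> by simp
qed

end

section \<open>Independence of the path\<close>

lemma holomorphic_starlike_primitives:
  fixes X :: "complex set" and \<sigma> c :: "nat \<Rightarrow> complex"
  assumes X: "open X" "starlike X" and b: "b \<in> X" and \<sigma>: "\<And>k. k \<in> {1..m} \<Longrightarrow> \<sigma> k \<notin> X"
  shows "\<exists>F. (\<forall>w. F 0 w = 1) \<and>
    (\<forall>k<m. (\<forall>w\<in>X. (F (Suc k) has_field_derivative F k w / (\<sigma> (Suc k) - w)) (at w)) \<and> F (Suc k) b = c (Suc k))"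
  using \<sigma>
proof (induction m)
  case 0
  show ?case by (intro exI[of _ "\<lambda>_ _. 1"]) auto
next
  case (Suc m)
  then obtain F where F: "\<And>w. F 0 w = 1"
    "\<And>k w. k < m \<Longrightarrow> w \<in> X \<Longrightarrow> (F (Suc k) has_field_derivative F k w / (\<sigma> (Suc k) - w)) (at w)"
    "\<And>k. k < m \<Longrightarrow> F (Suc k) b = c (Suc k)" by fastforce
  have hol: "F m field_differentiable at w" if "w \<in> X" for w
  proof (cases m)
    case 0
    then have "F m = (\<lambda>_. 1)" using F(1) by auto
    then show ?thesis by simp
  next
    case (Suc k)
    then show ?thesis using F(2)[OF _ that, of k] by (auto simp: field_differentiable_def)
  qed
  have ne: "\<sigma> (Suc m) - w \<noteq> 0" if "w \<in> X" for w using Suc.prems[of "Suc m"] that by auto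
  have fd: "(\<lambda>w. F m w / (\<sigma> (Suc m) - w)) field_differentiable at w" if "w \<in> X" for w
    using hol[OF that] ne[OF that] by (intro derivative_intros) auto
  have "continuous_on X (\<lambda>w. F m w / (\<sigma> (Suc m) - w))"
    using fd by (intro continuous_at_imp_continuous_on) (auto intro: field_differentiable_imp_continuous_at)
  then obtain g where g: "\<forall>w\<in>X. (g has_field_derivative F m w / (\<sigma> (Suc m) - w)) (at w)"
    using holomorphic_starlike_primitive[of X "\<lambda>w. F m w / (\<sigma> (Suc m) - w)" "{}"] X fd by blast
  define G where "G = F(Suc m := (\<lambda>w. g w - g b + c (Suc m)))"
  have "(G (Suc k) has_field_derivative G k w / (\<sigma> (Suc k) - w)) (at w)" if "k < Suc m" "w \<in> X" for k w
    using F(2)[of k w] g that unfolding G_def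
    by (cases "k = m") (auto intro!: derivative_eq_intros)
  moreover have "G (Suc k) b = c (Suc k)" if "k < Suc m" for k
    using F(3)[of k] that by (cases "k = m") (auto simp: G_def)
  moreover have "G 0 w = 1" for w using F(1) by (simp add: G_def)
  ultimately show ?case by (intro exI[of _ G]) blast
qed

text \<open>
  A thin rectangle around the open unit interval, cut from each point of \<open>P\<close> along the ray that points
  away from a centre slightly above the interval. It is starlike and contains all paths that follow the
  interval and pass the points of \<open>P\<close> above.
\<close>

definition slit_rectangle :: "real \<Rightarrow> complex set \<Rightarrow> complex set" where
  "slit_rectangle \<delta> P = (let c = Complex (1/2) (\<delta>/2) in
     {w. 0 < Re w \<and> Re w < 1 \<and> - \<delta> < Im w \<and> Im w < \<delta>} \<inter>
     (\<Inter>z\<in>P. - ({w. Im ((w - c) / (z - c)) = 0} \<inter> {w. 1 \<le> Re ((w - c) / (z - c))})))"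

lemma open_slit_rectangle: "finite P \<Longrightarrow> open (slit_rectangle \<delta> P)"
proof -
  assume P: "finite P"
  have "open {w. 0 < Re w \<and> Re w < 1 \<and> - \<delta> < Im w \<and> Im w < \<delta>}"
    by (intro open_Collect_conj open_Collect_less continuous_intros)
  moreover have "closed ({w. Im ((w - c) / (z - c)) = 0} \<inter> {w. 1 \<le> Re ((w - c) / (z - c))})" for z c
    unfolding divide_inverse
    by (intro closed_Int closed_Collect_eq closed_Collect_le continuous_intros)
  ultimately show ?thesis
    unfolding slit_rectangle_def Let_def using P by (intro open_Int open_INT ballI open_Compl)
qed

lemma center_in_slit_rectangle: "0 < \<delta> \<Longrightarrow> Complex (1/2) (\<delta>/2) \<in> slit_rectangle \<delta> P"
  by (auto simp: slit_rectangle_def Let_def)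

text \<open>Seen from the centre, a slit consists of the real multiples of one vector with factor at
  least 1. If a point shrunk towards the centre lay on a slit, so would the original point.\<close>

lemma starlike_slit_rectangle: "0 < \<delta> \<Longrightarrow> starlike (slit_rectangle \<delta> P)"
  unfolding starlike_def
proof (intro bexI[of _ "Complex (1/2) (\<delta>/2)"] ballI subsetI)
  fix w y assume \<delta>: "0 < \<delta>" and w: "w \<in> slit_rectangle \<delta> P"
    and y: "y \<in> closed_segment (Complex (1/2) (\<delta>/2)) w"
  let ?c = "Complex (1/2) (\<delta>/2)"
  obtain l where l: "0 \<le> l" "l \<le> 1" "y = (1 - l) *\<^sub>R ?c + l *\<^sub>R w"
    using y by (auto simp: in_segment)
  have wr: "0 < Re w" "Re w < 1" "- \<delta> < Im w" "Im w < \<delta>"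
    using w by (auto simp: slit_rectangle_def Let_def)
  have conv: "0 < (1 - l) * p + l * q" if "0 < p" "0 < q" for p q
    using that l(1,2) by (cases "l = 0") (auto intro!: add_nonneg_pos)
  have "0 < Re y \<and> Re y < 1 \<and> - \<delta> < Im y \<and> Im y < \<delta>"
  proof -
    have "Re y = (1 - l) * (1/2) + l * Re w" "Im y = (1 - l) * (\<delta>/2) + l * Im w"
      using l(3) by auto
    moreover have "0 < (1 - l) * (1/2) + l * Re w" by (rule conv) (use wr in auto)
    moreover have "0 < (1 - l) * (1/2) + l * (1 - Re w)" by (rule conv) (use wr in auto)
    moreover have "0 < (1 - l) * (\<delta>/2 + \<delta>) + l * (Im w + \<delta>)" by (rule conv) (use wr \<delta> in auto)
    moreover have "0 < (1 - l) * (\<delta>/2) + l * (\<delta> - Im w)" by (rule conv) (use wr \<delta> in auto)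
    ultimately show ?thesis by (auto simp: field_simps)
  qed
  moreover have "\<not> (Im ((y - ?c) / (z - ?c)) = 0 \<and> 1 \<le> Re ((y - ?c) / (z - ?c)))" if z: "z \<in> P" for z
  proof
    assume *: "Im ((y - ?c) / (z - ?c)) = 0 \<and> 1 \<le> Re ((y - ?c) / (z - ?c))"
    have "y - ?c = of_real l * (w - ?c)" using l(3) by (simp add: scaleR_conv_of_real algebra_simps)
    then have e: "(y - ?c) / (z - ?c) = of_real l * ((w - ?c) / (z - ?c))" by simp
    have 1: "l * Im ((w - ?c) / (z - ?c)) = 0" "1 \<le> l * Re ((w - ?c) / (z - ?c))"
    proof -
      have key: "l * Im q = 0 \<and> 1 \<le> l * Re q" if "Im (of_real l * q) = 0 \<and> 1 \<le> Re (of_real l * q)" for q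
        using that by simp
      show "l * Im ((w - ?c) / (z - ?c)) = 0" "1 \<le> l * Re ((w - ?c) / (z - ?c))"
        using key[OF *[unfolded e]] by blast+
    qed
    then have "l \<noteq> 0" by auto
    then have "Im ((w - ?c) / (z - ?c)) = 0" using 1 by simp
    moreover have "1 \<le> Re ((w - ?c) / (z - ?c))"
    proof -
      have "0 \<le> Re ((w - ?c) / (z - ?c))" using 1(2) l(1) \<open>l \<noteq> 0\<close> by (smt (verit) mult_nonneg_nonpos)
      then have "l * Re ((w - ?c) / (z - ?c)) \<le> 1 * Re ((w - ?c) / (z - ?c))" using l(2) by (rule mult_right_mono[rotated])
      then show ?thesis using 1(2) by linarith
    qed
    ultimately show False using w z unfolding slit_rectangle_def Let_def by blast
  qed
  ultimately show "y \<in> slit_rectangle \<delta> P" unfolding slit_rectangle_def Let_def by auto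
qed (use center_in_slit_rectangle in auto)

lemma notin_slit_rectangle:
  assumes "z \<in> P" "z \<noteq> Complex (1/2) (\<delta>/2)"
  shows "z \<notin> slit_rectangle \<delta> P"
proof
  assume "z \<in> slit_rectangle \<delta> P"
  then have "\<not> (Im ((z - Complex (1/2) (\<delta>/2)) / (z - Complex (1/2) (\<delta>/2))) = 0 \<and>
      1 \<le> Re ((z - Complex (1/2) (\<delta>/2)) / (z - Complex (1/2) (\<delta>/2))))"
    using assms(1) unfolding slit_rectangle_def Let_def by blast
  then show False using assms(2) by simp
qed

text \<open>If \<open>w\<close> lay on the slit of \<open>z\<close>, then \<open>z\<close> would lie
  between the centre and \<open>w\<close>, hence in the strip, and would be real. Beyond a real
  point the slit runs below the axis, because the centre is above it; so \<open>w = z\<close>, which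
  is excluded.\<close>

lemma upper_in_slit_rectangle:
  assumes \<delta>: "0 < \<delta>" and w: "0 < Re w" "Re w < 1" "0 \<le> Im w" "Im w < \<delta>" "w \<notin> P"
    and P: "\<And>z. z \<in> P \<Longrightarrow> 0 < Re z \<Longrightarrow> Re z < 1 \<Longrightarrow> \<bar>Im z\<bar> < \<delta> \<Longrightarrow> Im z = 0"
  shows "w \<in> slit_rectangle \<delta> P"
proof -
  let ?c = "Complex (1/2) (\<delta>/2)"
  have "\<not> (Im ((w - ?c) / (z - ?c)) = 0 \<and> 1 \<le> Re ((w - ?c) / (z - ?c)))" if z: "z \<in> P" for z
  proof
    assume *: "Im ((w - ?c) / (z - ?c)) = 0 \<and> 1 \<le> Re ((w - ?c) / (z - ?c))"
    define x where "x = Re ((w - ?c) / (z - ?c))"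
    have x: "1 \<le> x" "(w - ?c) / (z - ?c) = of_real x"
      using * by (auto simp: x_def complex_eq_iff)
    have zc: "z \<noteq> ?c" using x by auto
    then have "w - ?c = of_real x * (z - ?c)" using x(2) by (simp add: field_simps)
    then have "Re (w - ?c) = x * Re (z - ?c)" "Im (w - ?c) = x * Im (z - ?c)" by simp_all
    then have e: "Re w - 1/2 = x * (Re z - 1/2)" "Im w - \<delta>/2 = x * (Im z - \<delta>/2)" by simp_all
    have x0: "0 < x" using x(1) by simp
    have between: "\<bar>q\<bar> < d" if "x * q = p" "\<bar>p\<bar> < d" for p q d
    proof -
      have "\<bar>q\<bar> \<le> x * \<bar>q\<bar>" using x(1) by (simp add: mult_le_cancel_right1)
      also have "\<dots> = \<bar>p\<bar>" using that(1) x0 by (metis abs_mult abs_of_pos)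
      finally show ?thesis using that(2) by simp
    qed
    have rz: "\<bar>Re z - 1/2\<bar> < 1/2"
      by (rule between[OF e(1)[symmetric]]) (use w in \<open>auto simp: abs_if\<close>)
    have "0 < Re z" "Re z < 1"
      using rz by (auto simp: abs_if split: if_splits)
    moreover have "Im z < \<delta>"
    proof -
      have "x * (Im z - \<delta>/2) < \<delta>/2" using e(2) w(4) by linarith
      moreover have "\<delta>/2 \<le> x * (\<delta>/2)" using x(1) \<delta> by simp
      ultimately have "x * (Im z - \<delta>/2) < x * (\<delta>/2)" by linarith
      then show ?thesis using x0 by simp
    qed
    moreover have "- (\<delta>/2) \<le> Im z - \<delta>/2"
    proof (rule ccontr)
      assume "\<not> - (\<delta>/2) \<le> Im z - \<delta>/2"
      then have "x * (Im z - \<delta>/2) < x * (- (\<delta>/2))" using x0 by (intro mult_strict_left_mono) auto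
      also have "\<dots> \<le> - (\<delta>/2)" using x(1) \<delta> by simp
      finally show False using e(2) w(3) by linarith
    qed
    ultimately have "Im z = 0" using z \<delta> by (intro P) (auto simp: abs_less_iff)
    then have "Im w = (1 - x) * (\<delta>/2)" using e(2) by (simp add: algebra_simps)
    moreover have "(1 - x) * (\<delta>/2) \<le> 0" using x(1) \<delta> by (intro mult_nonpos_nonneg) auto
    ultimately have "(1 - x) * (\<delta>/2) = 0" using w(3) by linarith
    then have "x = 1" using \<delta> by simp
    then have "w = z" using e by (auto simp: complex_eq_iff)
    then show False using z w(5) by simp
  qed
  then show ?thesis using w \<delta> unfolding slit_rectangle_def Let_def by auto
qed

text \<open>Homotopy invariance. Both paths lie in one slit rectangle and agree near 0, so one tower
  of primitives computes both integrals. Near 1 the paths agree again, so the integrals up to \<tau>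
  coincide for \<tau> close to 1, and therefore in the limit.\<close>

lemma nested_integral_unit_path_independent:
  assumes p1: "unit_path \<gamma>1 \<gamma>1' E1 B1 \<rho>" and p2: "unit_path \<gamma>2 \<gamma>2' E2 B2 \<rho>"
    and \<delta>: "0 < \<delta>" "\<And>u. 0 < u \<Longrightarrow> u < 1 \<Longrightarrow> Im (\<gamma>1 u) < \<delta> \<and> Im (\<gamma>2 u) < \<delta>"
    and m: "1 \<le> m"
    and avoid: "\<And>i u. i \<in> {1..m} \<Longrightarrow> 0 < u \<Longrightarrow> u < 1 \<Longrightarrow> \<gamma>1 u \<noteq> \<sigma> i \<and> \<gamma>2 u \<noteq> \<sigma> i"
    and P: "\<And>i. i \<in> {1..m} \<Longrightarrow> 0 < Re (\<sigma> i) \<Longrightarrow> Re (\<sigma> i) < 1 \<Longrightarrow> \<bar>Im (\<sigma> i)\<bar> < \<delta> \<Longrightarrow> Im (\<sigma> i) = 0"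
    and ends: "\<sigma> 1 \<noteq> 0" "\<sigma> m \<noteq> 1"
  shows "nested_integral (unit_path.form \<gamma>1 \<gamma>1' \<sigma>) m 1 = nested_integral (unit_path.form \<gamma>2 \<gamma>2' \<sigma>) m 1"
proof -
  interpret p1: unit_path \<gamma>1 \<gamma>1' E1 B1 \<rho> by (rule p1)
  interpret p2: unit_path \<gamma>2 \<gamma>2' E2 B2 \<rho> by (rule p2)
  let ?P = "\<sigma> ` {1..m}"
  let ?X = "slit_rectangle \<delta> ?P"
  obtain C1 where C1: "singular_forms_end (p1.form \<sigma>) m C1 E1"
    using p1.singular_forms_form(2)[of m \<sigma>] avoid m ends by auto
  obtain C2 where C2: "singular_forms_end (p2.form \<sigma>) m C2 E2"
    using p2.singular_forms_form(2)[of m \<sigma>] avoid m ends by auto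
  interpret s1: singular_forms_end "p1.form \<sigma>" m C1 E1 by (rule C1)
  interpret s2: singular_forms_end "p2.form \<sigma>" m C2 E2 by (rule C2)
  have in1: "\<gamma>1 u \<in> ?X" if "0 < u" "u < 1" for u
    using p1.upper[OF that] \<delta>(2)[OF that] avoid that P by (intro upper_in_slit_rectangle[OF \<delta>(1)]) auto
  have in2: "\<gamma>2 u \<in> ?X" if "0 < u" "u < 1" for u
    using p2.upper[OF that] \<delta>(2)[OF that] avoid that P by (intro upper_in_slit_rectangle[OF \<delta>(1)]) auto
  have c: "Complex (1/2) (\<delta>/2) \<notin> ?P"
  proof
    assume "Complex (1/2) (\<delta>/2) \<in> ?P"
    then obtain i where i: "i \<in> {1..m}" "\<sigma> i = Complex (1/2) (\<delta>/2)" by force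
    from P[OF i(1)] \<delta>(1) show False unfolding i(2) by simp
  qed
  have notin: "\<sigma> k \<notin> ?X" if "k \<in> {1..m}" for k
    by (rule notin_slit_rectangle[OF imageI[OF that]]) (metis c imageI that)
  have b: "of_real \<rho> \<in> ?X"
    using in1[of \<rho>] p1.\<rho> p1.start[of \<rho>] by simp
  have same: "nested_integral (p1.form \<sigma>) k \<rho> = nested_integral (p2.form \<sigma>) k \<rho>" for k
  proof (rule nested_integral_cong[of "insert 0 (insert \<rho> (E1 \<union> E2))"])
    show "finite (insert 0 (insert \<rho> (E1 \<union> E2)))" using p1.fin_E p2.fin_E by simp
    fix i u assume u: "0 \<le> u" "u \<le> \<rho>" "u \<notin> insert 0 (insert \<rho> (E1 \<union> E2))"
    then have u': "0 < u" "u < \<rho>" "u < 1" using p1.\<rho> by auto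
    \<comment> \<open>The derivatives are data of the locale; on the initial piece they are
      recovered from the path, which is the identity there.\<close>
    have d: "(\<gamma> has_vector_derivative d) (at u) \<Longrightarrow> \<forall>u. 0 \<le> u \<longrightarrow> u \<le> \<rho> \<longrightarrow> \<gamma> u = of_real u \<Longrightarrow> d = 1" for \<gamma> :: "real \<Rightarrow> complex" and d
    proof -
      assume d: "(\<gamma> has_vector_derivative d) (at u)" and e: "\<forall>u. 0 \<le> u \<longrightarrow> u \<le> \<rho> \<longrightarrow> \<gamma> u = of_real u"
      have "((\<lambda>u. of_real u) has_vector_derivative d) (at u)"
        by (rule has_vector_derivative_transform_within_open[OF d, of "{0<..<\<rho>}"]) (use e u' in auto)
      moreover have "((\<lambda>u. of_real u :: complex) has_vector_derivative 1) (at u)"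
        by (auto intro!: derivative_eq_intros simp: has_vector_derivative_def scaleR_conv_of_real)
      ultimately show "d = 1" by (rule vector_derivative_unique_at)
    qed
    have "\<gamma>1' u = 1" using d[OF p1.deriv] p1.start u u' by auto
    moreover have "\<gamma>2' u = 1" using d[OF p2.deriv] p2.start u u' by auto
    ultimately show "p1.form \<sigma> i u = p2.form \<sigma> i u"
      using p1.start[of u] p2.start[of u] u by (simp add: p1.form_def p2.form_def)
  qed
  obtain F where F: "\<And>w. F 0 w = 1"
    "\<And>k w. k < m \<Longrightarrow> w \<in> ?X \<Longrightarrow> (F (Suc k) has_field_derivative F k w / (\<sigma> (Suc k) - w)) (at w)"
    "\<And>k. k < m \<Longrightarrow> F (Suc k) (of_real \<rho>) = nested_integral (p1.form \<sigma>) (Suc k) \<rho>"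
    using holomorphic_starlike_primitives[where X = ?X and b = "of_real \<rho>" and m = m and \<sigma> = \<sigma>
        and c = "\<lambda>k. nested_integral (p1.form \<sigma>) k \<rho>", OF open_slit_rectangle starlike_slit_rectangle[OF \<delta>(1)] b notin]
    by (auto simp del: nested_integral.simps)
  have F\<rho>: "F k (of_real \<rho>) = nested_integral (p1.form \<sigma>) k \<rho>" if "k \<le> m" for k
    using F(1) F(3)[of "k - 1"] that by (cases k) auto
  have 1: "nested_integral (p1.form \<sigma>) m \<tau> = F m (\<gamma>1 \<tau>)" if "\<rho> \<le> \<tau>" "\<tau> < 1" for \<tau>
    by (rule p1.nested_integral_eq_primitive[OF s1.singular_forms_axioms _ F(1,2) F\<rho> order.refl that])
      (use in1 p1.\<rho> in auto)
  have 2: "nested_integral (p2.form \<sigma>) m \<tau> = F m (\<gamma>2 \<tau>)" if "\<rho> \<le> \<tau>" "\<tau> < 1" for \<tau>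
    by (rule p2.nested_integral_eq_primitive[OF s2.singular_forms_axioms _ F(1,2) F\<rho>[unfolded same] order.refl that])
      (use in2 p1.\<rho> in auto)
  have "eventually (\<lambda>\<tau>. nested_integral (p1.form \<sigma>) m \<tau> = nested_integral (p2.form \<sigma>) m \<tau>) (at_left 1)"
  proof -
    have "nested_integral (p1.form \<sigma>) m \<tau> = nested_integral (p2.form \<sigma>) m \<tau>" if "1 - \<rho> < \<tau>" "\<tau> < 1" for \<tau>
      using 1[of \<tau>] 2[of \<tau>] p1.finish[of \<tau>] p2.finish[of \<tau>] that p1.\<rho> by simp
    then show ?thesis using p1.\<rho> by (auto simp: eventually_at_left_field intro!: exI[of _ "1 - \<rho>"])
  qed
  then have "(nested_integral (p2.form \<sigma>) m \<longlongrightarrow> nested_integral (p1.form \<sigma>) m 1) (at_left 1)"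
    by (rule Lim_transform_eventually[OF s1.nested_integral_tendsto])
  then show ?thesis
    using s2.nested_integral_tendsto by (intro tendsto_unique[OF _ _ s2.nested_integral_tendsto]) auto
qed

section \<open>Detours around points of the segment\<close>

text \<open>The deviation of the clockwise unit half circle from its diameter. It vanishes at -1 and
  1, so a path with several disjoint detours is the segment plus a finite sum of rescaled
  copies.\<close>

definition arc_bump :: "real \<Rightarrow> complex" where
  "arc_bump y = (if \<bar>y\<bar> < 1 then cis (pi / 2 * (1 - y)) - of_real y else 0)"

definition arc_bump_deriv :: "real \<Rightarrow> complex" where
  "arc_bump_deriv y = (if \<bar>y\<bar> < 1 then - (\<i> * of_real (pi / 2)) * cis (pi / 2 * (1 - y)) - 1 else 0)"

lemma continuous_arc_bump: "continuous_on UNIV arc_bump"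
proof -
  \<comment> \<open>Clamping the parameter gives one continuous formula, as the half circle meets
    its diameter at -1 and 1.\<close>
  let ?c = "\<lambda>y::real. max (-1) (min 1 y)"
  have "arc_bump y = cis (pi / 2 * (1 - ?c y)) - of_real (?c y)" for y
    by (auto simp: arc_bump_def abs_if max_def min_def)
  then have eq: "arc_bump = (\<lambda>y. cis (pi / 2 * (1 - ?c y)) - of_real (?c y))" by auto
  show ?thesis unfolding eq by (intro continuous_intros continuous_on_cis)
qed

lemma arc_bump_has_vector_derivative:
  assumes "\<bar>y\<bar> \<noteq> 1"
  shows "(arc_bump has_vector_derivative arc_bump_deriv y) (at y)"
proof (cases "\<bar>y\<bar> < 1")
  case True
  have "((\<lambda>z. exp (\<i> * (of_real (pi / 2) * (1 - z))) - z) has_field_derivative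
      - (\<i> * of_real (pi / 2)) * exp (\<i> * (of_real (pi / 2) * (1 - of_real y))) - 1) (at (of_real y))"
    by (auto intro!: derivative_eq_intros simp: algebra_simps)
  from has_vector_derivative_real_field[OF this]
  have "((\<lambda>y. cis (pi / 2 * (1 - y)) - of_real y) has_vector_derivative arc_bump_deriv y) (at y)"
    using True by (simp add: arc_bump_deriv_def cis_conv_exp)
  then show ?thesis
    by (rule has_vector_derivative_transform_within_open[of _ _ _ "{-1<..<1}"])
      (use True in \<open>auto simp: arc_bump_def abs_if split: if_splits\<close>)
next
  case False
  have "((\<lambda>_. 0) has_vector_derivative arc_bump_deriv y) (at y)"
    using False by (simp add: arc_bump_deriv_def)
  then show ?thesis
  proof (rule has_vector_derivative_transform_within_open)
    show "open {y::real. 1 < \<bar>y\<bar>}" by (intro open_Collect_less continuous_intros)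
  qed (use False assms in \<open>auto simp: arc_bump_def\<close>)
qed

lemma norm_arc_bump_deriv: "norm (arc_bump_deriv y) \<le> 3"
proof -
  have "norm (- (\<i> * of_real (pi / 2)) * cis (pi / 2 * (1 - y)) - 1) \<le> norm (- (\<i> * of_real (pi / 2)) * cis (pi / 2 * (1 - y))) + norm (1 :: complex)"
    by (rule norm_triangle_ineq4)
  also have "\<dots> \<le> 3" using pi_less_4 by (simp add: norm_mult)
  finally show ?thesis by (simp add: arc_bump_deriv_def)
qed

lemma measurable_arc_bump_deriv: "arc_bump_deriv \<in> borel_measurable borel"
proof -
  have [measurable]: "(\<lambda>y. cis (pi / 2 * (1 - y))) \<in> borel_measurable borel"
    by (intro borel_measurable_continuous_onI continuous_intros continuous_on_cis)
  show ?thesis unfolding arc_bump_deriv_def[abs_def] by measurable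
qed

definition detour_path :: "real set \<Rightarrow> real \<Rightarrow> real \<Rightarrow> complex" where
  "detour_path A r u = of_real u + (\<Sum>a\<in>A. of_real r * arc_bump ((u - a) / r))"

definition detour_path_deriv :: "real set \<Rightarrow> real \<Rightarrow> real \<Rightarrow> complex" where
  "detour_path_deriv A r u = 1 + (\<Sum>a\<in>A. arc_bump_deriv ((u - a) / r))"

text \<open>With distances at least \<open>2 * r\<close> the open parameter intervals of the arcs
  are disjoint, so at most one bump is nonzero at a time and the choice in
  \<open>detour_segment\<close> is determined.\<close>

definition separated :: "real set \<Rightarrow> real \<Rightarrow> bool" where
  "separated A r \<longleftrightarrow> finite A \<and> 0 < r \<and> (\<forall>a\<in>A. \<forall>b\<in>A. a \<noteq> b \<longrightarrow> 2 * r \<le> \<bar>a - b\<bar>)"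

lemma detour_path_near:
  assumes A: "separated A r" and a: "a \<in> A" "\<bar>u - a\<bar> < r"
  shows "detour_path A r u = of_real a + of_real r * cis (pi / 2 * (1 - (u - a) / r))"
    and "b \<in> A \<Longrightarrow> \<bar>u - b\<bar> < r \<Longrightarrow> b = a"
proof -
  have r: "0 < r" and fin: "finite A" using A by (auto simp: separated_def)
  show uniq: "b = a" if "b \<in> A" "\<bar>u - b\<bar> < r" for b
    using A a that unfolding separated_def by (smt (verit))
  have "(\<Sum>b\<in>A. of_real r * arc_bump ((u - b) / r)) = (\<Sum>b\<in>A. if b = a then of_real r * arc_bump ((u - a) / r) else 0)"
  proof (rule sum.cong[OF refl])
    fix b assume b: "b \<in> A"
    show "of_real r * arc_bump ((u - b) / r) = (if b = a then of_real r * arc_bump ((u - a) / r) else 0)"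
    proof (cases "b = a")
      case False
      then have "\<not> \<bar>u - b\<bar> < r" using uniq b by auto
      then show ?thesis using False r by (simp add: arc_bump_def abs_divide)
    qed simp
  qed
  also have "\<dots> = of_real r * arc_bump ((u - a) / r)"
    using a fin by simp
  also have "\<dots> = of_real r * cis (pi / 2 * (1 - (u - a) / r)) - of_real (u - a)"
  proof -
    have "\<bar>(u - a) / r\<bar> < 1" using a r by (simp add: abs_divide)
    moreover have "of_real r * of_real ((u - a) / r) = (of_real (u - a) :: complex)"
      using r unfolding of_real_mult[symmetric] by simp
    ultimately show ?thesis by (simp only: arc_bump_def if_True right_diff_distrib)
  qed
  finally show "detour_path A r u = of_real a + of_real r * cis (pi / 2 * (1 - (u - a) / r))"
    by (simp add: detour_path_def)
qed

lemma detour_path_away: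
  assumes "0 < r" "\<And>a. a \<in> A \<Longrightarrow> r \<le> \<bar>u - a\<bar>"
  shows "detour_path A r u = of_real u"
proof -
  have "arc_bump ((u - a) / r) = 0" if "a \<in> A" for a
    using assms(1) assms(2)[OF that] by (simp add: arc_bump_def abs_divide)
  then show ?thesis by (simp add: detour_path_def)
qed

lemma detour_segment_eq:
  assumes "separated A r"
  shows "detour_segment S A r u = S * detour_path A r u"
proof (cases "\<exists>a\<in>A. \<bar>u - a\<bar> < r")
  case True
  then obtain a where a: "a \<in> A" "\<bar>u - a\<bar> < r" by blast
  have "(SOME a. a \<in> A \<and> \<bar>u - a\<bar> < r) = a"
    by (rule some_equality) (use a detour_path_near(2)[OF assms a] in blast)+
  then show ?thesis
    unfolding detour_segment_def Let_def using True detour_path_near(1)[OF assms a] by simp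
next
  case False
  then have "detour_path A r u = of_real u"
    using assms by (intro detour_path_away) (auto simp: separated_def not_less)
  then show ?thesis using False by (simp add: detour_segment_def mult.commute)
qed

lemma detour_path_height:
  assumes A: "separated A r" and a: "a \<in> A" "\<bar>u - a\<bar> < r"
  shows "0 < Im (detour_path A r u)" "Im (detour_path A r u) \<le> r" "\<bar>Re (detour_path A r u) - a\<bar> \<le> r"
proof -
  have r: "0 < r" using A by (simp add: separated_def)
  let ?\<theta> = "pi / 2 * (1 - (u - a) / r)"
  have y: "- 1 < (u - a) / r" "(u - a) / r < 1" using a(2) r by (auto simp: abs_if field_simps split: if_splits)
  have "0 < ?\<theta>" using y(2) by simp
  moreover have "?\<theta> < pi"
  proof -
    have "pi / 2 * (1 - (u - a) / r) < pi / 2 * 2" using y(1) by (intro mult_strict_left_mono) auto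
    then show ?thesis by simp
  qed
  ultimately have s: "0 < sin ?\<theta>" by (rule sin_gt_zero)
  have im: "Im (detour_path A r u) = r * sin ?\<theta>" and re: "Re (detour_path A r u) = a + r * cos ?\<theta>"
    unfolding detour_path_near(1)[OF A a] by simp_all
  show "0 < Im (detour_path A r u)" unfolding im using s r by simp
  show "Im (detour_path A r u) \<le> r" unfolding im using r mult_left_le[OF sin_le_one, of r ?\<theta>] by simp
  show "\<bar>Re (detour_path A r u) - a\<bar> \<le> r"
    unfolding re using r mult_left_le[OF abs_cos_le_one, of r ?\<theta>] by (simp add: abs_mult)
qed

lemma unit_path_detour_path:
  assumes A: "separated A r" and \<rho>: "0 < \<rho>" "\<rho> < 1/2" "\<And>a. a \<in> A \<Longrightarrow> \<rho> \<le> a - r \<and> a + r \<le> 1 - \<rho>"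
  shows "unit_path (detour_path A r) (detour_path_deriv A r) ({0, 1} \<union> (\<Union>a\<in>A. {a - r, a + r})) (1 + 3 * real (card A)) \<rho>"
proof
  have r: "0 < r" and fin: "finite A" using A by (auto simp: separated_def)
  show "continuous_on {0..1} (detour_path A r)"
    unfolding detour_path_def[abs_def]
    by (intro continuous_intros continuous_on_compose2[OF continuous_arc_bump]) (use r in auto)
  note [measurable] = measurable_arc_bump_deriv
  show "detour_path_deriv A r \<in> borel_measurable borel"
    unfolding detour_path_deriv_def[abs_def] by measurable
  show "finite ({0, 1} \<union> (\<Union>a\<in>A. {a - r, a + r}))" using fin by simp
  show "0 < \<rho>" "\<rho> < 1/2" by (fact \<rho>)+
  show "norm (detour_path_deriv A r u) \<le> 1 + 3 * real (card A)" for u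
  proof -
    have "norm (detour_path_deriv A r u) \<le> norm (1::complex) + norm (\<Sum>a\<in>A. arc_bump_deriv ((u - a) / r))"
      unfolding detour_path_deriv_def by (rule norm_triangle_ineq)
    also have "norm (\<Sum>a\<in>A. arc_bump_deriv ((u - a) / r)) \<le> (\<Sum>a\<in>A. 3)"
      by (intro sum_norm_le norm_arc_bump_deriv)
    finally show ?thesis by simp
  qed
  show "(detour_path A r has_vector_derivative detour_path_deriv A r u) (at u)"
    if "u \<notin> {0, 1} \<union> (\<Union>a\<in>A. {a - r, a + r})" for u
  proof -
    have "((\<lambda>u. of_real r * arc_bump ((u - a) / r)) has_vector_derivative arc_bump_deriv ((u - a) / r)) (at u)"
      if a: "a \<in> A" for a
    proof -
      have "u \<noteq> a - r" "u \<noteq> a + r" using \<open>u \<notin> _\<close> a by auto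
      then have "\<bar>(u - a) / r\<bar> \<noteq> 1" using r by (auto simp: abs_divide abs_if field_simps split: if_splits)
      then have 1: "(arc_bump has_vector_derivative arc_bump_deriv ((u - a) / r)) (at ((u - a) / r))"
        by (rule arc_bump_has_vector_derivative)
      have 2: "((\<lambda>u. (u - a) / r) has_vector_derivative 1 / r) (at u)"
        using r by (auto intro!: derivative_eq_intros simp: has_real_derivative_iff_has_vector_derivative[symmetric])
      have "((\<lambda>u. arc_bump ((u - a) / r)) has_vector_derivative (1 / r) *\<^sub>R arc_bump_deriv ((u - a) / r)) (at u)"
        using vector_diff_chain_at[OF 2 1] by (simp add: o_def)
      from has_vector_derivative_mult_right[OF this, of "of_real r"] show ?thesis
        using r by (simp add: scaleR_conv_of_real)
    qed
    then have 2: "((\<lambda>u. \<Sum>a\<in>A. of_real r * arc_bump ((u - a) / r)) has_vector_derivative (\<Sum>a\<in>A. arc_bump_deriv ((u - a) / r))) (at u)"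
      by (rule has_vector_derivative_sum)
    have 1: "((\<lambda>u. of_real u :: complex) has_vector_derivative 1) (at u)"
      by (auto intro!: derivative_eq_intros simp: has_vector_derivative_def scaleR_conv_of_real)
    show ?thesis
      unfolding detour_path_def[abs_def] detour_path_deriv_def by (rule has_vector_derivative_add[OF 1 2])
  qed
  have away: "detour_path A r u = of_real u" if "u \<le> \<rho> \<or> 1 - \<rho> \<le> u" for u
    using \<rho>(3) that by (intro detour_path_away[OF r]) force
  show "detour_path A r u = of_real u" if "0 \<le> u" "u \<le> \<rho>" for u using away that by simp
  show "detour_path A r u = of_real u" if "1 - \<rho> \<le> u" "u \<le> 1" for u using away that by simp
  show "0 \<le> Im (detour_path A r u) \<and> 0 < Re (detour_path A r u) \<and> Re (detour_path A r u) < 1"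
    if u: "0 < u" "u < 1" for u
  proof (cases "\<exists>a\<in>A. \<bar>u - a\<bar> < r")
    case True
    then obtain a where a: "a \<in> A" "\<bar>u - a\<bar> < r" by blast
    from detour_path_height[OF A a] \<rho>(3)[OF a(1)] \<rho>(1) show ?thesis by linarith
  next
    case False
    then have "detour_path A r u = of_real u" by (intro detour_path_away[OF r]) (auto simp: not_less)
    then show ?thesis using u by simp
  qed
qed

text \<open>On an arc the height is positive and below \<delta>, where by assumption
  \<open>z\<close> cannot lie without being real. Off the arcs the path is real with parameter
  outside \<open>A\<close>, whereas \<open>A\<close> contains \<open>z\<close> if it is real and
  between 0 and 1.\<close>

lemma detour_path_avoids:
  assumes A: "separated A r" and r: "r < \<delta>" and u: "0 < u" "u < 1"
    and z: "0 < Re z \<Longrightarrow> Re z < 1 \<Longrightarrow> \<bar>Im z\<bar> < \<delta> \<Longrightarrow> Im z = 0" "\<And>t. z = of_real t \<Longrightarrow> 0 < t \<Longrightarrow> t < 1 \<Longrightarrow> t \<in> A"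
    and up: "0 < Re (detour_path A r u)" "Re (detour_path A r u) < 1"
  shows "detour_path A r u \<noteq> z" "Im (detour_path A r u) < \<delta>"
proof -
  have "detour_path A r u \<noteq> z \<and> Im (detour_path A r u) < \<delta>"
  proof (cases "\<exists>a\<in>A. \<bar>u - a\<bar> < r")
    case True
    then obtain a where a: "a \<in> A" "\<bar>u - a\<bar> < r" by blast
    note h = detour_path_height[OF A a]
    have "detour_path A r u \<noteq> z"
    proof
      assume "detour_path A r u = z"
      with h r up z(1) show False by auto
    qed
    then show ?thesis using h r by simp
  next
    case False
    have r0: "0 < r" using A by (simp add: separated_def)
    have d: "detour_path A r u = of_real u" using False by (intro detour_path_away[OF r0]) (auto simp: not_less)
    have "of_real u \<noteq> z"
    proof
      assume "of_real u = z"
      then have "u \<in> A" using z(2)[of u] u by simp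
      then show False using False r0 by auto
    qed
    then show ?thesis using d r r0 by simp
  qed
  then show "detour_path A r u \<noteq> z" "Im (detour_path A r u) < \<delta>" by auto
qed

lemma eventually_separated:
  assumes "finite A"
  shows "eventually (separated A) (at_right 0)"
proof -
  have "eventually (\<lambda>r. \<forall>a\<in>A. \<forall>b\<in>A. a \<noteq> b \<longrightarrow> 2 * r \<le> \<bar>a - b\<bar>) (at_right 0)"
  proof (intro eventually_ball_finite ballI assms)
    fix a b :: real
    show "eventually (\<lambda>r. a \<noteq> b \<longrightarrow> 2 * r \<le> \<bar>a - b\<bar>) (at_right 0)"
      by (cases "a = b") (auto simp: eventually_at_right_field intro!: exI[of _ "\<bar>a - b\<bar> / 2"])
  qed
  moreover have "eventually (\<lambda>r::real. 0 < r) (at_right 0)"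
    by (simp add: eventually_at_right_less)
  ultimately show ?thesis
    by eventually_elim (use assms in \<open>auto simp: separated_def\<close>)
qed

text \<open>\<open>M_fun\<close> bypasses only those points of the chain \<open>q\<close> that lie
  on the segment, with radii tending to 0. The sum over all chains requires one fixed path, with
  detours at the points \<open>A\<close> of a whole configuration. Path independence identifies the
  two, and shows that the expression under \<open>Lim\<close> is eventually constant.\<close>

lemma M_chain_eq:
  fixes s :: "nat \<Rightarrow> complex"
  assumes q: "length q = Suc k" "2 \<le> k" and x: "q ! 0 = x" and S: "S = s (q ! k) - s x" "S \<noteq> 0"
    and \<sigma>: "\<And>i. i \<in> {1..<k} \<Longrightarrow> \<sigma> i = (s (q ! i) - s x) / S"
    and first: "\<sigma> 1 \<noteq> 0" and last: "\<sigma> (k - 1) \<noteq> 1"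
    and A: "separated A r1" "\<And>i t. i \<in> {1..<k} \<Longrightarrow> \<sigma> i = of_real t \<Longrightarrow> 0 < t \<Longrightarrow> t < 1 \<Longrightarrow> t \<in> A"
    and \<delta>: "r1 < \<delta>" "\<And>i. i \<in> {1..<k} \<Longrightarrow> 0 < Re (\<sigma> i) \<Longrightarrow> Re (\<sigma> i) < 1 \<Longrightarrow> \<bar>Im (\<sigma> i)\<bar> < \<delta> \<Longrightarrow> Im (\<sigma> i) = 0"
    and \<rho>: "0 < \<rho>" "\<rho> < 1/2" "r1 \<le> \<rho>" "\<And>a. a \<in> A \<Longrightarrow> 2 * \<rho> \<le> a \<and> a \<le> 1 - 2 * \<rho>"
  shows "M_chain s q = 2 * of_real pi * \<i> *
    nested_integral (unit_path.form (detour_path A r1) (detour_path_deriv A r1) \<sigma>) (k - 1) 1"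
proof -
  let ?z = "increments s q"
  have ps: "psum ?z k = S" "\<And>i. i \<in> {1..<k} \<Longrightarrow> psum ?z i = S * \<sigma> i"
    using S \<sigma> x by (auto simp: psum_increments)
  define A' where "A' = segment_points k ?z"
  have A': "t \<in> A' \<longleftrightarrow> 0 < t \<and> t < 1 \<and> (\<exists>i\<in>{1..<k}. \<sigma> i = of_real t)" for t
  proof -
    have "(\<exists>i\<in>{1..<k}. psum ?z i = of_real t * psum ?z k) \<longleftrightarrow> (\<exists>i\<in>{1..<k}. \<sigma> i = of_real t)"
      using ps S(2) by (intro bex_cong) auto
    then show ?thesis unfolding A'_def segment_points_def by simp
  qed
  have sub: "A' \<subseteq> A" using A' A(2) by blast
  have finA': "finite A'" using A(1) sub by (auto simp: separated_def intro: finite_subset)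
  define N where "N = nested_integral (unit_path.form (detour_path A r1) (detour_path_deriv A r1) \<sigma>) (k - 1) 1"
  have r1: "0 < r1" using A(1) by (simp add: separated_def)
  have P1: "unit_path (detour_path A r1) (detour_path_deriv A r1) ({0, 1} \<union> (\<Union>a\<in>A. {a - r1, a + r1})) (1 + 3 * real (card A)) \<rho>"
    by (rule unit_path_detour_path[OF A(1) \<rho>(1,2)]) (use \<rho>(3,4) in force)
  interpret P1: unit_path "detour_path A r1" "detour_path_deriv A r1" "{0, 1} \<union> (\<Union>a\<in>A. {a - r1, a + r1})" "1 + 3 * real (card A)" \<rho>
    by (rule P1)
  have av1: "detour_path A r1 u \<noteq> \<sigma> i" "Im (detour_path A r1 u) < \<delta>" if "i \<in> {1..<k}" "0 < u" "u < 1" for i u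
    using detour_path_avoids[OF A(1) \<delta>(1) that(2,3) \<delta>(2)[OF that(1)] A(2)[OF that(1)]] P1.upper[OF that(2,3)] by auto
  have "eventually (\<lambda>r. iterated_integral (detour_segment S A' r) (k - 1) (\<lambda>i w. 1 / (psum ?z i - w)) = N) (at_right 0)"
  proof -
    have "eventually (\<lambda>r. r < min \<delta> \<rho>) (at_right 0)"
      using \<delta>(1) r1 \<rho>(1) by (auto simp: eventually_at_right_field intro!: exI[of _ "min \<delta> \<rho>"])
    with eventually_separated[OF finA'] show ?thesis
    proof eventually_elim
      case (elim r)
      let ?E = "{0, 1} \<union> (\<Union>a\<in>A'. {a - r, a + r})"
      have P2: "unit_path (detour_path A' r) (detour_path_deriv A' r) ?E (1 + 3 * real (card A')) \<rho>"
        by (rule unit_path_detour_path[OF elim(1) \<rho>(1,2)]) (use \<rho>(4) sub elim in force)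
      interpret P2: unit_path "detour_path A' r" "detour_path_deriv A' r" ?E "1 + 3 * real (card A')" \<rho>
        by (rule P2)
      have av2: "detour_path A' r u \<noteq> \<sigma> i" "Im (detour_path A' r u) < \<delta>" if "i \<in> {1..<k}" "0 < u" "u < 1" for i u
      proof -
        have inA: "t \<in> A'" if "\<sigma> i = of_real t" "0 < t" "t < 1" for t
          using A' that \<open>i \<in> {1..<k}\<close> by blast
        have "r < \<delta>" using elim(2) by simp
        from detour_path_avoids[OF elim(1) this that(2,3) \<delta>(2)[OF that(1)] inA] P2.upper[OF that(2,3)]
        show "detour_path A' r u \<noteq> \<sigma> i" "Im (detour_path A' r u) < \<delta>" by auto
      qed
      have k1: "1 \<in> {1..<k}" using q(2) by simp
      have rng: "{1..k - 1} = {1..<k}" using q(2) by auto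
      have "1 \<le> k - 1" using q(2) by simp
      from P2.singular_forms_form(2)[of "k - 1" \<sigma>, unfolded rng, OF av2(1) first this last]
      obtain C where C: "singular_forms_end (P2.form \<sigma>) (k - 1) C ?E" by blast
      have "iterated_integral (detour_segment S A' r) (k - 1) (\<lambda>i w. 1 / (psum ?z i - w)) = nested_integral (P2.form \<sigma>) (k - 1) 1"
      proof (rule iterated_integral_eq_nested[OF C])
        fix i u assume i: "i \<in> {1..k - 1}" and u: "0 \<le> u" "u \<le> 1" "u \<notin> ?E"
        have ds: "detour_segment S A' r = (\<lambda>u. S * detour_path A' r u)"
          using detour_segment_eq[OF elim(1)] by auto
        have "(detour_path A' r has_vector_derivative detour_path_deriv A' r u) (at u)"
          using u by (intro P2.deriv) (auto simp: order.strict_iff_order)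
        then have "((\<lambda>u. S * detour_path A' r u) has_vector_derivative S * detour_path_deriv A' r u) (at u)"
          by (rule has_vector_derivative_mult_right)
        then have "vector_derivative (\<lambda>u. S * detour_path A' r u) (at u within {0..1}) = S * detour_path_deriv A' r u"
          using u by (intro vector_derivative_at_within_ivl) auto
        moreover have "psum ?z i - S * detour_path A' r u = S * (\<sigma> i - detour_path A' r u)"
          using ps(2)[OF i[unfolded rng]] by (simp add: right_diff_distrib)
        ultimately show "P2.form \<sigma> i u = 1 / (psum ?z i - detour_segment S A' r u) *
            vector_derivative (detour_segment S A' r) (at u within {0..1})"
          using u S(2) unfolding ds by (simp add: P2.form_def)
      qed
      also have "\<dots> = N"
        unfolding N_def
      proof (rule nested_integral_unit_path_independent[OF P2 P1])
        show "0 < \<delta>" using \<delta>(1) r1 by simp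
        show "Im (detour_path A' r u) < \<delta> \<and> Im (detour_path A r1 u) < \<delta>" if "0 < u" "u < 1" for u
          using av1(2)[OF k1 that] av2(2)[OF k1 that] by simp
      qed (use av1 av2 \<delta>(2) first last q(2) in \<open>auto simp: rng\<close>)
      finally show ?case .
    qed
  qed
  then have "((\<lambda>r. iterated_integral (detour_segment S A' r) (k - 1) (\<lambda>i w. 1 / (psum ?z i - w))) \<longlongrightarrow> N) (at_right 0)"
    by (rule tendsto_eventually)
  then have "Lim (at_right 0) (\<lambda>r. iterated_integral (detour_segment S A' r) (k - 1) (\<lambda>i w. 1 / (psum ?z i - w))) = N"
    by (intro tendsto_Lim) auto
  then show ?thesis
    unfolding M_fun_def using q S ps(1) by (simp add: A'_def N_def)
qed

lemma chains_nth:
  assumes "q \<in> chains x l" "i < length q"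
  shows "x \<le> q ! i" "q ! i \<le> l" "0 < i \<Longrightarrow> x < q ! i" "Suc i < length q \<Longrightarrow> q ! i < l"
proof -
  have s: "sorted_wrt (<) q" and ne: "q \<noteq> []" "hd q = x" "last q = l" using assms by (auto simp: chains_def)
  have "q ! i \<in> {x..l}" using assms by (intro subsetD[OF chains_subset[OF assms(1)]]) auto
  then show "x \<le> q ! i" "q ! i \<le> l" by auto
  show "x < q ! i" if "0 < i"
    using sorted_wrt_nth_less[OF s that assms(2)] ne by (simp add: hd_conv_nth)
  show "q ! i < l" if "Suc i < length q"
    using sorted_wrt_nth_less[OF s, of i "length q - 1"] that ne by (simp add: last_conv_nth)
qed

section \<open>Telescoping of iterated integrals over chains\<close>

context unit_path
begin

definition chain_integral :: "(nat \<Rightarrow> complex) \<Rightarrow> nat list \<Rightarrow> nat \<Rightarrow> real \<Rightarrow> complex" where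
  "chain_integral s q k \<tau> = nested_integral (form (\<lambda>i. s (q ! i))) k \<tau>"

lemma chain_integral_0 [simp]: "chain_integral s q 0 \<tau> = 1"
  by (simp add: chain_integral_def)

lemma chain_integral_append:
  assumes "k < length q"
  shows "chain_integral s (q @ p) k \<tau> = chain_integral s q k \<tau>"
  unfolding chain_integral_def
  by (rule nested_integral_cong[of "{}"]) (use assms in \<open>auto simp: form_def nth_append\<close>)

lemma chain_prod_chain_nonzero:
  assumes q: "q \<in> chains x l" and nz: "chain_prod a q \<noteq> 0" and i: "0 < i" "i < length q"
    and a0: "\<And>k j. a k j \<noteq> 0 \<Longrightarrow> s k \<noteq> s j"
  shows "s (q ! (i - 1)) \<noteq> s (q ! i)"
proof -
  have "length q = Suc (length q - 1)" using i by auto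
  from chain_prod_nonzeroD[OF nz this, of i] i show ?thesis by (intro a0) auto
qed

text \<open>
  Summed over chains, the iterated integrals telescope: by the differential equation of
  \<open>\<phi>_l(t) = (s_l - t) * rayint\<close> with base point \<open>t\<close>, the integrand \<open>\<phi>_j(t) / (s_j - t)\<close> is again a
  \<open>rayint\<close>, without a singularity at \<open>s_j\<close>.
\<close>

lemma sum_chain_integrals:
  fixes s v v' :: "nat \<Rightarrow> complex" and x y :: nat
  defines "a \<equiv> (\<lambda>k l. (s l - s k) * rayint (l - Suc k) k s v)"
    and "\<phi> \<equiv> (\<lambda>l t. (s l - t) * rayint (l - Suc x) x (s(x := t)) v')"
  assumes s: "s x = 0" "s y = 1"
    and hp0: "half_planes \<kappa> w s v x y" "half_planes \<kappa> w s v' x y" "0 < \<kappa>"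
    and hp: "\<And>u. 0 \<le> u \<Longrightarrow> u < 1 \<Longrightarrow> \<exists>\<kappa> w d. half_planes \<kappa> w (s(x := \<gamma> u)) (v'(x := d)) x y \<and> 0 < \<kappa>"
    and v': "\<And>k. Suc x < k \<Longrightarrow> v' k = v k"
    and avoid: "\<And>l u. x < l \<Longrightarrow> l < y \<Longrightarrow> 0 < u \<Longrightarrow> u < 1 \<Longrightarrow> \<gamma> u \<noteq> s l"
    and l: "x < l" "l \<le> y" and \<tau>: "0 < \<tau>" "\<tau> < 1"
  shows "(\<Sum>q\<in>chains x l. chain_prod a q * chain_integral s q (length q - 2) \<tau>) = \<phi> l (\<gamma> \<tau>)"
  using l \<tau>
proof (induction l arbitrary: \<tau> rule: less_induct)
  case (less l)
  let ?R = "\<lambda>j t. rayint (j - Suc x) x (s(x := t)) v'"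
  let ?P = "\<lambda>j u. \<Sum>q\<in>chains x j. chain_prod a q * chain_integral s q (length q - 2) u"
  have \<tau>: "0 < \<tau>" "\<tau> < 1" and l: "x < l" "l \<le> y" using less.prems by auto
  have a0: "s k \<noteq> s j" if "a k j \<noteq> 0" for k j using that by (auto simp: a_def)
  have \<gamma>0: "\<gamma> 0 = 0" using start[of 0] \<rho> by simp
  have inner: "(\<lambda>u. ?R j (\<gamma> u) * \<gamma>' u) integrable_on {0..\<tau>}"
    "(\<Sum>q\<in>chains x j. chain_prod a q * chain_integral s q (length q - 1) \<tau>) = integral {0..\<tau>} (\<lambda>u. ?R j (\<gamma> u) * \<gamma>' u)"
    if j: "x < j" "j < l" for j
  proof -
    have jy: "j < y" using j l by simp
    let ?g = "\<lambda>q u. chain_prod a q * (chain_integral s q (length q - 2) u / (s j - \<gamma> u) * \<gamma>' u)"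
    have one: "?g q integrable_on {0..\<tau>} \<and> chain_prod a q * chain_integral s q (length q - 1) \<tau> = integral {0..\<tau>} (?g q)"
      if q: "q \<in> chains x j" for q
    proof (cases "chain_prod a q = 0")
      case False
      have len: "length q = Suc (Suc (length q - 2))"
        using q j by (cases q; cases "tl q") (auto simp: chains_def)
      define k where "k = length q - 2"
      have k: "length q = Suc (Suc k)" "length q - 1 = Suc k" using len by (auto simp: k_def)
      have last: "q ! Suc k = j" using q k by (auto simp: chains_def last_conv_nth)
      have hd: "q ! 0 = x" using q k by (auto simp: chains_def hd_conv_nth)
      let ?\<sigma> = "\<lambda>i. s (q ! i)"
      obtain C where C: "singular_forms (form ?\<sigma>) (Suc k) C E"
      proof -
        have "\<gamma> u \<noteq> ?\<sigma> i" if "i \<in> {1..Suc k}" "0 < u" "u < 1" for i u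
          using chains_nth[OF q, of i] that k jy by (intro avoid) auto
        moreover have "?\<sigma> 1 \<noteq> 0"
          using chain_prod_chain_nonzero[where s = s and i = 1, OF q False _ _ a0] k hd s by auto
        ultimately show ?thesis
          using singular_forms_form(1)[of "Suc k" ?\<sigma>] that by blast
      qed
      have split: "chain_integral s q (Suc k) \<tau> = chain_integral s q (Suc k) 0
         + integral {0..\<tau>} (\<lambda>u. chain_integral s q k u / (s j - \<gamma> u) * \<gamma>' u)"
        "(\<lambda>u. chain_integral s q k u / (s j - \<gamma> u) * \<gamma>' u) integrable_on {0..\<tau>}"
        using nested_integral_Suc_split[OF C, of k 0 \<tau>] \<tau> last unfolding chain_integral_def by auto
      have "chain_integral s q (Suc k) 0 = 0"
      proof -
        have "(LINT u:{0..0}|lborel. nested_integral (form ?\<sigma>) k u * form ?\<sigma> (Suc k) u) = 0"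
          unfolding set_lebesgue_integral_def
          by (rule integral_eq_zero_AE) (use AE_lborel_singleton[of "0::real"] in \<open>auto elim!: eventually_mono\<close>)
        then show ?thesis by (simp add: chain_integral_def)
      qed
      then have e: "chain_integral s q (length q - 1) \<tau> = integral {0..\<tau>} (\<lambda>u. chain_integral s q k u / (s j - \<gamma> u) * \<gamma>' u)"
        using split(1) unfolding k(2) by simp
      show ?thesis
        unfolding e k_def[symmetric]
        using integrable_on_mult_right[OF split(2), of "chain_prod a q"] integral_mult_right[symmetric] by blast
    qed (simp add: integrable_0)
    have int: "(\<lambda>u. \<Sum>q\<in>chains x j. ?g q u) integrable_on {0..\<tau>}"
      by (rule integrable_sum) (use one in auto)
    \<comment> \<open>The induction hypothesis concerns positive parameters only; the single
      parameter 0 is negligible for the integrals.\<close>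
    have eq: "(\<Sum>q\<in>chains x j. ?g q u) = ?R j (\<gamma> u) * \<gamma>' u" if u: "u \<in> {0..\<tau>} - {0}" for u
    proof -
      have "(\<Sum>q\<in>chains x j. ?g q u) = ?P j u / (s j - \<gamma> u) * \<gamma>' u"
        unfolding sum_divide_distrib sum_distrib_right by (intro sum.cong refl) simp
      also have "?P j u = \<phi> j (\<gamma> u)"
        using less.IH[of j u] j l u \<tau> by auto
      also have "\<phi> j (\<gamma> u) / (s j - \<gamma> u) = ?R j (\<gamma> u)"
        using avoid[of j u] j jy u \<tau> by (auto simp: \<phi>_def)
      finally show ?thesis .
    qed
    show "(\<lambda>u. ?R j (\<gamma> u) * \<gamma>' u) integrable_on {0..\<tau>}"
      by (rule integrable_spike[OF int, of "{0}"]) (use eq in auto)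
    have "(\<Sum>q\<in>chains x j. chain_prod a q * chain_integral s q (length q - 1) \<tau>) = (\<Sum>q\<in>chains x j. integral {0..\<tau>} (?g q))"
      using one by (intro sum.cong) auto
    also have "\<dots> = integral {0..\<tau>} (\<lambda>u. \<Sum>q\<in>chains x j. ?g q u)"
      by (rule integral_sum[symmetric]) (use one in auto)
    also have "\<dots> = integral {0..\<tau>} (\<lambda>u. ?R j (\<gamma> u) * \<gamma>' u)"
      by (rule integral_spike[of "{0}"]) (use eq in auto)
    finally show "(\<Sum>q\<in>chains x j. chain_prod a q * chain_integral s q (length q - 1) \<tau>) = integral {0..\<tau>} (\<lambda>u. ?R j (\<gamma> u) * \<gamma>' u)" .
  qed
  \<comment> \<open>Splitting off the last point: in a chain ending with \<open>j, l\<close> the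
    point \<open>j\<close> contributes a form unless \<open>j = x\<close>, whence
    \<open>length q - 1\<close> in place of \<open>length q - 2\<close>.\<close>
  have "?P l \<tau> = (\<Sum>j\<in>{x..<l}. \<Sum>q\<in>chains x j. chain_prod a (q @ [l]) * chain_integral s (q @ [l]) (length (q @ [l]) - 2) \<tau>)"
    by (rule sum_chains_snoc[OF l(1)])
  also have "\<dots> = (\<Sum>j\<in>{x..<l}. a j l * (\<Sum>q\<in>chains x j. chain_prod a q * chain_integral s q (length q - 1) \<tau>))"
  proof (rule sum.cong[OF refl])
    fix j assume j: "j \<in> {x..<l}"
    show "(\<Sum>q\<in>chains x j. chain_prod a (q @ [l]) * chain_integral s (q @ [l]) (length (q @ [l]) - 2) \<tau>)
       = a j l * (\<Sum>q\<in>chains x j. chain_prod a q * chain_integral s q (length q - 1) \<tau>)"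
      unfolding sum_distrib_left
    proof (rule sum.cong[OF refl])
      fix q assume q: "q \<in> chains x j"
      then have ne: "q \<noteq> []" "last q = j" by (auto simp: chains_def)
      then have "length (q @ [l]) - 2 = length q - 1" "length q - 1 < length q" by (auto simp: Suc_diff_Suc)
      then show "chain_prod a (q @ [l]) * chain_integral s (q @ [l]) (length (q @ [l]) - 2) \<tau>
         = a j l * (chain_prod a q * chain_integral s q (length q - 1) \<tau>)"
        by (simp only: chain_prod_snoc[OF ne(1)] ne(2) chain_integral_append mult_ac)
    qed
  qed
  \<comment> \<open>The term \<open>j = x\<close> comes from the chain \<open>[x, l]\<close>, which
    has no inner point and integral 1.\<close>
  also have "\<dots> = a x l + (\<Sum>j\<in>{Suc x..<l}. a j l * (\<Sum>q\<in>chains x j. chain_prod a q * chain_integral s q (length q - 1) \<tau>))"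
    using l by (subst sum.atLeast_Suc_lessThan) (auto simp: chains_refl)
  also have "\<dots> = a x l + (\<Sum>j\<in>{Suc x..<l}. a j l * integral {0..\<tau>} (\<lambda>u. ?R j (\<gamma> u) * \<gamma>' u))"
    using inner(2) by (intro arg_cong2[where f = "(+)"] sum.cong refl) auto
  also have "\<dots> = a x l + integral {0..\<tau>} (\<lambda>u. (\<Sum>j\<in>{Suc x..<l}. ?R j (\<gamma> u) * a j l) * \<gamma>' u)"
  proof -
    have "(\<Sum>j\<in>{Suc x..<l}. a j l * integral {0..\<tau>} (\<lambda>u. ?R j (\<gamma> u) * \<gamma>' u))
        = (\<Sum>j\<in>{Suc x..<l}. integral {0..\<tau>} (\<lambda>u. a j l * (?R j (\<gamma> u) * \<gamma>' u)))"
      by simp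
    also have "\<dots> = integral {0..\<tau>} (\<lambda>u. \<Sum>j\<in>{Suc x..<l}. a j l * (?R j (\<gamma> u) * \<gamma>' u))"
      by (rule integral_sum[symmetric]) (auto intro!: integrable_on_mult_right inner(1))
    finally show ?thesis by (simp add: sum_distrib_left sum_distrib_right mult_ac)
  qed
  \<comment> \<open>By \<open>scaled_rayint_base_deriv\<close> the integrand is the derivative of
    \<open>\<phi> l\<close> along the path.\<close>
  also have "integral {0..\<tau>} (\<lambda>u. (\<Sum>j\<in>{Suc x..<l}. ?R j (\<gamma> u) * a j l) * \<gamma>' u) = \<phi> l (\<gamma> \<tau>) - \<phi> l (\<gamma> 0)"
  proof (rule integral_unique, rule path_FTC)
    define m where "m = l - Suc x"
    have m: "l = Suc (x + m)" "l - Suc x = m" using l by (auto simp: m_def)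
    have hpl: "\<exists>\<kappa> w d. half_planes \<kappa> w (s(x := \<gamma> u)) (v'(x := d)) x (Suc (x + m)) \<and> 0 < \<kappa>" if "0 \<le> u" "u < 1" for u
      using hp[OF that] half_planes_front l m by metis
    have rd: "rayint m x (s(x := t)) (v'(x := d)) = rayint m x (s(x := t)) v'" for t d
      by (rule rayint_cong) auto
    have cont_R: "isCont (\<lambda>t. rayint m x (s(x := t)) v') (\<gamma> u)" if u: "0 \<le> u" "u < 1" for u
    proof -
      obtain \<kappa> w d where h: "half_planes \<kappa> w (s(x := \<gamma> u)) (v'(x := d)) x (Suc (x + m))" "0 < \<kappa>"
        using hpl[OF u] by blast
      have "isCont (\<lambda>t. rayint m x (s(x := t)) (v'(x := d))) (\<gamma> u)"
      proof (rule rayint_isCont[where P = "\<lambda>t. s(x := t)" and Q = "\<lambda>t. v'(x := d)", OF h])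
        show "isCont (\<lambda>t. (s(x := t)) k) (\<gamma> u)" for k by (cases "k = x") auto
      qed simp
      then show ?thesis by (simp add: rd)
    qed
    have "isCont (\<phi> l) (\<gamma> u)" if "0 \<le> u" "u < 1" for u
      unfolding \<phi>_def m(2) by (intro isCont_mult isCont_diff continuous_const continuous_ident cont_R that)
    then have "continuous_on (\<gamma> ` {0..\<tau>}) (\<phi> l)"
      using \<tau> by (intro continuous_at_imp_continuous_on) auto
    moreover have "continuous_on {0..\<tau>} \<gamma>" by (rule continuous_on_subset[OF cont]) (use \<tau> in auto)
    ultimately show "continuous_on {0..\<tau>} (\<lambda>u. \<phi> l (\<gamma> u))" by (rule continuous_on_compose2) auto
    fix u assume u: "0 < u" "u < \<tau>"
    obtain \<kappa> w d where h: "half_planes \<kappa> w (s(x := \<gamma> u)) (v'(x := d)) x (Suc (x + m))" "0 < \<kappa>"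
      using hpl[of u] u \<tau> by auto
    have ne: "s l \<noteq> \<gamma> u"
    proof (cases "l = y")
      case True
      have "Re (\<gamma> u) < 1" using upper[of u] u \<tau> by auto
      then show ?thesis using True s by auto
    next
      case False
      then show ?thesis using avoid[of l u] l u \<tau> by auto
    qed
    have "((\<lambda>t. ((s(x := \<gamma> u)) (Suc (x + m)) - t) * rayint m x ((s(x := \<gamma> u))(x := t)) (v'(x := d))) has_field_derivative
       (\<Sum>k=Suc x..x+m. rayint (k - Suc x) x (s(x := \<gamma> u)) (v'(x := d)) * (((s(x := \<gamma> u)) (Suc (x + m)) - (s(x := \<gamma> u)) k) *
          rayint (x + m - k) k (s(x := \<gamma> u)) (v'(x := d))))) (at ((s(x := \<gamma> u)) x))"
      by (rule scaled_rayint_base_deriv[OF h]) (use ne m in auto)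
    moreover have "(\<lambda>t. ((s(x := \<gamma> u)) (Suc (x + m)) - t) * rayint m x ((s(x := \<gamma> u))(x := t)) (v'(x := d))) = \<phi> l"
      using m by (auto simp: \<phi>_def rd fun_eq_iff)
    moreover have "(\<Sum>k=Suc x..x+m. rayint (k - Suc x) x (s(x := \<gamma> u)) (v'(x := d)) * (((s(x := \<gamma> u)) (Suc (x + m)) - (s(x := \<gamma> u)) k) *
          rayint (x + m - k) k (s(x := \<gamma> u)) (v'(x := d)))) = (\<Sum>j\<in>{Suc x..<l}. ?R j (\<gamma> u) * a j l)"
    proof (rule sum.cong)
      show "{Suc x..x + m} = {Suc x..<l}" using m by auto
      fix k assume k: "k \<in> {Suc x..<l}"
      have "rayint (k - Suc x) x (s(x := \<gamma> u)) (v'(x := d)) = ?R k (\<gamma> u)"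
        by (rule rayint_cong) auto
      moreover have "rayint (x + m - k) k (s(x := \<gamma> u)) (v'(x := d)) = rayint (l - Suc k) k s v"
      proof -
        have "x + m - k = l - Suc k" using m by simp
        moreover have "rayint (l - Suc k) k (s(x := \<gamma> u)) (v'(x := d)) = rayint (l - Suc k) k s v"
          by (rule rayint_cong) (use k v' in auto)
        ultimately show ?thesis by simp
      qed
      ultimately show "rayint (k - Suc x) x (s(x := \<gamma> u)) (v'(x := d)) * (((s(x := \<gamma> u)) (Suc (x + m)) - (s(x := \<gamma> u)) k) *
          rayint (x + m - k) k (s(x := \<gamma> u)) (v'(x := d))) = ?R k (\<gamma> u) * a k l"
        using k m by (simp add: a_def)
    qed
    ultimately show "(\<phi> l has_field_derivative (\<Sum>j\<in>{Suc x..<l}. ?R j (\<gamma> u) * a j l)) (at (\<gamma> u))"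
      by simp
  qed (use \<tau> in auto)
  \<comment> \<open>At the start the base point is \<open>s x\<close> itself and the directions
    \<open>v'\<close> may be replaced by \<open>v\<close>, so the initial value cancels the term of
    the chain \<open>[x, l]\<close>.\<close>
  also have "\<phi> l (\<gamma> 0) = a x l"
  proof -
    have "s(x := 0) = s" using s by auto
    moreover have "rayint (l - Suc x) x s v' = rayint (l - Suc x) x s v"
    proof (rule rayint_directions[OF _ _ hp0(3)])
      show "half_planes \<kappa> w s v' x (Suc (x + (l - Suc x)))"
        by (rule half_planes_front[OF hp0(2)]) (use l in auto)
      show "half_planes \<kappa> w s v x (Suc (x + (l - Suc x)))"
        by (rule half_planes_front[OF hp0(1)]) (use l in auto)
    qed
    ultimately show ?thesis by (simp add: \<phi>_def a_def \<gamma>0 s)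
  qed
  finally show ?case by simp
qed

text \<open>The passage of \<tau> to 1. In a chain of nonzero weight the first inner point differs
  from \<open>s x = 0\<close> and the last from \<open>s y = 1\<close>, since \<open>a\<close>
  vanishes on coincident points; hence its integral converges at the end.\<close>

lemma sum_chain_integrals_1:
  fixes s v v' :: "nat \<Rightarrow> complex" and x y :: nat
  defines "a \<equiv> (\<lambda>k l. (s l - s k) * rayint (l - Suc k) k s v)"
    and "\<phi> \<equiv> (\<lambda>l t. (s l - t) * rayint (l - Suc x) x (s(x := t)) v')"
  assumes xy: "x < y" and s: "s x = 0" "s y = 1"
    and hp0: "half_planes \<kappa> w s v x y" "half_planes \<kappa> w s v' x y" "0 < \<kappa>"
    and hp: "\<And>u. 0 \<le> u \<Longrightarrow> u < 1 \<Longrightarrow> \<exists>\<kappa> w d. half_planes \<kappa> w (s(x := \<gamma> u)) (v'(x := d)) x y \<and> 0 < \<kappa>"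
    and v': "\<And>k. Suc x < k \<Longrightarrow> v' k = v k"
    and avoid: "\<And>l u. x < l \<Longrightarrow> l < y \<Longrightarrow> 0 < u \<Longrightarrow> u < 1 \<Longrightarrow> \<gamma> u \<noteq> s l"
    and lim: "((\<lambda>u. \<phi> y (\<gamma> u)) \<longlongrightarrow> 0) (at_left 1)"
  shows "(\<Sum>q\<in>chains x y. chain_prod a q * chain_integral s q (length q - 2) 1) = 0"
proof -
  have a0: "s k \<noteq> s j" if "a k j \<noteq> 0" for k j using that by (auto simp: a_def)
  have "((\<lambda>\<tau>. \<Sum>q\<in>chains x y. chain_prod a q * chain_integral s q (length q - 2) \<tau>) \<longlongrightarrow>
     (\<Sum>q\<in>chains x y. chain_prod a q * chain_integral s q (length q - 2) 1)) (at_left 1)"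
  proof (rule tendsto_sum)
    fix q assume q: "q \<in> chains x y"
    show "((\<lambda>\<tau>. chain_prod a q * chain_integral s q (length q - 2) \<tau>) \<longlongrightarrow> chain_prod a q * chain_integral s q (length q - 2) 1) (at_left 1)"
    proof (cases "chain_prod a q = 0 \<or> length q - 2 = 0")
      case True
      then show ?thesis by auto
    next
      case False
      define k where "k = length q - 2"
      have k: "length q = Suc (Suc k)" "1 \<le> k" using False by (auto simp: k_def)
      let ?\<sigma> = "\<lambda>i. s (q ! i)"
      have hd: "q ! 0 = x" and last: "q ! Suc k = y" using q k by (auto simp: chains_def hd_conv_nth last_conv_nth)
      have "\<gamma> u \<noteq> ?\<sigma> i" if "i \<in> {1..k}" "0 < u" "u < 1" for i u
        using chains_nth[OF q, of i] that k by (intro avoid) auto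
      moreover have "?\<sigma> 1 \<noteq> 0"
        using chain_prod_chain_nonzero[where s = s and i = 1, OF q _ _ _ a0] False k hd s by auto
      moreover have "?\<sigma> k \<noteq> 1"
        using chain_prod_chain_nonzero[where s = s and i = "Suc k", OF q _ _ _ a0] False k last s by auto
      ultimately obtain C where "singular_forms_end (form ?\<sigma>) k C E"
        using singular_forms_form(2)[of k ?\<sigma>] k(2) by blast
      then have "(nested_integral (form ?\<sigma>) k \<longlongrightarrow> nested_integral (form ?\<sigma>) k 1) (at_left 1)"
        by (rule singular_forms_end.nested_integral_tendsto)
      then show ?thesis
        unfolding k_def[symmetric] chain_integral_def by (intro tendsto_mult tendsto_const)
    qed
  qed
  moreover have "eventually (\<lambda>\<tau>. \<phi> y (\<gamma> \<tau>) = (\<Sum>q\<in>chains x y. chain_prod a q * chain_integral s q (length q - 2) \<tau>)) (at_left 1)"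
  proof -
    have "\<phi> y (\<gamma> \<tau>) = (\<Sum>q\<in>chains x y. chain_prod a q * chain_integral s q (length q - 2) \<tau>)" if "0 < \<tau>" "\<tau> < 1" for \<tau>
      unfolding a_def \<phi>_def
      by (rule sum_chain_integrals[OF s hp0 hp v' avoid xy order.refl that, symmetric]) auto
    then show ?thesis by (auto simp: eventually_at_left_field intro!: exI[of _ 0])
  qed
  then have "((\<lambda>\<tau>. \<Sum>q\<in>chains x y. chain_prod a q * chain_integral s q (length q - 2) \<tau>) \<longlongrightarrow> 0) (at_left 1)"
    by (rule Lim_transform_eventually[OF lim])
  ultimately show ?thesis
    by (intro tendsto_unique[of "at_left (1::real)"]) auto
qed

end

section \<open>Half planes from the position of the vectors\<close>

text \<open>The bisector: for unit vectors e and f the form given by cnj e + cnj f has the same real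
  part 1 + Re (cnj e * f) on both, and this is positive unless f = - e.\<close>

lemma two_vectors_half_plane:
  fixes a b :: complex
  assumes "a \<noteq> 0" "b \<noteq> 0" and no: "\<And>r. 0 < r \<Longrightarrow> b \<noteq> - (of_real r * a)"
  shows "\<exists>\<omega>. 0 < Re (\<omega> * a) \<and> 0 < Re (\<omega> * b)"
proof -
  define e where "e = a / of_real (norm a)"
  define f where "f = b / of_real (norm b)"
  have ef: "norm e = 1" "norm f = 1" "a = of_real (norm a) * e" "b = of_real (norm b) * f"
    using assms(1,2) by (auto simp: e_def f_def norm_divide)
  have n2: "(Re e)\<^sup>2 + (Im e)\<^sup>2 = 1" "(Re f)\<^sup>2 + (Im f)\<^sup>2 = 1"
    using ef(1,2) by (simp_all add: cmod_def)
  have "f \<noteq> - e"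
  proof
    assume "f = - e"
    then have "b = - (of_real (norm b) * e)" using ef(4) by simp
    also have "\<dots> = - (of_real (norm b / norm a) * a)" by (simp add: e_def)
    finally show False using no[of "norm b / norm a"] assms(1,2) by simp
  qed
  then have "0 < (Re e + Re f)\<^sup>2 + (Im e + Im f)\<^sup>2"
    by (simp add: complex_eq_iff sum_power2_gt_zero_iff add_eq_0_iff)
  then have pos: "0 < 1 + Re e * Re f + Im e * Im f"
    using n2 by (simp add: power2_sum) 
  define \<omega> where "\<omega> = cnj e + cnj f"
  have "Re (\<omega> * e) = 1 + Re e * Re f + Im e * Im f" "Re (\<omega> * f) = 1 + Re e * Re f + Im e * Im f"
    using n2 by (simp_all add: \<omega>_def algebra_simps power2_eq_square)
  moreover have "Re (\<omega> * a) = norm a * Re (\<omega> * e)" "Re (\<omega> * b) = norm b * Re (\<omega> * f)"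
    by (subst ef(3) ef(4), simp add: algebra_simps)+
  ultimately show ?thesis using pos assms(1,2) by (intro exI[of _ \<omega>]) simp
qed

lemma half_planes_of_pos:
  assumes "\<And>k. i \<le> k \<Longrightarrow> k < n \<Longrightarrow>
    \<exists>w. 0 < Re (w * (s (Suc k) - s k)) \<and> Re (w * v k) < 0 \<and> (Suc k < n \<longrightarrow> 0 < Re (w * v (Suc k)))"
  shows "\<exists>\<kappa> w. 0 < \<kappa> \<and> half_planes \<kappa> w s v i n"
proof -
  have "\<exists>\<kappa> w. 0 < \<kappa> \<and> norm w \<le> 1 \<and> \<kappa> \<le> Re (w * (s (Suc k) - s k)) \<and> Re (w * v k) \<le> - \<kappa> \<and>
      (Suc k < n \<longrightarrow> \<kappa> \<le> Re (w * v (Suc k)))" if k: "k \<in> {i..<n}" for k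
  proof -
    obtain w where w: "0 < Re (w * (s (Suc k) - s k))" "Re (w * v k) < 0" "Suc k < n \<Longrightarrow> 0 < Re (w * v (Suc k))"
      using assms[of k] k by auto
    define w' where "w' = w / of_real (1 + norm w)"
    have c: "0 < 1 + norm w" by (simp add: add_pos_nonneg)
    have w'm: "Re (w' * u) = Re (w * u) / (1 + norm w)" for u
    proof -
      have "w' * u = w * u / of_real (1 + norm w)" by (simp add: w'_def)
      then show ?thesis by (simp only: Re_divide_of_real)
    qed
    have "norm w' = norm w / (1 + norm w)" using c by (simp add: w'_def norm_divide del: of_real_add)
    then have n1: "norm w' \<le> 1" using c by simp
    define \<kappa> where "\<kappa> = min (min (Re (w' * (s (Suc k) - s k))) (- Re (w' * v k))) (if Suc k < n then Re (w' * v (Suc k)) else 1)"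
    have "0 < Re (w' * (s (Suc k) - s k))" "0 < - Re (w' * v k)" "Suc k < n \<Longrightarrow> 0 < Re (w' * v (Suc k))"
      unfolding w'm using w c by (simp_all only: divide_pos_pos divide_neg_pos neg_0_less_iff_less)
    then have "0 < \<kappa>" unfolding \<kappa>_def by (auto simp only: min_less_iff_conj zero_less_one split: if_split)
    moreover have "\<kappa> \<le> Re (w' * (s (Suc k) - s k))" "Re (w' * v k) \<le> - \<kappa>" "Suc k < n \<longrightarrow> \<kappa> \<le> Re (w' * v (Suc k))"
      by (auto simp: \<kappa>_def)
    ultimately show ?thesis using n1 by blast
  qed
  then obtain \<kappa> w where kw: "\<And>k. k \<in> {i..<n} \<Longrightarrow> 0 < (\<kappa> k :: real) \<and> norm (w k) \<le> 1 \<and>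
      \<kappa> k \<le> Re (w k * (s (Suc k) - s k)) \<and> Re (w k * v k) \<le> - \<kappa> k \<and> (Suc k < n \<longrightarrow> \<kappa> k \<le> Re (w k * v (Suc k)))"
    by metis
  define K where "K = Min (insert 1 (\<kappa> ` {i..<n}))"
  have "0 < K" using kw by (auto simp: K_def)
  moreover have "K \<le> \<kappa> k" if "k \<in> {i..<n}" for k unfolding K_def by (rule Min_le) (use that in auto)
  then have "half_planes K w s v i n"
    unfolding half_planes_def using kw by (meson neg_le_iff_le order_trans)
  ultimately show ?thesis by blast
qed

text \<open>A form negative on v_k and positive on v_(k+1) exists exactly if v_k is not a positive
  multiple of v_(k+1), the condition defining the domain. The direction at the base point is free
  and is taken opposite to the first step.\<close>

lemma half_planes_exist:
  assumes step: "\<And>k. x \<le> k \<Longrightarrow> k < y \<Longrightarrow> s (Suc k) - s k = v (Suc k)"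
    and nz: "\<And>k. x < k \<Longrightarrow> k \<le> y \<Longrightarrow> v k \<noteq> 0"
    and D: "\<And>k. x < k \<Longrightarrow> k < y \<Longrightarrow> \<not> (\<exists>r>0. v k / v (k + 1) = of_real r)"
  shows "\<exists>\<kappa> w d. 0 < \<kappa> \<and> half_planes \<kappa> w s (v(x := d)) x y"
proof -
  have "\<exists>w. 0 < Re (w * (s (Suc k) - s k)) \<and> Re (w * (v(x := - v (Suc x))) k) < 0 \<and>
      (Suc k < y \<longrightarrow> 0 < Re (w * (v(x := - v (Suc x))) (Suc k)))" if k: "x \<le> k" "k < y" for k
  proof (cases "k = x")
    case True
    have "0 < Re (cnj (v (Suc x)) * v (Suc x))"
      using nz[of "Suc x"] k True by (simp add: complex_eq_iff sum_squares_gt_zero_iff)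
    then show ?thesis using True k step[of x] by (intro exI[of _ "cnj (v (Suc x))"]) auto
  next
    case False
    have "\<exists>\<omega>. 0 < Re (\<omega> * v (Suc k)) \<and> 0 < Re (\<omega> * (- v k))"
    proof (rule two_vectors_half_plane)
      show "v (Suc k) \<noteq> 0" "- v k \<noteq> 0" using nz[of k] nz[of "Suc k"] k False by auto
      fix r :: real assume "0 < r"
      then show "- v k \<noteq> - (of_real r * v (Suc k))"
        using D[of k] k False nz[of "Suc k"] by (auto simp: field_simps)
    qed
    then show ?thesis using False k step[of k] by auto
  qed
  from half_planes_of_pos[OF this] show ?thesis by blast
qed

text \<open>Only the conditions at \<open>k = x\<close> involve the base point. They ask for a form
  positive on v_(x+1) and on s_(x+1) - t; it fails to exist precisely if the second vector is 0 or
  opposite to the first, that is, if t lies on the closed ray.\<close>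

lemma half_planes_base:
  assumes hp: "half_planes \<kappa> w s v x y" "0 < \<kappa>" and xy: "Suc x < y"
    and t: "\<And>r. 0 \<le> r \<Longrightarrow> t \<noteq> s (Suc x) + of_real r * v (Suc x)"
  shows "\<exists>\<kappa> w d. half_planes \<kappa> w (s(x := t)) (v(x := d)) x y \<and> 0 < \<kappa>"
proof -
  have h: "0 < Re (w k * (s (Suc k) - s k))" "Re (w k * v k) < 0" "Suc k < y \<Longrightarrow> 0 < Re (w k * v (Suc k))"
    if "x \<le> k" "k < y" for k
  proof -
    have "\<kappa> \<le> Re (w k * (s (Suc k) - s k)) \<and> Re (w k * v k) \<le> - \<kappa> \<and> (Suc k < y \<longrightarrow> \<kappa> \<le> Re (w k * v (Suc k)))"
      using hp(1) that unfolding half_planes_def by (meson atLeastLessThan_iff)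
    then show "0 < Re (w k * (s (Suc k) - s k))" "Re (w k * v k) < 0" "Suc k < y \<Longrightarrow> 0 < Re (w k * v (Suc k))"
      using hp(2) by linarith+
  qed
  have "\<exists>\<omega>. 0 < Re (\<omega> * v (Suc x)) \<and> 0 < Re (\<omega> * (s (Suc x) - t))"
  proof (rule two_vectors_half_plane)
    show "v (Suc x) \<noteq> 0" using h(3)[of x] xy by auto
    show "s (Suc x) - t \<noteq> 0" using t[of 0] by auto
    show "s (Suc x) - t \<noteq> - (of_real r * v (Suc x))" if "0 < r" for r
      using t[of r] that by (auto simp: algebra_simps)
  qed
  then obtain \<omega> where \<omega>: "0 < Re (\<omega> * v (Suc x))" "0 < Re (\<omega> * (s (Suc x) - t))" by blast
  have "\<omega> \<noteq> 0" using \<omega> by auto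
  then have \<omega>0: "0 < Re \<omega> * Re \<omega> + Im \<omega> * Im \<omega>" by (simp add: complex_eq_iff sum_squares_gt_zero_iff)
  have "\<exists>w'. 0 < Re (w' * ((s(x := t)) (Suc k) - (s(x := t)) k)) \<and> Re (w' * (v(x := - cnj \<omega>)) k) < 0 \<and>
      (Suc k < y \<longrightarrow> 0 < Re (w' * (v(x := - cnj \<omega>)) (Suc k)))" if k: "x \<le> k" "k < y" for k
  proof (cases "k = x")
    case True
    then show ?thesis using \<omega> \<omega>0 by (intro exI[of _ \<omega>]) auto
  next
    case False
    then show ?thesis using h[of k] k by (intro exI[of _ "w k"]) auto
  qed
  from half_planes_of_pos[OF this] show ?thesis by blast
qed

text \<open>Dominated convergence with the pointwise limit allowed to fail at 0. When the first ray
  starts at the end of the path, the rescaled integrand need not vanish in the limit at the origin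
  of the ray.\<close>

lemma ray_integral_tendsto_0:
  fixes f :: "nat \<Rightarrow> real \<Rightarrow> complex"
  assumes cont: "\<And>n. continuous_on {0..} (f n)"
    and bd: "\<And>n x. 0 \<le> x \<Longrightarrow> norm (f n x) \<le> C * (1 + x) powr (-3/2)"
    and lim: "\<And>x. 0 < x \<Longrightarrow> (\<lambda>n. f n x) \<longlonglongrightarrow> 0"
  shows "(\<lambda>n. LINT x:{0..}|lborel. f n x) \<longlonglongrightarrow> 0"
proof -
  have "(\<lambda>n. LINT x|lborel. indicator {0..} x *\<^sub>R f n x) \<longlonglongrightarrow> (LINT x::real|lborel. (0::complex))"
  proof (rule integral_dominated_convergence)
    show "(\<lambda>x. indicator {0..} x *\<^sub>R f n x) \<in> borel_measurable lborel" for n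
      using ray_integrable[OF cont bd, of n] unfolding set_integrable_def by (simp add: borel_measurable_integrable)
    show "integrable lborel (\<lambda>x. C * (indicator {0..} x *\<^sub>R (1 + x) powr (-3/2)))"
      using set_integrable_ray_powr unfolding set_integrable_def by (intro integrable_mult_right)
    show "AE x in lborel. (\<lambda>n. indicator {0..} x *\<^sub>R f n x) \<longlonglongrightarrow> 0"
      using AE_lborel_singleton[of "0::real"]
    proof eventually_elim
      case (elim x)
      then show ?case using lim[of x] by (cases "0 < x") auto
    qed
    show "AE x in lborel. norm (indicator {0..} x *\<^sub>R f n x) \<le> C * (indicator {0..} x *\<^sub>R (1 + x) powr (-3/2))" for n
      using bd by (auto simp: indicator_def)
  qed auto
  then show ?thesis by (simp add: set_lebesgue_integral_def)
qed

lemma finite_positive_bound: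
  fixes f :: "'a \<Rightarrow> real"
  assumes "finite F"
  shows "\<exists>\<delta>>0. \<forall>j\<in>F. 0 < f j \<longrightarrow> \<delta> < f j"
  using assms
proof (induction rule: finite_induct)
  case (insert j F)
  then obtain \<delta> where \<delta>: "0 < \<delta>" "\<forall>j\<in>F. 0 < f j \<longrightarrow> \<delta> < f j" by blast
  show ?case using \<delta> by (intro exI[of _ "if 0 < f j then min \<delta> (f j / 2) else \<delta>"]) auto
qed (auto intro: exI[of _ 1])

text \<open>
  The path may have to pass through the first ray \<open>\<sigma>_(x+1) + \<real>_{\<ge>0} v_(x+1)\<close> when this ray runs along the
  segment; it is therefore tilted below the segment first.
\<close>

lemma exists_tilted_direction:
  assumes hp: "half_planes \<kappa> w \<sigma> v x y" "0 < \<kappa>" and xy: "Suc x < y" and \<sigma>: "\<sigma> x = 0" and v: "v (Suc x) = \<sigma> (Suc x)"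
    and A: "separated A r" "A = {t. 0 < t \<and> t < 1 \<and> (\<exists>j. x < j \<and> j < y \<and> \<sigma> j = of_real t)}"
    and r: "\<And>j. x < j \<Longrightarrow> j < y \<Longrightarrow> 0 < \<bar>Im (\<sigma> j)\<bar> \<Longrightarrow> r < \<bar>Im (\<sigma> j)\<bar>"
    and \<rho>: "0 < \<rho>" "\<rho> < 1/2" "\<And>a. a \<in> A \<Longrightarrow> \<rho> \<le> a - r \<and> a + r \<le> 1 - \<rho>"
  shows "\<exists>v' \<kappa>'. 0 < \<kappa>' \<and> \<kappa>' \<le> \<kappa> \<and> half_planes \<kappa>' w \<sigma> v' x y \<and> (\<forall>k. k \<noteq> Suc x \<longrightarrow> v' k = v k) \<and>
    (\<forall>u c. 0 \<le> u \<longrightarrow> u < 1 \<longrightarrow> 0 \<le> c \<longrightarrow> detour_path A r u \<noteq> \<sigma> (Suc x) + of_real c * v' (Suc x)) \<and>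
    ((\<forall>c\<ge>0. 1 \<noteq> \<sigma> (Suc x) + of_real c * v' (Suc x)) \<or> (\<sigma> (Suc x) = 1 \<and> Re (v' (Suc x)) = 1))"
proof -
  interpret unit_path "detour_path A r" "detour_path_deriv A r" "{0, 1} \<union> (\<Union>a\<in>A. {a - r, a + r})" "1 + 3 * real (card A)" \<rho>
    by (rule unit_path_detour_path) (use A(1) \<rho> in auto)
  define p where "p = \<sigma> (Suc x)"
  have r0: "0 < r" using A(1) by (simp add: separated_def)
  have p0: "p \<noteq> 0"
  proof
    assume "p = 0"
    then have "\<kappa> \<le> 0" using hp(1) xy \<sigma> unfolding half_planes_def p_def by (auto dest!: bspec[of _ _ x])
    then show False using hp(2) by simp
  qed
  have path: "(detour_path A r u = of_real u \<and> u \<notin> A) \<or> (0 < Im (detour_path A r u) \<and> Im (detour_path A r u) \<le> r)"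
    for u
  proof (cases "\<exists>a\<in>A. \<bar>u - a\<bar> < r")
    case True
    then show ?thesis using detour_path_height[OF A(1)] by blast
  next
    case False
    moreover from this have "u \<notin> A" using r0 by force
    moreover from False have "detour_path A r u = of_real u" by (intro detour_path_away r0) force
    ultimately show ?thesis by blast
  qed
  show ?thesis
  proof (cases "Im p = 0 \<and> 0 < Re p \<and> Re p \<le> 1")
    \<comment> \<open>The untilted ray consists of the multiples \<open>(1 + c) * p\<close>. It
      avoids the interval [0, 1], and if it lies above the axis its height is at least
      \<open>Im p\<close>, which exceeds that of the arcs.\<close>
    case False
    have mult: "p + of_real c * v (Suc x) = of_real (1 + c) * p" for c using v by (simp add: p_def algebra_simps)
    have ne: "of_real t \<noteq> of_real (1 + c) * p" if "0 \<le> c" "0 \<le> t" "t \<le> 1" for c t :: real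
    proof
      assume e: "of_real t = of_real (1 + c) * p"
      have "Im (of_real t) = (1 + c) * Im p" "Re (of_real t) = (1 + c) * Re p" unfolding e by simp_all
      then have "Im p = 0" and t: "t = (1 + c) * Re p" using that by auto
      with False p0 have "Re p < 0 \<or> 1 < Re p" by (auto simp: complex_eq_iff)
      then show False
      proof
        assume "Re p < 0"
        then have "(1 + c) * Re p < 0" using that by (intro mult_pos_neg) auto
        then show False using t that by simp
      next
        assume q: "1 < Re p"
        have "1 * Re p \<le> (1 + c) * Re p" using q that by (intro mult_right_mono) auto
        then show False using t that q by linarith
      qed
    qed
    have "detour_path A r u \<noteq> p + of_real c * v (Suc x)" if u: "0 \<le> u" "u < 1" and c: "0 \<le> c" for u c
      unfolding mult using path[of u]
    proof
      assume "detour_path A r u = of_real u \<and> u \<notin> A"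
      then show "detour_path A r u \<noteq> of_real (1 + c) * p" using ne[of c u] u c by simp
    next
      assume h: "0 < Im (detour_path A r u) \<and> Im (detour_path A r u) \<le> r"
      show "detour_path A r u \<noteq> of_real (1 + c) * p"
      proof
        assume "detour_path A r u = of_real (1 + c) * p"
        then have e: "Im (detour_path A r u) = (1 + c) * Im p" by simp
        then have "0 < Im p" using h c by (simp add: zero_less_mult_iff)
        moreover from this have "1 * Im p \<le> (1 + c) * Im p" using c by (intro mult_right_mono) auto
        moreover have "r < \<bar>Im p\<bar>" unfolding p_def by (rule r) (use \<open>0 < Im p\<close> xy in \<open>auto simp: p_def\<close>)
        ultimately show False using h e by linarith
      qed
    qed
    moreover have "1 \<noteq> p + of_real c * v (Suc x)" if "0 \<le> c" for c unfolding mult using ne[of c 1] that by simp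
    ultimately show ?thesis using hp by (intro exI[of _ v] exI[of _ \<kappa>]) (auto simp: p_def)
  next
    case True
    \<comment> \<open>Here the ray starts on the segment and runs along its line. Multiplying the
      direction by 1 - i \<epsilon> turns it below the axis while the path stays on or above; a
      small \<epsilon> keeps the half plane conditions.\<close>
    define V where "V = (\<lambda>\<epsilon>. v(Suc x := p * Complex 1 (- \<epsilon>)))"
    have "eventually (\<lambda>\<epsilon>. half_planes (\<kappa>/2) w \<sigma> (V \<epsilon>) x y) (at_right 0)"
    proof (rule half_planes_eventually[OF hp(1), where S = "\<lambda>_. \<sigma>"])
      show "((\<lambda>\<epsilon>. V \<epsilon> k) \<longlongrightarrow> v k) (at_right 0)" for k
      proof (cases "k = Suc x")
        case True
        have "((\<lambda>\<epsilon>. p * (1 - \<i> * of_real \<epsilon>)) \<longlongrightarrow> p * (1 - \<i> * of_real 0)) (at_right 0)"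
          by (intro tendsto_intros)
        moreover have "Complex 1 (- \<epsilon>) = 1 - \<i> * of_real \<epsilon>" for \<epsilon> by (simp add: complex_eq_iff)
        ultimately show ?thesis using True v by (simp add: V_def p_def)
      qed (simp add: V_def)
    qed (use hp in auto)
    moreover have "eventually (\<lambda>\<epsilon>::real. 0 < \<epsilon>) (at_right 0)" by (rule eventually_at_right_less)
    ultimately obtain \<epsilon> where \<epsilon>: "half_planes (\<kappa>/2) w \<sigma> (V \<epsilon>) x y" "0 < \<epsilon>"
      using eventually_happens'[OF _ eventually_conj] by (metis (no_types, lifting) trivial_limit_at_right_real)
    have ray: "Im (p + of_real c * V \<epsilon> (Suc x)) = - (c * (Re p * \<epsilon>))" for c
      using True by (simp add: V_def)
    have neg: "Im (p + of_real c * V \<epsilon> (Suc x)) < 0" if "0 < c" for c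
      unfolding ray using that True \<epsilon> by simp
    have off: "detour_path A r u \<noteq> p + of_real c * V \<epsilon> (Suc x)" if u: "0 \<le> u" "u < 1" and c: "0 \<le> c" for u c
    proof (cases "c = 0")
      case False
      then have "Im (p + of_real c * V \<epsilon> (Suc x)) < 0" using c neg by simp
      moreover have "0 \<le> Im (detour_path A r u)" using path[of u] by auto
      ultimately show ?thesis by (metis leD)
    next
      case c0: True
      show ?thesis
      proof
        assume "detour_path A r u = p + of_real c * V \<epsilon> (Suc x)"
        then have e: "detour_path A r u = p" using c0 by simp
        then have "p = of_real u" "u \<notin> A" using path[of u] True by auto
        moreover have "u \<in> A"
          unfolding A(2) using u \<open>p = of_real u\<close> p0 xy by (auto simp: p_def intro!: exI[of _ "Suc x"])
        ultimately show False by blast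
      qed
    qed
    \<comment> \<open>For \<open>p = 1\<close> the ray starts at the end of the path and cannot
      avoid it. The real part 1 of the direction then gives the lower bound on the denominator used
      in the limit.\<close>
    have one: "(\<forall>c\<ge>0. 1 \<noteq> p + of_real c * V \<epsilon> (Suc x)) \<or> (p = 1 \<and> Re (V \<epsilon> (Suc x)) = 1)"
    proof (cases "p = 1")
      case False
      have "1 \<noteq> p + of_real c * V \<epsilon> (Suc x)" if "0 \<le> c" for c
      proof (cases "c = 0")
        case nz: False
        then have "Im (p + of_real c * V \<epsilon> (Suc x)) < Im 1" using neg that by simp
        then show ?thesis by (metis less_irrefl)
      qed (use False in auto)
      then show ?thesis by blast
    qed (simp add: V_def)
    have "\<forall>k. k \<noteq> Suc x \<longrightarrow> V \<epsilon> k = v k" by (simp add: V_def)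
    then show ?thesis
      using \<epsilon> off one hp(2) unfolding p_def by (intro exI[of _ "V \<epsilon>"] exI[of _ "\<kappa>/2"] conjI) auto
  qed
qed

text \<open>If 1 is off the first ray, the ray integral is continuous there and the prefactor tends
  to 0. If the ray starts at 1, the prefactor is moved inside: with
  \<open>Re (v (Suc x)) = 1\<close> the quotient (1 - u) / (1 - u + c) dominates, which is at most 1
  / (1 + c) and tends to 0 for every c > 0.\<close>

lemma scaled_rayint_tendsto_0:
  assumes hp: "half_planes \<kappa> w \<sigma> v x y" "0 < \<kappa>" and xy: "Suc x < y" and \<sigma>: "\<sigma> y = 1"
    and off: "(\<forall>c\<ge>0. 1 \<noteq> \<sigma> (Suc x) + of_real c * v (Suc x)) \<or> (\<sigma> (Suc x) = 1 \<and> Re (v (Suc x)) = 1)"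
  shows "((\<lambda>u. (\<sigma> y - of_real u) * rayint (y - Suc x) x (\<sigma>(x := of_real u)) v) \<longlongrightarrow> 0) (at_left 1)"
proof -
  obtain m where m: "y = Suc (Suc (x + m))" using xy by (metis add_Suc less_imp_Suc_add)
  show ?thesis
    using off
  proof
    assume off: "\<forall>c\<ge>0. 1 \<noteq> \<sigma> (Suc x) + of_real c * v (Suc x)"
    obtain \<kappa>' w' d where h: "half_planes \<kappa>' w' (\<sigma>(x := 1)) (v(x := d)) x (Suc (x + Suc m))" "0 < \<kappa>'"
      using half_planes_base[OF hp xy, of 1] off m by auto
    have rd: "rayint (Suc m) x (\<sigma>(x := t)) (v(x := d)) = rayint (Suc m) x (\<sigma>(x := t)) v" for t d
      by (rule rayint_cong) auto
    have "isCont (\<lambda>t. rayint (Suc m) x (\<sigma>(x := t)) (v(x := d))) 1"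
    proof (rule rayint_isCont[where P = "\<lambda>t. \<sigma>(x := t)" and Q = "\<lambda>t. v(x := d)", OF h])
      show "isCont (\<lambda>t. (\<sigma>(x := t)) k) 1" for k by (cases "k = x") auto
    qed simp
    then have "isCont (\<lambda>t. rayint (Suc m) x (\<sigma>(x := t)) v) (of_real 1)" by (simp only: rd of_real_1)
    then have "((\<lambda>u. rayint (Suc m) x (\<sigma>(x := of_real u)) v) \<longlongrightarrow> rayint (Suc m) x (\<sigma>(x := of_real 1)) v) (at_left (1::real))"
      by (rule isCont_tendsto_compose) (intro tendsto_intros)
    then have "((\<lambda>u. (\<sigma> y - of_real u) * rayint (Suc m) x (\<sigma>(x := of_real u)) v) \<longlongrightarrow>
        (\<sigma> y - of_real 1) * rayint (Suc m) x (\<sigma>(x := of_real 1)) v) (at_left (1::real))"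
      by (intro tendsto_mult tendsto_diff tendsto_const tendsto_of_real tendsto_ident_at)
    then show ?thesis using \<sigma> m by simp
  next
    assume p: "\<sigma> (Suc x) = 1 \<and> Re (v (Suc x)) = 1"
    obtain B where B: "0 \<le> B" "\<forall>k\<le>y. norm (v k) \<le> B" using norm_bound[of y v] by blast
    let ?R = "\<lambda>c. rayint m (Suc x) (\<sigma>(Suc x := \<sigma> (Suc x) + of_real c * v (Suc x))) v"
    have h: "half_planes \<kappa> w \<sigma> v (Suc x) (Suc (Suc x + m))" using half_planes_mono[OF hp(1), of "Suc x" \<kappa>] m by simp
    have R: "norm (?R c) \<le> rayint_const \<kappa> B m * (1 + c) powr (-1/2)" if "0 \<le> c" for c
      by (rule rayint_bound[OF h hp(2) B(1) _ that]) (use B m in auto)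
    have contR: "continuous_on {0..} ?R" by (rule rayint_continuous_on_ray[OF h hp(2)])
    show ?thesis
    proof (rule tendsto_at_left_sequentially[of 0])
      fix T :: "nat \<Rightarrow> real" assume T: "\<And>n. T n < 1" "\<And>n. 0 < T n" "T \<longlonglongrightarrow> 1"
      define f where "f = (\<lambda>n c. (1 - of_real (T n)) * (v (Suc x) * ?R c / (1 + of_real c * v (Suc x) - of_real (T n))))"
      have den: "1 - T n + c \<le> norm (1 + of_real c * v (Suc x) - of_real (T n))" for n c
        using complex_Re_le_cmod[of "1 + of_real c * v (Suc x) - of_real (T n)"] p by simp
      have pos: "0 < 1 - T n + c" if "0 \<le> c" for n c using T(1)[of n] that by simp
      have nz: "1 + of_real c * v (Suc x) - of_real (T n) \<noteq> 0" if "0 \<le> c" for n c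
        using den[of n c] pos[OF that, of n] by auto
      have "(\<lambda>n. LINT c:{0..}|lborel. f n c) \<longlonglongrightarrow> 0"
      proof (rule ray_integral_tendsto_0)
        show "continuous_on {0..} (f n)" for n
          unfolding f_def by (intro continuous_intros contR) (use nz in auto)
        fix n and c :: real assume c: "0 \<le> c"
        have "(1 - T n) * (1 + c) \<le> 1 - T n + c"
          using mult_right_mono[of "1 - T n" 1 c] T(2)[of n] c by (simp add: algebra_simps)
        also have "\<dots> \<le> norm (1 + of_real c * v (Suc x) - of_real (T n))" by (rule den)
        finally have "norm (v (Suc x) * ?R c / (1 + of_real c * v (Suc x) - of_real (T n)))
            \<le> B * rayint_const \<kappa> B m / (1 - T n) * (1 + c) powr (-3/2)"
          using T(1)[of n] B xy c by (intro ray_integrand_bound R rayint_const_nonneg hp(2)) auto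
        then have "(1 - T n) * norm (v (Suc x) * ?R c / (1 + of_real c * v (Suc x) - of_real (T n)))
            \<le> (1 - T n) * (B * rayint_const \<kappa> B m / (1 - T n) * (1 + c) powr (-3/2))"
          using T(1)[of n] by (intro mult_left_mono) auto
        also have "\<dots> = B * rayint_const \<kappa> B m * (1 + c) powr (-3/2)" using T(1)[of n] by simp
        also have "(1 - T n) * norm (v (Suc x) * ?R c / (1 + of_real c * v (Suc x) - of_real (T n))) = norm (f n c)"
        proof -
          have "norm (1 - of_real (T n) :: complex) = 1 - T n"
            using T(1)[of n] norm_of_real[of "1 - T n", where 'a = complex] by simp
          then show ?thesis by (simp only: f_def norm_mult)
        qed
        finally show "norm (f n c) \<le> B * rayint_const \<kappa> B m * (1 + c) powr (-3/2)" .
      next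
        fix c :: real assume c: "0 < c"
        have v0: "v (Suc x) \<noteq> 0" using p by auto
        have "(\<lambda>n. f n c) \<longlonglongrightarrow> (1 - of_real 1) * (v (Suc x) * ?R c / (1 + of_real c * v (Suc x) - of_real 1))"
          unfolding f_def by (intro tendsto_intros T(3)) (use c v0 in auto)
        then show "(\<lambda>n. f n c) \<longlonglongrightarrow> 0" by simp
      qed
      then have "(\<lambda>n. inv_2pi_i * (LINT c:{0..}|lborel. f n c)) \<longlonglongrightarrow> inv_2pi_i * 0"
        by (intro tendsto_mult tendsto_const)
      moreover have "(\<sigma> y - of_real (T n)) * rayint (y - Suc x) x (\<sigma>(x := of_real (T n))) v = inv_2pi_i * (LINT c:{0..}|lborel. f n c)" for n
      proof -
        have R: "rayint m (Suc x) ((\<sigma>(x := of_real (T n)))(Suc x := (\<sigma>(x := of_real (T n))) (Suc x) + of_real c * v (Suc x))) v = ?R c" for c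
          by (rule rayint_cong) auto
        have "y - Suc x = Suc m" using m by simp
        then show ?thesis unfolding f_def set_integral_mult_right using \<sigma> p R by simp
      qed
      ultimately show "(\<lambda>n. (\<sigma> y - of_real (T n)) * rayint (y - Suc x) x (\<sigma>(x := of_real (T n))) v) \<longlonglongrightarrow> 0"
        by simp
    qed simp
  qed
qed

section \<open>The explicit formula for the inverse sequence\<close>

text \<open>Sending s_x, s_y to 0, 1 by an affine map leaves \<open>a\<close> unchanged, since it
  has degree 0. One detour path, with arcs lower than every nonreal point, then computes M for all
  chains of nonzero weight, and the weighted sum is the end value of the telescoping.\<close>

lemma M_chain_sum:
  fixes s v :: "nat \<Rightarrow> complex" and x y :: nat
  defines "a \<equiv> (\<lambda>k l. (s l - s k) * rayint (l - Suc k) k s v)"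
  assumes xy: "Suc x < y" and S: "s x \<noteq> s y"
    and step: "\<And>k. x \<le> k \<Longrightarrow> k < y \<Longrightarrow> s (Suc k) - s k = v (Suc k)"
    and nz: "\<And>k. x < k \<Longrightarrow> k \<le> y \<Longrightarrow> v k \<noteq> 0"
    and D: "\<And>k. x < k \<Longrightarrow> k < y \<Longrightarrow> \<not> (\<exists>r>0. v k / v (k + 1) = of_real r)"
  shows "(\<Sum>q\<in>chains x y. M_chain s q * chain_prod a q) = 0"
proof -
  define S where "S = s y - s x"
  define \<sigma> where "\<sigma> = (\<lambda>k. (s k - s x) / S)"
  have S0: "S \<noteq> 0" using S by (simp add: S_def)
  have \<sigma>x: "\<sigma> x = 0" and \<sigma>y: "\<sigma> y = 1" using S0 by (auto simp: \<sigma>_def S_def)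
  have \<sigma>step: "\<sigma> (Suc k) - \<sigma> k = v (Suc k) / S" if "x \<le> k" "k < y" for k
    using step[OF that] by (simp add: \<sigma>_def diff_divide_distrib[symmetric])
  have "\<exists>\<kappa> w d. 0 < \<kappa> \<and> half_planes \<kappa> w \<sigma> ((\<lambda>k. v k / S)(x := d)) x y"
  proof (rule half_planes_exist[where s = \<sigma> and v = "\<lambda>k. v k / S", OF \<sigma>step])
    fix k assume "x < k" "k < y"
    then show "\<not> (\<exists>r>0. v k / S / (v (k + 1) / S) = of_real r)" using D[of k] S0 by simp
  qed (use nz S0 in auto)
  then obtain \<kappa> w d where \<kappa>: "0 < \<kappa>" "half_planes \<kappa> w \<sigma> ((\<lambda>k. v k / S)(x := d)) x y" by blast
  define V where "V = (\<lambda>k. v k / S)(x := d)"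
  have hp: "half_planes \<kappa> w \<sigma> V x y" using \<kappa> by (simp add: V_def)
  have Vx: "V (Suc x) = \<sigma> (Suc x)" using \<sigma>step[of x] \<sigma>x xy by (simp add: V_def)
  define A where "A = {t. 0 < t \<and> t < 1 \<and> (\<exists>j. x < j \<and> j < y \<and> \<sigma> j = of_real t)}"
  have "A \<subseteq> (\<lambda>j. Re (\<sigma> j)) ` {x<..<y}"
  proof
    fix t assume "t \<in> A"
    then obtain j where "x < j" "j < y" "\<sigma> j = of_real t" by (auto simp: A_def)
    then show "t \<in> (\<lambda>j. Re (\<sigma> j)) ` {x<..<y}" by (intro image_eqI[of _ _ j]) auto
  qed
  then have finA: "finite A" by (rule finite_subset) simp
  obtain \<delta> where \<delta>: "0 < \<delta>" "\<forall>j\<in>{x<..<y}. 0 < \<bar>Im (\<sigma> j)\<bar> \<longrightarrow> \<delta> < \<bar>Im (\<sigma> j)\<bar>"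
    using finite_positive_bound[of "{x<..<y}" "\<lambda>j. \<bar>Im (\<sigma> j)\<bar>"] by auto
  obtain e where e: "0 < e" "\<forall>t\<in>A. 0 < min t (1 - t) \<longrightarrow> e < min t (1 - t)"
    using finite_positive_bound[OF finA, of "\<lambda>t. min t (1 - t)"] by blast
  \<comment> \<open>The points of \<open>A\<close> have distance more than \<open>e\<close> from 0
    and 1, so arcs of radius below \<rho> stay between \<rho> and 1 - \<rho>; the bound 1/4 keeps
    \<rho> below 1/2.\<close>
  define \<rho> where "\<rho> = min (e / 2) (1 / 4)"
  have \<rho>: "0 < \<rho>" "\<rho> < 1/2" using e by (auto simp: \<rho>_def)
  have \<rho>A: "2 * \<rho> \<le> t \<and> t \<le> 1 - 2 * \<rho>" if "t \<in> A" for t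
  proof -
    have "e < min t (1 - t)" using e(2) that by (auto simp: A_def)
    moreover have "2 * \<rho> \<le> e" by (simp add: \<rho>_def)
    ultimately show ?thesis by auto
  qed
  have "eventually (\<lambda>r. r < min \<delta> \<rho>) (at_right 0)"
    using \<delta> \<rho> by (auto simp: eventually_at_right_field intro!: exI[of _ "min \<delta> \<rho>"])
  then have "eventually (\<lambda>r. separated A r \<and> r < min \<delta> \<rho>) (at_right 0)"
    using eventually_separated[OF finA] by (rule eventually_elim2) auto
  then obtain r where r: "separated A r" "r < \<delta>" "r < \<rho>"
    using eventually_happens'[OF trivial_limit_at_right_real] by fastforce
  have \<rho>': "\<rho> \<le> t - r \<and> t + r \<le> 1 - \<rho>" if "t \<in> A" for t using \<rho>A[OF that] r by auto
  interpret unit_path "detour_path A r" "detour_path_deriv A r" "{0, 1} \<union> (\<Union>a\<in>A. {a - r, a + r})" "1 + 3 * real (card A)" \<rho>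
    by (rule unit_path_detour_path) (use r \<rho> \<rho>' in auto)
  have rIm: "r < \<bar>Im (\<sigma> j)\<bar>" if "x < j" "j < y" "0 < \<bar>Im (\<sigma> j)\<bar>" for j using \<delta>(2) that r by force
  obtain v' \<kappa>' where v': "0 < \<kappa>'" "\<kappa>' \<le> \<kappa>" "half_planes \<kappa>' w \<sigma> v' x y" "\<forall>k. k \<noteq> Suc x \<longrightarrow> v' k = V k"
    "\<forall>u c. 0 \<le> u \<longrightarrow> u < 1 \<longrightarrow> 0 \<le> c \<longrightarrow> detour_path A r u \<noteq> \<sigma> (Suc x) + of_real c * v' (Suc x)"
    "(\<forall>c\<ge>0. 1 \<noteq> \<sigma> (Suc x) + of_real c * v' (Suc x)) \<or> (\<sigma> (Suc x) = 1 \<and> Re (v' (Suc x)) = 1)"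
    using exists_tilted_direction[OF hp \<kappa>(1) xy \<sigma>x Vx r(1) A_def rIm \<rho> \<rho>'] by blast
  define b where "b = (\<lambda>k l. (\<sigma> l - \<sigma> k) * rayint (l - Suc k) k \<sigma> V)"
  have "(\<Sum>q\<in>chains x y. chain_prod b q * chain_integral \<sigma> q (length q - 2) 1) = 0"
    unfolding b_def
  proof (rule sum_chain_integrals_1[OF _ \<sigma>x \<sigma>y _ v'(3,1)])
    show "x < y" using xy by simp
    show "half_planes \<kappa>' w \<sigma> V x y" using half_planes_mono[OF hp _ v'(2)] by simp
    show "\<exists>\<kappa> w d. half_planes \<kappa> w (\<sigma>(x := detour_path A r u)) (v'(x := d)) x y \<and> 0 < \<kappa>" if "0 \<le> u" "u < 1" for u
      by (rule half_planes_base[OF v'(3,1) xy]) (use v'(5) that in auto)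
    show "detour_path A r u \<noteq> \<sigma> l" if "x < l" "l < y" "0 < u" "u < 1" for l u
    proof (rule detour_path_avoids(1)[OF r(1,2)])
      show "Im (\<sigma> l) = 0" if "\<bar>Im (\<sigma> l)\<bar> < \<delta>"
        using \<delta>(2) that \<open>x < l\<close> \<open>l < y\<close> by force
      show "t \<in> A" if "\<sigma> l = of_real t" "0 < t" "t < 1" for t
        using that \<open>x < l\<close> \<open>l < y\<close> by (auto simp: A_def)
    qed (use upper[of u] that in auto)
    have "((\<lambda>u. (\<sigma> y - of_real u) * rayint (y - Suc x) x (\<sigma>(x := of_real u)) v') \<longlongrightarrow> 0) (at_left 1)"
      by (rule scaled_rayint_tendsto_0[OF v'(3,1) xy \<sigma>y v'(6)])
    moreover have "eventually (\<lambda>u. (\<sigma> y - of_real u) * rayint (y - Suc x) x (\<sigma>(x := of_real u)) v'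
       = (\<sigma> y - detour_path A r u) * rayint (y - Suc x) x (\<sigma>(x := detour_path A r u)) v') (at_left 1)"
      using \<rho> finish by (auto simp: eventually_at_left_field intro!: exI[of _ "1 - \<rho>"])
    ultimately show "((\<lambda>u. (\<sigma> y - detour_path A r u) * rayint (y - Suc x) x (\<sigma>(x := detour_path A r u)) v') \<longlongrightarrow> 0) (at_left 1)"
      by (rule Lim_transform_eventually)
  qed (use v'(4) in auto)
  moreover have "M_chain s q * chain_prod a q = 2 * of_real pi * \<i> * (chain_prod b q * chain_integral \<sigma> q (length q - 2) 1)"
    if q: "q \<in> chains x y" for q
  proof -
    have ab: "chain_prod a q = chain_prod b q"
    proof (rule chain_prod_cong[OF q])
      fix k l assume kl: "x \<le> k" "k < l" "l \<le> y"
      have "rayint (l - Suc k) k s v = rayint (l - Suc k) k (\<lambda>k. S * \<sigma> k + s x) (\<lambda>k. S * V k)"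
        by (rule rayint_cong) (use S0 kl in \<open>auto simp: \<sigma>_def V_def\<close>)
      also have "\<dots> = rayint (l - Suc k) k \<sigma> V / S" by (rule rayint_affine[OF S0])
      also have "(s l - s k) * (rayint (l - Suc k) k \<sigma> V / S) = b k l"
      proof -
        have "\<sigma> l - \<sigma> k = (s l - s k) / S" by (simp add: \<sigma>_def diff_divide_distrib)
        then show ?thesis by (simp only: b_def times_divide_eq_left times_divide_eq_right)
      qed
      finally show "a k l = b k l" by (simp add: a_def)
    qed
    show ?thesis
    proof (cases "chain_prod a q = 0 \<or> length q = 2")
      \<comment> \<open>Without inner points M is the constant 2 pi i and the empty iterated
        integral is 1; chains of weight zero contribute 0 on both sides.\<close>
      case True
      then show ?thesis using ab by (auto simp: numeral_2_eq_2)
    next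
      case False
      define k where "k = length q - 1"
      have ends: "q ! 0 = x" "q ! k = y" using q by (auto simp: chains_def hd_conv_nth last_conv_nth k_def)
      have "q \<noteq> []" using q by (auto simp: chains_def)
      then have k: "length q = Suc k" by (simp add: k_def)
      moreover have "k \<noteq> 0" using ends xy by (intro notI) auto
      ultimately have k2: "2 \<le> k" using False by auto
      have mid: "x < q ! i" "q ! i < y" if "i \<in> {1..<k}" for i
        using chains_nth[OF q, of i] that k by auto
      have a0: "s k \<noteq> s j" if "a k j \<noteq> 0" for k j using that by (auto simp: a_def)
      have "s (q ! 0) \<noteq> s (q ! 1)"
        using chain_prod_chain_nonzero[where s = s and i = 1, OF q _ _ _ a0] False k k2 by auto
      then have first: "\<sigma> (q ! 1) \<noteq> 0" using S0 ends by (auto simp: \<sigma>_def)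
      have "s (q ! (k - 1)) \<noteq> s (q ! k)"
        using chain_prod_chain_nonzero[where s = s and i = k, OF q _ _ _ a0] False k k2 by auto
      then have last: "\<sigma> (q ! (k - 1)) \<noteq> 1" using S0 ends by (auto simp: \<sigma>_def S_def)
      have "M_chain s q = 2 * of_real pi * \<i> * nested_integral (form (\<lambda>i. \<sigma> (q ! i))) (k - 1) 1"
      proof (rule M_chain_eq[OF k k2 ends(1) _ S0 _ first last r(1) _ r(2) _ \<rho>])
        show "S = s (q ! k) - s x" using ends by (simp add: S_def)
        show "t \<in> A" if "i \<in> {1..<k}" "\<sigma> (q ! i) = of_real t" "0 < t" "t < 1" for i t
          using that mid[OF that(1)] by (auto simp: A_def)
        show "Im (\<sigma> (q ! i)) = 0" if "i \<in> {1..<k}" "\<bar>Im (\<sigma> (q ! i))\<bar> < \<delta>" for i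
          using \<delta>(2) mid[OF that(1)] that(2) by force
      qed (use \<rho>A r in \<open>auto simp: \<sigma>_def\<close>)
      moreover have "length q - 2 = k - 1" using k by simp
      ultimately show ?thesis by (simp add: ab chain_integral_def)
    qed
  qed
  ultimately show ?thesis by (simp add: sum_distrib_left[symmetric])
qed

lemma J_fun_eq_rayint:
  assumes n: "1 \<le> n" and z: "\<And>i. i \<in> {1..n} \<Longrightarrow> z i \<noteq> 0"
    and D: "\<And>i. i \<in> {1..<n} \<Longrightarrow> \<not> (\<exists>r>0. z i / z (i + 1) = of_real r)"
  shows "J_fun n z = psum z n * rayint (n - 1) 0 (psum z) z"
proof -
  define a where "a = (\<lambda>k l. (psum z l - psum z k) * rayint (l - Suc k) k (psum z) z)"
  have step: "psum z (Suc k) - psum z k = z (Suc k)" for k using psum_diff[of "Suc k" z] by simp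
  have "J_fun n z = a 0 n"
  proof (rule J_fun_eq_residue[where a = a and z = z, OF n z D])
    fix x y assume xy: "x < y" "y \<le> n"
    show "a x y = 0" if "psum z x = psum z y" using that by (simp add: a_def)
    assume ne: "psum z x \<noteq> psum z y"
    show "(\<Sum>r\<in>chains x y. M_chain (psum z) r * chain_prod a r) = (if y = Suc x then 1 else 0)"
    proof (cases "y = Suc x")
      case True
      have "chains x (Suc x) = {[x, Suc x]}"
      proof -
        have "(\<Sum>q\<in>chains x (Suc x). f q) = f [x, Suc x]" for f :: "nat list \<Rightarrow> nat"
          using sum_chains_snoc[of x "Suc x" "\<lambda>q. of_nat (f q)"] by (simp add: chains_refl flip: of_nat_sum)
        \<comment> \<open>Counting the other chains: their indicator sums to its value at
          \<open>[x, Suc x]\<close>, which is 0.\<close>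
        from this[of "\<lambda>q. if q = [x, Suc x] then 0 else 1"] have "\<forall>q\<in>chains x (Suc x). q = [x, Suc x]"
          by (auto simp: finite_chains split: if_splits)
        moreover have "[x, Suc x] \<in> chains x (Suc x)" by (simp add: chains_def)
        ultimately show ?thesis by blast
      qed
      moreover have "a x (Suc x) = inv_2pi_i" using ne True by (simp add: a_def)
      ultimately show ?thesis using True by (simp add: inv_2pi_i_def)
    next
      case False
      show ?thesis
        using M_chain_sum[of x y "psum z" z, folded a_def] False xy ne step z D by auto
    qed
  qed auto
  then show ?thesis using n by (simp add: a_def psum_def)
qed

text \<open>The partial sums of a block are those of \<open>z\<close>, shifted in index and
  translated by \<open>psum z i\<close>; the ray integral is invariant under both.\<close>

lemma J_fun_block_eq_rayint:
  assumes i: "i < n" and z: "\<And>i. i \<in> {1..n} \<Longrightarrow> z i \<noteq> 0"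
    and D: "\<And>i. i \<in> {1..<n} \<Longrightarrow> \<not> (\<exists>r>0. z i / z (i + 1) = of_real r)"
  shows "J_fun (n - i) (block z i) = (psum z n - psum z i) * rayint (n - Suc i) i (psum z) z"
proof -
  have ps: "psum (block z i) k = psum z (i + k) - psum z i" for k
    by (induction k) (auto simp: psum_def block_def)
  have "J_fun (n - i) (block z i) = psum (block z i) (n - i) * rayint (n - i - 1) 0 (psum (block z i)) (block z i)"
  proof (rule J_fun_eq_rayint)
    show "\<not> (\<exists>r>0. block z i j / block z i (j + 1) = of_real r)" if "j \<in> {1..<n - i}" for j
    proof -
      have "i + j \<in> {1..<n}" using that by auto
      from D[OF this] show ?thesis by (simp add: block_def)
    qed
  qed (use i z in \<open>auto simp: block_def\<close>)
  also have "rayint (n - i - 1) 0 (psum (block z i)) (block z i)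
      = rayint (n - Suc i) 0 (\<lambda>k. 1 * psum z (i + k) + - psum z i) (\<lambda>k. 1 * z (i + k))"
  proof -
    have "n - i - 1 = n - Suc i" by simp
    then show ?thesis by (simp only:) (rule rayint_cong, simp only: ps, simp_all add: block_def)
  qed
  also have "\<dots> = rayint (n - Suc i) 0 (\<lambda>k. psum z (i + k)) (\<lambda>k. z (i + k))"
    by (subst rayint_affine) auto
  also have "\<dots> = rayint (n - Suc i) i (psum z) z"
    using rayint_index_shift[of "n - Suc i" 0 "psum z" i z] by simp
  finally show ?thesis using i by (simp add: ps)
qed

section \<open>Continuity and the differential equation on the domain\<close>

lemma coord_psum_bounded_linear:
  "bounded_linear (\<lambda>p::complex ^ 'n::{finite,linorder}. psum (coord p) k)"
  unfolding psum_def coord_def by (intro bounded_linear_sum bounded_linear_vec_nth)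

lemma coord_isCont: "isCont (\<lambda>p::complex ^ 'n::{finite,linorder}. coord p k) q"
  unfolding coord_def by (intro continuous_intros)

lemma coord_psum_isCont: "isCont (\<lambda>p::complex ^ 'n::{finite,linorder}. psum (coord p) k) q"
  by (rule linear_continuous_at[OF coord_psum_bounded_linear])

lemma coord_psum_has_derivative:
  "((\<lambda>p::complex ^ 'n::{finite,linorder}. psum (coord p) k) has_derivative (\<lambda>h. psum (coord h) k)) F"
  by (rule bounded_linear_imp_has_derivative[OF coord_psum_bounded_linear])

lemma coord_psum_scale: "psum (coord (c *s h)) k = c * psum (coord h) k"
  by (simp add: psum_def coord_def sum_distrib_left)

lemma sum_eq_psum_diff: "i \<le> n \<Longrightarrow> (\<Sum>m=i+1..n. f m) = psum f n - psum f i"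
  unfolding psum_def by (induction n rule: dec_induct) auto

lemma D_dom_half_planes:
  assumes "(z :: complex ^ 'n::{finite,linorder}) \<in> D_dom"
  shows "\<exists>\<kappa> w d. 0 < \<kappa> \<and> half_planes \<kappa> w (psum (coord z)) ((coord z)(0 := d)) 0 CARD('n)"
proof (rule half_planes_exist)
  show "psum (coord z) (Suc k) - psum (coord z) k = coord z (Suc k)" for k
    using psum_diff[of "Suc k" "coord z"] by simp
qed (use assms in \<open>auto simp: D_dom_def\<close>)

text \<open>A form negative on z_i and positive on z_(i+1) forbids a positive quotient. As the half
  plane conditions are open, a neighbourhood of a point of the domain stays in the domain, and the
  integral formula can be differentiated there.\<close>

lemma half_planes_D_dom:
  assumes hp: "half_planes \<kappa> w (psum (coord p)) ((coord p)(0 := d)) 0 CARD('n)" "0 < \<kappa>"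
  shows "(p :: complex ^ 'n::{finite,linorder}) \<in> D_dom"
proof -
  have h: "\<kappa> \<le> Re (w k * coord p (Suc k))" "0 < k \<Longrightarrow> Re (w k * coord p k) \<le> - \<kappa>" if "k < CARD('n)" for k
  proof -
    have e: "psum (coord p) (Suc k) - psum (coord p) k = coord p (Suc k)"
      using psum_diff[of "Suc k" "coord p"] by simp
    have "\<kappa> \<le> Re (w k * (psum (coord p) (Suc k) - psum (coord p) k)) \<and> Re (w k * ((coord p)(0 := d)) k) \<le> - \<kappa>"
      using hp(1) that unfolding half_planes_def by (meson atLeastLessThan_iff le0)
    then show "\<kappa> \<le> Re (w k * coord p (Suc k))" "0 < k \<Longrightarrow> Re (w k * coord p k) \<le> - \<kappa>"
      unfolding e by simp_all
  qed
  have "coord p i \<noteq> 0" if "i \<in> {1..CARD('n)}" for i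
    using h(1)[of "i - 1"] that hp(2) by (cases i) (auto simp: Suc_le_eq)
  moreover have "\<not> (\<exists>r>0. coord p i / coord p (i + 1) = of_real r)" if i: "i \<in> {1..<CARD('n)}" for i
  proof
    assume "\<exists>r>0. coord p i / coord p (i + 1) = of_real r"
    then obtain r where r: "0 < r" "coord p i / coord p (i + 1) = of_real r" by blast
    have "coord p (i + 1) \<noteq> 0" using h(1)[of i] i hp(2) by auto
    then have "w i * coord p i = of_real r * (w i * coord p (Suc i))" using r(2) by (simp add: field_simps)
    moreover have "Re (of_real r * c) = r * Re c" for c by simp
    ultimately have "Re (w i * coord p i) = r * Re (w i * coord p (Suc i))" by (simp only:)
    moreover have "0 < r * Re (w i * coord p (Suc i))" using r(1) h(1)[of i] i hp(2) by (intro mult_pos_pos) auto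
    moreover have "Re (w i * coord p i) \<le> - \<kappa>" using h(2)[of i] i by auto
    ultimately show False using hp(2) by linarith
  qed
  ultimately show ?thesis unfolding D_dom_def by blast
qed

text \<open>Index 0 is no coordinate of \<open>z\<close>; the free value \<open>d\<close>
  accommodates the direction at the base point in \<open>D_dom_half_planes\<close>.\<close>

lemma J_vec_eq_rayint:
  assumes "(z :: complex ^ 'n::{finite,linorder}) \<in> D_dom"
  shows "J_vec z = psum (coord z) CARD('n) * rayint (CARD('n) - 1) 0 (psum (coord z)) ((coord z)(0 := d))"
proof -
  have "J_vec z = psum (coord z) CARD('n) * rayint (CARD('n) - 1) 0 (psum (coord z)) (coord z)"
    unfolding J_vec_def by (rule J_fun_eq_rayint) (use assms in \<open>auto simp: D_dom_def Suc_le_eq\<close>)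
  also have "rayint (CARD('n) - 1) 0 (psum (coord z)) (coord z) = rayint (CARD('n) - 1) 0 (psum (coord z)) ((coord z)(0 := d))"
    by (rule rayint_cong) auto
  finally show ?thesis .
qed

lemma continuous_on_J_vec: "continuous_on (D_dom :: (complex ^ 'n::{finite,linorder}) set) J_vec"
proof -
  let ?G = "\<lambda>z::complex ^ 'n::{finite,linorder}. psum (coord z) CARD('n) * rayint (CARD('n) - 1) 0 (psum (coord z)) ((coord z)(0 := 0))"
  have "isCont ?G z" if z: "z \<in> D_dom" for z :: "complex ^ 'n::{finite,linorder}"
  proof -
    obtain \<kappa> w d where h: "0 < \<kappa>" "half_planes \<kappa> w (psum (coord z)) ((coord z)(0 := d)) 0 CARD('n)"
      using D_dom_half_planes[OF z] by blast
    have h': "half_planes \<kappa> w (psum (coord z)) ((coord z)(0 := d)) 0 (Suc (0 + (CARD('n) - 1)))" using h(2) by simp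
    have "isCont (\<lambda>z::complex ^ 'n::{finite,linorder}. rayint (CARD('n) - 1) 0 (psum (coord z)) ((coord z)(0 := d))) z"
    proof (rule rayint_isCont[where P = "\<lambda>z. psum (coord z)" and Q = "\<lambda>z. (coord z)(0 := d)", OF h' h(1)])
      show "isCont (\<lambda>z::complex ^ 'n::{finite,linorder}. ((coord z)(0 := d)) k) z" for k by (cases "k = 0") (auto intro: coord_isCont)
    qed (rule coord_psum_isCont)
    moreover have "rayint (CARD('n) - 1) 0 (psum (coord z)) ((coord z)(0 := d)) = rayint (CARD('n) - 1) 0 (psum (coord z)) ((coord z)(0 := 0))"
      for z :: "complex ^ 'n::{finite,linorder}" by (rule rayint_cong) auto
    ultimately show ?thesis by (intro isCont_mult coord_psum_isCont) simp
  qed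
  then have "continuous_on D_dom ?G" by (intro continuous_at_imp_continuous_on) blast
  then show ?thesis by (rule continuous_on_eq) (rule J_vec_eq_rayint[symmetric])
qed

text \<open>The hyperplanes concern sums of at least two coordinates; a single coordinate is nonzero
  by membership in \<open>D_dom\<close>.\<close>

lemma psum_distinct:
  assumes "(z :: complex ^ 'n::{finite,linorder}) \<in> D_dom - H_union" "i < j" "j \<le> CARD('n)"
  shows "psum (coord z) i \<noteq> psum (coord z) j"
proof -
  have "(\<Sum>m=i+1..j. coord z m) \<noteq> 0"
  proof (cases "j = i + 1")
    case True
    then show ?thesis using assms by (auto simp: D_dom_def)
  next
    case False
    then show ?thesis using assms by (auto simp: H_union_def H_plane_def)
  qed
  then show ?thesis using sum_eq_psum_diff[of i j "coord z"] assms(2) by auto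
qed

lemma dlog_ratio:
  fixes z :: "complex ^ 'n::{finite,linorder}"
  assumes z: "z \<in> D_dom - H_union" and i: "i \<in> {1..<CARD('n)}"
  defines "s \<equiv> psum (coord z)"
  shows "dlog (\<lambda>w. (\<Sum>m=i+1..CARD('n). coord w m) / (\<Sum>m=1..i. coord w m)) z h
    = (psum (coord h) CARD('n) * s i - s CARD('n) * psum (coord h) i) / (s i * (s CARD('n) - s i))"
proof -
  have ne: "s i \<noteq> 0" "s CARD('n) - s i \<noteq> 0"
    using psum_distinct[OF z, of 0 i] psum_distinct[OF z, of i "CARD('n)"] i by (auto simp: s_def psum_def)
  have f: "(\<lambda>w::complex ^ 'n::{finite,linorder}. (\<Sum>m=i+1..CARD('n). coord w m) / (\<Sum>m=1..i. coord w m))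
     = (\<lambda>w. (psum (coord w) CARD('n) - psum (coord w) i) / psum (coord w) i)"
    using i sum_eq_psum_diff[of i "CARD('n)"] by (simp add: psum_def)
  have "((\<lambda>w::complex ^ 'n::{finite,linorder}. (psum (coord w) CARD('n) - psum (coord w) i) / psum (coord w) i) has_derivative
     (\<lambda>h. ((psum (coord h) CARD('n) - psum (coord h) i) * s i - (s CARD('n) - s i) * psum (coord h) i) / (s i * s i))) (at z)"
    unfolding s_def by (intro has_derivative_divide' has_derivative_diff coord_psum_has_derivative) (use ne s_def in auto)
  from frechet_derivative_at[OF this, symmetric] ne show ?thesis
    unfolding dlog_def f by (simp add: s_def[symmetric] field_simps)
qed

text \<open>Near \<open>z\<close> the directions may be frozen at those of \<open>z\<close> by
  \<open>rayint_directions\<close>, so only the points vary and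
  \<open>scaled_rayint_has_derivative\<close> applies with the derivatives of s_k / s_n.\<close>

lemma J_vec_has_derivative:
  fixes z :: "complex ^ 'n::{finite,linorder}"
  assumes z: "z \<in> D_dom - H_union"
  defines "s \<equiv> psum (coord z)"
  shows "(J_vec has_derivative
    (\<lambda>h. \<Sum>i\<in>{1..<CARD('n)}. J_fun i (coord z) * J_fun (CARD('n) - i) (block (coord z) i) *
       ((psum (coord h) CARD('n) * s i - s CARD('n) * psum (coord h) i) / (s i * (s CARD('n) - s i))))) (at z)"
proof -
  let ?n = "CARD('n)"
  let ?S = "\<lambda>p::complex ^ 'n::{finite,linorder}. psum (coord p)"
  have zD: "z \<in> D_dom" using z by simp
  have n: "Suc (0 + (?n - 1)) = ?n" by simp
  have s0: "?S p 0 = 0" for p by (simp add: psum_def)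
  have s_0: "s 0 = 0" by (simp add: s_def psum_def)
  have ne: "s ?n \<noteq> 0" using psum_distinct[OF z, of 0 ?n] by (auto simp: s_def psum_def)
  obtain \<kappa> w d where h: "0 < \<kappa>" "half_planes \<kappa> w (?S z) ((coord z)(0 := d)) 0 ?n"
    using D_dom_half_planes[OF zD] by blast
  let ?v = "\<lambda>p::complex ^ 'n::{finite,linorder}. (coord p)(0 := d)"
  let ?F = "\<lambda>p. (?S p (Suc (0 + (?n - 1))) - ?S p 0) * rayint (?n - 1) 0 (?S p) (?v z)"
  have dF: "(?F has_derivative (\<lambda>h. \<Sum>k=Suc 0..0+(?n - 1). - ((?S z (Suc (0 + (?n - 1))) - ?S z 0)\<^sup>2 *
        (rayint (k - Suc 0) 0 (?S z) (?v z) * rayint (0 + (?n - 1) - k) k (?S z) (?v z))) *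
        (((psum (coord h) k - 0) * (?S z ?n - 0) - (?S z k - 0) * (psum (coord h) ?n - 0)) / ((?S z ?n - 0) * (?S z ?n - 0))))) (at z)"
  proof (rule scaled_rayint_has_derivative[where S = ?S])
    show "half_planes \<kappa> w (?S z) (?v z) 0 (Suc (0 + (?n - 1)))" using h(2) n by simp
    show "((\<lambda>p. (?S p k - ?S p 0) / (?S p (Suc (0 + (?n - 1))) - ?S p 0)) has_derivative
       (\<lambda>h. ((psum (coord h) k - 0) * (?S z ?n - 0) - (?S z k - 0) * (psum (coord h) ?n - 0)) / ((?S z ?n - 0) * (?S z ?n - 0)))) (at z)" for k
      unfolding n s0
      by (intro has_derivative_divide' has_derivative_diff coord_psum_has_derivative has_derivative_const) (use ne s_def in auto)
  qed (use h(1) ne s0 s_def in \<open>auto intro: coord_psum_isCont\<close>)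
  have ev: "eventually (\<lambda>p. ?F p = J_vec p) (nhds z)"
  proof -
    have S: "((\<lambda>p. ?S p k) \<longlongrightarrow> ?S z k) (nhds z)" for k by (intro isCont_tendsto_nhds coord_psum_isCont)
    have "eventually (\<lambda>p. half_planes (\<kappa>/2) w (?S p) (?v z) 0 ?n) (nhds z)"
      by (rule half_planes_eventually[OF h(2), where S = ?S]) (use S h(1) in auto)
    moreover have "eventually (\<lambda>p. half_planes (\<kappa>/2) w (?S p) (?v p) 0 ?n) (nhds z)"
    proof (rule half_planes_eventually[OF h(2), where S = ?S])
      show "((\<lambda>p. ?v p k) \<longlongrightarrow> ?v z k) (nhds z)" for k
        by (cases "k = 0") (auto intro: isCont_tendsto_nhds coord_isCont)
    qed (use S h(1) in auto)
    ultimately show ?thesis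
    proof eventually_elim
      case (elim p)
      have "p \<in> D_dom" using half_planes_D_dom[OF elim(2)] h(1) by simp
      then have "J_vec p = ?S p ?n * rayint (?n - 1) 0 (?S p) (?v p)" by (rule J_vec_eq_rayint)
      also have "rayint (?n - 1) 0 (?S p) (?v p) = rayint (?n - 1) 0 (?S p) (?v z)"
        by (rule rayint_directions[of "\<kappa>/2" w]) (use elim h(1) n in auto)
      finally show ?case unfolding n s0 by simp
    qed
  qed
  have "eventually (\<lambda>p. ?F p = J_vec p) (at z)"
    using ev by (auto simp: eventually_at_filter elim: eventually_mono)
  from has_derivative_transform_eventually[OF dF this eventually_nhds_x_imp_x[OF ev] UNIV_I]
  show ?thesis
  proof (rule has_derivative_eq_rhs, intro ext sum.cong)
    show "{Suc 0..0 + (?n - 1)} = {1..<?n}" by auto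
    fix h :: "complex ^ 'n::{finite,linorder}" and i assume i: "i \<in> {1..<?n}"
    have ne': "s i \<noteq> 0" "s ?n - s i \<noteq> 0"
      using psum_distinct[OF z, of 0 i] psum_distinct[OF z, of i ?n] i by (auto simp: s_def psum_def)
    have J1: "J_fun i (coord z) = s i * rayint (i - Suc 0) 0 s (?v z)"
    proof -
      have "J_fun i (coord z) = s i * rayint (i - 1) 0 s (coord z)"
        unfolding s_def by (rule J_fun_eq_rayint) (use zD i in \<open>auto simp: D_dom_def\<close>)
      also have "rayint (i - 1) 0 s (coord z) = rayint (i - Suc 0) 0 s (?v z)"
        unfolding One_nat_def by (rule rayint_cong) auto
      finally show ?thesis .
    qed
    have J2: "J_fun (?n - i) (block (coord z) i) = (s ?n - s i) * rayint (0 + (?n - 1) - i) i s (?v z)"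
    proof -
      have "J_fun (?n - i) (block (coord z) i) = (s ?n - s i) * rayint (?n - Suc i) i s (coord z)"
        unfolding s_def by (rule J_fun_block_eq_rayint) (use zD i in \<open>auto simp: D_dom_def\<close>)
      also have "rayint (?n - Suc i) i s (coord z) = rayint (?n - Suc i) i s (?v z)"
        by (rule rayint_cong) auto
      finally show ?thesis by simp
    qed
    show "- ((?S z (Suc (0 + (?n - 1))) - ?S z 0)\<^sup>2 *
        (rayint (i - Suc 0) 0 (?S z) (?v z) * rayint (0 + (?n - 1) - i) i (?S z) (?v z))) *
        (((psum (coord h) i - 0) * (?S z ?n - 0) - (?S z i - 0) * (psum (coord h) ?n - 0)) / ((?S z ?n - 0) * (?S z ?n - 0)))
      = J_fun i (coord z) * J_fun (?n - i) (block (coord z) i) *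
       ((psum (coord h) ?n * s i - s ?n * psum (coord h) i) / (s i * (s ?n - s i)))"
    proof -
      \<comment> \<open>With I = s_i and N = s_n this is the identity - N^2 d(I / N) = I (N - I)
        dlog ((N - I) / I); the factors I and N - I complete the two ray integrals to values of
        J.\<close>
      have alg: "- (N\<^sup>2 * (R * Q)) * ((a * N - I * b) / (N * N)) = I * R * ((N - I) * Q) * ((b * I - N * a) / (I * (N - I)))"
        if "N \<noteq> 0" "I \<noteq> 0" "N - I \<noteq> 0" for N I R Q a b :: complex
      proof -
        have "- (N\<^sup>2 * (R * Q)) * ((a * N - I * b) / (N * N)) = R * Q * (b * I - N * a)"
          using that(1) by (simp add: power2_eq_square field_simps)
        moreover have "I * R * ((N - I) * Q) * ((b * I - N * a) / (I * (N - I))) = R * Q * (b * I - N * a)"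
          using that(2,3) by (simp add: divide_simps) 
        ultimately show ?thesis by simp
      qed
      show ?thesis
        unfolding J1 J2 n s0 diff_zero s_def[symmetric] s_0 diff_zero by (rule alg[OF ne ne'])
    qed
  qed
qed

theorem theorem4p9:
  shows "continuous_on (D_dom :: (complex ^ 'n::{finite,linorder}) set) J_vec
       \<and> holomorphic_several_on J_vec (D_dom - H_union :: (complex ^ 'n::{finite,linorder}) set)
       \<and> (\<forall>z \<in> (D_dom - H_union :: (complex ^ 'n::{finite,linorder}) set).
           (J_vec has_derivative
              (\<lambda>h. \<Sum>i\<in>{1..<CARD('n)}.
                     J_fun i (coord z) * J_fun (CARD('n) - i) (block (coord z) i) *
                     dlog (\<lambda>w. (\<Sum>m=i+1..CARD('n). coord w m) / (\<Sum>m=1..i. coord w m)) z h))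
             (at z))"
proof (intro conjI ballI)
  show "continuous_on (D_dom :: (complex ^ 'n::{finite,linorder}) set) J_vec" by (rule continuous_on_J_vec)
  show "holomorphic_several_on J_vec (D_dom - H_union :: (complex ^ 'n::{finite,linorder}) set)"
    unfolding holomorphic_several_on_def
  proof
    fix z :: "complex ^ 'n::{finite,linorder}" assume z: "z \<in> D_dom - H_union"
    \<comment> \<open>In the explicit derivative the tangent vector enters only through partial sums
      of its coordinates, which are complex linear.\<close>
    show "\<exists>D. (J_vec has_derivative D) (at z within D_dom - H_union) \<and> (\<forall>c h. D (c *s h) = c * D h)"
    proof (rule exI, rule conjI, rule has_derivative_at_withinI[OF J_vec_has_derivative[OF z]], intro allI)
      have scale: "P * ((c * a * I - N * (c * b)) / d) = c * (P * ((a * I - N * b) / d))" for P N I a b c d :: complex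
      proof -
        have "c * a * I - N * (c * b) = c * (a * I - N * b)" by (simp add: algebra_simps)
        then show ?thesis by simp
      qed
      show "(\<Sum>i\<in>{1..<CARD('n)}. J_fun i (coord z) * J_fun (CARD('n) - i) (block (coord z) i) *
          ((psum (coord (c *s h)) CARD('n) * psum (coord z) i - psum (coord z) CARD('n) * psum (coord (c *s h)) i) /
           (psum (coord z) i * (psum (coord z) CARD('n) - psum (coord z) i))))
        = c * (\<Sum>i\<in>{1..<CARD('n)}. J_fun i (coord z) * J_fun (CARD('n) - i) (block (coord z) i) *
          ((psum (coord h) CARD('n) * psum (coord z) i - psum (coord z) CARD('n) * psum (coord h) i) /
           (psum (coord z) i * (psum (coord z) CARD('n) - psum (coord z) i))))" for c h
        unfolding coord_psum_scale scale sum_distrib_left ..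
    qed
  qed
  fix z :: "complex ^ 'n::{finite,linorder}" assume z: "z \<in> D_dom - H_union"
  show "(J_vec has_derivative
              (\<lambda>h. \<Sum>i\<in>{1..<CARD('n)}.
                     J_fun i (coord z) * J_fun (CARD('n) - i) (block (coord z) i) *
                     dlog (\<lambda>w. (\<Sum>m=i+1..CARD('n). coord w m) / (\<Sum>m=1..i. coord w m)) z h)) (at z)"
    using J_vec_has_derivative[OF z] by (rule has_derivative_eq_rhs) (intro ext sum.cong refl, simp only: dlog_ratio[OF z])
qed

end
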